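(* Let $G$ be a locally compact group, let $A$, $B$ be C*-algebras with actions of $G$, and let $0\le\alpha<1$. Let $(A,E_B,D)$ be a conformally $G$-equivariant order-$\frac{1}{1-\alpha}$ cycle. Then $(A,E_B,F_D)$ is a $G$-equivariant bounded Kasparov module.
   Context: All C*-algebras are complex and trivially graded. $\operatorname{End}^*(E)$, $\operatorname{End}^0(E)$ are the adjointable and compact operators of a right Hilbert $B$-module $E$. An $A$-$B$-correspondence is a right Hilbert $B$-module $E$ with a $*$-homomorphism $A\to\operatorname{End}^*(E)$; elements of $A$ are identified with their images. For $D$ self-adjoint regular, $\langle D\rangle=(1+D^2)^{1/2}$, $F_D=D(1+D^2)^{-1/2}$. $\overline{\operatorname{span}}$ is the norm-closed linear span. A densely defined operator is bounded if it extends to an adjointable operator. Bounded Kasparov $A$-$B$-module: an $A$-$B$-correspondence $E$ and $F\in\operatorname{End}^*(E)$ with $(F^*-F)a,(1-F^2)a,[F,a]$ compact for all $a\in A$; even if $E$ is $\mathbb Z/2$-graded with $A$ acting evenly and $F$ odd, odd if $E$ is ungraded. $\operatorname{Lip}^*_\alpha(D)$: the $*$-algebra of $a\in\operatorname{End}^*(E)$ with $a\operatorname{dom}D\subseteq\operatorname{dom}D$ such that $[D,a]\langle D\rangle^{-\alpha}$ and $\langle D\rangle^{-\alpha}[D,a]$ extend to adjointable operators. An order-$\frac{1}{1-\alpha}$ cycle $(A,E_B,D)$ is an $A$-$B$-correspondence $E$ with a self-adjoint regular operator $D$ such that $(1+D^2)^{-1}a$ is compact for all $a\in A$ and $A$ is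 contained in the norm closure of $\operatorname{Lip}^*_\alpha(D)$; even if $E$ is $\mathbb Z/2$-graded, $A$ acts evenly and $D$ is odd, odd if $E$ is ungraded. With $\alpha^A$ and $\beta$ denoting the actions of $G$ on $A$ and $B$, a $G$-equivariant $A$-$B$-correspondence is an $A$-$B$-correspondence $E$ with a continuous map $U:G\times E\to E$, $\mathbb C$-linear in $E$, with $U_{gh}=U_gU_h$, $U_g(xb)=U_g(x)\beta_g(b)$, $\beta_g((x,y)_B)=(U_gx,U_gy)_B$ and $U_g(ax)=\alpha^A_g(a)U_g(x)$. Write $U_g^*=U_g^{-1}$; note that $U_gTU_g^*$ is $B$-linear when $T$ is. A bounded Kasparov module $(A,E_B,F)$ is $G$-equivariant if $E$ is a $G$-equivariant $A$-$B$-correspondence and, for all $a\in A$, $g\mapsto(U_gFU_g^*-F)a$ is norm-continuous from $G$ into $\operatorname{End}^0(E)$. An order-$\frac1{1-\alpha}$ cycle $(A,E_B,D)$ is conformally $G$-equivariant if $E$ is a $G$-equivariant $A$-$B$-correspondence and there is a $*$-strongly continuous family $(\mu_g)_{g\in G}\subseteq\operatorname{End}^*(E)$ of invertible operators (even if $E$ is graded), called the conformal factor, such that $A\subseteq\overline{\operatorname{span}}(A\mathscr Q)\cap\overline{\operatorname{span}}(\mathscr QA)$, where $\mathscr Q$ is the set of $a\in\operatorname{Lip}^*_\alpha(D)$ such that for all $g\in G$ one has $\{a\mu_g,a\mu_g^{-1*}\}\operatorname{dom}D\subseteq\operatorname{dom}D\cap U_g\operatorname{dom}D$, and the maps $g\mapsto(U_gDU_g^*a-a\mu_gD\mu_g^*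 )\mu_g^{-1*}\langle D\rangle^{-\alpha}$, $g\mapsto U_g\langle D\rangle^{-\alpha}U_g^*(U_gDU_g^*a-a\mu_gD\mu_g^* )$, $g\mapsto[D,a\mu_g]\langle D\rangle^{-\alpha}$, $g\mapsto\langle D\rangle^{-\alpha}[D,a\mu_g]$, $g\mapsto[D,a\mu_g^{-1*}]\langle D\rangle^{-\alpha}$, $g\mapsto\langle D\rangle^{-\alpha}[D,a\mu_g^{-1*}]$ are $*$-strongly continuous from $G$ into bounded operators (not necessarily globally bounded over $G$). Here $\mu_g^{-1*}=(\mu_g^{-1})^*$. *)

theory Defs
  imports "HOL-Analysis.Analysis" "HOL-Computational_Algebra.Polynomial"
begin

section \<open>Complex Banach spaces and C*-algebras\<close>

class scaleC =
  fixes scaleC :: "complex \<Rightarrow> 'a \<Rightarrow> 'a"  (infixr \<open>*\<^sub>C\<close> 75)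

class complex_vector = real_vector + scaleC +
  assumes scaleC_add_right: "c *\<^sub>C (x + y) = c *\<^sub>C x + c *\<^sub>C y"
    and scaleC_add_left: "(c + d) *\<^sub>C x = c *\<^sub>C x + d *\<^sub>C x"
    and scaleC_scaleC: "c *\<^sub>C d *\<^sub>C x = (c * d) *\<^sub>C x"
    and scaleR_scaleC: "r *\<^sub>R x = complex_of_real r *\<^sub>C x"

global_interpretation complex_vector: vector_space "scaleC :: complex \<Rightarrow> 'a \<Rightarrow> 'a::complex_vector"
proof
  fix x :: 'a
  show "1 *\<^sub>C x = x"
    using scaleR_scaleC[of 1 x] by simp
qed (simp_all add: scaleC_add_right scaleC_add_left scaleC_scaleC)

class complex_normed_vector = complex_vector + real_normed_vector +
  assumes norm_scaleC: "norm (c *\<^sub>C x) = cmod c * norm x"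

class cbanach = complex_normed_vector + complete_space

subclass (in cbanach) banach ..

lemma bounded_linear_scaleC: "bounded_linear (\<lambda>x::'a::complex_normed_vector. c *\<^sub>C x)"
  by (rule bounded_linear_intro[where K = "cmod c"])
    (simp_all add: scaleC_add_right scaleR_scaleC scaleC_scaleC norm_scaleC mult.commute)

instantiation blinfun :: (real_normed_vector, complex_normed_vector) complex_normed_vector
begin

lift_definition scaleC_blinfun :: "complex \<Rightarrow> 'a \<Rightarrow>\<^sub>L 'b \<Rightarrow> 'a \<Rightarrow>\<^sub>L 'b"
  is "\<lambda>c f x. c *\<^sub>C f x"
  by (rule bounded_linear_compose[OF bounded_linear_scaleC])

instance
proof
  fix c d :: complex and r :: real and f g :: "'a \<Rightarrow>\<^sub>L 'b"
  show "c *\<^sub>C (f + g) = c *\<^sub>C f + c *\<^sub>C g"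
    by transfer (simp add: scaleC_add_right)
  show "(c + d) *\<^sub>C f = c *\<^sub>C f + d *\<^sub>C f"
    by transfer (simp add: scaleC_add_left)
  show "c *\<^sub>C d *\<^sub>C f = (c * d) *\<^sub>C f"
    by transfer (simp add: scaleC_scaleC)
  show "r *\<^sub>R f = complex_of_real r *\<^sub>C f"
    by transfer (simp add: scaleR_scaleC)
  have le: "norm (c *\<^sub>C f) \<le> cmod c * norm f" for c and f :: "'a \<Rightarrow>\<^sub>L 'b"
    by (rule norm_blinfun_bound)
      (auto simp: scaleC_blinfun.rep_eq norm_scaleC mult.assoc intro!: mult_left_mono norm_blinfun)
  show "norm (c *\<^sub>C f) = cmod c * norm f"
  proof (cases "c = 0")
    case True
    then show ?thesis using le[of 0 f] by simp
  next
    case False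
    have "inverse c *\<^sub>C c *\<^sub>C f = f"
      using False by transfer simp
    then have "norm f \<le> cmod (inverse c) * norm (c *\<^sub>C f)"
      using le[of "inverse c" "c *\<^sub>C f"] by simp
    then have "cmod c * norm f \<le> norm (c *\<^sub>C f)"
      using False by (simp add: norm_inverse norm_divide field_simps)
    then show ?thesis using le[of c f] by simp
  qed
qed

end

class cstar_algebra = cbanach + real_normed_algebra +
  fixes star :: "'a \<Rightarrow> 'a"
  assumes mult_scaleC_left: "(c *\<^sub>C x) * y = c *\<^sub>C (x * y)"
    and mult_scaleC_right: "x * (c *\<^sub>C y) = c *\<^sub>C (x * y)"
    and star_add: "star (x + y) = star x + star y"
    and star_scaleC: "star (c *\<^sub>C x) = cnj c *\<^sub>C star x"
    and star_mult: "star (x * y) = star y * star x"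
    and star_star: "star (star x) = x"
    and cstar_identity: "norm (star x * x) = (norm x)\<^sup>2"

definition cstar_positive :: "'a::cstar_algebra \<Rightarrow> bool" where
  "cstar_positive x \<longleftrightarrow> (\<exists>y. x = star y * y)"

definition star_hom :: "('a::cstar_algebra \<Rightarrow> 'b::cstar_algebra) \<Rightarrow> bool" where
  "star_hom \<phi> \<longleftrightarrow>
     (\<forall>x y. \<phi> (x + y) = \<phi> x + \<phi> y) \<and> (\<forall>c x. \<phi> (c *\<^sub>C x) = c *\<^sub>C \<phi> x) \<and>
     (\<forall>x y. \<phi> (x * y) = \<phi> x * \<phi> y) \<and> (\<forall>x. \<phi> (star x) = star (\<phi> x))"

text \<open>
  Groups are written additively, since the possibly non-abelian class \<open>topological_group_add\<close> is the
  library's notion of a topological group: \<open>g + h\<close> is the product, \<open>0\<close> the unit.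
\<close>

definition cstar_action :: "('g::topological_group_add \<Rightarrow> 'a::cstar_algebra \<Rightarrow> 'a) \<Rightarrow> bool" where
  "cstar_action \<theta> \<longleftrightarrow>
     (\<forall>g. star_hom (\<theta> g)) \<and> \<theta> 0 = id \<and> (\<forall>g h. \<theta> (g + h) = \<theta> g \<circ> \<theta> h) \<and>
     (\<forall>x. continuous_on UNIV (\<lambda>g. \<theta> g x))"


section \<open>Partially defined operators\<close>

text \<open>
  An unbounded operator is identified with its graph \<open>{(x, T x) | x \<in> dom T}\<close>, so that
  its domain is \<^const>\<open>Domain\<close>. Sums and composites carry their natural (maximal) domains.
\<close>

type_synonym 'e unb = "('e \<times> 'e) set"

definition gr :: "('e::real_normed_vector \<Rightarrow>\<^sub>L 'e) \<Rightarrow> 'e unb" where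
  "gr T = {(x, blinfun_apply T x) | x. True}"

definition unb_comp :: "'e unb \<Rightarrow> 'e unb \<Rightarrow> 'e unb"  (infixr \<open>\<circ>\<^sub>u\<close> 75) where
  "S \<circ>\<^sub>u T = T O S"

definition unb_add :: "'e::real_normed_vector unb \<Rightarrow> 'e unb \<Rightarrow> 'e unb"  (infixl \<open>+\<^sub>u\<close> 65) where
  "S +\<^sub>u T = {(x, y + z) | x y z. (x, y) \<in> S \<and> (x, z) \<in> T}"

definition unb_diff :: "'e::real_normed_vector unb \<Rightarrow> 'e unb \<Rightarrow> 'e unb"  (infixl \<open>-\<^sub>u\<close> 65) where
  "S -\<^sub>u T = {(x, y - z) | x y z. (x, y) \<in> S \<and> (x, z) \<in> T}"

definition commutator :: "'e::real_normed_vector unb \<Rightarrow> ('e \<Rightarrow>\<^sub>L 'e) \<Rightarrow> 'e unb" where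
  "commutator D a = (D \<circ>\<^sub>u gr a) -\<^sub>u (gr a \<circ>\<^sub>u D)"

text \<open>For an everywhere defined bounded operator given by its graph.\<close>

definition of_gr :: "'e::real_normed_vector unb \<Rightarrow> ('e \<Rightarrow>\<^sub>L 'e)" where
  "of_gr T = (THE S. gr S = T)"

definition one_plus_square :: "'e::real_normed_vector unb \<Rightarrow> 'e unb" where
  "one_plus_square D = gr id_blinfun +\<^sub>u (D \<circ>\<^sub>u D)"

definition resolvent :: "'e::real_normed_vector unb \<Rightarrow> ('e \<Rightarrow>\<^sub>L 'e)" where
  "resolvent D = of_gr ((one_plus_square D)\<inverse>)"

definition op_inv :: "('e::real_normed_vector \<Rightarrow>\<^sub>L 'e) \<Rightarrow> ('e \<Rightarrow>\<^sub>L 'e)" where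
  "op_inv T = (THE S. S o\<^sub>L T = id_blinfun \<and> T o\<^sub>L S = id_blinfun)"

definition poly_op :: "real poly \<Rightarrow> ('e::real_normed_vector \<Rightarrow>\<^sub>L 'e) \<Rightarrow> ('e \<Rightarrow>\<^sub>L 'e)" where
  "poly_op p T = (\<Sum>i\<le>degree p. coeff p i *\<^sub>R (((\<lambda>S. T o\<^sub>L S) ^^ i) id_blinfun))"


section \<open>Hilbert modules\<close>

text \<open>
  A right Hilbert \<open>B\<close>-module, \<open>B\<close> being the type \<open>'b\<close>. The norm of the Banach space \<open>'e\<close> is
  required to be the one induced by the inner product, which is linear in the second variable.
\<close>

locale hilbert_module =
  fixes ip :: "'e::cbanach \<Rightarrow> 'e \<Rightarrow> 'b::cstar_algebra"
    and ract :: "'e \<Rightarrow> 'b \<Rightarrow> 'e"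
  assumes ract_add_left: "ract (x + y) b = ract x b + ract y b"
    and ract_add_right: "ract x (b + c) = ract x b + ract x c"
    and ract_mult: "ract x (b * c) = ract (ract x b) c"
    and ract_scaleC_left: "ract (k *\<^sub>C x) b = k *\<^sub>C ract x b"
    and ract_scaleC_right: "ract x (k *\<^sub>C b) = k *\<^sub>C ract x b"
    and ip_add_right: "ip x (y + z) = ip x y + ip x z"
    and ip_scaleC_right: "ip x (k *\<^sub>C y) = k *\<^sub>C ip x y"
    and ip_ract_right: "ip x (ract y b) = ip x y * b"
    and star_ip: "star (ip x y) = ip y x"
    and ip_self_positive: "cstar_positive (ip x x)"
    and norm_ip: "norm x = sqrt (norm (ip x x))"
begin

subsection \<open>Adjointable and compact operators\<close>

text \<open>
  Operators that have an adjoint are automatically bounded and \<open>B\<close>-linear (hence complex linear),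
  so nothing is lost by looking for them among the real-linear bounded operators, whose norm
  topology is the one in which closures and norm-continuity below are taken.
\<close>

definition adjointable_ops :: "('e \<Rightarrow>\<^sub>L 'e) set" where
  "adjointable_ops = {T :: 'e \<Rightarrow>\<^sub>L 'e. \<exists>S :: 'e \<Rightarrow>\<^sub>L 'e. \<forall>x y. ip (T x) y = ip x (S y)}"

definition adj :: "('e \<Rightarrow>\<^sub>L 'e) \<Rightarrow> ('e \<Rightarrow>\<^sub>L 'e)" where
  "adj T = (THE S :: 'e \<Rightarrow>\<^sub>L 'e. \<forall>x y. ip (T x) y = ip x (S y))"

definition rank_one :: "'e \<Rightarrow> 'e \<Rightarrow> ('e \<Rightarrow>\<^sub>L 'e)" where
  "rank_one x y = Blinfun (\<lambda>z. ract x (ip y z))"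

definition compact_ops :: "('e \<Rightarrow>\<^sub>L 'e) set" where
  "compact_ops = closure (complex_vector.span {rank_one x y | x y. True})"

definition invertible_op :: "('e \<Rightarrow>\<^sub>L 'e) \<Rightarrow> bool" where
  "invertible_op T \<longleftrightarrow> T \<in> adjointable_ops \<and>
     (\<exists>S\<in>adjointable_ops. S o\<^sub>L T = id_blinfun \<and> T o\<^sub>L S = id_blinfun)"

definition star_strongly_continuous :: "('g::topological_space \<Rightarrow> ('e \<Rightarrow>\<^sub>L 'e)) \<Rightarrow> bool" where
  "star_strongly_continuous T \<longleftrightarrow>
     range T \<subseteq> adjointable_ops \<and>
     (\<forall>x. continuous_on UNIV (\<lambda>g. T g x) \<and> continuous_on UNIV (\<lambda>g. adj (T g) x))"

subsection \<open>Continuous functional calculus of self-adjoint adjointable operators\<close>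

definition real_spectrum :: "('e \<Rightarrow>\<^sub>L 'e) \<Rightarrow> real set" where
  "real_spectrum T = {t. \<not> invertible_op (T - t *\<^sub>R id_blinfun)}"

text \<open>
  For self-adjoint \<open>T\<close> (whose spectrum is real) and \<open>f\<close> continuous on the spectrum, \<open>f(T)\<close> is the
  common limit of \<open>p\<^sub>n(T)\<close> for all sequences of polynomials \<open>p\<^sub>n\<close> tending to \<open>f\<close> uniformly on
  the spectrum.
\<close>

definition fun_calc :: "(real \<Rightarrow> real) \<Rightarrow> ('e \<Rightarrow>\<^sub>L 'e) \<Rightarrow> ('e \<Rightarrow>\<^sub>L 'e)" where
  "fun_calc f T = (THE S. \<forall>p :: nat \<Rightarrow> real poly.
     uniform_limit (real_spectrum T) (\<lambda>n. poly (p n)) f sequentially \<longrightarrow>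
     (\<lambda>n. poly_op (p n) T) \<longlonglongrightarrow> S)"

subsection \<open>Self-adjoint regular operators\<close>

definition densely_defined :: "'e unb \<Rightarrow> bool" where
  "densely_defined T \<longleftrightarrow> closure (Domain T) = UNIV"

definition unb_adj :: "'e unb \<Rightarrow> 'e unb" where
  "unb_adj T = {(y, z). \<forall>(x, w)\<in>T. ip w y = ip x z}"

text \<open>
  The adjoint relation of a densely defined operator is closed, single-valued and \<open>B\<close>-linear;
  hence so is any \<open>D\<close> as below.
\<close>

definition selfadjoint_regular :: "'e unb \<Rightarrow> bool" where
  "selfadjoint_regular D \<longleftrightarrow> densely_defined D \<and> unb_adj D = D \<and>
     closure (Range (one_plus_square D)) = UNIV"

text \<open>
  \<open>japanese_power D s\<close> is \<open>\<langle>D\<rangle>\<^sup>-\<^sup>s = ((1 + D\<^sup>2)\<^sup>-\<^sup>1)\<^bsup>s/2\<^esup>\<close> for \<open>s \<ge> 0\<close>. The case distinction makes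
  \<open>\<langle>D\<rangle>\<^sup>0 = 1\<close>, because \<open>0 powr 0 = 0\<close> while \<open>0\<close> may lie in the spectrum of \<open>(1 + D\<^sup>2)\<^sup>-\<^sup>1\<close>.
\<close>

definition japanese_power :: "'e unb \<Rightarrow> real \<Rightarrow> ('e \<Rightarrow>\<^sub>L 'e)" where
  "japanese_power D s = fun_calc (\<lambda>t. if s = 0 then 1 else t powr (s / 2)) (resolvent D)"

definition bounded_transform :: "'e unb \<Rightarrow> ('e \<Rightarrow>\<^sub>L 'e)" where
  "bounded_transform D = of_gr (D \<circ>\<^sub>u gr (japanese_power D 1))"

subsection \<open>Densely defined operators with adjointable extension\<close>

definition unb_bounded :: "'e unb \<Rightarrow> bool" where
  "unb_bounded T \<longleftrightarrow> densely_defined T \<and> (\<exists>S\<in>adjointable_ops. T \<subseteq> gr S)"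

definition bounded_ext :: "'e unb \<Rightarrow> ('e \<Rightarrow>\<^sub>L 'e)" where
  "bounded_ext T = (THE S. S \<in> adjointable_ops \<and> T \<subseteq> gr S)"

definition star_strongly_continuous_unb :: "('g::topological_space \<Rightarrow> 'e unb) \<Rightarrow> bool" where
  "star_strongly_continuous_unb T \<longleftrightarrow>
     (\<forall>g. unb_bounded (T g)) \<and> star_strongly_continuous (\<lambda>g. bounded_ext (T g))"

definition Lip :: "real \<Rightarrow> 'e unb \<Rightarrow> ('e \<Rightarrow>\<^sub>L 'e) set" where
  "Lip \<alpha> D = {a \<in> adjointable_ops.
     blinfun_apply a ` Domain D \<subseteq> Domain D \<and>
     unb_bounded (commutator D a \<circ>\<^sub>u gr (japanese_power D \<alpha>)) \<and>
     unb_bounded (gr (japanese_power D \<alpha>) \<circ>\<^sub>u commutator D a)}"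

subsection \<open>Gradings\<close>

text \<open>
  As \<open>B\<close> is trivially graded, a \<open>\<int>/2\<close>-grading of the module is an orthogonal decomposition into
  two submodules; it is encoded by its grading operator, which is \<open>1\<close> on the even and \<open>-1\<close> on the
  odd part.
\<close>

definition grading :: "('e \<Rightarrow>\<^sub>L 'e) \<Rightarrow> bool" where
  "grading \<gamma> \<longleftrightarrow> \<gamma> \<in> adjointable_ops \<and> adj \<gamma> = \<gamma> \<and> \<gamma> o\<^sub>L \<gamma> = id_blinfun"

definition even_op :: "('e \<Rightarrow>\<^sub>L 'e) \<Rightarrow> ('e \<Rightarrow>\<^sub>L 'e) \<Rightarrow> bool" where
  "even_op \<gamma> T \<longleftrightarrow> T o\<^sub>L \<gamma> = \<gamma> o\<^sub>L T"

definition odd_op :: "('e \<Rightarrow>\<^sub>L 'e) \<Rightarrow> ('e \<Rightarrow>\<^sub>L 'e) \<Rightarrow> bool" where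
  "odd_op \<gamma> T \<longleftrightarrow> T o\<^sub>L \<gamma> = - (\<gamma> o\<^sub>L T)"

definition odd_unb :: "('e \<Rightarrow>\<^sub>L 'e) \<Rightarrow> 'e unb \<Rightarrow> bool" where
  "odd_unb \<gamma> D \<longleftrightarrow> (\<forall>(x, y)\<in>D. (\<gamma> x, - \<gamma> y) \<in> D)"

end


section \<open>Correspondences, Kasparov modules and cycles\<close>

locale correspondence = hilbert_module ip ract
  for ip :: "'e::cbanach \<Rightarrow> 'e \<Rightarrow> 'b::cstar_algebra" and ract :: "'e \<Rightarrow> 'b \<Rightarrow> 'e" +
  fixes \<pi> :: "'a::cstar_algebra \<Rightarrow> ('e \<Rightarrow>\<^sub>L 'e)"
  assumes \<pi>_adjointable: "\<pi> a \<in> adjointable_ops"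
    and \<pi>_add: "\<pi> (a + b) = \<pi> a + \<pi> b"
    and \<pi>_scaleC: "\<pi> (c *\<^sub>C a) = c *\<^sub>C \<pi> a"
    and \<pi>_mult: "\<pi> (a * b) = \<pi> a o\<^sub>L \<pi> b"
    and \<pi>_star: "\<pi> (star a) = adj (\<pi> a)"

text \<open>
  In what follows \<open>\<Gamma> = Some \<gamma>\<close> is the even case, with grading operator \<open>\<gamma>\<close>, and \<open>\<Gamma> = None\<close> is the
  odd case of an ungraded module.
\<close>

locale kasparov_module = correspondence ip ract \<pi>
  for ip :: "'e::cbanach \<Rightarrow> 'e \<Rightarrow> 'b::cstar_algebra" and ract :: "'e \<Rightarrow> 'b \<Rightarrow> 'e"
    and \<pi> :: "'a::cstar_algebra \<Rightarrow> ('e \<Rightarrow>\<^sub>L 'e)" +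
  fixes \<Gamma> :: "('e \<Rightarrow>\<^sub>L 'e) option" and F :: "'e \<Rightarrow>\<^sub>L 'e"
  assumes F_adjointable: "F \<in> adjointable_ops"
    and F_adj_compact: "(adj F - F) o\<^sub>L \<pi> a \<in> compact_ops"
    and F_square_compact: "(id_blinfun - (F o\<^sub>L F)) o\<^sub>L \<pi> a \<in> compact_ops"
    and F_commutator_compact: "(F o\<^sub>L \<pi> a) - (\<pi> a o\<^sub>L F) \<in> compact_ops"
    and graded: "\<Gamma> = Some \<gamma> \<Longrightarrow> grading \<gamma> \<and> (\<forall>a. even_op \<gamma> (\<pi> a)) \<and> odd_op \<gamma> F"

text \<open>Cycles of order \<open>1 / (1 - \<alpha>)\<close>.\<close>

locale order_cycle = correspondence ip ract \<pi>
  for ip :: "'e::cbanach \<Rightarrow> 'e \<Rightarrow> 'b::cstar_algebra" and ract :: "'e \<Rightarrow> 'b \<Rightarrow> 'e"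
    and \<pi> :: "'a::cstar_algebra \<Rightarrow> ('e \<Rightarrow>\<^sub>L 'e)" +
  fixes \<Gamma> :: "('e \<Rightarrow>\<^sub>L 'e) option" and \<alpha> :: real and D :: "'e unb"
  assumes D_selfadjoint_regular: "selfadjoint_regular D"
    and resolvent_compact: "resolvent D o\<^sub>L \<pi> a \<in> compact_ops"
    and \<pi>_in_closure_Lip: "range \<pi> \<subseteq> closure (Lip \<alpha> D)"
    and graded: "\<Gamma> = Some \<gamma> \<Longrightarrow> grading \<gamma> \<and> (\<forall>a. even_op \<gamma> (\<pi> a)) \<and> odd_unb \<gamma> D"

text \<open>
  Each \<open>U\<^sub>g\<close> is a bounded real-linear map because it is linear and continuous; it is in general
  not \<open>B\<close>-linear. By the axioms it is bijective, with inverse \<open>U\<^sub>-\<^sub>g\<close>.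
\<close>

locale equivariant_correspondence = correspondence ip ract \<pi>
  for ip :: "'e::cbanach \<Rightarrow> 'e \<Rightarrow> 'b::cstar_algebra" and ract :: "'e \<Rightarrow> 'b \<Rightarrow> 'e"
    and \<pi> :: "'a::cstar_algebra \<Rightarrow> ('e \<Rightarrow>\<^sub>L 'e)" +
  fixes \<alpha>A :: "'g::topological_group_add \<Rightarrow> 'a \<Rightarrow> 'a"
    and \<beta> :: "'g \<Rightarrow> 'b \<Rightarrow> 'b"
    and U :: "'g \<Rightarrow> ('e \<Rightarrow>\<^sub>L 'e)"
  assumes U_continuous: "continuous_on UNIV (\<lambda>(g, x). U g x)"
    and U_scaleC: "U g (c *\<^sub>C x) = c *\<^sub>C U g x"
    and U_add: "U (g + h) = U g o\<^sub>L U h"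
    and U_ract: "U g (ract x b) = ract (U g x) (\<beta> g b)"
    and U_ip: "\<beta> g (ip x y) = ip (U g x) (U g y)"
    and U_\<pi>: "U g (\<pi> a x) = \<pi> (\<alpha>A g a) (U g x)"

locale equivariant_kasparov_module =
  kasparov_module ip ract \<pi> \<Gamma> F + equivariant_correspondence ip ract \<pi> \<alpha>A \<beta> U
  for ip :: "'e::cbanach \<Rightarrow> 'e \<Rightarrow> 'b::cstar_algebra" and ract :: "'e \<Rightarrow> 'b \<Rightarrow> 'e"
    and \<pi> :: "'a::cstar_algebra \<Rightarrow> ('e \<Rightarrow>\<^sub>L 'e)"
    and \<alpha>A :: "'g::topological_group_add \<Rightarrow> 'a \<Rightarrow> 'a"
    and \<beta> :: "'g \<Rightarrow> 'b \<Rightarrow> 'b"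
    and U :: "'g \<Rightarrow> ('e \<Rightarrow>\<^sub>L 'e)"
    and \<Gamma> :: "('e \<Rightarrow>\<^sub>L 'e) option" and F :: "'e \<Rightarrow>\<^sub>L 'e" +
  assumes equivariance_compact: "((U g o\<^sub>L F o\<^sub>L op_inv (U g)) - F) o\<^sub>L \<pi> a \<in> compact_ops"
    and equivariance_continuous:
      "continuous_on UNIV (\<lambda>g. ((U g o\<^sub>L F o\<^sub>L op_inv (U g)) - F) o\<^sub>L \<pi> a)"

definition (in hilbert_module) conformal_set ::
  "real \<Rightarrow> 'e unb \<Rightarrow> ('g::topological_group_add \<Rightarrow> ('e \<Rightarrow>\<^sub>L 'e)) \<Rightarrow>
   ('g \<Rightarrow> ('e \<Rightarrow>\<^sub>L 'e)) \<Rightarrow> ('e \<Rightarrow>\<^sub>L 'e) set" where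
  "conformal_set \<alpha> D U \<mu> = {a \<in> Lip \<alpha> D.
     let J = japanese_power D \<alpha>;
         \<nu> = (\<lambda>g. adj (op_inv (\<mu> g)));
         \<Delta> = (\<lambda>g. (gr (U g) \<circ>\<^sub>u D \<circ>\<^sub>u gr (op_inv (U g)) \<circ>\<^sub>u gr a)
                  -\<^sub>u (gr (a o\<^sub>L \<mu> g) \<circ>\<^sub>u D \<circ>\<^sub>u gr (adj (\<mu> g))))
     in (\<forall>g. blinfun_apply (a o\<^sub>L \<mu> g) ` Domain D \<subseteq> Domain D \<inter> blinfun_apply (U g) ` Domain D) \<and>
        (\<forall>g. blinfun_apply (a o\<^sub>L \<nu> g) ` Domain D \<subseteq> Domain D \<inter> blinfun_apply (U g) ` Domain D) \<and>
        star_strongly_continuous_unb (\<lambda>g. \<Delta> g \<circ>\<^sub>u gr (\<nu> g) \<circ>\<^sub>u gr J) \<and>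
        star_strongly_continuous_unb (\<lambda>g. gr (U g o\<^sub>L J o\<^sub>L op_inv (U g)) \<circ>\<^sub>u \<Delta> g) \<and>
        star_strongly_continuous_unb (\<lambda>g. commutator D (a o\<^sub>L \<mu> g) \<circ>\<^sub>u gr J) \<and>
        star_strongly_continuous_unb (\<lambda>g. gr J \<circ>\<^sub>u commutator D (a o\<^sub>L \<mu> g)) \<and>
        star_strongly_continuous_unb (\<lambda>g. commutator D (a o\<^sub>L \<nu> g) \<circ>\<^sub>u gr J) \<and>
        star_strongly_continuous_unb (\<lambda>g. gr J \<circ>\<^sub>u commutator D (a o\<^sub>L \<nu> g))}"

definition (in hilbert_module) conformal_factor ::
  "('a \<Rightarrow> ('e \<Rightarrow>\<^sub>L 'e)) \<Rightarrow> ('g::topological_group_add \<Rightarrow> ('e \<Rightarrow>\<^sub>L 'e)) \<Rightarrow>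
   ('e \<Rightarrow>\<^sub>L 'e) option \<Rightarrow> real \<Rightarrow> 'e unb \<Rightarrow> ('g \<Rightarrow> ('e \<Rightarrow>\<^sub>L 'e)) \<Rightarrow> bool" where
  "conformal_factor \<pi> U \<Gamma> \<alpha> D \<mu> \<longleftrightarrow>
     star_strongly_continuous \<mu> \<and> (\<forall>g. invertible_op (\<mu> g)) \<and>
     (\<forall>\<gamma> g. \<Gamma> = Some \<gamma> \<longrightarrow> even_op \<gamma> (\<mu> g)) \<and>
     range \<pi> \<subseteq> closure (complex_vector.span {\<pi> a o\<^sub>L q | a q. q \<in> conformal_set \<alpha> D U \<mu>})
           \<inter> closure (complex_vector.span {q o\<^sub>L \<pi> a | a q. q \<in> conformal_set \<alpha> D U \<mu>})"

locale conformally_equivariant_cycle =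
  order_cycle ip ract \<pi> \<Gamma> \<alpha> D + equivariant_correspondence ip ract \<pi> \<alpha>A \<beta> U
  for ip :: "'e::cbanach \<Rightarrow> 'e \<Rightarrow> 'b::cstar_algebra" and ract :: "'e \<Rightarrow> 'b \<Rightarrow> 'e"
    and \<pi> :: "'a::cstar_algebra \<Rightarrow> ('e \<Rightarrow>\<^sub>L 'e)"
    and \<alpha>A :: "'g::topological_group_add \<Rightarrow> 'a \<Rightarrow> 'a"
    and \<beta> :: "'g \<Rightarrow> 'b \<Rightarrow> 'b"
    and U :: "'g \<Rightarrow> ('e \<Rightarrow>\<^sub>L 'e)"
    and \<Gamma> :: "('e \<Rightarrow>\<^sub>L 'e) option" and \<alpha> :: real and D :: "'e unb" +
  assumes ex_conformal_factor: "\<exists>\<mu>. conformal_factor \<pi> U \<Gamma> \<alpha> D \<mu>"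

end

theory Submission
  imports Defs "HOL-Computational_Algebra.Fundamental_Theorem_Algebra"
begin

text \<open>
  Put \<open>F = F\<^sub>D\<close> and \<open>V\<^sub>g = U\<^sub>g F U\<^sub>g\<^sup>* - F\<close>. The heart of the matter is that \<open>V\<^sub>g b\<close> is compact and norm-continuous in
  \<open>g\<close> for \<open>b \<in> A\<close>.

  All unbounded operators are replaced by the cut-offs \<open>e\<^sub>\<Lambda> = \<Lambda>\<^sup>2 (\<Lambda>\<^sup>2 + D\<^sup>2)\<^sup>-\<^sup>1\<close> and \<open>f\<^sub>\<Lambda> = \<Lambda> D (\<Lambda>\<^sup>2 + D\<^sup>2)\<^sup>-\<^sup>1\<close>, which satisfy
  \<open>D e\<^sub>\<Lambda> = \<Lambda> f\<^sub>\<Lambda>\<close> and \<open>D f\<^sub>\<Lambda> = \<Lambda> (1 - e\<^sub>\<Lambda>)\<close>. An element of the Lipschitz algebra commutes with them up to \<open>O(\<Lambda>\<^sup>\<alpha>\<^sup>-\<^sup>1)\<close>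
  (\<open>lip_commutator\<close>), and since \<open>\<alpha> < 1\<close> this is a negative power of \<open>\<Lambda>\<close>. Let \<open>a\<close> belong to the set \<open>\<Q>\<close> of the
  conformal condition, let \<open>c = a a\<^sup>*\<close> and \<open>k = (a \<mu>\<^sub>g) (a \<mu>\<^sub>g)\<^sup>*\<close>, and let \<open>e\<^sub>1, f\<^sub>1, F\<^sub>1\<close> be the conjugates by \<open>U\<^sub>g\<close>. That
  \<open>U\<^sub>g D U\<^sub>g\<^sup>* a\<close> is close to \<open>a \<mu>\<^sub>g D \<mu>\<^sub>g\<^sup>*\<close> becomes the pair of exchange relations
  \<open>f\<^sub>1 c e \<approx> e\<^sub>1 k f\<close> and \<open>(1 - e\<^sub>1) c e \<approx> f\<^sub>1 k f\<close> (\<open>exchange_bounds\<close>).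

  Modulo families decaying like a power of \<open>\<Lambda>\<close> these are identities in a ring, and they imply by algebra
  alone that \<open>c e\<close> and \<open>k f\<close> commute with each other and with \<open>e\<^sub>1, f\<^sub>1\<close> (\<open>exchange_commute\<close>). An integral formula
  for \<open>F\<close> shows that \<open>F\<close> commutes with \<open>f Y f\<close> whenever \<open>Y\<close> commutes with the cut-offs (\<open>norm_F_commutator_le\<close>).
  Put \<open>h = c e k f\<close>. As \<open>F f \<ge> 0\<close> and \<open>F\<^sub>1 f\<^sub>1 \<ge> 0\<close>, both \<open>F h\<^sup>3\<close> and \<open>F\<^sub>1 h\<^sup>3\<close> are represented by positive operators; both have
  the square \<open>h\<^sup>6\<close>, because \<open>F\<^sup>2 f \<approx> f\<close>; and they commute. Positive square roots being unique, also in an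
  approximate sense, \<open>(F\<^sub>1 - F) h\<^sup>3 \<approx> 0\<close> (\<open>bounded_transforms_agree\<close>).

  It remains to remove the weights. Polynomials divisible by \<open>c\<close> and \<open>k\<close> are approximate units on \<open>a\<close>, and the
  decay on the spectral bands \<open>e\<^sub>\<Lambda> f\<^sub>\<Lambda>\<close> is summed over dyadic scales. The result is that \<open>V\<^sub>g a\<close> is small on the
  complement of a cut-off \<open>P(e\<^sub>\<Lambda>)\<close>, uniformly over any set of \<open>g\<close> on which \<open>\<mu>\<^sub>g\<close>, its inverse and the operators of
  the conformal condition are bounded (\<open>conformal_decay\<close>). Since \<open>P(e\<^sub>\<Lambda>) b\<close> is compact and \<open>\<Q> A\<close> spans a space whose
  closure contains \<open>A\<close>, each \<open>V\<^sub>g b\<close> is compact (\<open>V_compact\<close>), and uniformly close to \<open>V\<^sub>g K\<close> with a fixed compact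
  operator \<open>K\<close>. On \<open>K\<close> strong continuity is norm continuity. Strong continuity of \<open>\<mu>\<close> by itself
  gives no local bound on the inverses \<open>\<mu>\<^sub>g\<^sup>-\<^sup>1\<close>, but Baire's theorem provides all bounds near some point of the
  locally compact group, and the cocycle identity \<open>V\<^bsub>gh\<^esub> = U\<^sub>g V\<^sub>h U\<^sub>g\<^sup>* + V\<^sub>g\<close> transports continuity from there to the unit and to
  every other point (\<open>continuous_V_p\<close>).

  Compactness of \<open>[F, a]\<close> follows in the same way from the commutation of \<open>a\<close> with the cut-offs
  (\<open>F_commutator_compact\<close>), while \<open>F\<^sup>* = F\<close> and \<open>1 - F\<^sup>2 = (1 + D\<^sup>2)\<^sup>-\<^sup>1\<close>. The first part of the text develops the spectral theory
  of self-adjoint elements of a C*-algebra, up to the positivity of \<open>X\<^sup>* X\<close> and the Cauchy--Schwarz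
  inequality in Hilbert modules, on which all of this rests.
\<close>

section \<open>Spectral theory of self-adjoint elements\<close>

text \<open>
  A unital C*-algebra \<open>A\<close> that sits in a larger ring of real-linear operators, with its imaginary unit
  \<open>J\<close> as an element. The surrounding ring is where group elements live, which act by operators that
  have no adjoint; the scalars are real, since only spectra of self-adjoint elements are used.
\<close>

locale cstar_ops =
  fixes A :: "'r::{real_normed_algebra, banach, monoid_mult} set"
    and ad :: "'r \<Rightarrow> 'r" and J :: 'r
  assumes closed_A: "closed A"
    and one_in: "1 \<in> A"
    and add_in: "S \<in> A \<Longrightarrow> T \<in> A \<Longrightarrow> S + T \<in> A"
    and mult_in: "S \<in> A \<Longrightarrow> T \<in> A \<Longrightarrow> S * T \<in> A"
    and scaleR_in: "T \<in> A \<Longrightarrow> t *\<^sub>R T \<in> A"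
    and ad_in: "T \<in> A \<Longrightarrow> ad T \<in> A"
    and ad_add: "S \<in> A \<Longrightarrow> T \<in> A \<Longrightarrow> ad (S + T) = ad S + ad T"
    and ad_mult: "S \<in> A \<Longrightarrow> T \<in> A \<Longrightarrow> ad (S * T) = ad T * ad S"
    and ad_scaleR: "T \<in> A \<Longrightarrow> ad (t *\<^sub>R T) = t *\<^sub>R ad T"
    and ad_ad: "T \<in> A \<Longrightarrow> ad (ad T) = T"
    and J_in: "J \<in> A" and J_J: "J * J = - 1" and ad_J: "ad J = - J"
    and J_comm: "T \<in> A \<Longrightarrow> T * J = J * T"
    and cstar_id: "T \<in> A \<Longrightarrow> norm (ad T * T) = (norm T)\<^sup>2"
begin

subsection \<open>Norms and inverses\<close>

lemma minus_in: "T \<in> A \<Longrightarrow> - T \<in> A"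
  using scaleR_in[of T "-1"] by simp

lemma diff_in: "S \<in> A \<Longrightarrow> T \<in> A \<Longrightarrow> S - T \<in> A"
  using add_in[of S "- T"] minus_in[of T] by simp

lemma zero_in: "0 \<in> A"
  using scaleR_in[OF one_in, of 0] by simp

lemma power_in: "T \<in> A \<Longrightarrow> T ^ n \<in> A"
  by (induction n) (auto intro: one_in mult_in)

lemma sum_in: "(\<And>i. i \<in> X \<Longrightarrow> f i \<in> A) \<Longrightarrow> sum f X \<in> A"
  by (induction X rule: infinite_finite_induct) (auto intro: zero_in add_in)

lemmas in_A = one_in add_in mult_in scaleR_in ad_in minus_in diff_in zero_in power_in sum_in J_in

lemma ad_minus: "T \<in> A \<Longrightarrow> ad (- T) = - ad T"
  using ad_scaleR[of T "-1"] by simp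

lemma ad_diff: "S \<in> A \<Longrightarrow> T \<in> A \<Longrightarrow> ad (S - T) = ad S - ad T"
  using ad_add[of S "- T"] minus_in[of T] ad_minus[of T] by simp

lemma ad_zero: "ad 0 = 0"
  using ad_scaleR[OF one_in, of 0] by simp

lemma ad_one: "ad 1 = 1"
  using ad_mult[OF one_in ad_in[OF one_in]] ad_ad[OF one_in] by simp

lemma ad_power: "T \<in> A \<Longrightarrow> ad (T ^ n) = ad T ^ n"
  by (induction n) (auto simp: ad_one ad_mult power_in power_commutes)

lemma ad_sum: "(\<And>i. i \<in> X \<Longrightarrow> f i \<in> A) \<Longrightarrow> ad (sum f X) = (\<Sum>i\<in>X. ad (f i))"
  by (induction X rule: infinite_finite_induct) (auto simp: ad_zero ad_add sum_in)

lemmas ad_simps = ad_minus ad_diff ad_zero ad_one ad_power ad_add ad_mult ad_scaleR ad_ad ad_J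

lemma norm_ad_le: assumes T: "T \<in> A" shows "norm T \<le> norm (ad T)"
proof (cases "norm T = 0")
  case False
  have "(norm T)\<^sup>2 \<le> norm (ad T) * norm T"
    using cstar_id[OF T] norm_mult_ineq[of "ad T" T] by simp
  then show ?thesis
    using False by (simp add: power2_eq_square)
qed (use T in simp)

lemma norm_ad: "T \<in> A \<Longrightarrow> norm (ad T) = norm T"
  using norm_ad_le[of T] norm_ad_le[of "ad T"] by (simp add: ad_ad in_A)

lemma norm_one_le: "norm (1::'r) \<le> 1"
proof -
  have "norm (1::'r) = (norm (1::'r))\<^sup>2"
    using cstar_id[OF one_in] by (simp add: ad_one)
  then have "norm (1::'r) = 0 \<or> norm (1::'r) = 1"
    by (auto simp: power2_eq_square)
  then show ?thesis
    by auto
qed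

lemma norm_power_le: "T \<in> A \<Longrightarrow> norm (T ^ n) \<le> norm T ^ n"
proof (induction n)
  case (Suc n)
  have "norm (T ^ Suc n) \<le> norm T * norm (T ^ n)"
    by (simp add: norm_mult_ineq)
  also have "\<dots> \<le> norm T * norm T ^ n"
    using Suc by (intro mult_left_mono) auto
  finally show ?case
    by simp
qed (simp add: norm_one_le)

lemma norm_J_mult: assumes "T \<in> A" shows "norm T \<le> norm (J * T)"
proof -
  have "norm (ad J * J) = (norm J)\<^sup>2"
    using cstar_id[OF J_in] .
  then have "(norm J)\<^sup>2 \<le> 1"
    using norm_one_le by (simp add: ad_J J_J)
  then have nJ: "norm J \<le> 1"
    by (intro power2_le_imp_le[of "norm J" 1]) auto
  have "T = - (J * (J * T))"
    by (simp add: mult.assoc[symmetric] J_J)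
  then have "norm T \<le> norm J * norm (J * T)"
    by (metis norm_minus_cancel norm_mult_ineq)
  also have "\<dots> \<le> 1 * norm (J * T)"
    using nJ by (intro mult_right_mono) auto
  finally show ?thesis
    by simp
qed

definition inv_in :: "'r \<Rightarrow> bool" where
  "inv_in T \<longleftrightarrow> T \<in> A \<and> (\<exists>S\<in>A. S * T = 1 \<and> T * S = 1)"

definition sa :: "'r \<Rightarrow> bool" where
  "sa T \<longleftrightarrow> T \<in> A \<and> ad T = T"

definition spec :: "'r \<Rightarrow> real set" where
  "spec T = {t. \<not> inv_in (T - t *\<^sub>R 1)}"

lemma inv_in_one: "inv_in 1"
  by (auto simp: inv_in_def in_A)

lemma inv_in_mult: assumes "inv_in S" "inv_in T" shows "inv_in (S * T)"
proof -
  obtain S' T' where *: "S' \<in> A" "S' * S = 1" "S * S' = 1" "T' \<in> A" "T' * T = 1" "T * T' = 1"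
    using assms by (auto simp: inv_in_def)
  have "T' * S' * (S * T) = T' * (S' * S) * T" "S * T * (T' * S') = S * (T * T') * S'"
    by (simp_all only: mult.assoc)
  then have "T' * S' * (S * T) = 1" "S * T * (T' * S') = 1"
    using * by simp_all
  then show ?thesis
    using * assms unfolding inv_in_def by (blast intro: mult_in)
qed

lemma inv_in_minus: "inv_in T \<Longrightarrow> inv_in (- T)"
  unfolding inv_in_def by (metis minus_in minus_mult_minus)

lemma inv_in_scaleR: "inv_in T \<Longrightarrow> t \<noteq> 0 \<Longrightarrow> inv_in (t *\<^sub>R T)"
  unfolding inv_in_def
  by (auto intro!: in_A bexI[where x = "inverse t *\<^sub>R S" for S])

lemma inv_in_J: "inv_in J"
  using J_J J_in by (auto simp: inv_in_def in_A intro!: bexI[where x = "- J"])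

lemma inv_in_scaleR_one: "t \<noteq> 0 \<Longrightarrow> inv_in (t *\<^sub>R 1)"
  by (rule inv_in_scaleR[OF inv_in_one])

lemma inv_in_one_minus:
  assumes T: "T \<in> A" and "norm T < 1"
  shows "inv_in (1 - T)"
proof -
  have *: "summable (\<lambda>n. norm (T ^ n))"
    by (rule summable_comparison_test'[where g = "\<lambda>n. norm T ^ n" and N = 0])
      (use assms in \<open>auto simp: norm_power_le summable_geometric\<close>)
  then have s: "summable (\<lambda>n. T ^ n)"
    by (rule summable_norm_cancel)
  define S where "S = (\<Sum>n. T ^ n)"
  have lim: "(\<lambda>n. \<Sum>i<n. T ^ i) \<longlonglongrightarrow> S"
    using s unfolding S_def by (rule summable_LIMSEQ)
  \<comment> \<open>The Neumann series converges in the ambient ring, and \<open>A\<close> is closed.\<close>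
  have "S \<in> A"
    by (rule closed_sequentially[OF closed_A _ lim]) (auto intro!: in_A T)
  have z: "(\<lambda>n. T ^ n) \<longlonglongrightarrow> 0"
    using s by (rule summable_LIMSEQ_zero)
  have e: "(\<Sum>i<n. T ^ i) * (1 - T) = 1 - T ^ n" "(1 - T) * (\<Sum>i<n. T ^ i) = 1 - T ^ n" for n
    by (induction n) (simp_all add: distrib_left distrib_right, simp_all add: algebra_simps power_commutes)
  have "(\<lambda>n. (\<Sum>i<n. T ^ i) * (1 - T)) \<longlonglongrightarrow> S * (1 - T)"
    "(\<lambda>n. (1 - T) * (\<Sum>i<n. T ^ i)) \<longlonglongrightarrow> (1 - T) * S"
    by (intro tendsto_intros lim)+
  moreover have "(\<lambda>n. 1 - T ^ n) \<longlonglongrightarrow> 1 - 0"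
    by (intro tendsto_intros z)
  ultimately have "S * (1 - T) = 1" "(1 - T) * S = 1"
    unfolding e using LIMSEQ_unique by fastforce+
  then show ?thesis
    using \<open>S \<in> A\<close> T by (auto simp: inv_in_def in_A)
qed

lemma inv_in_diff:
  assumes T: "T \<in> A" and "norm T < t"
  shows "inv_in (t *\<^sub>R 1 - T)"
proof -
  have "t > 0"
    using assms norm_ge_zero[of T] by linarith
  then have "inv_in (t *\<^sub>R (1 - inverse t *\<^sub>R T))"
    using assms by (intro inv_in_scaleR inv_in_one_minus in_A) (auto simp: field_simps)
  then show ?thesis
    using \<open>t > 0\<close> by (simp add: algebra_simps)
qed

lemma sa_in: "sa T \<Longrightarrow> T \<in> A"
  by (simp add: sa_def)

lemma sa_add: "sa S \<Longrightarrow> sa T \<Longrightarrow> sa (S + T)"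
  and sa_diff: "sa S \<Longrightarrow> sa T \<Longrightarrow> sa (S - T)"
  and sa_scaleR: "sa T \<Longrightarrow> sa (t *\<^sub>R T)"
  and sa_power: "sa T \<Longrightarrow> sa (T ^ n)"
  and sa_one: "sa 1"
  and sa_zero: "sa 0"
  and sa_minus: "sa T \<Longrightarrow> sa (- T)"
  and sa_ad_mult: "X \<in> A \<Longrightarrow> sa (ad X * X)"
  and sa_mult_ad: "X \<in> A \<Longrightarrow> sa (X * ad X)"
  by (simp_all add: sa_def in_A ad_simps)

lemmas sa_intros = sa_add sa_diff sa_scaleR sa_power sa_one sa_zero sa_minus sa_ad_mult sa_mult_ad

lemma norm_sa_square: "sa T \<Longrightarrow> norm (T * T) = (norm T)\<^sup>2"
  using cstar_id[of T] by (simp add: sa_def)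

lemma norm_sa_power_two: "sa T \<Longrightarrow> norm (T ^ (2 ^ n)) = norm T ^ (2 ^ n)"
proof (induction n)
  case (Suc n)
  have "norm (T ^ (2 ^ Suc n)) = norm (T ^ (2 ^ n) * T ^ (2 ^ n))"
    by (simp add: power_add[symmetric] mult_2)
  also have "\<dots> = (norm T ^ (2 ^ n))\<^sup>2"
    using norm_sa_square[OF sa_power[OF Suc.prems]] Suc by simp
  finally show ?case
    by (simp add: power_mult[symmetric] mult.commute)
qed simp

text \<open>
  Adding a large imaginary multiple of the unit moves \<open>T\<close> only to second order, by the
  C*-identity; so \<open>T - b J\<close> is a small perturbation of a large multiple of \<open>J\<close>.
\<close>

lemma inv_in_sa_plus_J:
  assumes T: "sa T" and "b \<noteq> 0"
  shows "inv_in (T + b *\<^sub>R J)"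
proof -
  have pos: "inv_in (T - b *\<^sub>R J)" if T: "sa T" and b: "b > 0" for T b
  proof -
    have TA: "T \<in> A" and aT: "ad T = T"
      using T by (auto simp: sa_def)
    define l where "l = (norm T)\<^sup>2 / (2 * b)"
    have "(norm (T + l *\<^sub>R J))\<^sup>2 = norm (ad (T + l *\<^sub>R J) * (T + l *\<^sub>R J))"
      using TA by (simp add: cstar_id in_A)
    also have "ad (T + l *\<^sub>R J) * (T + l *\<^sub>R J) = T * T + (l * l) *\<^sub>R 1"
      using TA aT J_comm[OF TA] by (simp add: ad_simps in_A algebra_simps J_J)
    also have "norm (T * T + (l * l) *\<^sub>R 1) \<le> norm (T * T) + norm ((l * l) *\<^sub>R (1::'r))"
      by (rule norm_triangle_ineq)
    also have "\<dots> \<le> (norm T)\<^sup>2 + l\<^sup>2"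
      using norm_sa_square[OF T] norm_one_le mult_left_mono[OF norm_one_le, of "l\<^sup>2"]
      by (simp add: power2_eq_square)
    also have "\<dots> < (b + l)\<^sup>2"
    proof -
      have "2 * b * l = (norm T)\<^sup>2"
        using b by (simp add: l_def)
      then show ?thesis
        using b by (simp add: power2_sum)
    qed
    finally have n: "norm (T + l *\<^sub>R J) < b + l"
      using b by (intro power2_less_imp_less[of _ "b + l"]) (auto simp: l_def)
    have "norm (- J * (T + l *\<^sub>R J)) \<le> norm (T + l *\<^sub>R J)"
    proof -
      have "norm (J * (T + l *\<^sub>R J)) \<le> norm (J * (J * (T + l *\<^sub>R J)))"
        using TA by (intro norm_J_mult in_A)
      also have "J * (J * (T + l *\<^sub>R J)) = - (T + l *\<^sub>R J)"
        by (simp only: mult.assoc[symmetric] J_J) simp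
      finally show ?thesis
        by (simp only: norm_minus_cancel mult_minus_left)
    qed
    then have "inv_in ((b + l) *\<^sub>R 1 - (- J * (T + l *\<^sub>R J)))"
      using n TA by (intro inv_in_diff in_A) linarith+
    moreover have "inv_in (- J)"
      by (rule inv_in_minus[OF inv_in_J])
    ultimately have "inv_in (- J * ((b + l) *\<^sub>R 1 - (- J * (T + l *\<^sub>R J))))"
      by (rule inv_in_mult[rotated])
    also have "- J * ((b + l) *\<^sub>R 1 - (- J * (T + l *\<^sub>R J))) = T - b *\<^sub>R J"
      by (simp add: algebra_simps mult.assoc[symmetric] J_J)
    finally show ?thesis .
  qed
  show ?thesis
  proof (cases "b > 0")
    case True
    then show ?thesis
      using inv_in_minus[OF pos[OF sa_minus[OF T] True]] by (simp add: add.commute)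
  next
    case False
    then show ?thesis
      using pos[OF T, of "- b"] assms(2) by simp
  qed
qed

lemma inv_in_sa_quadratic:
  assumes T: "sa T" and "b \<noteq> 0"
  shows "inv_in (T * T + (b * b) *\<^sub>R 1)"
proof -
  have "T * T + (b * b) *\<^sub>R 1 = (T + b *\<^sub>R J) * (T + (- b) *\<^sub>R J)"
    using J_comm[OF sa_in[OF T]] by (simp add: algebra_simps J_J)
  then show ?thesis
    using inv_in_mult[OF inv_in_sa_plus_J[OF T, of b] inv_in_sa_plus_J[OF T, of "- b"]] assms
    by simp
qed

text \<open>
  This is \<open>\<bar>2 h / (1 + h\<^sup>2)\<bar> \<le> 1\<close>: up to the factor \<open>\<i>\<close> the left-hand side is the
  imaginary part of the Cayley transform \<open>(1 + \<i>h) / (1 - \<i>h)\<close>, a unitary.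
\<close>

lemma cayley_contraction:
  assumes T: "sa T"
  obtains Z where "Z \<in> A" "Z * (1 + T * T) = 1" "(1 + T * T) * Z = 1" "norm (2 *\<^sub>R (T * Z)) \<le> 1"
proof -
  have TA: "T \<in> A" and aT: "ad T = T" and TJ: "T * J = J * T"
    using T J_comm by (auto simp: sa_def)
  define P where "P = 1 + J * T"
  define M where "M = 1 - J * T"
  have PM: "P \<in> A" "M \<in> A" "ad P = M" "ad M = P" "P * M = 1 + T * T" "M * P = 1 + T * T"
  proof -
    have JTJT: "J * T * (J * T) = - (T * T)"
    proof -
      have "J * T * (J * T) = J * (T * J) * T"
        by (simp only: mult.assoc)
      also have "\<dots> = (J * J) * (T * T)"
        by (simp only: TJ mult.assoc)
      finally show ?thesis
        by (simp add: J_J)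
    qed
    show "P \<in> A" "M \<in> A" "ad P = M" "ad M = P"
      using TA aT TJ by (auto simp: P_def M_def in_A ad_simps)
    show "P * M = 1 + T * T" "M * P = 1 + T * T"
      using JTJT by (auto simp: P_def M_def algebra_simps)
  qed
  have inv: "inv_in (b *\<^sub>R J * (T - b *\<^sub>R J))" if "b * b = 1" for b
  proof -
    have "b \<noteq> 0"
      using that by auto
    then show ?thesis
      using inv_in_sa_plus_J[OF T, of "- b"] by (intro inv_in_mult inv_in_scaleR inv_in_J) auto
  qed
  have "inv_in P" "inv_in M"
    using inv[of 1] inv[of "-1"] by (auto simp: P_def M_def algebra_simps J_J)
  then obtain P' M' where P': "P' \<in> A" "P' * P = 1" "P * P' = 1" and M': "M' \<in> A" "M' * M = 1" "M * M' = 1"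
    by (auto simp: inv_in_def)
  define u where "u = P * M'"
  have PM': "P * M' = M' * P"
  proof -
    have "M' * (M * P) * M' = M' * (P * M) * M'"
      using PM by simp
    then show ?thesis
      using M' by (metis mult.assoc mult.left_neutral mult.right_neutral)
  qed
  have MP': "M * P' = P' * M"
  proof -
    have "P' * (M * P) * P' = P' * (P * M) * P'"
      using PM by simp
    then show ?thesis
      using P' by (metis mult.assoc mult.left_neutral mult.right_neutral)
  qed
  have adM': "ad M' = P'"
  proof -
    have "ad M' * P = ad (M * M')"
      using ad_mult[OF PM(2) M'(1)] PM(4) by simp
    then have "ad M' * P = 1"
      using M' by (simp add: ad_one)
    then show ?thesis
      using P' by (metis mult.assoc mult.left_neutral mult.right_neutral)
  qed
  have adu: "ad u = M * P'"
    using PM M' MP' by (simp add: u_def ad_mult adM')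
  have "ad u * u = P' * (M * P) * M'"
    by (simp only: adu MP') (simp only: u_def mult.assoc)
  also have "\<dots> = 1"
    using PM P' M' by (metis mult.assoc mult.left_neutral mult.right_neutral)
  finally have "(norm u)\<^sup>2 \<le> 1"
    using cstar_id[of u] PM M' norm_one_le by (simp add: u_def in_A)
  then have nu: "norm u \<le> 1"
    by (intro power2_le_imp_le[of "norm u" 1]) auto
  define Z where "Z = P' * M'"
  have ZA: "Z \<in> A"
    using P' M' by (simp add: Z_def in_A)
  have Z1: "Z * (1 + T * T) = 1"
    using PM P' M' PM' MP' by (metis Z_def mult.assoc mult.right_neutral)
  have Z2: "(1 + T * T) * Z = 1"
    using PM P' M' PM' MP' by (metis Z_def mult.assoc mult.right_neutral)
  have "u - ad u = (P * P - M * M) * Z"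
  proof -
    have "(P * P) * Z = P * (P * P') * M'"
      by (simp only: Z_def mult.assoc)
    moreover have "M * M * Z = M * (M * P') * M'"
      by (simp only: Z_def mult.assoc)
    ultimately have "(P * P) * Z = u" "M * M * Z = M * (P' * (M * M'))"
      using P' MP' by (simp_all add: u_def mult.assoc)
    then show ?thesis
      using M' by (simp add: adu algebra_simps)
  qed
  also have "P * P - M * M = 4 *\<^sub>R (J * T)"
  proof -
    have "(4::real) *\<^sub>R X = X + X + X + X" for X :: 'r
      using scaleR_left_distrib[of 2 2 X] by (simp add: scaleR_2)
    then show ?thesis
      by (simp add: P_def M_def algebra_simps)
  qed
  finally have "u - ad u = 2 *\<^sub>R (J * (2 *\<^sub>R (T * Z)))"
    by (simp add: mult.assoc)
  then have "2 * norm (J * (2 *\<^sub>R (T * Z))) = norm (u - ad u)"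
    by simp
  also have "\<dots> \<le> 2"
    using norm_triangle_ineq4[of u "ad u"] nu norm_ad[of u] PM M' by (simp add: u_def in_A)
  finally have "norm (2 *\<^sub>R (T * Z)) \<le> 1"
    using norm_J_mult[of "2 *\<^sub>R (T * Z)"] TA ZA by (simp add: in_A)
  then show ?thesis
    using that ZA Z1 Z2 by blast
qed

end

context cstar_ops
begin

subsection \<open>The norm of a self-adjoint element is its spectral radius\<close>

text \<open>
  Normalise \<open>\<parallel>T\<parallel> = 1\<close> and put \<open>K = T\<^sup>2\<close>. If \<open>1 - K\<close> were invertible, the partial sums
  \<open>X\<^sub>n = 1 + K + \<dots> + K\<^bsup>n-1\<^esup>\<close> would stay bounded. For \<open>n = 2\<^sup>k\<close>, however,
  \<open>X\<^sub>n\<close> is the product of the factors \<open>1 + H\<^sup>2\<close> with \<open>H = T, T\<^sup>2, T\<^sup>4, \<dots>\<close>, and dividing the product of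
  the \<open>2 H\<close> by it leaves a contraction; so \<open>n T\<^bsup>n-1\<^esup>\<close>, whose norm is at least \<open>n\<close>, is bounded
  by \<open>\<parallel>X\<^sub>n\<parallel>\<close>.
\<close>

lemma dyadic_geometric_sum:
  assumes T: "sa T"
  shows "\<exists>G\<in>A. norm G \<le> 1 \<and> G * T = T * G \<and>
    (2 ^ k) *\<^sub>R T ^ (2 ^ k - 1) = G * (\<Sum>j<2 ^ k. (T * T) ^ j)"
proof (induction k)
  case 0
  show ?case
    by (auto intro!: bexI[where x = 1] simp: norm_one_le in_A)
next
  case (Suc k)
  then obtain G where G: "G \<in> A" "norm G \<le> 1" "G * T = T * G"
    "(2 ^ k) *\<^sub>R T ^ (2 ^ k - 1) = G * (\<Sum>j<2 ^ k. (T * T) ^ j)"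
    by auto
  define H where "H = T ^ (2 ^ k)"
  have TA: "T \<in> A" and H: "sa H" "H \<in> A"
    using sa_power[OF T] sa_in T by (auto simp: H_def)
  obtain Z where Z: "Z \<in> A" "Z * (1 + H * H) = 1" "(1 + H * H) * Z = 1" "norm (2 *\<^sub>R (H * Z)) \<le> 1"
    using cayley_contraction[OF H(1)] .
  have TH: "T * H = H * T"
    by (simp add: H_def power_commutes)
  have TZ: "T * Z = Z * T"
  proof -
    have "T * (H * H) = (H * H) * T"
      by (metis TH mult.assoc)
    then have c: "T * (1 + H * H) = (1 + H * H) * T"
      by (simp add: distrib_left distrib_right)
    have "(Z * T) * ((1 + H * H) * Z) = Z * (T * (1 + H * H)) * Z"
      by (simp only: mult.assoc)
    also have "\<dots> = (Z * (1 + H * H)) * (T * Z)"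
      by (simp only: c mult.assoc)
    finally show ?thesis
      using Z by simp
  qed
  have HZ: "H * Z = Z * H"
    using TZ power_commuting_commutes[of T Z] by (simp add: H_def)
  define G' where "G' = 2 *\<^sub>R (H * Z) * G"
  have 1: "G' \<in> A" "norm G' \<le> 1"
  proof -
    show "norm G' \<le> 1"
      using norm_mult_ineq[of "2 *\<^sub>R (H * Z)" G] mult_mono[OF Z(4) G(2)] by (simp add: G'_def)
  qed (use G Z H in \<open>auto simp: G'_def in_A\<close>)
  have 2: "G' * T = T * G'"
  proof -
    have "H * Z * G * T = H * (Z * (G * T))"
      by (simp only: mult.assoc)
    also have "\<dots> = (H * (Z * T)) * G"
      by (simp only: G(3) mult.assoc)
    also have "\<dots> = ((H * T) * Z) * G"
      by (simp only: TZ[symmetric] mult.assoc)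
    also have "\<dots> = T * (H * Z * G)"
      by (simp only: TH[symmetric] mult.assoc)
    finally show ?thesis
      by (simp add: G'_def)
  qed
  have s: "(\<Sum>j<2 ^ Suc k. (T * T) ^ j) = (1 + H * H) * (\<Sum>j<2 ^ k. (T * T) ^ j)"
  proof -
    have split: "{..<2 ^ Suc k} = {..<2 ^ k} \<union> (\<lambda>j. 2 ^ k + j) ` {..<2 ^ k :: nat}"
    proof -
      have "x \<in> (\<lambda>j. 2 ^ k + j) ` {..<2 ^ k}" if "x < 2 ^ Suc k" "\<not> x < 2 ^ k" for x :: nat
        using that by (intro image_eqI[where x = "x - 2 ^ k"]) auto
      then show ?thesis
        by auto
    qed
    have "(\<Sum>j<2 ^ Suc k. (T * T) ^ j) = (\<Sum>j<2 ^ k. (T * T) ^ j) + (\<Sum>j<2 ^ k. (T * T) ^ (2 ^ k + j))"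
      unfolding split by (subst sum.union_disjoint) (auto simp: sum.reindex inj_on_def)
    also have "(\<Sum>j<2 ^ k. (T * T) ^ (2 ^ k + j)) = H * H * (\<Sum>j<2 ^ k. (T * T) ^ j)"
      by (simp add: power_add sum_distrib_left H_def power_mult_distrib[symmetric]
          power2_eq_square[symmetric] power_mult[symmetric] mult.commute)
    finally show ?thesis
      by (simp add: algebra_simps)
  qed
  have GH: "G * H = H * G"
    using G(3) power_commuting_commutes[of T G] by (simp add: H_def)
  have e: "2 ^ Suc k - 1 = 2 ^ k + (2 ^ k - (1::nat))"
    by simp
  have "(2 ^ Suc k) *\<^sub>R T ^ (2 ^ Suc k - 1) = 2 *\<^sub>R (H * ((2 ^ k) *\<^sub>R T ^ (2 ^ k - 1)))"
    unfolding e power_add by (simp add: H_def)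
  also have "\<dots> = 2 *\<^sub>R (H * (G * (\<Sum>j<2 ^ k. (T * T) ^ j)))"
    by (simp only: G(4))
  also have "\<dots> = G' * ((1 + H * H) * (\<Sum>j<2 ^ k. (T * T) ^ j))"
  proof -
    have "G * (H * H) = (H * H) * G"
      by (metis GH mult.assoc)
    then have "G * (1 + H * H) = (1 + H * H) * G"
      by (simp add: distrib_left distrib_right)
    then have "G' * (1 + H * H) = 2 *\<^sub>R (H * (Z * (1 + H * H)) * G)"
      unfolding G'_def mult.assoc mult_scaleR_left by (simp only: mult.assoc)
    also have "\<dots> = 2 *\<^sub>R (H * G)"
      using Z by simp
    finally show ?thesis
      by (simp add: mult.assoc[symmetric])
  qed
  finally show ?case
    using 1 2 s by (intro bexI[where x = G']) auto
qed

lemma not_inv_in_norm_square: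
  assumes T: "sa T" and "T \<noteq> 0"
  shows "\<not> inv_in ((norm T)\<^sup>2 *\<^sub>R 1 - T * T)"
proof
  assume inv: "inv_in ((norm T)\<^sup>2 *\<^sub>R 1 - T * T)"
  define m where "m = norm T"
  define S where "S = inverse m *\<^sub>R T"
  have m: "m > 0"
    using assms by (simp add: m_def)
  have S: "sa S" "norm S = 1" "S \<in> A"
    using T m by (auto simp: S_def sa_scaleR sa_in in_A m_def)
  have "inv_in (inverse (m * m) *\<^sub>R ((norm T)\<^sup>2 *\<^sub>R 1 - T * T))"
    using m by (intro inv_in_scaleR inv) auto
  also have "inverse (m * m) *\<^sub>R ((norm T)\<^sup>2 *\<^sub>R 1 - T * T) = 1 - S * S"
    using m by (simp add: S_def m_def power2_eq_square algebra_simps)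
  finally obtain Y where Y: "Y \<in> A" "Y * (1 - S * S) = 1"
    by (auto simp: inv_in_def)
  have SS: "norm ((S * S) ^ n) \<le> 1" for n
    using norm_power_le[of "S * S" n] norm_sa_square[OF S(1)] S by (auto simp: in_A)
  have "2 ^ k \<le> norm Y * 2" for k :: nat
  proof -
    obtain G where G: "G \<in> A" "norm G \<le> 1"
      "(2 ^ k) *\<^sub>R S ^ (2 ^ k - 1) = G * (\<Sum>j<2 ^ k. (S * S) ^ j)"
      using dyadic_geometric_sum[OF S(1)] by blast
    have "(\<Sum>j<n. (S * S) ^ j) = Y * (1 - (S * S) ^ n)" for n
    proof -
      have "(1 - S * S) * (\<Sum>j<n. (S * S) ^ j) = 1 - (S * S) ^ n"
        by (induction n) (simp_all add: distrib_left, simp_all add: algebra_simps)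
      then show ?thesis
        using Y(2) by (metis mult.assoc mult.left_neutral)
    qed
    then have "norm (\<Sum>j<n. (S * S) ^ j) \<le> norm Y * 2" for n
    proof -
      have "norm (1 - (S * S) ^ n) \<le> 2"
        using norm_triangle_ineq4[of 1 "(S * S) ^ n"] norm_one_le SS[of n] by linarith
      then have "norm Y * norm (1 - (S * S) ^ n) \<le> norm Y * 2"
        by (intro mult_left_mono) auto
      then show ?thesis
        using norm_mult_ineq[of Y "1 - (S * S) ^ n"] \<open>(\<Sum>j<n. (S * S) ^ j) = Y * (1 - (S * S) ^ n)\<close>
        by simp
    qed
    note bound = this[of "2 ^ k"]
    have "norm (S ^ (2 ^ k - 1)) \<ge> 1"
    proof -
      have "(1::real) = norm (S ^ (2 ^ k))"
        using norm_sa_power_two[OF S(1)] S(2) by simp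
      also have "\<dots> = norm (S * S ^ (2 ^ k - 1))"
        by (metis power_eq_if power_not_zero zero_neq_numeral)
      also have "\<dots> \<le> norm (S ^ (2 ^ k - 1))"
        using norm_mult_ineq[of S] S(2) by (metis mult_1)
      finally show ?thesis .
    qed
    then have "2 ^ k * 1 \<le> 2 ^ k * norm (S ^ (2 ^ k - 1))"
      by (intro mult_left_mono) auto
    also have "\<dots> = norm (G * (\<Sum>j<2 ^ k. (S * S) ^ j))"
      using G(3) by (metis abs_numeral norm_scaleR power_abs)
    also have "\<dots> \<le> norm G * norm (\<Sum>j<2 ^ k. (S * S) ^ j)"
      by (rule norm_mult_ineq)
    also have "\<dots> \<le> 1 * norm (\<Sum>j<2 ^ k. (S * S) ^ j)"
      using G by (intro mult_right_mono) auto
    finally show ?thesis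
      using bound by simp
  qed
  moreover obtain k :: nat where "norm Y * 2 < 2 ^ k"
    using real_arch_pow[of 2] by auto
  ultimately show False
    by (meson not_less)
qed

lemma norm_in_spec:
  assumes T: "sa T" and "T \<noteq> 0"
  shows "\<exists>t\<in>spec T. \<bar>t\<bar> = norm T"
proof (rule ccontr)
  assume *: "\<not> ?thesis"
  then have "norm T \<notin> spec T" "- norm T \<notin> spec T"
    by force+
  then have "inv_in (T - norm T *\<^sub>R 1)" "inv_in (T - (- norm T) *\<^sub>R 1)"
    unfolding spec_def by blast+
  then have "inv_in (- ((T - norm T *\<^sub>R 1) * (T - (- norm T) *\<^sub>R 1)))"
    by (intro inv_in_minus inv_in_mult)
  also have "- ((T - norm T *\<^sub>R 1) * (T - (- norm T) *\<^sub>R 1)) = (norm T)\<^sup>2 *\<^sub>R 1 - T * T"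
    by (simp add: algebra_simps power2_eq_square)
  finally show False
    using not_inv_in_norm_square[OF assms] by simp
qed

lemma norm_le_spec:
  assumes "sa T" "\<And>t. t \<in> spec T \<Longrightarrow> \<bar>t\<bar> \<le> b" "0 \<le> b"
  shows "norm T \<le> b"
  using norm_in_spec[OF assms(1)] assms by (cases "T = 0") force+

lemma spec_le_norm: assumes "T \<in> A" "t \<in> spec T" shows "\<bar>t\<bar> \<le> norm T"
proof (rule ccontr)
  assume "\<not> ?thesis"
  then consider "norm T < t" | "norm (- T) < - t"
    by (auto simp: abs_if split: if_splits)
  then have "inv_in (T - t *\<^sub>R 1)"
  proof cases
    case 1
    then show ?thesis
      using inv_in_minus[OF inv_in_diff[OF assms(1)]] by simp
  next
    case 2
    then show ?thesis
      using inv_in_diff[of "- T" "- t"] assms by (simp add: in_A algebra_simps)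
  qed
  then show False
    using assms by (simp add: spec_def)
qed

lemma closed_spec: assumes "T \<in> A" shows "closed (spec T)"
proof -
  have "open (- spec T)"
    unfolding open_dist
  proof
    fix t assume "t \<in> - spec T"
    then obtain S where S: "S \<in> A" "S * (T - t *\<^sub>R 1) = 1" "(T - t *\<^sub>R 1) * S = 1"
      and inv: "inv_in (T - t *\<^sub>R 1)"
      by (auto simp: spec_def inv_in_def)
    have "s \<in> - spec T" if "dist s t < 1 / (norm S + 1)" for s
    proof -
      have "\<bar>s - t\<bar> * norm S \<le> \<bar>s - t\<bar> * (norm S + 1)"
        by (intro mult_left_mono) auto
      also have "\<dots> < 1"
        using that by (simp add: dist_real_def pos_less_divide_eq add_nonneg_pos)
      finally have "inv_in (1 - (s - t) *\<^sub>R S)"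
        using S by (intro inv_in_one_minus in_A) auto
      then have "inv_in ((T - t *\<^sub>R 1) * (1 - (s - t) *\<^sub>R S))"
        using inv by (rule inv_in_mult[rotated])
      also have "(T - t *\<^sub>R 1) * (1 - (s - t) *\<^sub>R S) = T - s *\<^sub>R 1"
        using S(3) by (simp add: right_diff_distrib) (simp add: algebra_simps)
      finally show ?thesis
        by (simp add: spec_def)
    qed
    then show "\<exists>e>0. \<forall>s. dist s t < e \<longrightarrow> s \<in> - spec T"
      by (intro exI[where x = "1 / (norm S + 1)"]) (auto simp: add_nonneg_pos)
  qed
  then show ?thesis
    by (simp add: closed_def)
qed

lemma compact_spec: "T \<in> A \<Longrightarrow> compact (spec T)"
  using closed_spec[of T] spec_le_norm[of T]
  by (auto simp: compact_eq_bounded_closed bounded_iff intro!: exI[where x = "norm T"])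

subsection \<open>Polynomials and the continuous functional calculus\<close>

definition peval :: "real poly \<Rightarrow> 'r \<Rightarrow> 'r" where
  "peval p T = (\<Sum>i\<le>degree p. coeff p i *\<^sub>R T ^ i)"

lemma peval_altdef: "degree p \<le> n \<Longrightarrow> peval p T = (\<Sum>i\<le>n. coeff p i *\<^sub>R T ^ i)"
  unfolding peval_def by (rule sum.mono_neutral_left) (auto simp: coeff_eq_0)

lemma peval_0 [simp]: "peval 0 T = 0"
  by (simp add: peval_def)

lemma peval_pCons: "peval (pCons a p) T = a *\<^sub>R 1 + T * peval p T"
proof -
  have "degree (pCons a p) \<le> Suc (degree p)"
    by (simp add: degree_pCons_le)
  then have "peval (pCons a p) T = (\<Sum>i\<le>Suc (degree p). coeff (pCons a p) i *\<^sub>R T ^ i)"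
    by (rule peval_altdef)
  also have "\<dots> = a *\<^sub>R 1 + (\<Sum>i\<le>degree p. coeff p i *\<^sub>R T ^ Suc i)"
    by (subst sum.atMost_Suc_shift) simp
  finally show ?thesis
    by (simp add: peval_def sum_distrib_left)
qed

lemma peval_add: "peval (p + q) T = peval p T + peval q T"
proof -
  have "degree (p + q) \<le> max (degree p) (degree q)"
    by (rule degree_add_le_max)
  then show ?thesis
    by (simp add: peval_altdef[of _ "max (degree p) (degree q)"] algebra_simps sum.distrib)
qed

lemma peval_smult: "peval (smult a p) T = a *\<^sub>R peval p T"
  by (simp add: peval_altdef[OF degree_smult_le] peval_def scaleR_sum_right)

lemma peval_commute:
  assumes "Y * T = T * Y"
  shows "Y * peval p T = peval p T * Y"
proof (induction p)
  case (pCons a p)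
  have "Y * (T * peval p T) = T * (Y * peval p T)"
    using assms by (metis mult.assoc)
  then show ?case
    using pCons.IH by (simp add: peval_pCons algebra_simps)
qed simp

lemma peval_mult: "peval (p * q) T = peval p T * peval q T"
  by (induction p) (simp_all add: peval_add peval_smult peval_pCons algebra_simps)

lemma peval_diff: "peval (p - q) T = peval p T - peval q T"
  using peval_add[of p "smult (-1) q" T] peval_smult[of "-1" q T] by simp

lemma sa_peval: assumes "sa T" shows "sa (peval p T)"
  unfolding peval_def sa_def using assms
  by (auto simp: sa_def ad_sum ad_simps in_A)

text \<open>
  A real polynomial without zeros on the spectrum factors into linear polynomials with zeros off the
  spectrum and quadratic polynomials \<open>(t - a)\<^sup>2 + b\<^sup>2\<close>, \<open>b \<noteq> 0\<close>. The latter are invertible at \<open>T\<close> because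
  \<open>T\<close> is self-adjoint.
\<close>

lemma inv_in_peval:
  assumes T: "sa T"
  shows "p \<noteq> 0 \<Longrightarrow> (\<And>t. t \<in> spec T \<Longrightarrow> poly p t \<noteq> 0) \<Longrightarrow> inv_in (peval p T)"
proof (induction "degree p" arbitrary: p rule: less_induct)
  case less
  define P where "P q = (map_poly of_real q :: complex poly)" for q
  have P_pCons: "poly (P (pCons a q)) z = of_real a + z * poly (P q) z" for a q z
    by (cases "a = 0 \<and> q = 0") (auto simp: P_def map_poly_pCons)
  have P_add: "poly (P (q + r)) z = poly (P q) z + poly (P r) z" for q r z
  proof (induction q arbitrary: r)
    case (pCons a q)
    then show ?case
      by (cases r) (simp add: P_pCons algebra_simps)
  qed (simp add: P_def)
  have P_smult: "poly (P (smult c q)) z = of_real c * poly (P q) z" for c q z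
    by (induction q) (simp_all add: P_pCons algebra_simps, simp add: P_def)
  have P_mult: "poly (P (q * r)) z = poly (P q) z * poly (P r) z" for q r z
    by (induction q) (simp_all add: P_pCons P_add P_smult algebra_simps, simp add: P_def)
  have dP: "degree (P q) = degree q" for q
    by (simp add: P_def degree_map_poly)
  show ?case
  proof (cases "degree p = 0")
    case True
    then obtain a where "p = [:a:]" "a \<noteq> 0"
      using less.prems by (metis degree_eq_zeroE pCons_0_0)
    then show ?thesis
      by (simp add: peval_pCons inv_in_scaleR_one)
  next
    case False
    then have "\<not> constant (poly (P p))"
      by (simp add: constant_degree dP)
    then obtain z where z: "poly (P p) z = 0"
      using fundamental_theorem_of_algebra by blast
    have step: ?thesis if dvd: "Q dvd p" and Q: "degree Q > 0" "inv_in (peval Q T)" for Q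
    proof -
      obtain q where pq: "p = Q * q"
        using dvd by (elim dvdE)
      then have "q \<noteq> 0" "Q \<noteq> 0"
        using less.prems by auto
      then have "inv_in (peval q T)"
        using less.hyps[of q] less.prems Q pq by (simp add: degree_mult_eq)
      then show ?thesis
        using Q pq by (simp add: peval_mult inv_in_mult)
    qed
    show ?thesis
    proof (cases "Im z = 0")
      case True
      then have "poly (P q) z = of_real (poly q (Re z))" for q
        by (induction q) (simp_all add: P_pCons complex_eq_iff, simp add: P_def)
      then have r: "poly p (Re z) = 0"
        using z by simp
      then have "Re z \<notin> spec T"
        using less.prems by auto
      then have "inv_in (peval [:- Re z, 1:] T)"
        by (simp add: spec_def peval_pCons algebra_simps)
      then show ?thesis
        using r by (intro step[of "[:- Re z, 1:]"]) (auto simp: poly_eq_0_iff_dvd)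
    next
      case False
      define Q where "Q = [:(Re z)\<^sup>2 + (Im z)\<^sup>2, - 2 * Re z, 1:]"
      have Qz: "poly (P Q) z = 0"
        by (simp add: Q_def P_pCons complex_eq_iff power2_eq_square algebra_simps) (simp add: P_def)
      have degQ: "degree Q = 2" "Q \<noteq> 0"
        by (auto simp: Q_def)
      have "degree (p mod Q) < 2"
        using degree_mod_less'[of Q p] degQ by (cases "p mod Q = 0") auto
      then obtain c d where cd: "p mod Q = [:c, d:]"
        by (intro that[of "coeff (p mod Q) 0" "coeff (p mod Q) 1"] poly_eqI)
          (auto simp: coeff_pCons coeff_eq_0 split: nat.split)
      have "poly (P p) z = poly (P Q) z * poly (P (p div Q)) z + poly (P (p mod Q)) z"
        by (metis P_add P_mult mult_div_mod_eq)
      then have "poly (P [:c, d:]) z = 0"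
        using Qz z cd by simp
      then have "of_real c + z * of_real d = 0"
        by (simp add: P_pCons) (simp add: P_def)
      then have "c = 0 \<and> d = 0"
        using False by (auto simp: complex_eq_iff)
      then have "Q dvd p"
        using cd by (simp add: mod_eq_0_iff_dvd)
      moreover have "peval Q T = (T - Re z *\<^sub>R 1) * (T - Re z *\<^sub>R 1) + (Im z * Im z) *\<^sub>R 1"
      proof -
        have "(2 * Re z) *\<^sub>R T = Re z *\<^sub>R T + Re z *\<^sub>R T"
          by (simp add: scaleR_left_distrib[symmetric])
        then show ?thesis
          by (simp add: Q_def peval_pCons power2_eq_square algebra_simps)
      qed
      ultimately show ?thesis
        using inv_in_sa_quadratic[of "T - Re z *\<^sub>R 1" "Im z"] T False degQ
        by (intro step[of Q]) (auto intro: sa_intros)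
    qed
  qed
qed

text \<open>
  By the preceding lemma the spectrum of \<open>p(T)\<close> is contained in the image of that of \<open>T\<close> under \<open>p\<close>.
\<close>

lemma norm_peval_le:
  assumes T: "sa T" and "\<And>t. t \<in> spec T \<Longrightarrow> \<bar>poly p t\<bar> \<le> b" and "0 \<le> b"
  shows "norm (peval p T) \<le> b"
proof (rule norm_le_spec[OF sa_peval[OF T]])
  fix s assume s: "s \<in> spec (peval p T)"
  have ps: "peval (p - [:s:]) T = peval p T - s *\<^sub>R 1"
    by (simp add: peval_diff peval_pCons)
  show "\<bar>s\<bar> \<le> b"
  proof (cases "p = [:s:]")
    case True
    then have "\<not> inv_in 0"
      using s by (simp add: spec_def peval_pCons)
    then have "0 \<in> spec 0"
      by (simp add: spec_def)
    then have "spec T \<noteq> {}"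
      using norm_in_spec[OF T] by (cases "T = 0") auto
    then show ?thesis
      using assms(2) True by auto
  next
    case False
    then have "\<exists>t\<in>spec T. poly (p - [:s:]) t = 0"
      using inv_in_peval[OF T, of "p - [:s:]"] s ps by (auto simp: spec_def)
    then show ?thesis
      using assms(2) by auto
  qed
qed fact

end

context cstar_ops
begin

definition fc :: "(real \<Rightarrow> real) \<Rightarrow> 'r \<Rightarrow> 'r" where
  "fc f T = (THE S. \<forall>p :: nat \<Rightarrow> real poly.
     uniform_limit (spec T) (\<lambda>n. poly (p n)) f sequentially \<longrightarrow> (\<lambda>n. peval (p n) T) \<longlonglongrightarrow> S)"

lemma ex_poly_approx:
  assumes "T \<in> A" "continuous_on (spec T) f"
  shows "\<exists>p :: nat \<Rightarrow> real poly. uniform_limit (spec T) (\<lambda>n. poly (p n)) f sequentially"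
proof -
  have "\<exists>p :: real poly. \<forall>t\<in>spec T. \<bar>f t - poly p t\<bar> < inverse (Suc n)" for n
  proof -
    obtain g where g: "real_polynomial_function g" "\<And>t. t \<in> spec T \<Longrightarrow> \<bar>f t - g t\<bar> < inverse (Suc n)"
      using Stone_Weierstrass_real_polynomial_function[OF compact_spec[OF assms(1)] assms(2), of "inverse (Suc n)"]
      by auto
    obtain a k where a: "g = (\<lambda>t. \<Sum>i\<le>k. a i * t ^ i)"
      using g(1) by (auto simp: real_polynomial_function_iff_sum)
    have "poly (\<Sum>i\<le>k. monom (a i) i) t = g t" for t
      by (simp add: a poly_sum poly_monom)
    then show ?thesis
      using g(2) by metis
  qed
  then obtain p :: "nat \<Rightarrow> real poly" where p: "\<And>n t. t \<in> spec T \<Longrightarrow> \<bar>f t - poly (p n) t\<bar> < inverse (Suc n)"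
    by metis
  have "uniform_limit (spec T) (\<lambda>n. poly (p n)) f sequentially"
  proof (rule uniform_limitI)
    fix e :: real assume "e > 0"
    then obtain N where N: "inverse (Suc N) < e"
      using reals_Archimedean by blast
    have "dist (poly (p n) t) (f t) < e" if "n \<ge> N" "t \<in> spec T" for n t
    proof -
      have "inverse (real (Suc n)) \<le> inverse (real (Suc N))"
        using that by simp
      moreover have "dist (poly (p n) t) (f t) = \<bar>f t - poly (p n) t\<bar>"
        by (simp add: dist_real_def abs_minus_commute)
      ultimately show ?thesis
        using p[OF that(2), of n] N by linarith
    qed
    then show "\<forall>\<^sub>F n in sequentially. \<forall>t\<in>spec T. dist (poly (p n) t) (f t) < e"
      by (auto simp: eventually_sequentially)
  qed
  then show ?thesis
    by blast
qed

lemma fc_tendsto: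
  assumes T: "sa T" and f: "continuous_on (spec T) f"
    and p: "uniform_limit (spec T) (\<lambda>n. poly (p n)) f sequentially"
  shows "(\<lambda>n. peval (p n) T) \<longlonglongrightarrow> fc f T"
proof -
  have close: "\<exists>N. \<forall>m\<ge>N. \<forall>n\<ge>N. norm (peval (p m) T - peval (q n) T) \<le> e"
    if p: "uniform_limit (spec T) (\<lambda>n. poly (p n)) f sequentially"
      and q: "uniform_limit (spec T) (\<lambda>n. poly (q n)) f sequentially" and "e > 0" for p q e
  proof -
    have "\<forall>\<^sub>F n in sequentially. (\<forall>t\<in>spec T. dist (poly (p n) t) (f t) < e / 2) \<and>
        (\<forall>t\<in>spec T. dist (poly (q n) t) (f t) < e / 2)"
      using uniform_limitD[OF p, of "e / 2"] uniform_limitD[OF q, of "e / 2"] \<open>e > 0\<close>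
      by (intro eventually_conj) auto
    then obtain N where N: "\<And>n t. n \<ge> N \<Longrightarrow> t \<in> spec T \<Longrightarrow>
        dist (poly (p n) t) (f t) < e / 2 \<and> dist (poly (q n) t) (f t) < e / 2"
      by (auto simp: eventually_sequentially)
    have "norm (peval (p m) T - peval (q n) T) \<le> e" if "m \<ge> N" "n \<ge> N" for m n
      unfolding peval_diff[symmetric]
    proof (rule norm_peval_le[OF T])
      show "\<bar>poly (p m - q n) t\<bar> \<le> e" if "t \<in> spec T" for t
        using N[OF \<open>m \<ge> N\<close> that] N[OF \<open>n \<ge> N\<close> that]
        unfolding dist_real_def poly_diff by linarith
    qed (use \<open>e > 0\<close> in simp)
    then show ?thesis
      by blast
  qed
  have conv: "\<exists>S. \<forall>q. uniform_limit (spec T) (\<lambda>n. poly (q n)) f sequentially \<longrightarrow>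
    (\<lambda>n. peval (q n) T) \<longlonglongrightarrow> S"
  proof -
    have "Cauchy (\<lambda>n. peval (p n) T)"
    proof (rule CauchyI)
      fix e :: real assume "e > 0"
      then obtain N where "\<forall>m\<ge>N. \<forall>n\<ge>N. norm (peval (p m) T - peval (p n) T) \<le> e / 2"
        using close[OF p p, of "e / 2"] by auto
      then have "norm (peval (p m) T - peval (p n) T) < e" if "m \<ge> N" "n \<ge> N" for m n
        using that \<open>e > 0\<close> by (smt (verit, best) field_sum_of_halves)
      then show "\<exists>N. \<forall>m\<ge>N. \<forall>n\<ge>N. norm (peval (p m) T - peval (p n) T) < e"
        by blast
    qed
    then obtain S where S: "(\<lambda>n. peval (p n) T) \<longlonglongrightarrow> S"
      by (auto simp: Cauchy_convergent_iff convergent_def)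
    have "(\<lambda>n. peval (q n) T) \<longlonglongrightarrow> S" if q: "uniform_limit (spec T) (\<lambda>n. poly (q n)) f sequentially" for q
    proof -
      have "(\<lambda>n. peval (q n) T - peval (p n) T) \<longlonglongrightarrow> 0"
      proof (rule LIMSEQ_I)
        fix e :: real assume "e > 0"
        then obtain N where "\<forall>m\<ge>N. \<forall>n\<ge>N. norm (peval (q m) T - peval (p n) T) \<le> e / 2"
          using close[OF q p, of "e / 2"] by auto
        then have "\<forall>n\<ge>N. norm (peval (q n) T - peval (p n) T - 0) < e"
          using \<open>e > 0\<close> by force
        then show "\<exists>N. \<forall>n\<ge>N. norm (peval (q n) T - peval (p n) T - 0) < e" ..
      qed
      then show ?thesis
        using tendsto_add[OF _ S] by fastforce
    qed
    then show ?thesis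
      by blast
  qed
  have "\<forall>q. uniform_limit (spec T) (\<lambda>n. poly (q n)) f sequentially \<longrightarrow>
    (\<lambda>n. peval (q n) T) \<longlonglongrightarrow> fc f T"
    unfolding fc_def
  proof (rule theI')
    show "\<exists>!S. \<forall>q. uniform_limit (spec T) (\<lambda>n. poly (q n)) f sequentially \<longrightarrow>
      (\<lambda>n. peval (q n) T) \<longlonglongrightarrow> S"
      using conv p LIMSEQ_unique by blast
  qed
  then show ?thesis
    using p by blast
qed

lemma fc_approx:
  assumes T: "sa T" and f: "continuous_on (spec T) f"
  obtains p where "uniform_limit (spec T) (\<lambda>n. poly (p n)) f sequentially"
    "(\<lambda>n. peval (p n) T) \<longlonglongrightarrow> fc f T"
  using ex_poly_approx[OF sa_in[OF T] f] fc_tendsto[OF T f] by blast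

lemma fc_poly: assumes "sa T" shows "fc (poly p) T = peval p T"
proof -
  have "(\<lambda>n. peval p T) \<longlonglongrightarrow> fc (poly p) T"
    using assms by (intro fc_tendsto continuous_intros uniform_limit_const)
  then show ?thesis
    by (simp add: LIMSEQ_const_iff)
qed

lemma fc_cong: assumes "\<And>t. t \<in> spec T \<Longrightarrow> f t = g t" shows "fc f T = fc g T"
proof -
  have "uniform_limit (spec T) h f sequentially \<longleftrightarrow> uniform_limit (spec T) h g sequentially" for h
    by (rule uniform_limit_cong') (use assms in auto)
  then show ?thesis
    by (simp add: fc_def)
qed

lemma fc_const: assumes "sa T" shows "fc (\<lambda>t. c) T = c *\<^sub>R 1"
proof -
  have "poly [:c:] = (\<lambda>t. c)"
    by auto
  then show ?thesis
    using fc_poly[OF assms, of "[:c:]"] by (simp add: peval_pCons)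
qed

lemma fc_id: assumes "sa T" shows "fc (\<lambda>t. t) T = T"
proof -
  have "poly [:0, 1:] = (\<lambda>t. t :: real)"
    by auto
  then show ?thesis
    using fc_poly[OF assms, of "[:0, 1:]"] by (simp add: peval_pCons)
qed

lemma fc_add:
  assumes T: "sa T" and f: "continuous_on (spec T) f" and g: "continuous_on (spec T) g"
  shows "fc (\<lambda>t. f t + g t) T = fc f T + fc g T"
proof -
  obtain p where p: "uniform_limit (spec T) (\<lambda>n. poly (p n)) f sequentially"
    "(\<lambda>n. peval (p n) T) \<longlonglongrightarrow> fc f T"
    using fc_approx[OF T f] .
  obtain q where q: "uniform_limit (spec T) (\<lambda>n. poly (q n)) g sequentially"
    "(\<lambda>n. peval (q n) T) \<longlonglongrightarrow> fc g T"
    using fc_approx[OF T g] .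
  have "(\<lambda>n. peval (p n + q n) T) \<longlonglongrightarrow> fc (\<lambda>t. f t + g t) T"
  proof (intro fc_tendsto T continuous_intros f g)
    have "(\<lambda>n. poly (p n + q n)) = (\<lambda>n t. poly (p n) t + poly (q n) t)"
      by (intro ext) simp
    then show "uniform_limit (spec T) (\<lambda>n. poly (p n + q n)) (\<lambda>t. f t + g t) sequentially"
      using uniform_limit_add[OF p(1) q(1)] by simp
  qed
  moreover have "(\<lambda>n. peval (p n + q n) T) \<longlonglongrightarrow> fc f T + fc g T"
    using tendsto_add[OF p(2) q(2)] by (simp add: peval_add)
  ultimately show ?thesis
    by (rule LIMSEQ_unique)
qed

lemma fc_mult:
  assumes T: "sa T" and f: "continuous_on (spec T) f" and g: "continuous_on (spec T) g"
  shows "fc (\<lambda>t. f t * g t) T = fc f T * fc g T"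
proof -
  obtain p where p: "uniform_limit (spec T) (\<lambda>n. poly (p n)) f sequentially"
    "(\<lambda>n. peval (p n) T) \<longlonglongrightarrow> fc f T"
    using fc_approx[OF T f] .
  obtain q where q: "uniform_limit (spec T) (\<lambda>n. poly (q n)) g sequentially"
    "(\<lambda>n. peval (q n) T) \<longlonglongrightarrow> fc g T"
    using fc_approx[OF T g] .
  have b: "bounded (f ` spec T)" "bounded (g ` spec T)"
    using compact_continuous_image[OF f] compact_continuous_image[OF g] compact_spec[OF sa_in[OF T]]
    by (auto intro: compact_imp_bounded)
  have "(\<lambda>n. peval (p n * q n) T) \<longlonglongrightarrow> fc (\<lambda>t. f t * g t) T"
  proof (intro fc_tendsto T continuous_intros f g)
    have "(\<lambda>n. poly (p n * q n)) = (\<lambda>n t. poly (p n) t * poly (q n) t)"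
      by (intro ext) simp
    then show "uniform_limit (spec T) (\<lambda>n. poly (p n * q n)) (\<lambda>t. f t * g t) sequentially"
      using uniform_lim_mult[OF p(1) q(1) b] by simp
  qed
  moreover have "(\<lambda>n. peval (p n * q n) T) \<longlonglongrightarrow> fc f T * fc g T"
    using tendsto_mult[OF p(2) q(2)] by (simp add: peval_mult)
  ultimately show ?thesis
    by (rule LIMSEQ_unique)
qed

lemma fc_scaleR:
  assumes T: "sa T" and f: "continuous_on (spec T) f"
  shows "fc (\<lambda>t. c * f t) T = c *\<^sub>R fc f T"
  using fc_mult[OF T continuous_on_const f, of c] by (simp add: fc_const[OF T])

lemma fc_diff:
  assumes T: "sa T" and f: "continuous_on (spec T) f" and g: "continuous_on (spec T) g"
  shows "fc (\<lambda>t. f t - g t) T = fc f T - fc g T"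
proof -
  have "fc (\<lambda>t. f t + (-1) * g t) T = fc f T + (-1) *\<^sub>R fc g T"
    using fc_add[OF T f, of "\<lambda>t. (-1) * g t"] fc_scaleR[OF T g, of "-1"] g
    by (auto intro: continuous_intros)
  then show ?thesis
    by simp
qed

lemma fc_commute:
  assumes T: "sa T" and f: "continuous_on (spec T) f" and Y: "Y * T = T * Y"
  shows "Y * fc f T = fc f T * Y"
proof -
  obtain p where p: "(\<lambda>n. peval (p n) T) \<longlonglongrightarrow> fc f T"
    using fc_approx[OF T f] .
  have "(\<lambda>n. Y * peval (p n) T) \<longlonglongrightarrow> Y * fc f T" "(\<lambda>n. peval (p n) T * Y) \<longlonglongrightarrow> fc f T * Y"
    by (intro tendsto_intros p)+
  then show ?thesis
    unfolding peval_commute[OF Y] by (rule LIMSEQ_unique)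
qed

lemma sa_limit: assumes "\<And>n. sa (X n)" "X \<longlonglongrightarrow> T" shows "sa T"
proof -
  have T: "T \<in> A"
    using assms by (intro closed_sequentially[OF closed_A _ assms(2)]) (auto simp: sa_def)
  have "(\<lambda>n. norm (X n - T)) \<longlonglongrightarrow> 0"
    using assms(2) by (simp add: LIM_zero_iff tendsto_norm_zero)
  moreover have "norm (X n - T) = norm (X n - ad T)" for n
    using norm_ad[of "X n - T"] assms(1)[of n] T by (simp add: sa_def in_A ad_simps)
  ultimately have "X \<longlonglongrightarrow> ad T"
    by (simp add: LIM_zero_iff tendsto_norm_zero_iff)
  then show ?thesis
    using assms(2) T LIMSEQ_unique by (auto simp: sa_def)
qed

lemma sa_fc: assumes T: "sa T" and f: "continuous_on (spec T) f" shows "sa (fc f T)"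
  using fc_approx[OF T f] sa_limit[OF sa_peval[OF T]] by metis

lemma norm_fc_le:
  assumes T: "sa T" and f: "continuous_on (spec T) f"
    and b: "\<And>t. t \<in> spec T \<Longrightarrow> \<bar>f t\<bar> \<le> b" "0 \<le> b"
  shows "norm (fc f T) \<le> b"
proof (rule field_le_epsilon)
  fix e :: real assume "e > 0"
  obtain p where p: "uniform_limit (spec T) (\<lambda>n. poly (p n)) f sequentially"
    "(\<lambda>n. peval (p n) T) \<longlonglongrightarrow> fc f T"
    using fc_approx[OF T f] .
  have "\<forall>\<^sub>F n in sequentially. norm (peval (p n) T) \<le> b + e"
    using uniform_limitD[OF p(1) \<open>e > 0\<close>]
  proof eventually_elim
    case (elim n)
    have "\<bar>poly (p n) t\<bar> \<le> b + e" if "t \<in> spec T" for t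
      using bspec[OF elim that] b(1)[OF that] unfolding dist_real_def by linarith
    then show ?case
      using b \<open>e > 0\<close> by (intro norm_peval_le[OF T]) auto
  qed
  then show "norm (fc f T) \<le> b + e"
    using Lim_norm_ubound[OF _ p(2)] by simp
qed

subsection \<open>Positive elements\<close>

definition pos :: "'r \<Rightarrow> bool" where
  "pos T \<longleftrightarrow> sa T \<and> (\<forall>t\<in>spec T. 0 \<le> t)"

lemma spec_one_diff: "t \<in> spec (m *\<^sub>R 1 - T) \<Longrightarrow> m - t \<in> spec T"
  unfolding spec_def using inv_in_minus[of "T - (m - t) *\<^sub>R 1"] by (auto simp: algebra_simps)

text \<open>
  Positivity of \<open>T\<close> means that \<open>T\<close> is close to a multiple of the unit, a condition that is visibly
  stable under sums.
\<close>

lemma pos_if_norm: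
  assumes T: "sa T" and n: "norm (m *\<^sub>R 1 - T) \<le> m"
  shows "pos T"
proof -
  have "inv_in (T - t *\<^sub>R 1)" if "t < 0" for t
  proof -
    have "inv_in ((m - t) *\<^sub>R 1 - (m *\<^sub>R 1 - T))"
      using assms that by (intro inv_in_diff in_A) (auto simp: sa_in)
    then show ?thesis
      by (simp add: algebra_simps)
  qed
  then have "0 \<le> t" if "t \<in> spec T" for t
    using that by (auto simp: spec_def not_le[symmetric])
  then show ?thesis
    using T by (auto simp: pos_def)
qed

lemma pos_norm:
  assumes "pos T"
  shows "norm (norm T *\<^sub>R 1 - T) \<le> norm T"
proof (rule norm_le_spec)
  show "sa (norm T *\<^sub>R 1 - T)"
    using assms by (auto simp: pos_def intro: sa_intros)
  fix t assume "t \<in> spec (norm T *\<^sub>R 1 - T)"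
  then have "norm T - t \<in> spec T"
    by (rule spec_one_diff)
  then have "0 \<le> norm T - t" "\<bar>norm T - t\<bar> \<le> norm T"
    using assms spec_le_norm by (auto simp: pos_def sa_in)
  then show "\<bar>t\<bar> \<le> norm T"
    by auto
qed auto

lemma pos_sa: "pos T \<Longrightarrow> sa T"
  by (simp add: pos_def)

lemma pos_add: assumes "pos S" "pos T" shows "pos (S + T)"
proof (rule pos_if_norm)
  show "sa (S + T)"
    using assms by (auto intro: sa_intros pos_sa)
  have eq: "(norm S + norm T) *\<^sub>R 1 - (S + T) = (norm S *\<^sub>R 1 - S) + (norm T *\<^sub>R 1 - T)"
    by (simp add: algebra_simps)
  show "norm ((norm S + norm T) *\<^sub>R 1 - (S + T)) \<le> norm S + norm T"
    using norm_triangle_ineq[of "norm S *\<^sub>R 1 - S" "norm T *\<^sub>R 1 - T"] pos_norm[OF assms(1)] pos_norm[OF assms(2)]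
    unfolding eq by linarith
qed

lemma pos_norm_diff: assumes "sa T" shows "pos (norm T *\<^sub>R 1 - T)"
proof -
  have "0 \<le> t" if "t \<in> spec (norm T *\<^sub>R 1 - T)" for t
    using spec_le_norm[OF sa_in[OF assms] spec_one_diff[OF that]] by linarith
  then show ?thesis
    using assms by (auto simp: pos_def intro: sa_intros)
qed

lemma norm_le_pos_add: assumes S: "pos S" and T: "pos T" shows "norm S \<le> norm (S + T)"
proof (rule norm_le_spec)
  let ?m = "norm (S + T)"
  have "pos ((?m *\<^sub>R 1 - (S + T)) + T)"
    using assms by (intro pos_add pos_norm_diff sa_intros pos_sa)
  then have p: "pos (?m *\<^sub>R 1 - S)"
    by simp
  fix t assume t: "t \<in> spec S"
  then have "?m - t \<in> spec (?m *\<^sub>R 1 - S)"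
    using spec_one_diff[of "?m - t" ?m S] spec_one_diff[of t ?m "?m *\<^sub>R 1 - S"] by simp
  then show "\<bar>t\<bar> \<le> ?m"
    using p S t by (auto simp: pos_def)
qed (use S in \<open>auto simp: pos_sa\<close>)

lemma pos_fc:
  assumes T: "sa T" and f: "continuous_on (spec T) f" and "\<And>t. t \<in> spec T \<Longrightarrow> 0 \<le> f t"
  shows "pos (fc f T)"
proof -
  obtain m where m: "\<And>t. t \<in> spec T \<Longrightarrow> \<bar>f t\<bar> \<le> m" "0 \<le> m"
  proof -
    have "bounded (f ` spec T)"
      using compact_continuous_image[OF f] compact_spec[OF sa_in[OF T]] by (auto intro: compact_imp_bounded)
    then obtain a where a: "\<forall>x\<in>f ` spec T. norm x \<le> a"
      by (auto simp: bounded_iff)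
    then show ?thesis
      by (intro that[of "\<bar>a\<bar>"]) (auto intro: order_trans)
  qed
  have "norm (fc (\<lambda>t. m - f t) T) \<le> m"
  proof (rule norm_fc_le[OF T])
    show "\<bar>m - f t\<bar> \<le> m" if "t \<in> spec T" for t
      using m(1)[OF that] assms(3)[OF that] by linarith
  qed (use f m in \<open>auto intro: continuous_intros\<close>)
  then show ?thesis
    using fc_diff[OF T _ f, of "\<lambda>t. m"] T f
    by (intro pos_if_norm[of _ m]) (auto simp: fc_const sa_fc intro: continuous_intros)
qed

lemma pos_square: assumes "sa T" shows "pos (T * T)"
proof -
  have "pos (fc (\<lambda>t. t * t) T)"
    using assms by (intro pos_fc) (auto intro: continuous_intros)
  then show ?thesis
    using fc_mult[OF assms, of "\<lambda>t. t" "\<lambda>t. t"] by (simp add: fc_id assms)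
qed

lemma spec_swap:
  assumes "X \<in> A" "Y \<in> A" "s \<noteq> 0" "s \<in> spec (X * Y)"
  shows "s \<in> spec (Y * X)"
proof (rule ccontr)
  assume "s \<notin> spec (Y * X)"
  then obtain S where S: "S \<in> A" "S * (Y * X - s *\<^sub>R 1) = 1" "(Y * X - s *\<^sub>R 1) * S = 1"
    by (auto simp: spec_def inv_in_def)
  define Z where "Z = inverse s *\<^sub>R (X * S * Y - 1)"
  have S': "S * (Y * X) = 1 + s *\<^sub>R S" "Y * X * S = 1 + s *\<^sub>R S"
    using S by (auto simp: algebra_simps)
  have "(X * S * Y) * (X * Y) = X * (S * (Y * X)) * Y" "(X * Y) * (X * S * Y) = X * (Y * X * S) * Y"
    by (simp_all only: mult.assoc)
  then have "(X * S * Y) * (X * Y) = X * Y + s *\<^sub>R (X * S * Y)" "(X * Y) * (X * S * Y) = X * Y + s *\<^sub>R (X * S * Y)"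
    unfolding S' by (simp_all add: algebra_simps)
  then have "(X * S * Y - 1) * (X * Y - s *\<^sub>R 1) = s *\<^sub>R 1" "(X * Y - s *\<^sub>R 1) * (X * S * Y - 1) = s *\<^sub>R 1"
    by (simp_all add: left_diff_distrib right_diff_distrib scaleR_right_diff_distrib)
  then have "Z * (X * Y - s *\<^sub>R 1) = 1" "(X * Y - s *\<^sub>R 1) * Z = 1"
    using \<open>s \<noteq> 0\<close> by (simp_all add: Z_def)
  moreover have "Z \<in> A"
    using assms S by (simp add: Z_def in_A)
  ultimately have "inv_in (X * Y - s *\<^sub>R 1)"
    using assms by (auto simp: inv_in_def in_A)
  then show False
    using assms by (simp add: spec_def)
qed

text \<open>
  The Kelley--Vaught argument. Let \<open>f\<close> be the negative part of the identity function and
  \<open>Y = X f(X\<^sup>*X)\<close>, so that \<open>- Y\<^sup>*Y = f\<^sup>3(X\<^sup>*X)\<close> is positive. Then \<open>- Y Y\<^sup>*\<close>, having the same spectrum apart from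
  zero, is positive too; but \<open>Y\<^sup>*Y + Y Y\<^sup>*\<close> is twice the sum of the squares of the real and
  imaginary parts of \<open>Y\<close>, and so \<open>Y\<close> must vanish.
\<close>

theorem pos_ad_mult: assumes X: "X \<in> A" shows "pos (ad X * X)"
proof -
  define T where "T = ad X * X"
  define f :: "real \<Rightarrow> real" where "f t = max (- t) 0" for t
  have T: "sa T" "T \<in> A"
    using X by (auto simp: T_def sa_ad_mult in_A)
  have cf: "continuous_on (spec T) f"
    unfolding f_def by (intro continuous_intros)
  have cf2: "continuous_on (spec T) (\<lambda>t. f t * f t)" "continuous_on (spec T) (\<lambda>t. f t * (f t * f t))"
    by (intro continuous_intros cf)+
  define \<Phi> where "\<Phi> = fc f T"
  have \<Phi>: "sa \<Phi>" "\<Phi> \<in> A" "ad \<Phi> = \<Phi>"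
    using sa_fc[OF T(1) cf] by (auto simp: \<Phi>_def sa_def)
  define P where "P = \<Phi> * (\<Phi> * \<Phi>)"
  have P_fc: "P = fc (\<lambda>t. f t * (f t * f t)) T"
    using T cf cf2 by (simp add: P_def \<Phi>_def fc_mult)
  then have P: "pos P"
    using T cf2 by (auto intro!: pos_fc simp: f_def)
  define Y where "Y = X * \<Phi>"
  define Y' where "Y' = ad Y"
  have Y: "Y \<in> A" "Y' \<in> A" "ad Y' = Y"
    using X \<Phi> by (auto simp: Y_def Y'_def in_A ad_simps)
  have "Y' * Y = \<Phi> * T * \<Phi>"
    using X \<Phi> by (simp add: Y_def Y'_def T_def ad_mult mult.assoc)
  also have "\<dots> = fc (\<lambda>t. (f t * t) * f t) T"
    using T cf by (simp add: \<Phi>_def fc_mult fc_id continuous_intros)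
  also have "\<dots> = fc (\<lambda>t. (-1) * (f t * (f t * f t))) T"
    by (rule fc_cong) (auto simp: f_def max_def)
  also have "\<dots> = - P"
    unfolding P_fc using fc_scaleR[OF T(1) cf2(2), of "-1"] by simp
  finally have YY: "Y' * Y = - P" .
  have "sa (- (Y * Y'))"
    using sa_mult_ad[OF Y(1)] by (auto simp: Y'_def intro: sa_intros)
  moreover have "0 \<le> t" if "t \<in> spec (- (Y * Y'))" for t
  proof (rule ccontr)
    assume "\<not> 0 \<le> t"
    have "- t \<in> spec (Y * Y')"
      using that unfolding spec_def using inv_in_minus[of "Y * Y' - (- t) *\<^sub>R 1"] by (auto simp: algebra_simps)
    then have "- t \<in> spec (Y' * Y)"
      using spec_swap[of Y Y' "- t"] Y \<open>\<not> 0 \<le> t\<close> by auto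
    then have "t \<in> spec P"
      unfolding YY spec_def using inv_in_minus[of "P - t *\<^sub>R 1"] by (auto simp: algebra_simps)
    then show False
      using P \<open>\<not> 0 \<le> t\<close> by (auto simp: pos_def)
  qed
  ultimately have YY': "pos (- (Y * Y'))"
    by (auto simp: pos_def)
  define a where "a = Y + Y'"
  define b where "b = J * (Y - Y')"
  have JY: "Y * J = J * Y" "Y' * J = J * Y'"
    using Y by (auto intro: J_comm)
  have a: "sa a" and b: "sa b"
    using Y JY by (auto simp: a_def b_def sa_def in_A ad_simps Y'_def[symmetric] algebra_simps)
  have bb: "b * b = - ((Y - Y') * (Y - Y'))"
  proof -
    have "b * b = J * ((Y - Y') * J) * (Y - Y')"
      by (simp only: b_def mult.assoc)
    also have "(Y - Y') * J = J * (Y - Y')"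
      using JY by (simp add: algebra_simps)
    also have "J * (J * (Y - Y')) * (Y - Y') = (J * J) * ((Y - Y') * (Y - Y'))"
      by (simp only: mult.assoc)
    finally show ?thesis
      by (simp add: J_J)
  qed
  have sum: "a * a + b * b + ((P + - (Y * Y')) + (P + - (Y * Y'))) = 0"
    using YY unfolding bb a_def by (simp add: algebra_simps)
  have "norm (a * a + b * b) \<le> norm (a * a + b * b + ((P + - (Y * Y')) + (P + - (Y * Y'))))"
    by (intro norm_le_pos_add pos_add pos_square a b P YY')
  then have "a * a + b * b = 0"
    using sum by simp
  then have "norm (a * a) \<le> 0" "norm (b * b) \<le> 0"
    using norm_le_pos_add[OF pos_square[OF a] pos_square[OF b]]
      norm_le_pos_add[OF pos_square[OF b] pos_square[OF a]] by (simp_all add: add.commute)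
  then have "a = 0" "b = 0"
    using norm_sa_square[OF a] norm_sa_square[OF b] by auto
  then have Y'_eq: "Y' = - Y"
    by (simp add: a_def eq_neg_iff_add_eq_0 add.commute)
  then have "J * (Y + Y) = 0"
    using \<open>b = 0\<close> by (simp add: b_def)
  then have "Y + Y = 0"
    using norm_J_mult[of "Y + Y"] Y by (simp add: in_A)
  then have "Y = 0"
    by (metis add_0 scaleR_2 scaleR_eq_0_iff zero_neq_numeral)
  then have "P = 0"
    using YY by simp
  then have "\<Phi> * \<Phi> * (\<Phi> * \<Phi>) = 0"
    by (simp add: P_def mult.assoc)
  then have "\<Phi> = 0"
    using norm_sa_square[OF \<Phi>(1)] norm_sa_square[of "\<Phi> * \<Phi>"] sa_power[OF \<Phi>(1), of 2]
    by (simp add: power2_eq_square)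
  have "fc (\<lambda>t. max t 0) T = fc (\<lambda>t. t + f t) T"
    by (rule fc_cong) (auto simp: f_def)
  also have "\<dots> = T"
    using T cf \<open>\<Phi> = 0\<close> by (simp add: fc_add fc_id \<Phi>_def[symmetric])
  finally show ?thesis
    using pos_fc[OF T(1), of "\<lambda>t. max t 0"] by (simp add: T_def continuous_intros)
qed

lemma sqrt_fc:
  assumes "pos T"
  shows "sa (fc sqrt T)" "fc sqrt T * fc sqrt T = T"
proof -
  have T: "sa T" and c: "continuous_on (spec T) sqrt"
    using assms by (auto simp: pos_def intro: continuous_intros)
  show "sa (fc sqrt T)"
    by (rule sa_fc[OF T c])
  have "fc sqrt T * fc sqrt T = fc (\<lambda>t. sqrt t * sqrt t) T"
    by (rule fc_mult[OF T c c, symmetric])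
  also have "\<dots> = fc (\<lambda>t. t) T"
    using assms by (intro fc_cong) (auto simp: pos_def)
  finally show "fc sqrt T * fc sqrt T = T"
    by (simp add: fc_id T)
qed

subsection \<open>Commutators with square roots\<close>

text \<open>
  If \<open>s \<ge> \<delta> > 0\<close>, the equation \<open>s Y + Y s = Z\<close> controls \<open>Y\<close>: it turns
  \<open>2 \<tau> Z\<close> into \<open>(\<tau> + s) Y (\<tau> + s) - (\<tau> - s) Y (\<tau> - s)\<close>, and
  \<open>(\<tau> - s) / (\<tau> + s)\<close> is a strict contraction.
\<close>

lemma sylvester_bound:
  assumes T: "sa T" and g: "continuous_on (spec T) g" and d: "0 < \<delta>" "\<And>t. t \<in> spec T \<Longrightarrow> \<delta> \<le> g t"
    and Z: "fc g T * Y + Y * fc g T = Z"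
  shows "norm Y \<le> norm Z / (2 * \<delta>)"
proof -
  obtain \<tau> where \<tau>: "\<And>t. t \<in> spec T \<Longrightarrow> g t \<le> \<tau>" "\<delta> \<le> \<tau>"
  proof -
    have "bounded (g ` spec T)"
      using compact_continuous_image[OF g] compact_spec[OF sa_in[OF T]] by (auto intro: compact_imp_bounded)
    then obtain a where "\<forall>x\<in>g ` spec T. norm x \<le> a"
      by (auto simp: bounded_iff)
    then show ?thesis
      by (intro that[of "max a \<delta>"]) force+
  qed
  define s where "s = fc g T"
  define N where "N = fc (\<lambda>t. 1 / (\<tau> + g t)) T"
  define C where "C = fc (\<lambda>t. (\<tau> - g t) * (1 / (\<tau> + g t))) T"
  have p: "\<tau> + g t > 0" if "t \<in> spec T" for t
    using d(2)[OF that] \<tau>(2) d(1) by linarith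
  have cN: "continuous_on (spec T) (\<lambda>t. 1 / (\<tau> + g t))"
    using p by (intro continuous_intros g) (metis less_irrefl)
  have c1: "continuous_on (spec T) (\<lambda>t. \<tau> + g t)" "continuous_on (spec T) (\<lambda>t. \<tau> - g t)"
    by (intro continuous_intros g)+
  have ts: "fc (\<lambda>t. \<tau> + g t) T = \<tau> *\<^sub>R 1 + s" "fc (\<lambda>t. \<tau> - g t) T = \<tau> *\<^sub>R 1 - s"
    using T g by (simp_all add: fc_add fc_diff fc_const s_def)
  have "fc (\<lambda>t. (\<tau> + g t) * (1 / (\<tau> + g t))) T = fc (\<lambda>t. 1) T"
    by (rule fc_cong) (use p in force)
  then have N1: "(\<tau> *\<^sub>R 1 + s) * N = 1"
    using fc_mult[OF T c1(1) cN] by (simp add: ts N_def fc_const T)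
  have "fc (\<lambda>t. (1 / (\<tau> + g t)) * (\<tau> + g t)) T = fc (\<lambda>t. 1) T"
    by (rule fc_cong) (use p in force)
  then have N2: "N * (\<tau> *\<^sub>R 1 + s) = 1"
    using fc_mult[OF T cN c1(1)] by (simp add: ts N_def fc_const T)
  have C1: "C = (\<tau> *\<^sub>R 1 - s) * N"
    using fc_mult[OF T c1(2) cN] by (simp add: C_def N_def ts)
  have C2: "C = N * (\<tau> *\<^sub>R 1 - s)"
    using fc_mult[OF T cN c1(2)] by (simp add: C_def N_def ts mult.commute)
  have "norm N \<le> 1 / (\<tau> + \<delta>)"
    unfolding N_def
  proof (rule norm_fc_le[OF T cN])
    show "\<bar>1 / (\<tau> + g t)\<bar> \<le> 1 / (\<tau> + \<delta>)" if "t \<in> spec T" for t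
      using p[OF that] d(2)[OF that] d(1) \<tau>(2) by (simp add: frac_le)
  qed (use d \<tau> in auto)
  have nC: "norm C \<le> (\<tau> - \<delta>) / (\<tau> + \<delta>)"
    unfolding C_def
  proof (rule norm_fc_le[OF T])
    show "continuous_on (spec T) (\<lambda>t. (\<tau> - g t) * (1 / (\<tau> + g t)))"
      by (intro continuous_on_mult c1 cN)
    show "\<bar>(\<tau> - g t) * (1 / (\<tau> + g t))\<bar> \<le> (\<tau> - \<delta>) / (\<tau> + \<delta>)" if "t \<in> spec T" for t
      using p[OF that] d(2)[OF that] d(1) \<tau>(1)[OF that] \<tau>(2) by (simp add: frac_le)
  qed (use d \<tau> in auto)
  have key: "Y = (2 * \<tau>) *\<^sub>R (N * Z * N) + C * Y * C"
  proof -
    have "(\<tau> *\<^sub>R 1 + s) * Y * (\<tau> *\<^sub>R 1 + s) = (2 * \<tau>) *\<^sub>R Z + (\<tau> *\<^sub>R 1 - s) * Y * (\<tau> *\<^sub>R 1 - s)"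
      unfolding Z[symmetric] s_def[symmetric]
      by (simp add: algebra_simps scaleR_left_distrib[symmetric] mult_2)
    then have "N * ((\<tau> *\<^sub>R 1 + s) * Y * (\<tau> *\<^sub>R 1 + s)) * N = N * ((2 * \<tau>) *\<^sub>R Z + (\<tau> *\<^sub>R 1 - s) * Y * (\<tau> *\<^sub>R 1 - s)) * N"
      by simp
    moreover have "N * ((\<tau> *\<^sub>R 1 + s) * Y * (\<tau> *\<^sub>R 1 + s)) * N = (N * (\<tau> *\<^sub>R 1 + s)) * Y * ((\<tau> *\<^sub>R 1 + s) * N)"
      by (simp only: mult.assoc)
    moreover have "N * ((2 * \<tau>) *\<^sub>R Z + (\<tau> *\<^sub>R 1 - s) * Y * (\<tau> *\<^sub>R 1 - s)) * N =
        (2 * \<tau>) *\<^sub>R (N * Z * N) + (N * (\<tau> *\<^sub>R 1 - s)) * Y * ((\<tau> *\<^sub>R 1 - s) * N)"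
      by (simp add: distrib_left distrib_right mult.assoc)
    ultimately show ?thesis
      by (simp add: N1 N2 C1[symmetric] C2[symmetric])
  qed
  define \<kappa> where "\<kappa> = (\<tau> - \<delta>) / (\<tau> + \<delta>)"
  have "norm (N * Z * N) \<le> 1 / (\<tau> + \<delta>) * norm Z * (1 / (\<tau> + \<delta>))"
    using \<open>norm N \<le> 1 / (\<tau> + \<delta>)\<close> d \<tau>
    by (intro order_trans[OF norm_mult_ineq] mult_mono) auto
  moreover have "norm (C * Y * C) \<le> \<kappa> * norm Y * \<kappa>"
    using nC d \<tau> unfolding \<kappa>_def
    by (intro order_trans[OF norm_mult_ineq] mult_mono) auto
  moreover have "norm Y \<le> 2 * \<tau> * norm (N * Z * N) + norm (C * Y * C)"
    using norm_triangle_ineq[of "(2 * \<tau>) *\<^sub>R (N * Z * N)" "C * Y * C"] d \<tau> by (subst key) simp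
  ultimately have "norm Y \<le> 2 * \<tau> * (1 / (\<tau> + \<delta>) * norm Z * (1 / (\<tau> + \<delta>))) + \<kappa> * norm Y * \<kappa>"
    using d \<tau> by (smt (verit) mult_left_mono)
  also have "\<dots> = (2 * \<tau> * norm Z + norm Y * (\<tau> - \<delta>)\<^sup>2) / (\<tau> + \<delta>)\<^sup>2"
    by (simp add: \<kappa>_def power2_eq_square add_divide_distrib)
  finally have "norm Y * (\<tau> + \<delta>)\<^sup>2 \<le> 2 * \<tau> * norm Z + norm Y * (\<tau> - \<delta>)\<^sup>2"
    using d \<tau> by (subst (asm) pos_le_divide_eq) (auto intro: add_pos_pos)
  then have "4 * \<tau> * \<delta> * norm Y \<le> 2 * \<tau> * norm Z"
    by (simp add: power2_eq_square algebra_simps)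
  then show ?thesis
    using d \<tau> by (simp add: field_simps)
qed

text \<open>
  With \<open>s = \<surd>(T + \<delta>\<^sup>2)\<close> the commutator \<open>Y = [s, X]\<close> satisfies \<open>s Y + Y s = [T, X]\<close>, and \<open>s\<close> differs from \<open>\<surd>T\<close> by
  at most \<open>\<delta>\<close>; the square root of \<open>\<parallel>[T, X]\<parallel>\<close> balances the two errors.
\<close>

lemma sqrt_commutator_bound:
  assumes T: "pos T"
  shows "norm (fc sqrt T * X - X * fc sqrt T) \<le> (2 * norm X + 1) * sqrt (norm (T * X - X * T))"
proof -
  have sT: "sa T" and nn: "\<And>t. t \<in> spec T \<Longrightarrow> 0 \<le> t"
    using T by (auto simp: pos_def)
  define S where "S = fc sqrt T"
  define \<epsilon> where "\<epsilon> = norm (T * X - X * T)"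
  have bound: "norm (S * X - X * S) \<le> 2 * \<delta> * norm X + \<epsilon> / (2 * \<delta>)" if d: "\<delta> > 0" for \<delta>
  proof -
    define g where "g t = sqrt (t + \<delta>\<^sup>2)" for t
    have cg: "continuous_on (spec T) g" and cs: "continuous_on (spec T) sqrt"
      unfolding g_def by (intro continuous_intros)+
    define s where "s = fc g T"
    have "s * s = fc (\<lambda>t. g t * g t) T"
      by (simp add: s_def fc_mult sT cg)
    also have "\<dots> = fc (\<lambda>t. t + \<delta>\<^sup>2) T"
      using nn by (intro fc_cong) (simp add: g_def)
    also have "\<dots> = T + \<delta>\<^sup>2 *\<^sub>R 1"
      using fc_add[OF sT, of "\<lambda>t. t" "\<lambda>t. \<delta>\<^sup>2"] by (simp add: fc_id fc_const sT)
    finally have ss: "s * s = T + \<delta>\<^sup>2 *\<^sub>R 1" .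
    have "norm (s * X - X * s) \<le> norm (T * X - X * T) / (2 * \<delta>)"
    proof (rule sylvester_bound[OF sT cg d])
      show "\<delta> \<le> g t" if "t \<in> spec T" for t
        using nn[OF that] d by (simp add: g_def real_le_rsqrt)
      have "s * (s * X - X * s) + (s * X - X * s) * s = s * s * X - X * (s * s)"
        by (simp add: algebra_simps)
      then show "fc g T * (s * X - X * s) + (s * X - X * s) * fc g T = T * X - X * T"
        by (simp add: s_def[symmetric] ss algebra_simps)
    qed
    moreover have "norm (S - s) \<le> \<delta>"
    proof -
      have "norm (fc (\<lambda>t. sqrt t - g t) T) \<le> \<delta>"
      proof (rule norm_fc_le[OF sT])
        fix t assume t: "t \<in> spec T"
        have "sqrt (t + \<delta>\<^sup>2) \<le> sqrt t + sqrt (\<delta>\<^sup>2)"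
          using nn[OF t] by (intro sqrt_add_le_add_sqrt) auto
        moreover have "sqrt t \<le> sqrt (t + \<delta>\<^sup>2)"
          by simp
        ultimately show "\<bar>sqrt t - g t\<bar> \<le> \<delta>"
          using d by (simp add: g_def)
      qed (use d cg cs in \<open>auto intro: continuous_intros\<close>)
      then show ?thesis
        by (simp add: fc_diff sT cg cs s_def S_def)
    qed
    then have "norm ((S - s) * X - X * (S - s)) \<le> 2 * \<delta> * norm X"
      using norm_triangle_ineq4[of "(S - s) * X" "X * (S - s)"] norm_mult_ineq[of "S - s" X] norm_mult_ineq[of X "S - s"]
        mult_right_mono[of "norm (S - s)" \<delta> "norm X"] by (simp add: mult.commute[of "norm X"])
    moreover have "S * X - X * S = ((S - s) * X - X * (S - s)) + (s * X - X * s)"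
      by (simp add: algebra_simps)
    ultimately show ?thesis
      unfolding \<epsilon>_def by (smt (verit) norm_triangle_ineq)
  qed
  show ?thesis
  proof (cases "\<epsilon> = 0")
    case True
    have "norm (S * X - X * S) \<le> 0"
    proof (rule field_le_epsilon)
      fix e :: real assume e: "e > 0"
      define \<delta> where "\<delta> = e / (2 * (norm X + 1))"
      have p: "norm X + 1 > 0"
        by (simp add: add_nonneg_pos)
      have "norm (S * X - X * S) \<le> 2 * \<delta> * norm X"
        using bound[of \<delta>] True e p by (simp add: \<delta>_def)
      also have "\<dots> \<le> 2 * \<delta> * (norm X + 1)"
        using e p by (intro mult_left_mono) (auto simp: \<delta>_def)
      also have "\<dots> = e"
        using p by (simp add: \<delta>_def field_simps)
      finally show "norm (S * X - X * S) \<le> 0 + e"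
        by simp
    qed
    then show ?thesis
      using True by (simp add: S_def \<epsilon>_def)
  next
    case False
    then have e: "\<epsilon> > 0"
      by (simp add: \<epsilon>_def)
    have "\<epsilon> / (2 * sqrt \<epsilon>) = sqrt \<epsilon> / 2"
      using e by (simp add: field_simps)
    then have "norm (S * X - X * S) \<le> 2 * sqrt \<epsilon> * norm X + sqrt \<epsilon> / 2"
      using bound[of "sqrt \<epsilon>"] e by simp
    also have "\<dots> \<le> (2 * norm X + 1) * sqrt \<epsilon>"
      using e by (simp add: algebra_simps)
    finally show ?thesis
      by (simp add: S_def[symmetric] \<epsilon>_def[symmetric])
  qed
qed

end

section \<open>The ring of bounded operators\<close>

text \<open>
  A copy of the space of bounded real-linear operators, carrying composition as its
  multiplication, so that operator identities become identities in a ring.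
\<close>

typedef (overloaded) 'a endo = "UNIV :: ('a::real_normed_vector \<Rightarrow>\<^sub>L 'a) set"
  morphisms bl En by simp

setup_lifting type_definition_endo

instantiation endo :: (real_normed_vector) real_normed_vector
begin

lift_definition zero_endo :: "'a endo" is 0 .
lift_definition plus_endo :: "'a endo \<Rightarrow> 'a endo \<Rightarrow> 'a endo" is "(+)" .
lift_definition minus_endo :: "'a endo \<Rightarrow> 'a endo \<Rightarrow> 'a endo" is "(-)" .
lift_definition uminus_endo :: "'a endo \<Rightarrow> 'a endo" is uminus .
lift_definition scaleR_endo :: "real \<Rightarrow> 'a endo \<Rightarrow> 'a endo" is "(*\<^sub>R)" .
lift_definition norm_endo :: "'a endo \<Rightarrow> real" is norm .

definition "dist (S :: 'a endo) T = norm (S - T)"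
definition "sgn (T :: 'a endo) = inverse (norm T) *\<^sub>R T"
definition [code del]: "(uniformity :: ('a endo \<times> 'a endo) filter) =
  (INF e\<in>{0 <..}. principal {(S, T). dist S T < e})"
definition [code del]: "open (U :: 'a endo set) \<longleftrightarrow>
  (\<forall>S\<in>U. eventually (\<lambda>(S', T). S' = S \<longrightarrow> T \<in> U) uniformity)"

instance
  by standard
    (simp_all only: dist_endo_def sgn_endo_def uniformity_endo_def open_endo_def,
     (transfer, auto simp: algebra_simps norm_triangle_ineq)+)

end

instantiation endo :: (real_normed_vector) "{real_normed_algebra, monoid_mult}"
begin

lift_definition one_endo :: "'a endo" is id_blinfun .
lift_definition times_endo :: "'a endo \<Rightarrow> 'a endo \<Rightarrow> 'a endo" is "(o\<^sub>L)" .

instance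
  by standard
    (transfer, auto intro!: blinfun_eqI norm_blinfun_compose simp: blinfun.bilinear_simps)+

end

instance endo :: (banach) banach
proof
  fix X :: "nat \<Rightarrow> 'a endo"
  assume "Cauchy X"
  then have "Cauchy (\<lambda>n. bl (X n))"
    unfolding Cauchy_def dist_norm by transfer
  then obtain L where "(\<lambda>n. bl (X n)) \<longlonglongrightarrow> L"
    by (auto simp: Cauchy_convergent_iff convergent_def)
  then have "X \<longlonglongrightarrow> En L"
    unfolding LIMSEQ_iff by (metis En_inverse UNIV_I minus_endo.rep_eq norm_endo.rep_eq)
  then show "convergent X"
    by (auto simp: convergent_def)
qed

lift_definition ap :: "'a::real_normed_vector endo \<Rightarrow> 'a \<Rightarrow> 'a"  (infixr \<open>\<cdot>\<close> 75) is blinfun_apply .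

definition mk :: "('a::real_normed_vector \<Rightarrow> 'a) \<Rightarrow> 'a endo" where
  "mk f = En (Blinfun f)"

lemma mk_ap: "bounded_linear f \<Longrightarrow> mk f \<cdot> v = f v"
  by (simp add: mk_def ap.rep_eq En_inverse bounded_linear_Blinfun_apply)

lemma endo_eqI: "(\<And>v. S \<cdot> v = T \<cdot> v) \<Longrightarrow> S = T"
  by transfer (rule blinfun_eqI)

lemma norm_ap: "norm (T \<cdot> v) \<le> norm T * norm v"
  by transfer (rule norm_blinfun)

lemma norm_endo_bound: "0 \<le> b \<Longrightarrow> (\<And>v. norm (T \<cdot> v) \<le> b * norm v) \<Longrightarrow> norm T \<le> b"
  by transfer (rule norm_blinfun_bound)

lemma ap_one [simp]: "1 \<cdot> v = v"
  and ap_zero [simp]: "0 \<cdot> v = 0"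
  and ap_zero_right [simp]: "T \<cdot> 0 = 0"
  and ap_mult: "(S * T) \<cdot> v = S \<cdot> T \<cdot> v"
  and ap_add: "(S + T) \<cdot> v = S \<cdot> v + T \<cdot> v"
  and ap_diff: "(S - T) \<cdot> v = S \<cdot> v - T \<cdot> v"
  and ap_minus: "(- T) \<cdot> v = - (T \<cdot> v)"
  and ap_scaleR: "(t *\<^sub>R T) \<cdot> v = t *\<^sub>R (T \<cdot> v)"
  and ap_add_right: "T \<cdot> (v + w) = T \<cdot> v + T \<cdot> w"
  and ap_diff_right: "T \<cdot> (v - w) = T \<cdot> v - T \<cdot> w"
  and ap_minus_right: "T \<cdot> (- v) = - (T \<cdot> v)"
  and ap_scaleR_right: "T \<cdot> (t *\<^sub>R v) = t *\<^sub>R (T \<cdot> v)"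
  by (transfer, simp add: blinfun.bilinear_simps)+

lemmas ap_simps = ap_mult ap_add ap_diff ap_minus ap_scaleR ap_add_right ap_diff_right ap_minus_right
  ap_scaleR_right

lemma bounded_linear_ap: "bounded_linear (\<lambda>v. T \<cdot> v)"
  by transfer (rule blinfun.bounded_linear_right)

lemma bounded_linear_ap_left: "bounded_linear (\<lambda>T. T \<cdot> v)"
  by (rule bounded_linear_intro[where K = "norm v"]) (auto simp: ap_simps norm_ap)

lemma tendsto_ap: "(f \<longlongrightarrow> S) F \<Longrightarrow> ((\<lambda>x. f x \<cdot> v) \<longlongrightarrow> S \<cdot> v) F"
  by (rule bounded_linear.tendsto[OF bounded_linear_ap_left])

lemma tendsto_ap_right: "(f \<longlongrightarrow> v) F \<Longrightarrow> ((\<lambda>x. T \<cdot> f x) \<longlongrightarrow> T \<cdot> v) F"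
  by (rule bounded_linear.tendsto[OF bounded_linear_ap])

lemma bl_eq_iff: "bl S = bl T \<longleftrightarrow> S = T"
  by (simp add: bl_inject)

lemma En_bl [simp]: "En (bl T) = T" and bl_En [simp]: "bl (En X) = X"
  by (simp_all add: bl_inverse En_inverse)

lemma bl_ap: "blinfun_apply (bl T) v = T \<cdot> v"
  by (simp add: ap.rep_eq)


section \<open>Adjointable operators on Hilbert modules\<close>

context hilbert_module
begin

lemma ip_add_left: "ip (x + y) z = ip x z + ip y z"
  by (metis star_ip star_add ip_add_right)

lemma ip_scaleC_left: "ip (k *\<^sub>C x) y = cnj k *\<^sub>C ip x y"
  by (metis star_ip star_scaleC ip_scaleC_right)

lemma ip_scaleR_right: "ip x (t *\<^sub>R y) = t *\<^sub>R ip x y"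
  by (simp add: scaleR_scaleC ip_scaleC_right)

lemma ip_scaleR_left: "ip (t *\<^sub>R x) y = t *\<^sub>R ip x y"
  by (simp add: scaleR_scaleC ip_scaleC_left)

lemma ip_minus_right: "ip x (- y) = - ip x y"
  using ip_scaleR_right[of x "-1" y] by simp

lemma ip_minus_left: "ip (- x) y = - ip x y"
  using ip_scaleR_left[of "-1" x y] by simp

lemma ip_diff_right: "ip x (y - z) = ip x y - ip x z"
  using ip_add_right[of x y "- z"] by (simp add: ip_minus_right)

lemma ip_diff_left: "ip (x - y) z = ip x z - ip y z"
  using ip_add_left[of x "- y" z] by (simp add: ip_minus_left)

lemma ip_zero [simp]: "ip x 0 = 0" "ip 0 x = 0"
  using ip_diff_right[of x 0 0] ip_diff_left[of 0 0 x] by simp_all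

lemmas ip_simps = ip_add_left ip_add_right ip_diff_left ip_diff_right ip_minus_left ip_minus_right
  ip_scaleR_left ip_scaleR_right ip_scaleC_left ip_scaleC_right

lemma norm_ip_self: "norm (ip x x) = (norm x)\<^sup>2"
  by (simp add: norm_ip)

lemma ip_eqI: "(\<And>z. ip z x = ip z y) \<Longrightarrow> x = y"
  using norm_ip_self[of "x - y"] by (simp add: ip_simps)

definition Adj :: "'e endo set" where
  "Adj = {T. bl T \<in> adjointable_ops}"

definition ad :: "'e endo \<Rightarrow> 'e endo" where
  "ad T = En (adj (bl T))"

definition Jop :: "'e endo" where
  "Jop = mk (\<lambda>x. \<i> *\<^sub>C x)"

lemma Jop_ap: "Jop \<cdot> x = \<i> *\<^sub>C x"
  unfolding Jop_def by (rule mk_ap[OF bounded_linear_scaleC])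

lemma AdjI: assumes "\<And>x y. ip (T \<cdot> x) y = ip x (S \<cdot> y)" shows "T \<in> Adj" and "ad T = S"
proof -
  show "T \<in> Adj"
    using assms unfolding Adj_def adjointable_ops_def bl_ap
    by (intro CollectI exI[where x = "bl S"]) (simp add: bl_ap)
  have "adj (bl T) = bl S"
    unfolding adj_def
  proof (rule the_equality)
    show "\<forall>x y. ip (bl T x) y = ip x (bl S y)"
      using assms by (simp add: bl_ap)
    show "X = bl S" if "\<forall>x y. ip (bl T x) y = ip x (blinfun_apply X y)" for X
      using that assms by (intro blinfun_eqI ip_eqI) (metis bl_ap)
  qed
  then show "ad T = S"
    by (simp add: ad_def)
qed

lemma AdjD: assumes "T \<in> Adj" shows "ip (T \<cdot> x) y = ip x (ad T \<cdot> y)"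
proof -
  obtain S where "\<forall>x y. ip (bl T x) y = ip x (blinfun_apply S y)"
    using assms by (auto simp: Adj_def adjointable_ops_def)
  then have "ip (T \<cdot> x) y = ip x (En S \<cdot> y)" for x y
    by (simp add: bl_ap[symmetric])
  then show ?thesis
    using AdjI(2) by metis
qed

lemma AdjD': assumes "T \<in> Adj" shows "ip x (T \<cdot> y) = ip (ad T \<cdot> x) y"
  by (metis AdjD[OF assms] star_ip)

lemma ad_Adj: assumes "T \<in> Adj" shows "ad T \<in> Adj" "ad (ad T) = T"
  using AdjI[of "ad T" T] AdjD'[OF assms] by auto

lemma bl_ad: "bl (ad T) = adj (bl T)"
  by (simp add: ad_def)

lemma Adj_ract: assumes "T \<in> Adj" shows "T \<cdot> ract x b = ract (T \<cdot> x) b"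
  using AdjD'[OF assms] by (intro ip_eqI) (simp add: ip_ract_right)

lemma Adj_scaleC: assumes "T \<in> Adj" shows "T \<cdot> (k *\<^sub>C x) = k *\<^sub>C (T \<cdot> x)"
  using AdjD'[OF assms] by (intro ip_eqI) (simp add: ip_scaleC_right)

lemma Adj_simps:
  shows "1 \<in> Adj" and "Jop \<in> Adj" "ad Jop = - Jop"
    and "S \<in> Adj \<Longrightarrow> T \<in> Adj \<Longrightarrow> S + T \<in> Adj" "S \<in> Adj \<Longrightarrow> T \<in> Adj \<Longrightarrow> ad (S + T) = ad S + ad T"
    and "S \<in> Adj \<Longrightarrow> T \<in> Adj \<Longrightarrow> S * T \<in> Adj" "S \<in> Adj \<Longrightarrow> T \<in> Adj \<Longrightarrow> ad (S * T) = ad T * ad S"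
    and "T \<in> Adj \<Longrightarrow> t *\<^sub>R T \<in> Adj" "T \<in> Adj \<Longrightarrow> ad (t *\<^sub>R T) = t *\<^sub>R ad T"
proof -
  show "1 \<in> Adj"
    by (rule AdjI[where S = 1]) simp
  have "ip (Jop \<cdot> x) y = ip x (- Jop \<cdot> y)" for x y
    by (simp add: Jop_ap ap_minus ip_simps complex_vector.scale_minus_left)
  from AdjI[OF this] show "Jop \<in> Adj" "ad Jop = - Jop"
    by auto
  show "S + T \<in> Adj" "ad (S + T) = ad S + ad T" if "S \<in> Adj" "T \<in> Adj" for S T
    using that by (auto intro!: AdjI[where S = "ad S + ad T"] simp: ap_simps ip_simps AdjD)
  show "S * T \<in> Adj" "ad (S * T) = ad T * ad S" if "S \<in> Adj" "T \<in> Adj" for S T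
    using that by (auto intro!: AdjI[where S = "ad T * ad S"] simp: ap_simps ip_simps AdjD)
  show "t *\<^sub>R T \<in> Adj" "ad (t *\<^sub>R T) = t *\<^sub>R ad T" if "T \<in> Adj" for t T
    using that by (auto intro!: AdjI[where S = "t *\<^sub>R ad T"] simp: ap_simps ip_simps AdjD)
qed

end

text \<open>
  The Cauchy--Schwarz inequality holds in every Hilbert module; it is an assumption here only
  because its proof uses the spectral theory of the coefficient algebra, which in turn comes from
  applying this locale to that algebra as a module over itself.
\<close>

locale cs_hilbert_module = hilbert_module +
  assumes cs: "norm (ip x y) \<le> norm x * norm y"
begin

lemma norm_ad_le_norm: assumes T: "T \<in> Adj" shows "norm (ad T) \<le> norm T"
proof (rule norm_endo_bound)
  fix y
  have "(norm (ad T \<cdot> y))\<^sup>2 = norm (ip (T \<cdot> ad T \<cdot> y) y)"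
    using AdjD[OF T] by (simp add: norm_ip_self[symmetric])
  also have "\<dots> \<le> norm (T \<cdot> ad T \<cdot> y) * norm y"
    by (rule cs)
  also have "\<dots> \<le> norm T * norm (ad T \<cdot> y) * norm y"
    by (intro mult_right_mono norm_ap) auto
  finally show "norm (ad T \<cdot> y) \<le> norm T * norm y"
    by (cases "ad T \<cdot> y = 0") (auto simp: power2_eq_square mult.commute mult.left_commute)
qed auto

lemma norm_ad_mult_self: assumes T: "T \<in> Adj" shows "norm (ad T * T) = (norm T)\<^sup>2"
proof (rule antisym)
  have "norm (ad T * T) \<le> norm (ad T) * norm T"
    by (rule norm_mult_ineq)
  also have "\<dots> \<le> norm T * norm T"
    by (intro mult_right_mono norm_ad_le_norm T) auto
  finally show "norm (ad T * T) \<le> (norm T)\<^sup>2"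
    by (simp add: power2_eq_square)
  have "norm T \<le> sqrt (norm (ad T * T))"
  proof (rule norm_endo_bound)
    fix x
    have "(norm (T \<cdot> x))\<^sup>2 = norm (ip x ((ad T * T) \<cdot> x))"
      using AdjD[OF T] by (simp add: norm_ip_self[symmetric] ap_mult)
    also have "\<dots> \<le> norm x * (norm (ad T * T) * norm x)"
      by (intro order_trans[OF cs] mult_left_mono norm_ap) auto
    also have "\<dots> = (sqrt (norm (ad T * T)) * norm x)\<^sup>2"
      by (simp add: power_mult_distrib power2_eq_square)
    finally show "norm (T \<cdot> x) \<le> sqrt (norm (ad T * T)) * norm x"
      by (rule power2_le_imp_le) auto
  qed auto
  then show "(norm T)\<^sup>2 \<le> norm (ad T * T)"
    by (metis norm_ge_zero power_mono real_sqrt_pow2)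
qed

lemma closed_Adj: "closed Adj"
  unfolding closed_sequential_limits
proof (intro allI impI)
  fix X T
  assume *: "(\<forall>n. X n \<in> Adj) \<and> X \<longlonglongrightarrow> T"
  have d: "norm (ad (X m) - ad (X n)) \<le> norm (X m - X n)" for m n
  proof -
    have "(- 1) *\<^sub>R X n \<in> Adj" "ad ((- 1) *\<^sub>R X n) = (- 1) *\<^sub>R ad (X n)"
      using * Adj_simps(8,9)[of "X n" "- 1"] by auto
    then have "X m + (- 1) *\<^sub>R X n \<in> Adj" "ad (X m + (- 1) *\<^sub>R X n) = ad (X m) + (- 1) *\<^sub>R ad (X n)"
      using * Adj_simps(4,5)[of "X m" "(- 1) *\<^sub>R X n"] by auto
    then show ?thesis
      using norm_ad_le_norm[of "X m + (- 1) *\<^sub>R X n"] by simp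
  qed
  have "Cauchy X"
    using * by (auto intro: LIMSEQ_imp_Cauchy)
  then have "Cauchy (\<lambda>n. ad (X n))"
    unfolding Cauchy_def dist_norm using d by (meson le_less_trans)
  then obtain S where S: "(\<lambda>n. ad (X n)) \<longlonglongrightarrow> S"
    by (auto simp: Cauchy_convergent_iff convergent_def)
  have lim: "(\<lambda>n. ip (f n) y) \<longlonglongrightarrow> ip x y" "(\<lambda>n. ip y (f n)) \<longlonglongrightarrow> ip y x" if f: "f \<longlonglongrightarrow> x" for f x y
  proof -
    have b: "bounded_linear (\<lambda>x. ip x y)" "bounded_linear (\<lambda>x. ip y x)"
      using cs[of _ y] cs[of y] by (auto intro!: bounded_linear_intro[where K = "norm y"] simp: ip_simps mult.commute[of _ "norm y"])
    show "(\<lambda>n. ip (f n) y) \<longlonglongrightarrow> ip x y" "(\<lambda>n. ip y (f n)) \<longlonglongrightarrow> ip y x"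
      using f by (auto intro: bounded_linear.tendsto[OF b(1)] bounded_linear.tendsto[OF b(2)])
  qed
  have "ip (T \<cdot> x) y = ip x (S \<cdot> y)" for x y
  proof (rule LIMSEQ_unique)
    show "(\<lambda>n. ip (X n \<cdot> x) y) \<longlonglongrightarrow> ip (T \<cdot> x) y"
      using * by (intro lim tendsto_ap) auto
    have "(\<lambda>n. ip x (ad (X n) \<cdot> y)) \<longlonglongrightarrow> ip x (S \<cdot> y)"
      by (intro lim tendsto_ap S)
    then show "(\<lambda>n. ip (X n \<cdot> x) y) \<longlonglongrightarrow> ip x (S \<cdot> y)"
      using * AdjD by simp
  qed
  then show "T \<in> Adj"
    by (rule AdjI)
qed

sublocale cstar_ops Adj ad Jop
proof
  show "T * Jop = Jop * T" if "T \<in> Adj" for T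
    by (rule endo_eqI) (simp add: ap_mult Jop_ap Adj_scaleC that)
  show "Jop * Jop = - 1"
    by (rule endo_eqI) (simp add: ap_simps Jop_ap)
qed (simp_all add: Adj_simps ad_Adj closed_Adj norm_ad_mult_self)

end

subsection \<open>Order in the coefficient algebra and the Cauchy--Schwarz inequality\<close>

lemma norm_star: "norm (star x) = norm (x :: 'b::cstar_algebra)"
proof -
  have le: "norm x \<le> norm (star x)" for x :: 'b
  proof (cases "x = 0")
    case False
    have "norm x * norm x \<le> norm (star x) * norm x"
      using cstar_identity[of x] norm_mult_ineq[of "star x" x] by (simp add: power2_eq_square)
    then show ?thesis
      using False by simp
  qed simp
  show ?thesis
    using le[of x] le[of "star x"] by (simp add: star_star)
qed

lemma self_cs_hilbert_module: "cs_hilbert_module (\<lambda>x y :: 'b::cstar_algebra. star x * y) (*)"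
proof
  fix x y z b c :: 'b and k :: complex
  show "cstar_positive (star x * x)"
    by (auto simp: cstar_positive_def)
  show "norm (star x * y) \<le> norm x * norm y"
    using norm_mult_ineq[of "star x" y] by (simp add: norm_star)
  show "star (star x * y) = star y * x"
    by (simp add: star_mult star_star)
  show "norm x = sqrt (norm (star x * x))"
    by (simp add: cstar_identity)
qed (simp_all only: distrib_left distrib_right mult.assoc mult_scaleC_left mult_scaleC_right)

global_interpretation self: cs_hilbert_module "\<lambda>x y :: 'b::cstar_algebra. star x * y" "(*)"
  by (rule self_cs_hilbert_module)

definition Lm :: "'b::cstar_algebra \<Rightarrow> 'b endo" where
  "Lm b = mk (\<lambda>x. b * x)"

lemma Lm_ap: "Lm b \<cdot> x = b * x"
  unfolding Lm_def by (rule mk_ap) (rule bounded_linear_mult_right)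

lemma Lm_mult: "Lm (a * b) = Lm a * Lm b"
  and Lm_add: "Lm (a + b) = Lm a + Lm b"
  and Lm_diff: "Lm (a - b) = Lm a - Lm b"
  by (rule endo_eqI, simp add: Lm_ap ap_simps algebra_simps)+

lemma Lm_Adj: "Lm b \<in> self.Adj" and ad_Lm: "self.ad (Lm b) = Lm (star b)"
  by (rule self.AdjI[where S = "Lm (star b)"]; simp add: Lm_ap star_mult mult.assoc)+

lemma norm_Lm: "norm (Lm b) = norm b"
proof (rule antisym)
  show "norm (Lm b) \<le> norm b"
    by (rule norm_endo_bound) (auto simp: Lm_ap norm_mult_ineq)
  have "(norm b)\<^sup>2 = norm (Lm b \<cdot> star b)"
    using cstar_identity[of "star b"] by (simp add: Lm_ap star_star norm_star)
  also have "\<dots> \<le> norm (Lm b) * norm b"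
    using norm_ap[of "Lm b" "star b"] by (simp add: norm_star)
  finally show "norm b \<le> norm (Lm b)"
    by (cases "b = 0") (auto simp: power2_eq_square)
qed

text \<open>
  Positivity in the coefficient algebra, which may lack a unit, is that of left multiplications.
\<close>

definition spos :: "'b::cstar_algebra \<Rightarrow> bool" where
  "spos b \<longleftrightarrow> self.pos (Lm b)"

lemma spos_star_mult: "spos (star b * b)"
  using self.pos_ad_mult[OF Lm_Adj[of b]] by (simp add: spos_def Lm_mult ad_Lm)

lemma spos_cstar_positive: "cstar_positive b \<Longrightarrow> spos b"
  by (auto simp: cstar_positive_def spos_star_mult)

lemma spos_add: "spos a \<Longrightarrow> spos b \<Longrightarrow> spos (a + b)"
  by (simp add: spos_def Lm_add self.pos_add)

lemma norm_le_spos_add: "spos a \<Longrightarrow> spos b \<Longrightarrow> norm a \<le> norm (a + b)"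
  using self.norm_le_pos_add[of "Lm a" "Lm b"] by (simp add: spos_def norm_Lm[symmetric] Lm_add)

lemma (in hilbert_module) spos_ip: "spos (ip x x)"
  by (rule spos_cstar_positive[OF ip_self_positive])

lemma (in hilbert_module) ip_ract_left: "ip (ract x b) y = star b * ip x y"
  by (metis star_ip star_mult ip_ract_right star_star)

text \<open>
  For \<open>\<parallel>x\<parallel> = 1\<close>, \<open>h = \<langle>x, x\<rangle>\<close> and \<open>b = \<langle>x, y\<rangle>\<close> one has
  \<open>\<langle>y, y\<rangle> - b\<^sup>*b = \<langle>y - x b, y - x b\<rangle> + b\<^sup>*(1 - h) b\<close>, a sum of two positive elements.
\<close>

lemma (in hilbert_module) cauchy_schwarz: "norm (ip x y) \<le> norm x * norm y"
proof -
  have unit: "norm (ip x y) \<le> norm y" if x: "norm x = 1" for x y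
  proof -
    define b where "b = ip x y"
    define h where "h = ip x x"
    have h: "self.pos (Lm h)" "norm (Lm h) = 1"
      using spos_ip[of x] norm_ip_self[of x] x by (auto simp: h_def spos_def norm_Lm)
    then have p: "self.pos (1 - Lm h)"
      using self.pos_norm_diff[OF self.pos_sa[OF h(1)]] by simp
    define Z where "Z = self.fc sqrt (1 - Lm h)"
    have Z: "Z \<in> self.Adj" "self.ad Z = Z" "Z * Z = 1 - Lm h"
      using self.sqrt_fc[OF p] by (auto simp: Z_def self.sa_def)
    have "self.ad (Z * Lm b) = Lm (star b) * Z"
      using Z by (simp add: self.ad_mult Lm_Adj ad_Lm)
    then have "self.ad (Z * Lm b) * (Z * Lm b) = Lm (star b) * (Z * Z) * Lm b"
      by (simp only: mult.assoc)
    also have "\<dots> = Lm (star b * b - star b * h * b)"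
      unfolding Z by (simp add: Lm_diff Lm_mult algebra_simps)
    finally have s1: "spos (star b * b - star b * h * b)"
      using self.pos_ad_mult[of "Z * Lm b"] Z by (simp add: spos_def Lm_Adj self.in_A)
    have "ip (y - ract x b) (y - ract x b) = ip y y - star b * b - (star b * b - star b * h * b)"
      using star_ip[of x y]
      by (simp add: ip_simps ip_ract_left ip_ract_right b_def h_def algebra_simps)
    then have "spos (ip y y - star b * b - (star b * b - star b * h * b))"
      by (metis spos_ip)
    from spos_add[OF this s1] have "spos (ip y y - star b * b)"
      by simp
    from norm_le_spos_add[OF spos_star_mult[of b] this] have "norm (star b * b) \<le> norm (ip y y)"
      by simp
    then show ?thesis
      by (simp add: cstar_identity norm_ip_self b_def)
  qed
  show ?thesis
  proof (cases "x = 0")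
    case False
    have "norm (ip (inverse (norm x) *\<^sub>R x) y) \<le> norm y"
      using False by (intro unit) simp
    then show ?thesis
      using False by (simp add: ip_simps divide_inverse[symmetric] field_simps)
  qed simp
qed

lemma (in hilbert_module) cs_hilbert_module: "cs_hilbert_module ip ract"
  by unfold_locales (rule cauchy_schwarz)

subsection \<open>Comparison of the two forms of the functional calculus\<close>

context cs_hilbert_module
begin

lemma inv_in_iff: "inv_in T \<longleftrightarrow> invertible_op (bl T)"
proof -
  have eq: "S * T = 1 \<and> T * S = 1 \<longleftrightarrow> bl S o\<^sub>L bl T = id_blinfun \<and> bl T o\<^sub>L bl S = id_blinfun" for S
    by (simp add: times_endo.rep_eq[symmetric] one_endo.rep_eq[symmetric] bl_inject)
  have mem: "S \<in> Adj \<longleftrightarrow> bl S \<in> adjointable_ops" for S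
    by (simp add: Adj_def)
  have ex: "(\<exists>S\<in>Adj. P (bl S)) \<longleftrightarrow> (\<exists>S\<in>adjointable_ops. P S)" for P
    by (metis bl_En mem)
  show ?thesis
    unfolding inv_in_def invertible_op_def eq mem[of T]
    by (subst ex[of "\<lambda>S. S o\<^sub>L bl T = id_blinfun \<and> bl T o\<^sub>L S = id_blinfun"]) (rule refl)
qed

lemma spec_eq: "spec T = real_spectrum (bl T)"
  by (simp add: spec_def real_spectrum_def inv_in_iff minus_endo.rep_eq scaleR_endo.rep_eq one_endo.rep_eq)

lemma bl_sum: "bl (sum f X) = (\<Sum>x\<in>X. bl (f x))"
  by (induction X rule: infinite_finite_induct) (simp_all add: zero_endo.rep_eq plus_endo.rep_eq)

lemma bl_peval: "bl (peval p T) = poly_op p (bl T)"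
proof -
  have "bl (T ^ i) = ((\<lambda>S. bl T o\<^sub>L S) ^^ i) id_blinfun" for i
    by (induction i) (simp_all add: one_endo.rep_eq times_endo.rep_eq)
  then show ?thesis
    by (simp add: peval_def poly_op_def bl_sum scaleR_endo.rep_eq)
qed

lemma bl_tendsto_iff: "((\<lambda>n. bl (X n)) \<longlonglongrightarrow> S) \<longleftrightarrow> (X \<longlonglongrightarrow> En S)"
  unfolding LIMSEQ_iff norm_endo.rep_eq minus_endo.rep_eq by simp

text \<open>
  Both definitions describe the limit by the same sequences of polynomials on the same spectrum.
\<close>

lemma fun_calc_eq:
  assumes T: "sa T" and f: "continuous_on (spec T) f"
  shows "fun_calc f (bl T) = bl (fc f T)"
  unfolding fun_calc_def spec_eq[symmetric] bl_peval[symmetric] bl_tendsto_iff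
proof (rule the_equality)
  show "\<forall>p. uniform_limit (spec T) (\<lambda>n. poly (p n)) f sequentially \<longrightarrow>
      (\<lambda>n. peval (p n) T) \<longlonglongrightarrow> En (bl (fc f T))"
    using fc_tendsto[OF T f] by simp
  fix S assume "\<forall>p. uniform_limit (spec T) (\<lambda>n. poly (p n)) f sequentially \<longrightarrow>
      (\<lambda>n. peval (p n) T) \<longlonglongrightarrow> En S"
  then have "En S = fc f T"
    using fc_approx[OF T f] LIMSEQ_unique by metis
  then show "S = bl (fc f T)"
    by (metis bl_En)
qed

text \<open>An operator whose quadratic form is positive has non-negative spectrum.\<close>

lemma pos_if_form:
  assumes T: "sa T" and form: "\<And>v. spos (ip v (T \<cdot> v))"
  shows "pos T"
proof -
  have TA: "T \<in> Adj"
    using T by (simp add: sa_def)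
  have lower: "l * norm v \<le> norm ((T + l *\<^sub>R 1) \<cdot> v)" if l: "l > 0" for l v
  proof (cases "v = 0")
    case False
    have "spos (ip (sqrt l *\<^sub>R v) (sqrt l *\<^sub>R v))"
      by (rule spos_ip)
    then have "norm (l *\<^sub>R ip v v) \<le> norm (l *\<^sub>R ip v v + ip v (T \<cdot> v))"
      using form[of v] l by (intro norm_le_spos_add) (auto simp: ip_simps)
    also have "l *\<^sub>R ip v v + ip v (T \<cdot> v) = ip v ((T + l *\<^sub>R 1) \<cdot> v)"
      by (simp add: ip_simps ap_simps)
    also have "norm \<dots> \<le> norm v * norm ((T + l *\<^sub>R 1) \<cdot> v)"
      by (rule cs)
    finally show ?thesis
      using l False by (simp add: norm_ip_self power2_eq_square mult.left_commute)
  qed simp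
  have "inv_in (T + l *\<^sub>R 1)" if l: "l > 0" for l
  proof -
    define m where "m = norm T + l"
    have m: "m > norm T" "m \<ge> l" "m > 0"
      using l by (auto simp: m_def add_nonneg_pos)
    have inv: "inv_in (T + m *\<^sub>R 1)"
      using inv_in_diff[of "- T" m] m TA by (simp add: in_A add.commute)
    then obtain S where S: "S \<in> Adj" "S * (T + m *\<^sub>R 1) = 1" "(T + m *\<^sub>R 1) * S = 1"
      by (auto simp: inv_in_def)
    have "norm S \<le> 1 / m"
    proof (rule norm_endo_bound)
      fix v
      have "m * norm (S \<cdot> v) \<le> norm ((T + m *\<^sub>R 1) \<cdot> S \<cdot> v)"
        by (rule lower) (use m in auto)
      then show "norm (S \<cdot> v) \<le> 1 / m * norm v"
        using m by (simp add: ap_mult[symmetric] S field_simps)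
    qed (use m in auto)
    then have "norm ((m - l) *\<^sub>R S) \<le> (m - l) / m"
      using m by (simp add: mult_left_mono divide_inverse)
    also have "\<dots> < 1"
      using m l by simp
    finally have "inv_in (1 - (m - l) *\<^sub>R S)"
      using S by (intro inv_in_one_minus in_A)
    from inv_in_mult[OF inv this] show ?thesis
      using S by (simp add: right_diff_distrib) (simp add: algebra_simps)
  qed
  from this[of "- t" for t] have "0 \<le> t" if "t \<in> spec T" for t
    using that by (force simp: spec_def not_le[symmetric])
  then show ?thesis
    using T by (auto simp: pos_def)
qed

end

section \<open>Self-adjoint regular operators\<close>

text \<open>Under a uniform bound, strong convergence on a dense set extends to all vectors.\<close>

lemma dense_strong_limit:
  fixes T :: "nat \<Rightarrow> 'a::real_normed_vector endo"
  assumes dense: "closure X = UNIV" and bound: "\<And>n. norm (T n) \<le> C" and bL: "norm L \<le> C"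
    and conv: "\<And>x. x \<in> X \<Longrightarrow> (\<lambda>n. T n \<cdot> x) \<longlonglongrightarrow> L \<cdot> x"
  shows "(\<lambda>n. T n \<cdot> v) \<longlonglongrightarrow> L \<cdot> v"
proof (rule LIMSEQ_I)
  fix \<epsilon> :: real assume e: "\<epsilon> > 0"
  have C: "C \<ge> 0"
    using bL norm_ge_zero[of L] by linarith
  define d where "d = \<epsilon> / (4 * (C + 1))"
  have d: "d > 0" "C * d \<le> \<epsilon> / 4"
    using e C by (auto simp: d_def field_simps)
  have "v \<in> closure X"
    using dense by simp
  then obtain x where x: "x \<in> X" "norm (v - x) < d"
    using d(1) by (metis closure_approachable dist_norm norm_minus_commute)
  obtain N where N: "\<And>n. n \<ge> N \<Longrightarrow> norm (T n \<cdot> x - L \<cdot> x) < \<epsilon> / 4"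
    using LIMSEQ_D[OF conv[OF x(1)], of "\<epsilon> / 4"] e by auto
  have small: "norm (S \<cdot> (v - x)) \<le> \<epsilon> / 4" if "norm S \<le> C" for S
  proof -
    have "norm (S \<cdot> (v - x)) \<le> C * d"
      using x(2) that C by (intro order_trans[OF norm_ap] mult_mono) auto
    then show ?thesis
      using d by linarith
  qed
  have "norm (T n \<cdot> v - L \<cdot> v) < \<epsilon>" if "n \<ge> N" for n
  proof -
    have "T n \<cdot> v - L \<cdot> v = (T n \<cdot> x - L \<cdot> x) + T n \<cdot> (v - x) - L \<cdot> (v - x)"
      by (simp add: ap_simps)
    also have "norm \<dots> \<le> norm (T n \<cdot> x - L \<cdot> x) + norm (T n \<cdot> (v - x)) + norm (L \<cdot> (v - x))"
      by (rule order_trans[OF norm_triangle_ineq4 add_right_mono[OF norm_triangle_ineq]])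
    also have "\<dots> < \<epsilon>"
      using N[OF that] small[OF bound[of n]] small[OF bL] e by linarith
    finally show ?thesis .
  qed
  then show "\<exists>N. \<forall>n\<ge>N. norm (T n \<cdot> v - L \<cdot> v) < \<epsilon>"
    by blast
qed

lemma dense_endo_eqI:
  fixes S T :: "'a::real_normed_vector endo"
  assumes "closure X = UNIV" "\<And>x. x \<in> X \<Longrightarrow> S \<cdot> x = T \<cdot> x"
  shows "S = T"
proof (rule endo_eqI)
  fix v
  have "(\<lambda>n::nat. S \<cdot> v) \<longlonglongrightarrow> T \<cdot> v"
    by (rule dense_strong_limit[OF assms(1), where C = "max (norm S) (norm T)"]) (auto simp: assms(2))
  then show "S \<cdot> v = T \<cdot> v"
    by (simp add: LIMSEQ_const_iff)
qed

lemma dense_rangeE: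
  fixes g :: "'a \<Rightarrow> 'b::metric_space"
  assumes "closure (range g) = UNIV"
  obtains u where "(\<lambda>n. g (u n)) \<longlonglongrightarrow> v"
proof -
  have "v \<in> closure (range g)"
    using assms by simp
  then obtain f where f: "\<And>n. f n \<in> range g" "f \<longlonglongrightarrow> v"
    by (auto simp: closure_sequential)
  have "\<forall>n. \<exists>u. f n = g u"
    using f(1) by auto
  from choice[OF this] obtain u where "\<forall>n. f n = g (u n)" ..
  then have "f = (\<lambda>n. g (u n))"
    by auto
  then show ?thesis
    using f(2) that by blast
qed

lemma (in cs_hilbert_module) tendsto_ip:
  assumes "f \<longlonglongrightarrow> x"
  shows "(\<lambda>n. ip (f n) y) \<longlonglongrightarrow> ip x y" "(\<lambda>n. ip y (f n)) \<longlonglongrightarrow> ip y x"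
proof -
  have "bounded_linear (\<lambda>x. ip x y)" "bounded_linear (\<lambda>x. ip y x)"
    using cs[of _ y] cs[of y]
    by (auto intro!: bounded_linear_intro[where K = "norm y"] simp: ip_simps mult.commute[of _ "norm y"])
  then show "(\<lambda>n. ip (f n) y) \<longlonglongrightarrow> ip x y" "(\<lambda>n. ip y (f n)) \<longlonglongrightarrow> ip y x"
    using assms by (auto intro: bounded_linear.tendsto)
qed

lemma (in cs_hilbert_module) dense_ip_eqI:
  assumes dense: "closure X = UNIV" and eq: "\<And>x. x \<in> X \<Longrightarrow> ip x y = ip x z"
  shows "y = z"
proof (rule ip_eqI)
  fix v
  have "v \<in> closure X"
    using dense by simp
  then obtain f where f: "\<And>n. f n \<in> X" "f \<longlonglongrightarrow> v"
    by (auto simp: closure_sequential)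
  have "(\<lambda>n. ip (f n) y) \<longlonglongrightarrow> ip v y" "(\<lambda>n. ip (f n) y) \<longlonglongrightarrow> ip v z"
    using tendsto_ip(1)[OF f(2), of y] tendsto_ip(1)[OF f(2), of z] eq[OF f(1)] by simp_all
  then show "ip v y = ip v z"
    by (rule LIMSEQ_unique)
qed

locale regular_operator = cs_hilbert_module ip ract
  for ip :: "'e::cbanach \<Rightarrow> 'e \<Rightarrow> 'b::cstar_algebra" and ract :: "'e \<Rightarrow> 'b \<Rightarrow> 'e" +
  fixes D :: "'e unb"
  assumes sar: "selfadjoint_regular D"
begin

subsection \<open>The resolvent\<close>

lemma dense_Domain: "closure (Domain D) = UNIV"
  using sar by (simp add: selfadjoint_regular_def densely_defined_def)

lemma D_iff: "(y, z) \<in> D \<longleftrightarrow> (\<forall>x w. (x, w) \<in> D \<longrightarrow> ip w y = ip x z)"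
proof -
  have "D = unb_adj D"
    using sar by (simp add: selfadjoint_regular_def)
  then have "(y, z) \<in> D \<longleftrightarrow> (y, z) \<in> unb_adj D"
    by simp
  then show ?thesis
    by (auto simp: unb_adj_def)
qed

lemma D_sym: "(x, w) \<in> D \<Longrightarrow> (y, z) \<in> D \<Longrightarrow> ip w y = ip x z"
  using iffD1[OF D_iff[of y z]] by blast

lemma D_fun: assumes "(x, y) \<in> D" "(x, z) \<in> D" shows "y = z"
proof (rule dense_ip_eqI[OF dense_Domain])
  fix v assume "v \<in> Domain D"
  then show "ip v y = ip v z"
    using D_sym assms by (metis DomainE)
qed

lemma D_add: "(x, y) \<in> D \<Longrightarrow> (x', y') \<in> D \<Longrightarrow> (x + x', y + y') \<in> D"
  and D_diff: "(x, y) \<in> D \<Longrightarrow> (x', y') \<in> D \<Longrightarrow> (x - x', y - y') \<in> D"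
  and D_scaleR: "(x, y) \<in> D \<Longrightarrow> (t *\<^sub>R x, t *\<^sub>R y) \<in> D"
  by (rule iffD2[OF D_iff], simp add: ip_simps D_sym)+

lemma D_zero: "(0, 0) \<in> D"
  by (rule iffD2[OF D_iff]) simp

lemma D_closed:
  assumes "X \<longlonglongrightarrow> x" "Y \<longlonglongrightarrow> y" "\<And>n. (X n, Y n) \<in> D"
  shows "(x, y) \<in> D"
proof (rule iffD2[OF D_iff], intro allI impI)
  fix v w assume "(v, w) \<in> D"
  then have eq: "ip w (X n) = ip v (Y n)" for n
    by (rule D_sym[OF _ assms(3)])
  show "ip w x = ip v y"
    by (rule LIMSEQ_unique[OF tendsto_ip(2)[OF assms(1), of w] tendsto_ip(2)[OF assms(2), of v, folded eq]])
qed

definition dop :: "'e \<Rightarrow> 'e" where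
  "dop x = (THE y. (x, y) \<in> D)"

lemma dop_eq: "(x, y) \<in> D \<Longrightarrow> dop x = y"
  unfolding dop_def using D_fun by blast

lemma dop_in: "x \<in> Domain D \<Longrightarrow> (x, dop x) \<in> D"
  using dop_eq by auto

text \<open>
  Both bounds come from \<open>\<langle>x, (1 + D\<^sup>2) x\<rangle> = \<langle>x, x\<rangle> + \<langle>D x, D x\<rangle>\<close>. They make \<open>1 + D\<^sup>2\<close> injective, and its dense range closed.
\<close>

lemma one_plus_square_bound:
  assumes "(x, y) \<in> D" "(y, z) \<in> D"
  shows "norm x \<le> norm (x + z)" "norm y \<le> norm (x + z)"
proof -
  have yy: "ip y y = ip x z"
    using D_sym[OF assms] .
  have le: "norm (ip x x + ip y y) \<le> norm x * norm (x + z)"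
    unfolding yy ip_add_right[symmetric] by (rule cs)
  have "(norm x)\<^sup>2 \<le> norm x * norm (x + z)"
    using norm_le_spos_add[OF spos_ip[of x] spos_ip[of y]] le by (simp add: norm_ip_self)
  then show 1: "norm x \<le> norm (x + z)"
    by (cases "x = 0") (auto simp: power2_eq_square)
  have "(norm y)\<^sup>2 \<le> norm x * norm (x + z)"
    using norm_le_spos_add[OF spos_ip[of y] spos_ip[of x]] le by (simp add: norm_ip_self add.commute)
  also have "\<dots> \<le> (norm (x + z))\<^sup>2"
    using 1 by (simp add: power2_eq_square mult_right_mono)
  finally show "norm y \<le> norm (x + z)"
    by (rule power2_le_imp_le) auto
qed

lemma one_plus_square_iff: "(x, v) \<in> one_plus_square D \<longleftrightarrow> (\<exists>y. (x, y) \<in> D \<and> (y, v - x) \<in> D)"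
proof -
  have "(x, v) \<in> one_plus_square D \<longleftrightarrow> (\<exists>y z. (x, y) \<in> D \<and> (y, z) \<in> D \<and> v = x + z)"
    unfolding one_plus_square_def unb_add_def unb_comp_def gr_def by auto
  then show ?thesis
    by (metis add_diff_cancel_left' diff_add_cancel add.commute)
qed

lemma one_plus_square_surj: "\<exists>x. (x, v) \<in> one_plus_square D"
proof -
  have "v \<in> closure (Range (one_plus_square D))"
    using sar by (simp add: selfadjoint_regular_def)
  then obtain V where V: "\<And>n. V n \<in> Range (one_plus_square D)" "V \<longlonglongrightarrow> v"
    by (auto simp: closure_sequential)
  then have "\<exists>x y. (x, y) \<in> D \<and> (y, V n - x) \<in> D" for n
    using one_plus_square_iff by (metis RangeE)
  then obtain X Y where XY: "\<And>n. (X n, Y n) \<in> D" "\<And>n. (Y n, V n - X n) \<in> D"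
    by metis
  have b: "norm (X m - X n) \<le> norm (V m - V n)" "norm (Y m - Y n) \<le> norm (V m - V n)" for m n
    using one_plus_square_bound[OF D_diff[OF XY(1)[of m] XY(1)[of n]] D_diff[OF XY(2)[of m] XY(2)[of n]]]
    by (simp_all add: algebra_simps)
  have "Cauchy V"
    using V(2) by (rule LIMSEQ_imp_Cauchy)
  then have "Cauchy X" "Cauchy Y"
    unfolding Cauchy_def dist_norm using b by (meson le_less_trans)+
  then obtain x y where xy: "X \<longlonglongrightarrow> x" "Y \<longlonglongrightarrow> y"
    by (auto simp: Cauchy_convergent_iff convergent_def)
  have "(x, y) \<in> D" "(y, v - x) \<in> D"
    using D_closed[OF xy XY(1)] D_closed[OF xy(2) tendsto_diff[OF V(2) xy(1)] XY(2)] by auto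
  then show ?thesis
    using one_plus_square_iff by blast
qed

lemma one_plus_square_inj:
  assumes "(x, v) \<in> one_plus_square D" "(x', v) \<in> one_plus_square D"
  shows "x = x'"
proof -
  obtain y y' where *: "(x, y) \<in> D" "(y, v - x) \<in> D" "(x', y') \<in> D" "(y', v - x') \<in> D"
    using assms by (auto simp: one_plus_square_iff)
  show ?thesis
    using one_plus_square_bound(1)[OF D_diff[OF *(1,3)] D_diff[OF *(2,4)]] by simp
qed

definition R :: "'e endo" where
  "R = mk (\<lambda>v. THE x. (x, v) \<in> one_plus_square D)"

lemma R_iff: "R \<cdot> v = x \<longleftrightarrow> (x, v) \<in> one_plus_square D"
proof -
  define r where "r v = (THE x. (x, v) \<in> one_plus_square D)" for v
  have r: "(r v, v) \<in> one_plus_square D" for v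
    unfolding r_def using one_plus_square_surj one_plus_square_inj by (rule_tac theI') blast
  have "bounded_linear r"
  proof (rule bounded_linear_intro[where K = 1])
    have add: "(x + x', v + v') \<in> one_plus_square D" if "(x, v) \<in> one_plus_square D" "(x', v') \<in> one_plus_square D" for x x' v v'
      using that D_add unfolding one_plus_square_iff by (metis add_diff_add)
    have scale: "(t *\<^sub>R x, t *\<^sub>R v) \<in> one_plus_square D" if "(x, v) \<in> one_plus_square D" for t x v
      using that D_scaleR unfolding one_plus_square_iff by (metis scaleR_right_diff_distrib)
    show "r (v + w) = r v + r w" for v w
      using one_plus_square_inj[OF r add[OF r r]] .
    show "r (t *\<^sub>R v) = t *\<^sub>R r v" for t v
      using one_plus_square_inj[OF r scale[OF r]] .
    show "norm (r v) \<le> norm v * 1" for v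
      using r[of v] one_plus_square_bound(1) by (force simp: one_plus_square_iff)
  qed
  then have "R \<cdot> v = r v"
    using mk_ap[of r] by (simp add: R_def r_def[abs_def])
  then show ?thesis
    using r[of v] one_plus_square_inj by auto
qed

lemma R_D: obtains y where "(R \<cdot> v, y) \<in> D" "(y, v - R \<cdot> v) \<in> D"
  using R_iff[of v "R \<cdot> v"] by (auto simp: one_plus_square_iff)

lemma R_eqI: "(x, y) \<in> D \<Longrightarrow> (y, v - x) \<in> D \<Longrightarrow> R \<cdot> v = x"
  unfolding R_iff one_plus_square_iff by blast

lemma sa_R: "sa R"
proof -
  have "ip (R \<cdot> v) w = ip v (R \<cdot> w)" for v w
  proof -
    obtain y where y: "(R \<cdot> v, y) \<in> D" "(y, v - R \<cdot> v) \<in> D"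
      by (rule R_D)
    obtain y' where y': "(R \<cdot> w, y') \<in> D" "(y', w - R \<cdot> w) \<in> D"
      by (rule R_D)
    have "ip y y' = ip (R \<cdot> v) (w - R \<cdot> w)" "ip (v - R \<cdot> v) (R \<cdot> w) = ip y y'"
      using D_sym[OF y(1) y'(2)] D_sym[OF y(2) y'(1)] by auto
    then show ?thesis
      by (simp add: ip_simps)
  qed
  from AdjI[OF this] show ?thesis
    by (simp add: sa_def)
qed

lemma spec_R: assumes "t \<in> spec R" shows "0 \<le> t" "t \<le> 1"
proof -
  have form: "spos (ip v (R \<cdot> v))" "spos (ip v ((1 - R) \<cdot> v))" for v
  proof -
    obtain y where y: "(R \<cdot> v, y) \<in> D" "(y, v - R \<cdot> v) \<in> D"
      by (rule R_D)
    have 1: "ip (v - R \<cdot> v) (R \<cdot> v) = ip y y" "ip (R \<cdot> v) (v - R \<cdot> v) = ip y y"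
      using D_sym[OF y(2) y(1)] D_sym[OF y] by auto
    have "ip v (R \<cdot> v) = ip (R \<cdot> v) (R \<cdot> v) + ip (v - R \<cdot> v) (R \<cdot> v)"
      "ip v (v - R \<cdot> v) = ip (R \<cdot> v) (v - R \<cdot> v) + ip (v - R \<cdot> v) (v - R \<cdot> v)"
      by (simp_all only: ip_add_left[symmetric]) simp_all
    then show "spos (ip v (R \<cdot> v))" "spos (ip v ((1 - R) \<cdot> v))"
      unfolding 1 by (auto simp: ap_simps intro: spos_add spos_ip)
  qed
  have "pos R" "pos (1 - R)"
    using form by (auto intro!: pos_if_form sa_R sa_intros)
  moreover have "1 - t \<in> spec (1 - R)"
    using spec_one_diff[of t 1 "1 - R"] assms by simp
  ultimately show "0 \<le> t" "t \<le> 1"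
    using assms by (auto simp: pos_def)
qed

lemma resolvent_eq: "resolvent D = bl R"
  unfolding resolvent_def of_gr_def
proof (rule the_equality)
  show R: "gr (bl R) = (one_plus_square D)\<inverse>"
    by (auto simp: gr_def bl_ap R_iff[symmetric])
  show "S = bl R" if "gr S = (one_plus_square D)\<inverse>" for S
  proof (rule blinfun_eqI)
    fix v
    have "(v, blinfun_apply S v) \<in> gr (bl R)"
      using that R by (auto simp: gr_def)
    then show "blinfun_apply S v = blinfun_apply (bl R) v"
      by (auto simp: gr_def)
  qed
qed

subsection \<open>Functional calculus of the resolvent\<close>

abbreviation cont :: "(real \<Rightarrow> real) \<Rightarrow> bool" where
  "cont h \<equiv> continuous_on {0..1} h"

definition \<Phi> :: "(real \<Rightarrow> real) \<Rightarrow> 'e endo" where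
  "\<Phi> h = fc h R"

lemma cont_spec: "cont h \<Longrightarrow> continuous_on (spec R) h"
  by (rule continuous_on_subset) (auto simp: spec_R)

lemma \<Phi>_mult: "cont h \<Longrightarrow> cont k \<Longrightarrow> \<Phi> (\<lambda>t. h t * k t) = \<Phi> h * \<Phi> k"
  and \<Phi>_add: "cont h \<Longrightarrow> cont k \<Longrightarrow> \<Phi> (\<lambda>t. h t + k t) = \<Phi> h + \<Phi> k"
  and \<Phi>_diff: "cont h \<Longrightarrow> cont k \<Longrightarrow> \<Phi> (\<lambda>t. h t - k t) = \<Phi> h - \<Phi> k"
  and \<Phi>_scale: "cont h \<Longrightarrow> \<Phi> (\<lambda>t. c * h t) = c *\<^sub>R \<Phi> h"
  and \<Phi>_const: "\<Phi> (\<lambda>t. c) = c *\<^sub>R 1"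
  and \<Phi>_id: "\<Phi> (\<lambda>t. t) = R"
  by (simp_all add: \<Phi>_def fc_mult fc_add fc_diff fc_scaleR fc_const fc_id sa_R cont_spec)

lemma \<Phi>_cong: "(\<And>t. 0 \<le> t \<Longrightarrow> t \<le> 1 \<Longrightarrow> h t = k t) \<Longrightarrow> \<Phi> h = \<Phi> k"
  unfolding \<Phi>_def by (rule fc_cong) (auto simp: spec_R)

lemma \<Phi>_mult_eq:
  assumes "cont h" "cont k" "\<And>t. 0 \<le> t \<Longrightarrow> t \<le> 1 \<Longrightarrow> h t * k t = l t"
  shows "\<Phi> h * \<Phi> k = \<Phi> l"
  unfolding \<Phi>_mult[OF assms(1,2), symmetric] using assms(3) by (rule \<Phi>_cong)

lemma \<Phi>_commute: "cont h \<Longrightarrow> cont k \<Longrightarrow> \<Phi> h * \<Phi> k = \<Phi> k * \<Phi> h"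
  using \<Phi>_mult[of h k] \<Phi>_mult[of k h] by (simp add: mult.commute)

lemma sa_\<Phi>: "cont h \<Longrightarrow> sa (\<Phi> h)"
  by (simp add: \<Phi>_def sa_fc sa_R cont_spec)

lemma norm_\<Phi>_le: "cont h \<Longrightarrow> (\<And>t. 0 \<le> t \<Longrightarrow> t \<le> 1 \<Longrightarrow> \<bar>h t\<bar> \<le> c) \<Longrightarrow> norm (\<Phi> h) \<le> c"
  unfolding \<Phi>_def by (rule norm_fc_le[OF sa_R]) (auto simp: spec_R cont_spec intro: order_trans[OF abs_ge_zero, of "h 0"])

lemma \<Phi>_comm: "cont h \<Longrightarrow> Y * R = R * Y \<Longrightarrow> Y * \<Phi> h = \<Phi> h * Y"
  by (simp add: \<Phi>_def fc_commute sa_R cont_spec)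

lemma R_preserves_D: assumes "(x, y) \<in> D" shows "(R \<cdot> x, R \<cdot> y) \<in> D"
proof -
  obtain a where a: "(R \<cdot> x, a) \<in> D" "(a, x - R \<cdot> x) \<in> D"
    by (rule R_D)
  have "R \<cdot> y = a"
    by (rule R_eqI[OF a(2)]) (rule D_diff[OF assms a(1)])
  then show ?thesis
    using a by simp
qed

lemma \<Phi>_preserves_D: assumes "cont h" and D: "(x, y) \<in> D" shows "(\<Phi> h \<cdot> x, \<Phi> h \<cdot> y) \<in> D"
proof -
  have p: "(peval p R \<cdot> x, peval p R \<cdot> y) \<in> D" for p
    by (induction p) (auto simp: peval_pCons ap_simps D_zero intro!: D_add D_scaleR D R_preserves_D)
  obtain p where "(\<lambda>n. peval (p n) R) \<longlonglongrightarrow> \<Phi> h"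
    unfolding \<Phi>_def using fc_approx[OF sa_R cont_spec[OF assms(1)]] by metis
  then show ?thesis
    by (intro D_closed[OF tendsto_ap tendsto_ap p])
qed

subsection \<open>The bounded transform\<close>

text \<open>\<open>e \<Lambda>\<close> is \<open>\<Lambda>\<^sup>2 (\<Lambda>\<^sup>2 + D\<^sup>2)\<^sup>-\<^sup>1\<close>, a smooth cut-off to the spectral region \<open>\<bar>D\<bar> \<le> \<Lambda>\<close>.\<close>

definition den :: "real \<Rightarrow> real \<Rightarrow> real" where
  "den \<Lambda> t = 1 + (\<Lambda>\<^sup>2 - 1) * t"

definition e :: "real \<Rightarrow> 'e endo" where
  "e \<Lambda> = \<Phi> (\<lambda>t. \<Lambda>\<^sup>2 * t / den \<Lambda> t)"

lemma den_bounds: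
  assumes "\<Lambda> \<ge> 1" "0 \<le> t" "t \<le> 1"
  shows "1 \<le> den \<Lambda> t" "\<Lambda>\<^sup>2 * t \<le> den \<Lambda> t" "0 < den \<Lambda> t"
    "\<Lambda> * sqrt t \<le> den \<Lambda> t"
proof -
  have "1 \<le> \<Lambda>\<^sup>2"
    using assms by simp
  then have "0 \<le> (\<Lambda>\<^sup>2 - 1) * t"
    using assms by (intro mult_nonneg_nonneg) auto
  then show 1: "1 \<le> den \<Lambda> t" "\<Lambda>\<^sup>2 * t \<le> den \<Lambda> t"
    using assms by (auto simp: den_def algebra_simps)
  then show "0 < den \<Lambda> t"
    by linarith
  have "(\<Lambda> * sqrt t)\<^sup>2 = \<Lambda>\<^sup>2 * t * 1"
    using assms by (simp add: power_mult_distrib)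
  also have "\<dots> \<le> (den \<Lambda> t)\<^sup>2"
    unfolding power2_eq_square[of "den \<Lambda> t"] using 1 by (intro mult_mono) auto
  finally have "(\<Lambda> * sqrt t)\<^sup>2 \<le> (den \<Lambda> t)\<^sup>2" .
  then show "\<Lambda> * sqrt t \<le> den \<Lambda> t"
    by (rule power2_le_imp_le) (use 1 in auto)
qed

lemma den_complement:
  assumes "\<Lambda> \<ge> 1" "0 \<le> t" "t \<le> 1"
  shows "1 - \<Lambda>\<^sup>2 * t / den \<Lambda> t = (1 - t) / den \<Lambda> t"
proof -
  have "den \<Lambda> t - \<Lambda>\<^sup>2 * t = 1 - t"
    by (simp add: den_def algebra_simps)
  then show ?thesis
    using den_bounds(3)[OF assms] by (metis diff_divide_distrib divide_self less_irrefl)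
qed

lemma cont_den: "cont h \<Longrightarrow> \<Lambda> \<ge> 1 \<Longrightarrow> cont (\<lambda>t. h t / den \<Lambda> t)"
  using den_bounds(3) unfolding den_def
  by (intro continuous_intros) (auto simp: less_le)

lemma norm_DR: assumes "(R \<cdot> v, y) \<in> D" shows "(norm y)\<^sup>2 = norm (ip v ((R - R * R) \<cdot> v))"
proof -
  have RA: "R \<in> Adj" "ad R = R"
    using sa_R by (auto simp: sa_def)
  obtain y' where "(R \<cdot> v, y') \<in> D" "(y', v - R \<cdot> v) \<in> D"
    by (rule R_D)
  then have "(y, v - R \<cdot> v) \<in> D"
    using assms D_fun by blast
  then have "ip y y = ip (R \<cdot> v) (v - R \<cdot> v)"
    using D_sym[OF assms] by blast
  also have "\<dots> = ip v ((R - R * R) \<cdot> v)"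
    using AdjD[OF RA(1)] RA(2) by (simp add: ap_simps ip_simps)
  finally show ?thesis
    by (simp add: norm_ip_self[symmetric])
qed

text \<open>
  The cut-offs converge strongly to the identity on the domain of \<open>D\<close>, at the rate \<open>1 / \<Lambda>\<close>: the function
  \<open>1 - \<Lambda>\<^sup>2 / (\<Lambda>\<^sup>2 + x\<^sup>2)\<close> is bounded by \<open>\<bar>x\<bar> / \<Lambda>\<close>.
\<close>

lemma one_minus_e_D:
  assumes L: "\<Lambda> \<ge> 1" and D: "(x, y) \<in> D"
  shows "norm ((1 - e \<Lambda>) \<cdot> x) \<le> norm y / \<Lambda>"
proof -
  define k where "k t = 1 / den \<Lambda> t" for t
  have k: "cont k"
    unfolding k_def by (intro cont_den continuous_intros L)
  have kA: "\<Phi> k \<in> Adj" "ad (\<Phi> k) = \<Phi> k"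
    using sa_\<Phi>[OF k] by (auto simp: sa_def)
  have kR: "\<Phi> k * R = R * \<Phi> k"
    using \<Phi>_comm[OF k, of R] by simp
  have "\<Phi> (\<lambda>t. 1 - t) * \<Phi> k = \<Phi> (\<lambda>t. 1 - \<Lambda>\<^sup>2 * t / den \<Lambda> t)"
    using den_complement[OF L] by (intro \<Phi>_mult_eq k continuous_intros) (simp add: k_def)
  also have "\<Phi> (\<lambda>t. 1 - t) = 1 - R"
    by (simp add: \<Phi>_diff \<Phi>_const \<Phi>_id continuous_intros)
  also have "\<Phi> (\<lambda>t. 1 - \<Lambda>\<^sup>2 * t / den \<Lambda> t) = 1 - e \<Lambda>"
    using L by (subst \<Phi>_diff) (auto intro!: cont_den continuous_intros simp: \<Phi>_const e_def)
  finally have eq: "(1 - R) * \<Phi> k = 1 - e \<Lambda>" .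
  have Dk: "(\<Phi> k \<cdot> x, \<Phi> k \<cdot> y) \<in> D"
    by (rule \<Phi>_preserves_D[OF k D])
  obtain a where a: "(R \<cdot> \<Phi> k \<cdot> x, a) \<in> D" "(a, \<Phi> k \<cdot> x - R \<cdot> \<Phi> k \<cdot> x) \<in> D"
    by (rule R_D)
  have "a = R \<cdot> \<Phi> k \<cdot> y"
    using D_fun[OF a(1) R_preserves_D[OF Dk]] .
  then have "(R \<cdot> \<Phi> k \<cdot> y, (1 - e \<Lambda>) \<cdot> x) \<in> D"
    using a(2) by (simp add: eq[symmetric] ap_simps)
  from norm_DR[OF this] have "(norm ((1 - e \<Lambda>) \<cdot> x))\<^sup>2 = norm (ip (\<Phi> k \<cdot> y) ((R - R * R) \<cdot> \<Phi> k \<cdot> y))" .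
  also have "\<dots> = norm (ip y ((\<Phi> k * (R - R * R) * \<Phi> k) \<cdot> y))"
    using AdjD[OF kA(1)] kA(2) by (simp add: ap_mult)
  also have "\<Phi> k * (R - R * R) * \<Phi> k = \<Phi> (\<lambda>t. k t * (t - t * t) * k t)"
    by (simp add: \<Phi>_mult \<Phi>_diff \<Phi>_id k continuous_intros)
  also have "norm (ip y (\<dots> \<cdot> y)) \<le> norm y * (norm (\<Phi> (\<lambda>t. k t * (t - t * t) * k t)) * norm y)"
    by (intro order_trans[OF cs] mult_left_mono norm_ap) auto
  also have "\<dots> \<le> norm y * ((1 / \<Lambda>\<^sup>2) * norm y)"
  proof (intro mult_left_mono mult_right_mono norm_\<Phi>_le)
    show "cont (\<lambda>t. k t * (t - t * t) * k t)"
      by (intro continuous_intros k)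
    fix t :: real assume t: "0 \<le> t" "t \<le> 1"
    note b = den_bounds[OF L t]
    have "(t - t * t) * \<Lambda>\<^sup>2 \<le> \<Lambda>\<^sup>2 * t * 1"
      using t by (simp add: algebra_simps)
    also have "\<dots> \<le> den \<Lambda> t * den \<Lambda> t"
      using b by (intro mult_mono) auto
    finally have "(t - t * t) * \<Lambda>\<^sup>2 \<le> den \<Lambda> t * den \<Lambda> t" .
    moreover have "0 \<le> t - t * t"
      using t by (simp add: mult_left_le)
    ultimately show "\<bar>k t * (t - t * t) * k t\<bar> \<le> 1 / \<Lambda>\<^sup>2"
      using b L by (simp add: k_def field_simps)
  qed auto
  finally have "(norm ((1 - e \<Lambda>) \<cdot> x))\<^sup>2 \<le> (norm y / \<Lambda>)\<^sup>2"
    using L by (simp add: power2_eq_square)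
  then show ?thesis
    by (rule power2_le_imp_le) (use L in auto)
qed

lemma e_eq_R: assumes "\<Lambda> \<ge> 1" shows "\<exists>X. e \<Lambda> = R * X"
proof -
  have "\<Phi> (\<lambda>t. t) * \<Phi> (\<lambda>t. \<Lambda>\<^sup>2 / den \<Lambda> t) = e \<Lambda>"
    unfolding e_def using assms by (intro \<Phi>_mult_eq cont_den continuous_intros) auto
  then show ?thesis
    by (metis \<Phi>_id)
qed

lemma dense_range_R: "closure (range (\<lambda>v. R \<cdot> v)) = UNIV"
proof -
  have "Domain D \<subseteq> closure (range (\<lambda>v. R \<cdot> v))"
  proof
    fix x assume "x \<in> Domain D"
    then obtain y where y: "(x, y) \<in> D"
      by auto
    show "x \<in> closure (range (\<lambda>v. R \<cdot> v))"
      unfolding closure_approachable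
    proof (intro allI impI)
      fix d :: real assume d: "d > 0"
      define \<Lambda> where "\<Lambda> = norm y / d + 1"
      have L: "\<Lambda> \<ge> 1" and p: "\<Lambda> > 0"
        using d by (auto simp: \<Lambda>_def add_nonneg_pos)
      have "norm y / \<Lambda> < d"
        using d p by (simp add: \<Lambda>_def field_simps)
      then have "dist (e \<Lambda> \<cdot> x) x < d"
        using one_minus_e_D[OF L y] by (simp add: dist_norm ap_simps norm_minus_commute)
      then show "\<exists>z\<in>range (\<lambda>v. R \<cdot> v). dist z x < d"
        using e_eq_R[OF L] by (auto simp: ap_mult)
    qed
  qed
  then have "closure (Domain D) \<subseteq> closure (range (\<lambda>v. R \<cdot> v))"
    by (simp add: closure_minimal)
  then show ?thesis
    using dense_Domain by auto
qed

definition S :: "'e endo" where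
  "S = \<Phi> sqrt"

lemma cont_sqrt: "cont sqrt"
  by (intro continuous_intros)

lemma S_S: "S * S = R"
  using \<Phi>_mult_eq[OF cont_sqrt cont_sqrt, of "\<lambda>t. t"] by (simp add: S_def \<Phi>_id)

lemma sa_S: "sa S" and S_Adj: "S \<in> Adj" and ad_S: "ad S = S"
  using sa_\<Phi>[OF cont_sqrt] by (auto simp: S_def sa_def)

lemma dense_range_S: "closure (range (\<lambda>v. S \<cdot> v)) = UNIV"
proof -
  have "range (\<lambda>v. R \<cdot> v) \<subseteq> range (\<lambda>v. S \<cdot> v)"
    by (auto simp: S_S[symmetric] ap_mult)
  then show ?thesis
    using dense_range_R closure_mono by blast
qed

lemma norm_DR_le: assumes "(R \<cdot> v, y) \<in> D" shows "norm y \<le> norm (S \<cdot> v)"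
proof -
  have "R - R * R = \<Phi> (\<lambda>t. sqrt t * (1 - t) * sqrt t)"
    unfolding \<Phi>_id[symmetric]
    by (subst \<Phi>_mult[symmetric], simp_all add: continuous_intros, subst \<Phi>_diff[symmetric])
      (auto intro!: \<Phi>_cong continuous_intros simp: algebra_simps)
  also have "\<dots> = S * \<Phi> (\<lambda>t. 1 - t) * S"
    by (simp add: \<Phi>_mult S_def continuous_intros)
  finally have "(norm y)\<^sup>2 = norm (ip (S \<cdot> v) (\<Phi> (\<lambda>t. 1 - t) \<cdot> S \<cdot> v))"
    using norm_DR[OF assms] AdjD[OF S_Adj] by (simp add: ap_mult ad_S)
  also have "\<dots> \<le> norm (S \<cdot> v) * (norm (\<Phi> (\<lambda>t. 1 - t)) * norm (S \<cdot> v))"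
    by (intro order_trans[OF cs] mult_left_mono norm_ap) auto
  also have "\<dots> \<le> norm (S \<cdot> v) * (1 * norm (S \<cdot> v))"
    by (intro mult_left_mono mult_right_mono norm_\<Phi>_le) (auto intro!: continuous_intros)
  finally have "(norm y)\<^sup>2 \<le> (norm (S \<cdot> v))\<^sup>2"
    by (simp add: power2_eq_square)
  then show ?thesis
    by (rule power2_le_imp_le) simp
qed

text \<open>
  The range of \<open>(1 + D\<^sup>2)\<^sup>-\<^sup>1\<^sup>/\<^sup>2\<close> lies in the domain of \<open>D\<close>, which makes \<open>F = D (1 + D\<^sup>2)\<^sup>-\<^sup>1\<^sup>/\<^sup>2\<close> everywhere defined. For
  vectors in the range of \<open>S\<close> this holds by construction of the resolvent; the estimate of
  \<open>D R v\<close> by \<open>S v\<close> carries it to the closure.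
\<close>

lemma S_Domain: "\<exists>z. (S \<cdot> v, z) \<in> D \<and> norm z \<le> norm v"
proof -
  obtain u where u: "(\<lambda>n. S \<cdot> u n) \<longlonglongrightarrow> v"
    using dense_rangeE[OF dense_range_S] .
  have "\<exists>y. (R \<cdot> u n, y) \<in> D" for n
    by (rule R_D[of "u n"]) blast
  then obtain y where y: "\<And>n. (R \<cdot> u n, y n) \<in> D"
    by metis
  have "norm (y m - y n) \<le> norm (S \<cdot> u m - S \<cdot> u n)" for m n
    using norm_DR_le[of "u m - u n" "y m - y n"] D_diff[OF y y] by (simp add: ap_simps)
  moreover have "Cauchy (\<lambda>n. S \<cdot> u n)"
    using u by (rule LIMSEQ_imp_Cauchy)
  ultimately have "Cauchy y"
    unfolding Cauchy_def dist_norm by (meson le_less_trans)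
  then obtain z where z: "y \<longlonglongrightarrow> z"
    by (auto simp: Cauchy_convergent_iff convergent_def)
  have "(\<lambda>n. R \<cdot> u n) \<longlonglongrightarrow> S \<cdot> v"
    unfolding S_S[symmetric] ap_mult by (rule tendsto_ap_right[OF u])
  then have "(S \<cdot> v, z) \<in> D"
    by (rule D_closed[OF _ z y])
  moreover have "norm z \<le> norm v"
    by (rule LIMSEQ_le[OF tendsto_norm[OF z] tendsto_norm[OF u]]) (auto intro: norm_DR_le y)
  ultimately show ?thesis
    by blast
qed

definition F :: "'e endo" where
  "F = mk (\<lambda>v. dop (S \<cdot> v))"

lemma bounded_linear_DS: "bounded_linear (\<lambda>v. dop (S \<cdot> v))"
proof (rule bounded_linear_intro[where K = 1])
  fix v w :: 'e and t :: real
  obtain y where y: "(S \<cdot> v, y) \<in> D" "norm y \<le> norm v"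
    using S_Domain by blast
  moreover obtain z where "(S \<cdot> w, z) \<in> D"
    using S_Domain by blast
  ultimately show "dop (S \<cdot> (v + w)) = dop (S \<cdot> v) + dop (S \<cdot> w)"
    "dop (S \<cdot> (t *\<^sub>R v)) = t *\<^sub>R dop (S \<cdot> v)" "norm (dop (S \<cdot> v)) \<le> norm v * 1"
    by (auto simp: ap_simps dop_eq dop_eq[OF D_add] dop_eq[OF D_scaleR])
qed

lemma D_S: "(S \<cdot> v, F \<cdot> v) \<in> D"
  using S_Domain[of v] unfolding F_def mk_ap[OF bounded_linear_DS] by (intro dop_in) auto

lemma F_eq: "(S \<cdot> v, y) \<in> D \<Longrightarrow> F \<cdot> v = y"
  using D_S D_fun by blast

lemma F_of_D: assumes "(x, y) \<in> D" shows "F \<cdot> x = S \<cdot> y"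
  using \<Phi>_preserves_D[OF cont_sqrt assms] by (intro F_eq) (simp add: S_def)

lemma norm_F_le: "norm F \<le> 1"
proof (rule norm_endo_bound)
  fix v
  obtain z where "(S \<cdot> v, z) \<in> D" "norm z \<le> norm v"
    using S_Domain by blast
  then show "norm (F \<cdot> v) \<le> 1 * norm v"
    using F_eq by simp
qed simp

lemma F_S: "F * S = S * F"
proof (rule endo_eqI)
  show "(F * S) \<cdot> v = (S * F) \<cdot> v" for v
    using F_of_D[OF D_S[of v]] by (simp add: ap_mult)
qed

lemma sa_F: "sa F"
proof -
  have "ip (F \<cdot> v) w = ip v (F \<cdot> w)" for v w
  proof -
    obtain u where u: "(\<lambda>n. S \<cdot> u n) \<longlonglongrightarrow> w"
      using dense_rangeE[OF dense_range_S] .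
    have "ip (F \<cdot> v) (S \<cdot> u n) = ip v (F \<cdot> S \<cdot> u n)" for n
      using D_sym[OF D_S[of v] D_S[of "u n"]] AdjD[OF S_Adj] F_S by (metis ad_S ap_mult)
    then show ?thesis
      using tendsto_ip(2)[OF u, of "F \<cdot> v"] tendsto_ip(2)[OF tendsto_ap_right[OF u, of F], of v] LIMSEQ_unique
      by simp
  qed
  from AdjI[OF this] show ?thesis
    by (simp add: sa_def)
qed

lemma F_Adj: "F \<in> Adj" and ad_F: "ad F = F"
  using sa_F by (auto simp: sa_def)

lemma F_F: "F * F = 1 - R"
proof (rule dense_endo_eqI[OF dense_range_S], safe)
  fix u
  obtain y where y: "(R \<cdot> u, y) \<in> D" "(y, u - R \<cdot> u) \<in> D"
    by (rule R_D)
  have "F \<cdot> S \<cdot> u = y"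
    by (rule F_eq) (use y in \<open>simp add: S_S[symmetric] ap_mult\<close>)
  then have "(F * F) \<cdot> S \<cdot> u = S \<cdot> (u - R \<cdot> u)"
    using F_of_D[OF y(2)] by (simp add: ap_mult)
  also have "\<dots> = (1 - R) \<cdot> S \<cdot> u"
    by (simp add: ap_simps S_S[symmetric])
  finally show "(F * F) \<cdot> S \<cdot> u = (1 - R) \<cdot> S \<cdot> u" .
qed

lemma F_R: "F * R = R * F"
  using F_S by (metis S_S mult.assoc)

lemma F_\<Phi>: "cont h \<Longrightarrow> F * \<Phi> h = \<Phi> h * F"
  by (rule \<Phi>_comm[OF _ F_R])

lemma continuous_powr: "s > 0 \<Longrightarrow> cont (\<lambda>t. t powr s)"
  by (intro continuous_on_powr' continuous_intros) auto

lemma japanese_power_eq: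
  assumes "s \<ge> 0"
  shows "japanese_power D s = bl (\<Phi> (\<lambda>t. if s = 0 then 1 else t powr (s / 2)))"
proof -
  have "cont (\<lambda>t. if s = 0 then 1 else t powr (s / 2))"
    using assms by (cases "s = 0") (auto intro: continuous_powr)
  then show ?thesis
    unfolding japanese_power_def resolvent_eq \<Phi>_def by (intro fun_calc_eq sa_R cont_spec)
qed

lemma japanese_power_1: "japanese_power D 1 = bl S"
  unfolding japanese_power_eq[OF zero_le_one] S_def
  by (intro arg_cong[where f = bl] \<Phi>_cong) (simp add: powr_half_sqrt)

lemma bounded_transform_eq: "bounded_transform D = bl F"
  unfolding bounded_transform_def japanese_power_1 of_gr_def
proof (rule the_equality)
  show F: "gr (bl F) = D \<circ>\<^sub>u gr (bl S)"
    using D_S F_eq by (fastforce simp: gr_def unb_comp_def bl_ap)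
  show "X = bl F" if "gr X = D \<circ>\<^sub>u gr (bl S)" for X
  proof (rule blinfun_eqI)
    fix v
    have "(v, blinfun_apply X v) \<in> gr (bl F)"
      using that F by (auto simp: gr_def)
    then show "blinfun_apply X v = blinfun_apply (bl F) v"
      by (auto simp: gr_def)
  qed
qed

end

section \<open>Cut-offs and commutators with the bounded transform\<close>

lemma commute_mult:
  fixes X :: "'a::semigroup_mult"
  assumes "X * P = P * X" "X * Q = Q * X"
  shows "X * (P * Q) = P * Q * X"
  by (metis assms mult.assoc)

context regular_operator
begin

definition m :: "real \<Rightarrow> 'e endo" where
  "m \<Lambda> = \<Phi> (\<lambda>t. 1 / den \<Lambda> t)"

text \<open>\<open>f \<Lambda>\<close> is \<open>\<Lambda> D (\<Lambda>\<^sup>2 + D\<^sup>2)\<^sup>-\<^sup>1\<close>. With \<open>e \<Lambda>\<close> it expresses \<open>D / \<Lambda>\<close> by bounded operators.\<close>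

definition f :: "real \<Rightarrow> 'e endo" where
  "f \<Lambda> = \<Lambda> *\<^sub>R (F * S * m \<Lambda>)"

lemma norm_F_\<Phi>_le: assumes "cont h" "\<And>t. 0 \<le> t \<Longrightarrow> t \<le> 1 \<Longrightarrow> \<bar>h t\<bar> \<le> c" shows "norm (F * \<Phi> h) \<le> c"
proof -
  have "norm (F * \<Phi> h) \<le> norm F * norm (\<Phi> h)"
    by (rule norm_mult_ineq)
  also have "\<dots> \<le> 1 * c"
    using norm_F_le norm_\<Phi>_le[OF assms] by (intro mult_mono) auto
  finally show ?thesis
    by simp
qed

lemma sa_mult: "sa X \<Longrightarrow> sa Y \<Longrightarrow> X * Y = Y * X \<Longrightarrow> sa (X * Y)"
  by (simp add: sa_def in_A ad_simps)

lemma norm_mult3_le: "norm (X * Y * Z) \<le> norm X * norm Y * norm (Z :: 'e endo)"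
  by (intro order_trans[OF norm_mult_ineq] mult_right_mono norm_mult_ineq) auto

context
  fixes \<Lambda> :: real
  assumes L: "\<Lambda> \<ge> 1"
begin

lemma cont_m: "cont (\<lambda>t. 1 / den \<Lambda> t)"
  by (rule cont_den[OF continuous_on_const L])

lemma m_comm: "m \<Lambda> * R = R * m \<Lambda>" "m \<Lambda> * S = S * m \<Lambda>" "F * m \<Lambda> = m \<Lambda> * F"
  using \<Phi>_comm[OF cont_m, of R] \<Phi>_commute[OF cont_m cont_sqrt] F_\<Phi>[OF cont_m]
  by (simp_all add: m_def S_def)

lemma e_eq: "e \<Lambda> = \<Lambda>\<^sup>2 *\<^sub>R (R * m \<Lambda>)"
proof -
  have "\<Lambda>\<^sup>2 *\<^sub>R (R * m \<Lambda>) = \<Lambda>\<^sup>2 *\<^sub>R \<Phi> (\<lambda>t. t * (1 / den \<Lambda> t))"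
    using \<Phi>_mult[OF continuous_on_id cont_m] by (simp add: m_def \<Phi>_id)
  also have "\<dots> = e \<Lambda>"
    unfolding e_def by (subst \<Phi>_scale[symmetric]) (auto intro: cont_den[OF continuous_on_id L])
  finally show ?thesis ..
qed

lemma one_minus_e_eq: "1 - e \<Lambda> = (1 - R) * m \<Lambda>"
proof -
  have "(1 - R) * m \<Lambda> = \<Phi> (\<lambda>t. 1 - t) * m \<Lambda>"
    by (simp add: \<Phi>_diff \<Phi>_const \<Phi>_id continuous_intros)
  also have "\<dots> = \<Phi> (\<lambda>t. 1 - \<Lambda>\<^sup>2 * t / den \<Lambda> t)"
    unfolding m_def using den_complement[OF L] by (intro \<Phi>_mult_eq cont_m continuous_intros) simp
  also have "\<dots> = 1 - e \<Lambda>"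
    using L by (subst \<Phi>_diff) (auto intro!: cont_den continuous_intros simp: \<Phi>_const e_def)
  finally show ?thesis ..
qed

lemma f_f: "f \<Lambda> * f \<Lambda> = e \<Lambda> * (1 - e \<Lambda>)"
proof -
  have "(F * S * m \<Lambda>) * (F * S * m \<Lambda>) = (F * F) * (S * S) * (m \<Lambda> * m \<Lambda>)"
    by (metis (no_types, lifting) F_S m_comm mult.assoc)
  also have "\<dots> = (R * m \<Lambda>) * ((1 - R) * m \<Lambda>)"
  proof -
    have c: "m \<Lambda> * (1 - R) = (1 - R) * m \<Lambda>" "(1 - R) * R = R * (1 - R)"
      by (simp_all add: algebra_simps m_comm)
    have "F * F * (S * S) * (m \<Lambda> * m \<Lambda>) = R * ((1 - R) * m \<Lambda>) * m \<Lambda>"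
      by (simp only: F_F S_S c(2) mult.assoc)
    also have "\<dots> = R * m \<Lambda> * ((1 - R) * m \<Lambda>)"
      by (simp only: c(1)[symmetric] mult.assoc)
    finally show ?thesis .
  qed
  finally show ?thesis
    unfolding one_minus_e_eq unfolding e_eq by (simp add: f_def power2_eq_square)
qed

lemma e_graph: "(e \<Lambda> \<cdot> v, \<Lambda> *\<^sub>R (f \<Lambda> \<cdot> v)) \<in> D"
  using D_scaleR[OF D_S[of "S \<cdot> m \<Lambda> \<cdot> v"], of "\<Lambda>\<^sup>2"]
  by (simp add: e_eq f_def ap_simps S_S[symmetric] power2_eq_square)

lemma f_graph: "(f \<Lambda> \<cdot> v, \<Lambda> *\<^sub>R ((1 - e \<Lambda>) \<cdot> v)) \<in> D"
proof -
  have "F \<cdot> F \<cdot> m \<Lambda> \<cdot> v = (1 - e \<Lambda>) \<cdot> v"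
    by (simp only: one_minus_e_eq ap_mult[symmetric] F_F mult.assoc[symmetric])
  moreover have "S \<cdot> F \<cdot> m \<Lambda> \<cdot> v = F \<cdot> S \<cdot> m \<Lambda> \<cdot> v"
    using F_S by (metis ap_mult)
  ultimately show ?thesis
    using D_scaleR[OF D_S[of "F \<cdot> m \<Lambda> \<cdot> v"], of \<Lambda>] by (simp add: f_def ap_simps)
qed

lemma e_of_D: assumes "(x, y) \<in> D" shows "e \<Lambda> \<cdot> y = \<Lambda> *\<^sub>R (f \<Lambda> \<cdot> x)"
proof -
  have "R * m \<Lambda> = S * m \<Lambda> * S" "F * S * m \<Lambda> = S * m \<Lambda> * F"
    using F_S S_S m_comm by (metis mult.assoc)+
  then show ?thesis
    using F_of_D[OF assms] by (simp add: e_eq f_def ap_simps power2_eq_square)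
qed

lemma f_of_D: assumes "(x, y) \<in> D" shows "f \<Lambda> \<cdot> y = \<Lambda> *\<^sub>R ((1 - e \<Lambda>) \<cdot> x)"
proof -
  have "F * S * m \<Lambda> = F * m \<Lambda> * S" "(1 - R) * m \<Lambda> = F * m \<Lambda> * F"
    using F_F m_comm by (metis mult.assoc)+
  then show ?thesis
    using F_of_D[OF assms] by (simp add: one_minus_e_eq f_def ap_simps)
qed

lemma cont_e: "cont (\<lambda>t. \<Lambda>\<^sup>2 * t / den \<Lambda> t)"
  by (intro cont_den continuous_intros L)

lemma f_\<Phi>: "f \<Lambda> = F * \<Phi> (\<lambda>t. \<Lambda> * sqrt t / den \<Lambda> t)" and cont_f: "cont (\<lambda>t. \<Lambda> * sqrt t / den \<Lambda> t)"
proof -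
  have "S * m \<Lambda> = \<Phi> (\<lambda>t. sqrt t / den \<Lambda> t)"
    unfolding S_def m_def by (intro \<Phi>_mult_eq cont_sqrt cont_m) simp
  then have "\<Lambda> *\<^sub>R (S * m \<Lambda>) = \<Phi> (\<lambda>t. \<Lambda> * (sqrt t / den \<Lambda> t))"
    by (simp add: \<Phi>_scale[symmetric] cont_den cont_sqrt L)
  then show "f \<Lambda> = F * \<Phi> (\<lambda>t. \<Lambda> * sqrt t / den \<Lambda> t)"
    by (simp add: f_def mult.assoc mult_scaleR_right[symmetric] del: mult_scaleR_right)
  show "cont (\<lambda>t. \<Lambda> * sqrt t / den \<Lambda> t)"
    by (intro cont_den continuous_intros L)
qed

lemma sa_e: "sa (e \<Lambda>)"
  unfolding e_def by (rule sa_\<Phi>[OF cont_e])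

lemma sa_f: "sa (f \<Lambda>)"
  unfolding f_\<Phi> by (intro sa_mult sa_F sa_\<Phi> cont_f F_\<Phi>)

lemma e_f: "e \<Lambda> * f \<Lambda> = f \<Lambda> * e \<Lambda>"
  unfolding f_\<Phi> e_def by (intro commute_mult \<Phi>_commute cont_e cont_f F_\<Phi>[symmetric])

lemma F_e: "F * e \<Lambda> = e \<Lambda> * F"
  unfolding e_def by (rule F_\<Phi>[OF cont_e])

lemma F_f: "F * f \<Lambda> = f \<Lambda> * F"
  unfolding f_\<Phi> by (intro commute_mult F_\<Phi> cont_f refl)

lemma norm_e_le: "norm (e \<Lambda>) \<le> 1"
  unfolding e_def using den_bounds[OF L] by (intro norm_\<Phi>_le cont_e) (simp add: abs_of_pos)

lemma norm_f_le: "norm (f \<Lambda>) \<le> 1"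
proof -
  have "\<bar>\<Lambda> * sqrt t / den \<Lambda> t\<bar> \<le> 1" if "0 \<le> t" "t \<le> 1" for t
    using den_bounds[OF L that] L that by simp
  then show ?thesis
    unfolding f_\<Phi> by (rule norm_F_\<Phi>_le[OF cont_f])
qed

lemma norm_R_f_le: "norm (R * f \<Lambda>) \<le> 1 / \<Lambda>"
proof -
  have "R * f \<Lambda> = F * (\<Phi> (\<lambda>t. t) * \<Phi> (\<lambda>t. \<Lambda> * sqrt t / den \<Lambda> t))"
    unfolding f_\<Phi> \<Phi>_id by (simp only: mult.assoc[symmetric] F_R)
  also have "\<dots> = F * \<Phi> (\<lambda>t. t * (\<Lambda> * sqrt t / den \<Lambda> t))"
    using \<Phi>_mult[OF continuous_on_id cont_f] by simp
  also have "norm \<dots> \<le> 1 / \<Lambda>"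
  proof (rule norm_F_\<Phi>_le)
    show "cont (\<lambda>t. t * (\<Lambda> * sqrt t / den \<Lambda> t))"
      by (intro continuous_intros cont_f)
    fix t :: real assume t: "0 \<le> t" "t \<le> 1"
    note d = den_bounds[OF L t]
    have "\<Lambda>\<^sup>2 * t * sqrt t \<le> den \<Lambda> t * 1"
      using d t by (intro mult_mono) auto
    then have "\<Lambda>\<^sup>2 * t * sqrt t / den \<Lambda> t / \<Lambda> \<le> 1 / \<Lambda>"
      using d L by (intro divide_right_mono) (auto simp: divide_le_eq_1)
    then show "\<bar>t * (\<Lambda> * sqrt t / den \<Lambda> t)\<bar> \<le> 1 / \<Lambda>"
      using d t L by (simp add: power2_eq_square mult.left_commute)
  qed
  finally show ?thesis .
qed

lemma pos_F_f: "pos (F * f \<Lambda>)"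
proof -
  have "F * f \<Lambda> = \<Phi> (\<lambda>t. 1 - t) * \<Phi> (\<lambda>t. \<Lambda> * sqrt t / den \<Lambda> t)"
    by (simp add: f_\<Phi> mult.assoc[symmetric] F_F \<Phi>_diff \<Phi>_const \<Phi>_id continuous_intros)
  also have "\<dots> = \<Phi> (\<lambda>t. (1 - t) * (\<Lambda> * sqrt t / den \<Lambda> t))"
    by (rule \<Phi>_mult[symmetric]) (intro cont_f continuous_intros)+
  also have "pos \<dots>"
    unfolding \<Phi>_def
  proof (rule pos_fc[OF sa_R])
    show "continuous_on (spec R) (\<lambda>t. (1 - t) * (\<Lambda> * sqrt t / den \<Lambda> t))"
      by (intro cont_spec continuous_intros cont_f)
    show "0 \<le> (1 - t) * (\<Lambda> * sqrt t / den \<Lambda> t)" if "t \<in> spec R" for t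
      using den_bounds(3)[OF L spec_R[OF that]] spec_R[OF that] L by simp
  qed
  finally show ?thesis .
qed

lemma pos_F_f_e: "pos (F * f \<Lambda> * e \<Lambda>)"
proof -
  have "F * f \<Lambda> * e \<Lambda> = \<Phi> (\<lambda>t. 1 - t) * \<Phi> (\<lambda>t. \<Lambda> * sqrt t / den \<Lambda> t) * \<Phi> (\<lambda>t. \<Lambda>\<^sup>2 * t / den \<Lambda> t)"
    by (simp add: f_\<Phi> e_def mult.assoc[symmetric] F_F \<Phi>_diff \<Phi>_const \<Phi>_id continuous_intros)
  also have "\<dots> = \<Phi> (\<lambda>t. (1 - t) * (\<Lambda> * sqrt t / den \<Lambda> t) * (\<Lambda>\<^sup>2 * t / den \<Lambda> t))"
    using \<Phi>_mult[of "\<lambda>t. 1 - t" "\<lambda>t. \<Lambda> * sqrt t / den \<Lambda> t"]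
      \<Phi>_mult[of "\<lambda>t. (1 - t) * (\<Lambda> * sqrt t / den \<Lambda> t)" "\<lambda>t. \<Lambda>\<^sup>2 * t / den \<Lambda> t"]
    by (simp only: cont_f cont_e continuous_intros)
  also have "pos \<dots>"
    unfolding \<Phi>_def
  proof (rule pos_fc[OF sa_R])
    show "continuous_on (spec R) (\<lambda>t. (1 - t) * (\<Lambda> * sqrt t / den \<Lambda> t) * (\<Lambda>\<^sup>2 * t / den \<Lambda> t))"
      by (intro cont_spec continuous_intros cont_f cont_e)
    show "0 \<le> (1 - t) * (\<Lambda> * sqrt t / den \<Lambda> t) * (\<Lambda>\<^sup>2 * t / den \<Lambda> t)" if "t \<in> spec R" for t
      using den_bounds(3)[OF L spec_R[OF that]] spec_R[OF that] L by simp
  qed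
  finally show ?thesis .
qed

end

subsection \<open>Commutators with the bounded transform\<close>

context
  fixes \<Lambda> \<Lambda>' :: real
  assumes L: "\<Lambda> \<ge> 1" and L': "\<Lambda>' \<ge> 1"
begin

text \<open>
  The relations \<open>D e\<^sub>\<Lambda> = \<Lambda> f\<^sub>\<Lambda>\<close> and \<open>D f\<^sub>\<Lambda> = \<Lambda> (1 - e\<^sub>\<Lambda>)\<close>, used for two scales at once: \<open>D\<close> may be absorbed by either.
\<close>

lemma cutoff_exchange:
  "\<Lambda> *\<^sub>R (e \<Lambda>' * (1 - e \<Lambda>)) = \<Lambda>' *\<^sub>R (f \<Lambda>' * f \<Lambda>)"
  "\<Lambda> *\<^sub>R (f \<Lambda>' * (1 - e \<Lambda>)) = \<Lambda>' *\<^sub>R ((1 - e \<Lambda>') * f \<Lambda>)"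
  "\<Lambda> *\<^sub>R ((1 - e \<Lambda>) * e \<Lambda>') = \<Lambda>' *\<^sub>R (f \<Lambda> * f \<Lambda>')"
  "\<Lambda> *\<^sub>R ((1 - e \<Lambda>) * f \<Lambda>') = \<Lambda>' *\<^sub>R (f \<Lambda> * (1 - e \<Lambda>'))"
proof -
  show "\<Lambda> *\<^sub>R (e \<Lambda>' * (1 - e \<Lambda>)) = \<Lambda>' *\<^sub>R (f \<Lambda>' * f \<Lambda>)"
    using e_of_D[OF L' f_graph[OF L]] by (intro endo_eqI) (simp add: ap_simps)
  show "\<Lambda> *\<^sub>R (f \<Lambda>' * (1 - e \<Lambda>)) = \<Lambda>' *\<^sub>R ((1 - e \<Lambda>') * f \<Lambda>)"
    using f_of_D[OF L' f_graph[OF L]] by (intro endo_eqI) (simp add: ap_simps)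
  show "\<Lambda> *\<^sub>R ((1 - e \<Lambda>) * e \<Lambda>') = \<Lambda>' *\<^sub>R (f \<Lambda> * f \<Lambda>')"
    using f_of_D[OF L e_graph[OF L']] by (intro endo_eqI) (simp add: ap_simps)
  show "\<Lambda> *\<^sub>R ((1 - e \<Lambda>) * f \<Lambda>') = \<Lambda>' *\<^sub>R (f \<Lambda> * (1 - e \<Lambda>'))"
    using f_of_D[OF L f_graph[OF L']] by (intro endo_eqI) (simp add: ap_simps)
qed

text \<open>
  The commutator identity \<open>[f', T] = e' [D / \<Lambda>', T] e' - f' [D / \<Lambda>', T] f'\<close> with \<open>f\<^sub>\<Lambda> Y f\<^sub>\<Lambda>\<close> for \<open>T\<close>, where \<open>D\<close> has been
  absorbed by the factors \<open>f\<^sub>\<Lambda>\<close>; so \<open>X\<close> stands for \<open>[D / \<Lambda>, T]\<close>, and all operators are bounded.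
\<close>

lemma cutoff_commutator:
  fixes Y :: "'e endo"
  defines "X \<equiv> (1 - e \<Lambda>) * Y * f \<Lambda> - f \<Lambda> * Y * (1 - e \<Lambda>)"
    and "T \<equiv> f \<Lambda> * Y * f \<Lambda>"
  shows "\<Lambda>' *\<^sub>R (f \<Lambda>' * T - T * f \<Lambda>') = \<Lambda> *\<^sub>R (e \<Lambda>' * X * e \<Lambda>' - f \<Lambda>' * X * f \<Lambda>')"
proof -
  note ex = cutoff_exchange
  have "\<Lambda> *\<^sub>R (e \<Lambda>' * X * e \<Lambda>')
      = (\<Lambda> *\<^sub>R (e \<Lambda>' * (1 - e \<Lambda>))) * Y * f \<Lambda> * e \<Lambda>' - e \<Lambda>' * f \<Lambda> * Y * (\<Lambda> *\<^sub>R ((1 - e \<Lambda>) * e \<Lambda>'))"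
    unfolding X_def by (simp only: left_diff_distrib right_diff_distrib scaleR_right_diff_distrib
        mult.assoc mult_scaleR_left mult_scaleR_right)
  also have "\<dots> = \<Lambda>' *\<^sub>R (f \<Lambda>' * T * e \<Lambda>' - e \<Lambda>' * T * f \<Lambda>')"
    unfolding ex T_def by (simp only: scaleR_right_diff_distrib mult.assoc mult_scaleR_left mult_scaleR_right)
  finally have 1: "\<Lambda> *\<^sub>R (e \<Lambda>' * X * e \<Lambda>') = \<Lambda>' *\<^sub>R (f \<Lambda>' * T * e \<Lambda>' - e \<Lambda>' * T * f \<Lambda>')" .
  have "\<Lambda> *\<^sub>R (f \<Lambda>' * X * f \<Lambda>')
      = (\<Lambda> *\<^sub>R (f \<Lambda>' * (1 - e \<Lambda>))) * Y * f \<Lambda> * f \<Lambda>' - f \<Lambda>' * f \<Lambda> * Y * (\<Lambda> *\<^sub>R ((1 - e \<Lambda>) * f \<Lambda>'))"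
    unfolding X_def by (simp only: left_diff_distrib right_diff_distrib scaleR_right_diff_distrib
        mult.assoc mult_scaleR_left mult_scaleR_right)
  also have "\<dots> = \<Lambda>' *\<^sub>R ((1 - e \<Lambda>') * T * f \<Lambda>' - f \<Lambda>' * T * (1 - e \<Lambda>'))"
    unfolding ex T_def by (simp only: scaleR_right_diff_distrib mult.assoc mult_scaleR_left mult_scaleR_right)
  finally have 2: "\<Lambda> *\<^sub>R (f \<Lambda>' * X * f \<Lambda>') = \<Lambda>' *\<^sub>R ((1 - e \<Lambda>') * T * f \<Lambda>' - f \<Lambda>' * T * (1 - e \<Lambda>'))" .
  show ?thesis
    unfolding scaleR_right_diff_distrib[of \<Lambda>] 1 2 by (simp add: algebra_simps)
qed

text \<open>
  \<open>X\<close> is a combination of commutators of \<open>Y\<close> with \<open>e\<^sub>\<Lambda>\<close> and \<open>f\<^sub>\<Lambda>\<close>, because \<open>e\<^sub>\<Lambda>\<close> and \<open>f\<^sub>\<Lambda>\<close> commute.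
\<close>

lemma norm_cutoff_commutator_le:
  fixes Y :: "'e endo"
  defines "T \<equiv> f \<Lambda> * Y * f \<Lambda>"
    and "\<eta> \<equiv> norm (e \<Lambda> * Y - Y * e \<Lambda>) + norm (f \<Lambda> * Y - Y * f \<Lambda>)"
  shows "norm (f \<Lambda>' * T - T * f \<Lambda>') \<le> 4 * \<Lambda> * \<eta> / \<Lambda>'"
proof -
  define X where "X = (1 - e \<Lambda>) * Y * f \<Lambda> - f \<Lambda> * Y * (1 - e \<Lambda>)"
  have X: "X = f \<Lambda> * (Y * e \<Lambda> - e \<Lambda> * Y) - (f \<Lambda> * Y - Y * f \<Lambda>) + e \<Lambda> * (f \<Lambda> * Y - Y * f \<Lambda>)"
    unfolding X_def using e_f[OF L] by (simp add: algebra_simps) (metis mult.assoc)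
  have le: "norm (Z * W) \<le> norm W" if "norm Z \<le> 1" for Z W :: "'e endo"
    using mult_right_mono[OF that, of "norm W"] norm_mult_ineq[of Z W] by simp
  have sw: "norm (Y * e \<Lambda> - e \<Lambda> * Y) = norm (e \<Lambda> * Y - Y * e \<Lambda>)"
    by (rule norm_minus_commute)
  have "norm X \<le> norm (f \<Lambda> * (Y * e \<Lambda> - e \<Lambda> * Y)) + norm (f \<Lambda> * Y - Y * f \<Lambda>)
      + norm (e \<Lambda> * (f \<Lambda> * Y - Y * f \<Lambda>))"
    unfolding X by (rule order_trans[OF norm_triangle_ineq add_right_mono[OF norm_triangle_ineq4]])
  also have "\<dots> \<le> 2 * \<eta>"
    using le[OF norm_f_le[OF L], of "Y * e \<Lambda> - e \<Lambda> * Y"] le[OF norm_e_le[OF L], of "f \<Lambda> * Y - Y * f \<Lambda>"]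
      norm_ge_zero[of "e \<Lambda> * Y - Y * e \<Lambda>"]
    unfolding \<eta>_def sw by (smt (verit))
  finally have X_le: "norm X \<le> 2 * \<eta>" .
  have sandwich: "norm (Z * X * Z) \<le> norm X" if "norm Z \<le> 1" for Z :: "'e endo"
    using norm_mult3_le[of Z X Z] mult_mono[OF mult_right_mono[OF that norm_ge_zero[of X]] that] by simp
  have "\<Lambda>' * norm (f \<Lambda>' * T - T * f \<Lambda>') = norm (\<Lambda>' *\<^sub>R (f \<Lambda>' * T - T * f \<Lambda>'))"
    using L' by simp
  also have "\<dots> = \<Lambda> * norm (e \<Lambda>' * X * e \<Lambda>' - f \<Lambda>' * X * f \<Lambda>')"
    unfolding T_def X_def cutoff_commutator using L by simp
  also have "\<dots> \<le> \<Lambda> * (norm X + norm X)"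
    using sandwich[OF norm_e_le[OF L']] sandwich[OF norm_f_le[OF L']] L
    by (intro mult_left_mono order_trans[OF norm_triangle_ineq4 add_mono]) auto
  also have "\<dots> \<le> \<Lambda> * (4 * \<eta>)"
    using X_le L by (intro mult_left_mono) auto
  finally show ?thesis
    using L' by (simp add: field_simps)
qed

end

end

lemma arctan_linearization:
  "\<bar>arctan v - arctan u - (v - u) / (1 + u\<^sup>2)\<bar> \<le> (v - u)\<^sup>2"
proof -
  define g where "g x = arctan x - x / (1 + u\<^sup>2)" for x :: real
  have pos: "1 + x\<^sup>2 > 0" for x :: real
    by (simp add: add_pos_nonneg)
  have "norm (g v - g u) \<le> \<bar>v - u\<bar> * norm (v - u)"
  proof (rule field_differentiable_bound)
    show "convex (closed_segment u v)" "v \<in> closed_segment u v" "u \<in> closed_segment u v"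
      by auto
    fix z assume z: "z \<in> closed_segment u v"
    show "(g has_field_derivative inverse (1 + z\<^sup>2) - 1 / (1 + u\<^sup>2)) (at z within closed_segment u v)"
      unfolding g_def using pos[of u] by (auto intro!: derivative_eq_intros)
    have zu: "\<bar>u - z\<bar> \<le> \<bar>v - u\<bar>"
      using z by (auto simp: closed_segment_eq_real_ivl split: if_splits)
    have "\<bar>u + z\<bar> \<le> (1 + u\<^sup>2) * (1 + z\<^sup>2)"
    proof -
      have "2 * \<bar>u + z\<bar> \<le> 2 + u\<^sup>2 + z\<^sup>2"
        using zero_le_power2[of "\<bar>u\<bar> - 1"] zero_le_power2[of "\<bar>z\<bar> - 1"] abs_triangle_ineq[of u z]
        by (simp add: power2_diff)
      also have "\<dots> \<le> 2 * ((1 + u\<^sup>2) * (1 + z\<^sup>2))"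
        by (simp add: algebra_simps)
      finally show ?thesis
        by simp
    qed
    then have "\<bar>u - z\<bar> * \<bar>u + z\<bar> \<le> \<bar>v - u\<bar> * ((1 + u\<^sup>2) * (1 + z\<^sup>2))"
      using zu by (intro mult_mono) auto
    moreover have "inverse (1 + z\<^sup>2) - 1 / (1 + u\<^sup>2) = (u - z) * (u + z) / ((1 + u\<^sup>2) * (1 + z\<^sup>2))"
      using pos[of u] pos[of z] by (simp add: field_simps power2_eq_square)
    ultimately show "norm (inverse (1 + z\<^sup>2) - 1 / (1 + u\<^sup>2)) \<le> \<bar>v - u\<bar>"
      using pos[of u] pos[of z] by (simp add: abs_mult divide_le_eq)
  qed
  then show ?thesis
    by (simp add: g_def diff_divide_distrib power2_eq_square abs_mult_self_eq algebra_simps)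
qed

lemma arctan_tail:
  fixes x N :: real
  assumes "x \<ge> 0" "N > 0"
  shows "\<bar>(1 - 2 / pi * arctan (N * x)) * x\<bar> \<le> 1 / N"
proof (cases "x = 0")
  case False
  then have p: "N * x > 0"
    using assms by simp
  have "pi / 2 - arctan (N * x) = arctan (1 / (N * x))"
    using arctan_inverse[of "N * x"] p by (simp add: mult.commute inverse_eq_divide del: inverse_mult_distrib)
  also have "\<dots> \<le> 1 / (N * x)"
    using p by (intro arctan_le_self) simp
  finally have 1: "pi / 2 - arctan (N * x) \<le> 1 / (N * x)" .
  have nn: "0 \<le> pi / 2 - arctan (N * x)"
    using arctan_ubound[of "N * x"] by simp
  have "(1 - 2 / pi * arctan (N * x)) * x = 2 / pi * ((pi / 2 - arctan (N * x)) * x)"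
    by (simp add: field_simps)
  moreover have "2 / pi * ((pi / 2 - arctan (N * x)) * x) \<le> 1 * (1 / (N * x) * x)"
    using 1 nn assms pi_ge_two by (intro mult_mono mult_right_mono) (auto simp: divide_le_eq)
  moreover have "0 \<le> 2 / pi * ((pi / 2 - arctan (N * x)) * x)"
    using nn assms by simp
  ultimately show ?thesis
    using False assms by simp
qed (use assms in simp)

context regular_operator
begin

text \<open>
  A norm-differentiable path that tends strongly to \<open>\<pi> / 2\<close> times \<open>F\<close>; its derivative is \<open>D (\<Lambda>'\<^sup>2 + D\<^sup>2)\<^sup>-\<^sup>1\<close> for
  \<open>\<Lambda>'\<^sup>2 = 1 + u\<^sup>2\<close>, whose commutators with bounded operators are under control.
\<close>

definition Fa :: "real \<Rightarrow> 'e endo" where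
  "Fa u = F * \<Phi> (\<lambda>t. arctan (u * sqrt t))"

lemma cont_arctan: "cont (\<lambda>t. arctan (u * sqrt t))"
  by (intro continuous_intros)

lemma cont_Fa_deriv: "cont (\<lambda>t. sqrt t / (1 + u\<^sup>2 * t))"
  by (intro continuous_intros) (auto simp: add_nonneg_eq_0_iff)

lemma Fa_deriv: "(Fa has_vector_derivative F * \<Phi> (\<lambda>t. sqrt t / (1 + u\<^sup>2 * t))) (at u)"
  (is "(Fa has_vector_derivative ?G) _")
  unfolding has_vector_derivative_def
proof (rule has_derivativeI_sandwich[where e = 1 and H = "\<lambda>v. \<bar>v - u\<bar>"])
  show "bounded_linear (\<lambda>x. x *\<^sub>R ?G)"
    by (rule bounded_linear_scaleR_left)
  show "((\<lambda>v. \<bar>v - u\<bar>) \<longlongrightarrow> 0) (at u)"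
    by (intro tendsto_eq_intros) auto
  fix v assume "v \<noteq> u"
  have "Fa v - Fa u - (v - u) *\<^sub>R ?G
      = F * \<Phi> (\<lambda>t. arctan (v * sqrt t) - arctan (u * sqrt t) - (v - u) * (sqrt t / (1 + u\<^sup>2 * t)))"
    using cont_Fa_deriv[of u] cont_arctan[of u] cont_arctan[of v]
    by (simp add: Fa_def \<Phi>_diff \<Phi>_scale continuous_on_diff continuous_on_mult_left right_diff_distrib
        del: times_divide_eq_right)
  also have "norm \<dots> \<le> (v - u)\<^sup>2"
  proof (rule norm_F_\<Phi>_le)
    show "cont (\<lambda>t. arctan (v * sqrt t) - arctan (u * sqrt t) - (v - u) * (sqrt t / (1 + u\<^sup>2 * t)))"
      by (intro continuous_on_diff continuous_on_mult_left cont_arctan cont_Fa_deriv)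
    fix t :: real assume t: "0 \<le> t" "t \<le> 1"
    have "\<bar>arctan (v * sqrt t) - arctan (u * sqrt t) - (v * sqrt t - u * sqrt t) / (1 + (u * sqrt t)\<^sup>2)\<bar>
        \<le> (v * sqrt t - u * sqrt t)\<^sup>2"
      by (rule arctan_linearization)
    also have "\<dots> = (v - u)\<^sup>2 * t"
      using t by (simp add: left_diff_distrib[symmetric] power_mult_distrib)
    also have "\<dots> \<le> (v - u)\<^sup>2"
      using t by (simp add: mult_left_le)
    finally show "\<bar>arctan (v * sqrt t) - arctan (u * sqrt t) - (v - u) * (sqrt t / (1 + u\<^sup>2 * t))\<bar> \<le> (v - u)\<^sup>2"
      using t by (simp add: left_diff_distrib power_mult_distrib)
  qed
  finally have "norm (Fa v - Fa u - (v - u) *\<^sub>R ?G) \<le> \<bar>v - u\<bar> * \<bar>v - u\<bar>"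
    by (simp add: power2_eq_square abs_mult_self_eq)
  then show "norm (Fa v - Fa u - (v - u) *\<^sub>R ?G) / norm (v - u) \<le> \<bar>v - u\<bar>"
    using \<open>v \<noteq> u\<close> by (simp add: divide_le_eq)
qed auto

lemma Fa_deriv_eq:
  defines "\<Lambda>' u \<equiv> sqrt (1 + u\<^sup>2)"
  shows "\<Lambda>' u \<ge> 1" "F * \<Phi> (\<lambda>t. sqrt t / (1 + u\<^sup>2 * t)) = (1 / \<Lambda>' u) *\<^sub>R f (\<Lambda>' u)"
proof -
  show L: "\<Lambda>' u \<ge> 1"
    by (simp add: \<Lambda>'_def)
  have "den (\<Lambda>' u) t = 1 + u\<^sup>2 * t" for t
    by (simp add: den_def \<Lambda>'_def)
  then have "f (\<Lambda>' u) = F * \<Phi> (\<lambda>t. \<Lambda>' u * (sqrt t / (1 + u\<^sup>2 * t)))"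
    by (simp add: f_\<Phi>[OF L])
  then show "F * \<Phi> (\<lambda>t. sqrt t / (1 + u\<^sup>2 * t)) = (1 / \<Lambda>' u) *\<^sub>R f (\<Lambda>' u)"
    using \<Phi>_scale[OF cont_Fa_deriv, of "\<Lambda>' u" u] L by simp
qed

lemma norm_F_\<Phi>_f_le:
  assumes L: "\<Lambda> \<ge> 1" and h: "cont h" and le: "\<And>t. 0 \<le> t \<Longrightarrow> t \<le> 1 \<Longrightarrow> \<bar>h t * (\<Lambda> * sqrt t / den \<Lambda> t)\<bar> \<le> c"
  shows "norm (F * \<Phi> h * f \<Lambda>) \<le> c"
proof -
  have "F * \<Phi> h * f \<Lambda> = F * (F * \<Phi> (\<lambda>t. h t * (\<Lambda> * sqrt t / den \<Lambda> t)))"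
    unfolding f_\<Phi>[OF L] by (simp only: \<Phi>_mult[OF h cont_f[OF L]]) (simp only: mult.assoc[symmetric] F_\<Phi>[OF h])
  also have "norm \<dots> \<le> norm F * norm (F * \<Phi> (\<lambda>t. h t * (\<Lambda> * sqrt t / den \<Lambda> t)))"
    by (rule norm_mult_ineq)
  also have "\<dots> \<le> 1 * c"
    by (intro mult_mono norm_F_le norm_F_\<Phi>_le continuous_on_mult h cont_f L le) auto
  finally show ?thesis
    by simp
qed

text \<open>
  \<open>F\<close> is \<open>2 / \<pi>\<close> times the integral over \<open>u > 0\<close> of \<open>D (\<Lambda>'\<^sup>2 + D\<^sup>2)\<^sup>-\<^sup>1\<close>, where \<open>\<Lambda>'\<^sup>2 = 1 + u\<^sup>2\<close>, and the commutator with
  \<open>f\<^sub>\<Lambda> Y f\<^sub>\<Lambda>\<close> is estimated under the integral: for every \<open>u\<close> by a multiple of \<open>\<parallel>Y\<parallel> / \<Lambda>\<close>, since the integrand is of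
  size \<open>1 / \<Lambda>\<close> on the range of \<open>f\<^sub>\<Lambda>\<close>, and for large \<open>u\<close> by the commutators of \<open>Y\<close> with the cut-offs, divided by
  \<open>u\<^sup>2\<close>. Splitting the integral at \<open>u = \<Lambda> M\<close> gives the two terms. The integral converges to \<open>F\<close> in norm
  only after multiplication by \<open>f\<^sub>\<Lambda>\<close>, so that the tail is treated separately.
\<close>

lemma norm_F_commutator_le:
  fixes Y :: "'e endo"
  assumes L: "\<Lambda> \<ge> 1" and M: "M > 0"
  shows "norm (F * (f \<Lambda> * Y * f \<Lambda>) - f \<Lambda> * Y * f \<Lambda> * F)
    \<le> 2 * norm Y * M + 4 * (norm (e \<Lambda> * Y - Y * e \<Lambda>) + norm (f \<Lambda> * Y - Y * f \<Lambda>)) / M"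
proof -
  define T where "T = f \<Lambda> * Y * f \<Lambda>"
  define \<eta> where "\<eta> = norm (e \<Lambda> * Y - Y * e \<Lambda>) + norm (f \<Lambda> * Y - Y * f \<Lambda>)"
  have eta: "\<eta> \<ge> 0"
    by (simp add: \<eta>_def)
  define G where "G u = F * \<Phi> (\<lambda>t. sqrt t / (1 + u\<^sup>2 * t))" for u
  define K where "K u = Fa u * T - T * Fa u" for u
  have f_comm: "F * \<Phi> h * f \<Lambda> = f \<Lambda> * (F * \<Phi> h)" if h: "cont h" for h
    unfolding f_\<Phi>[OF L]
  proof (rule commute_mult)
    show "F * \<Phi> h * F = F * (F * \<Phi> h)"
      by (simp only: mult.assoc F_\<Phi>[OF h, symmetric])
    show "F * \<Phi> h * \<Phi> (\<lambda>t. \<Lambda> * sqrt t / den \<Lambda> t) = \<Phi> (\<lambda>t. \<Lambda> * sqrt t / den \<Lambda> t) * (F * \<Phi> h)"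
      by (rule commute_mult[symmetric]) (intro F_\<Phi>[symmetric] \<Phi>_commute cont_f[OF L] h)+
  qed
  have comm_le: "norm (X * T - T * X) \<le> 2 * norm Y * b" if "norm (X * f \<Lambda>) \<le> b" "X * f \<Lambda> = f \<Lambda> * X" for X b
  proof -
    have b: "0 \<le> b"
      using that(1) norm_ge_zero order_trans by blast
    have "X * T - T * X = X * f \<Lambda> * Y * f \<Lambda> - f \<Lambda> * Y * (f \<Lambda> * X)"
      by (simp only: T_def mult.assoc)
    also have "\<dots> = X * f \<Lambda> * Y * f \<Lambda> - f \<Lambda> * Y * (X * f \<Lambda>)"
      by (simp only: that(2))
    also have "norm \<dots> \<le> norm (X * f \<Lambda>) * norm Y * norm (f \<Lambda>) + norm (f \<Lambda>) * norm Y * norm (X * f \<Lambda>)"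
      by (rule order_trans[OF norm_triangle_ineq4 add_mono[OF norm_mult3_le norm_mult3_le]])
    also have "\<dots> \<le> b * norm Y * 1 + 1 * norm Y * b"
      using that(1) norm_f_le[OF L] b by (intro add_mono mult_mono) auto
    finally show ?thesis
      by (simp add: algebra_simps)
  qed
  have K_deriv: "(K has_vector_derivative (G u * T - T * G u)) (at u)" for u
    unfolding K_def G_def
    by (rule bounded_linear.has_vector_derivative[OF bounded_linear_sub[OF bounded_linear_mult_left bounded_linear_mult_right] Fa_deriv])
  have small: "norm (G u * T - T * G u) \<le> 2 * norm Y * (1 / \<Lambda>)" for u
  proof (rule comm_le)
    show "norm (G u * f \<Lambda>) \<le> 1 / \<Lambda>"
      unfolding G_def
    proof (rule norm_F_\<Phi>_f_le[OF L cont_Fa_deriv])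
      fix t :: real assume t: "0 \<le> t" "t \<le> 1"
      note d = den_bounds[OF L t]
      have p: "1 \<le> 1 + u\<^sup>2 * t"
        using t by simp
      define w where "w = (\<Lambda>\<^sup>2 * t / den \<Lambda> t) / (1 + u\<^sup>2 * t)"
      have "sqrt t / (1 + u\<^sup>2 * t) * (\<Lambda> * sqrt t / den \<Lambda> t) = w / \<Lambda>"
        unfolding w_def using L t by (simp add: power2_eq_square mult.commute mult.left_commute)
      moreover have "w \<le> 1 / 1"
        unfolding w_def using d p t by (intro frac_le) auto
      moreover have "0 \<le> w"
        unfolding w_def using d p t by simp
      ultimately show "\<bar>sqrt t / (1 + u\<^sup>2 * t) * (\<Lambda> * sqrt t / den \<Lambda> t)\<bar> \<le> 1 / \<Lambda>"
        using L by (simp add: divide_right_mono)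
    qed
    show "G u * f \<Lambda> = f \<Lambda> * G u"
      unfolding G_def by (rule f_comm[OF cont_Fa_deriv])
  qed
  have large: "norm (G u * T - T * G u) \<le> 4 * \<Lambda> * \<eta> / u\<^sup>2" if u: "u > 0" for u
  proof -
    define \<Lambda>' where "\<Lambda>' = sqrt (1 + u\<^sup>2)"
    have L': "\<Lambda>' \<ge> 1" and G: "G u = (1 / \<Lambda>') *\<^sub>R f \<Lambda>'"
      using Fa_deriv_eq[of u] by (simp_all add: G_def \<Lambda>'_def)
    have "norm (G u * T - T * G u) = norm ((1 / \<Lambda>') *\<^sub>R (f \<Lambda>' * T - T * f \<Lambda>'))"
      by (simp add: G scaleR_right_diff_distrib)
    also have "\<dots> = norm (f \<Lambda>' * T - T * f \<Lambda>') / \<Lambda>'"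
      using L' by simp
    also have "\<dots> \<le> 4 * \<Lambda> * \<eta> / \<Lambda>' / \<Lambda>'"
      using norm_cutoff_commutator_le[OF L L', of Y] L' by (intro divide_right_mono) (auto simp: T_def \<eta>_def)
    also have "\<dots> = 4 * \<Lambda> * \<eta> / (1 + u\<^sup>2)"
      by (simp add: \<Lambda>'_def)
    also have "\<dots> \<le> 4 * \<Lambda> * \<eta> / u\<^sup>2"
      using u L eta by (intro divide_left_mono) (auto intro!: mult_pos_pos add_pos_pos)
    finally show ?thesis .
  qed
  \<comment> \<open>The point at which the two estimates of the derivative change over.\<close>
  define N0 where "N0 = \<Lambda> * M"
  have N0: "N0 > 0"
    using L M by (simp add: N0_def)
  have K_cont: "continuous_on X K" for X
    using K_deriv by (intro differentiable_imp_continuous_on)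
      (auto simp: differentiable_on_def intro: has_vector_derivative_at_within differentiableI_vector)
  have K0: "K 0 = 0"
    by (simp add: K_def Fa_def \<Phi>_const)
  have K1: "norm (K N0) \<le> 2 * norm Y * M"
  proof -
    have "norm (K N0 - K 0) \<le> 2 * norm Y * (1 / \<Lambda>) * N0 - 2 * norm Y * (1 / \<Lambda>) * 0"
      using L by (intro differentiable_bound_general[OF N0 K_cont _ K_deriv _ small])
        (auto intro!: continuous_intros derivative_eq_intros simp: has_real_derivative_iff_has_vector_derivative[symmetric])
    then show ?thesis
      using L by (simp add: K0 N0_def)
  qed
  have K2: "norm (K N) \<le> 2 * norm Y * M + 4 * \<eta> / M" if "N > N0" for N
  proof -
    have "norm (K N - K N0) \<le> - (4 * \<Lambda> * \<eta> / N) - (- (4 * \<Lambda> * \<eta> / N0))"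
    proof (rule differentiable_bound_general[OF that K_cont _ K_deriv])
      show "continuous_on {N0..N} (\<lambda>u. - (4 * \<Lambda> * \<eta> / u))"
        using N0 by (intro continuous_intros) auto
      show "((\<lambda>u. - (4 * \<Lambda> * \<eta> / u)) has_vector_derivative 4 * \<Lambda> * \<eta> / u\<^sup>2) (at u)" if "N0 < u" for u
        unfolding has_real_derivative_iff_has_vector_derivative[symmetric]
        using that N0 by (auto intro!: derivative_eq_intros simp: power2_eq_square)
      show "norm (G u * T - T * G u) \<le> 4 * \<Lambda> * \<eta> / u\<^sup>2" if "N0 < u" for u
        using large that N0 by simp
    qed
    also have "\<dots> \<le> 4 * \<Lambda> * \<eta> / N0"
      using N0 that L eta by simp
    also have "\<dots> = 4 * \<eta> / M"
      using L by (simp add: N0_def)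
    finally show ?thesis
      using K1 norm_triangle_ineq[of "K N - K N0" "K N0"] by simp
  qed
  have est: "norm (F * T - T * F) \<le> 2 * norm Y * M + 4 * \<eta> / M + 2 * norm Y * (\<Lambda> / N)" if "N > N0" for N
  proof -
    have N: "N > 0"
      using that N0 by simp
    define X where "X = F * \<Phi> (\<lambda>t. 1 - 2 / pi * arctan (N * sqrt t))"
    have hc: "cont (\<lambda>t. 1 - 2 / pi * arctan (N * sqrt t))"
      by (intro continuous_intros)
    have h: "\<Phi> (\<lambda>t. 1 - 2 / pi * arctan (N * sqrt t)) = 1 - (2 / pi) *\<^sub>R \<Phi> (\<lambda>t. arctan (N * sqrt t))"
      using cont_arctan[of N] by (subst \<Phi>_diff) (auto intro!: continuous_on_mult_left simp: \<Phi>_const \<Phi>_scale simp del: times_divide_eq_left)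
    have F_eq: "F = (2 / pi) *\<^sub>R Fa N + X"
      unfolding X_def Fa_def h by (simp add: right_diff_distrib)
    have "norm (X * f \<Lambda>) \<le> \<Lambda> / N"
      unfolding X_def
    proof (rule norm_F_\<Phi>_f_le[OF L hc])
      fix t :: real assume t: "0 \<le> t" "t \<le> 1"
      note d = den_bounds[OF L t]
      have "\<bar>(1 - 2 / pi * arctan (N * sqrt t)) * (\<Lambda> * sqrt t / den \<Lambda> t)\<bar>
          = \<bar>(1 - 2 / pi * arctan (N * sqrt t)) * sqrt t\<bar> * (\<Lambda> / den \<Lambda> t)"
        using L d t by (simp add: abs_mult)
      also have "\<dots> \<le> (1 / N) * (\<Lambda> / 1)"
        using arctan_tail[of "sqrt t" N] N d L t by (intro mult_mono frac_le) auto
      finally show "\<bar>(1 - 2 / pi * arctan (N * sqrt t)) * (\<Lambda> * sqrt t / den \<Lambda> t)\<bar> \<le> \<Lambda> / N"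
        by simp
    qed
    then have X: "norm (X * T - T * X) \<le> 2 * norm Y * (\<Lambda> / N)"
      by (rule comm_le) (use f_comm[OF hc] in \<open>simp add: X_def\<close>)
    have "F * T - T * F = (2 / pi) *\<^sub>R K N + (X * T - T * X)"
      by (subst (1 2) F_eq) (simp add: K_def algebra_simps)
    also have "norm \<dots> \<le> (2 / pi) * norm (K N) + norm (X * T - T * X)"
      by (rule order_trans[OF norm_triangle_ineq]) simp
    also have "\<dots> \<le> 1 * norm (K N) + 2 * norm Y * (\<Lambda> / N)"
      using X pi_ge_two by (intro add_mono mult_right_mono) auto
    finally show ?thesis
      using K2[OF that] by simp
  qed
  have "norm (F * T - T * F) \<le> 2 * norm Y * M + 4 * \<eta> / M"
  proof (rule tendsto_lowerbound)
    show "((\<lambda>N. 2 * norm Y * M + 4 * \<eta> / M + 2 * norm Y * (\<Lambda> / N)) \<longlongrightarrow> 2 * norm Y * M + 4 * \<eta> / M) at_top"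
      by (rule tendsto_eq_intros tendsto_divide_0 filterlim_at_top_imp_at_infinity filterlim_ident | simp)+
    show "\<forall>\<^sub>F N in at_top. norm (F * T - T * F) \<le> 2 * norm Y * M + 4 * \<eta> / M + 2 * norm Y * (\<Lambda> / N)"
      using eventually_gt_at_top[of N0] by eventually_elim (rule est)
  qed simp
  then show ?thesis
    by (simp only: T_def \<eta>_def)
qed

end

subsection \<open>Lipschitz operators\<close>

lemma powr_half_bound:
  fixes \<Lambda> t \<alpha> p d :: real
  assumes "\<Lambda> \<ge> 1" "0 \<le> t" "t \<le> 1" "0 \<le> \<alpha>" "\<alpha> \<le> p" "1 \<le> d" "\<Lambda> powr p * t powr (p / 2) \<le> d" "p > 0"
  shows "\<Lambda> powr p * t powr ((p - \<alpha>) / 2) / d \<le> \<Lambda> powr \<alpha>"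
proof (cases "t = 0")
  case False
  then have t: "t > 0"
    using assms by simp
  define u where "u = \<Lambda> * sqrt t"
  have u: "u > 0"
    using t assms by (simp add: u_def)
  have tp: "t powr (r / 2) = sqrt t powr r" for r
    using t by (simp add: powr_half_sqrt[symmetric] powr_powr)
  have up: "\<Lambda> powr p * t powr ((p - \<alpha>) / 2) = \<Lambda> powr \<alpha> * u powr (p - \<alpha>)"
    using assms t by (simp add: tp u_def powr_mult powr_add[symmetric] mult.assoc[symmetric])
  have "u powr (p - \<alpha>) \<le> d"
  proof (cases "u \<le> 1")
    case True
    then have "u powr (p - \<alpha>) \<le> 1 powr (p - \<alpha>)"
      using u assms by (intro powr_mono2) auto
    then show ?thesis
      using assms by simp
  next
    case False
    then have "u powr (p - \<alpha>) \<le> u powr p"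
      using assms by (intro powr_mono) auto
    also have "\<dots> = \<Lambda> powr p * t powr (p / 2)"
      using assms t by (simp add: tp u_def powr_mult)
    finally show ?thesis
      using assms by simp
  qed
  then have "\<Lambda> powr \<alpha> * u powr (p - \<alpha>) \<le> \<Lambda> powr \<alpha> * d"
    by (intro mult_left_mono) auto
  then show ?thesis
    using assms by (simp add: up divide_le_eq)
qed (use assms in simp)

locale regular_operator_power = regular_operator ip ract D
  for ip :: "'e::cbanach \<Rightarrow> 'e \<Rightarrow> 'b::cstar_algebra" and ract :: "'e \<Rightarrow> 'b \<Rightarrow> 'e" and D :: "'e unb" +
  fixes \<alpha> :: real
  assumes alpha: "0 \<le> \<alpha>" "\<alpha> < 1"
begin

definition J :: "'e endo" where
  "J = \<Phi> (\<lambda>t. if \<alpha> = 0 then 1 else t powr (\<alpha> / 2))"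

lemma japanese_power_J: "japanese_power D \<alpha> = bl J"
  unfolding J_def by (rule japanese_power_eq[OF alpha(1)])

lemma cont_J: "cont (\<lambda>t. if \<alpha> = 0 then 1 else t powr (\<alpha> / 2))"
  using alpha by (cases "\<alpha> = 0") (auto intro: continuous_powr)

lemma sa_J: "sa J" and J_Adj: "J \<in> Adj" and ad_J: "ad J = J"
  using sa_\<Phi>[OF cont_J] by (auto simp: J_def sa_def)

text \<open>The cut-offs absorb the negative power of \<open>1 + D\<^sup>2\<close> at the cost of a factor \<open>\<Lambda>\<^sup>\<alpha>\<close>.\<close>

lemma J_factor:
  assumes L: "\<Lambda> \<ge> 1"
  shows "\<exists>K\<in>Adj. e \<Lambda> = J * K \<and> e \<Lambda> = K * J \<and> norm K \<le> \<Lambda> powr \<alpha>"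
    and "\<exists>K\<in>Adj. f \<Lambda> = J * K \<and> f \<Lambda> = K * J \<and> norm K \<le> \<Lambda> powr \<alpha>"
proof -
  define j where "j t = (if \<alpha> = 0 then 1 else t powr (\<alpha> / 2))" for t :: real
  have J: "J = \<Phi> j" and j: "cont j"
    using cont_J by (simp_all add: J_def j_def[abs_def])
  define k where "k p t = \<Lambda> powr p * t powr ((p - \<alpha>) / 2) / den \<Lambda> t" for p t :: real
  have k: "cont (k p)" if "p \<ge> 1" for p
    unfolding k_def using that alpha L by (intro cont_den continuous_on_mult_left continuous_powr) auto
  have jk: "j t * k p t = \<Lambda> powr p * t powr (p / 2) / den \<Lambda> t" if "0 \<le> t" for p t
    using alpha by (simp add: j_def k_def powr_add[symmetric] mult.left_commute[of "t powr _"] diff_divide_distrib)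
  have k_le: "\<bar>k p t\<bar> \<le> \<Lambda> powr \<alpha>"
    if "p \<ge> 1" "\<Lambda> powr p * t powr (p / 2) \<le> den \<Lambda> t" "0 \<le> t" "t \<le> 1" for p t
    using powr_half_bound[of \<Lambda> t \<alpha> p "den \<Lambda> t"] den_bounds[OF L that(3,4)] that alpha L
    by (simp add: k_def)
  have L2: "\<Lambda> powr 2 * t powr (2 / 2) = \<Lambda>\<^sup>2 * t" "\<Lambda> powr 1 * t powr (1 / 2) = \<Lambda> * sqrt t" if "0 \<le> t" for t
    using L that powr_realpow[of \<Lambda> 2] by (simp_all add: powr_half_sqrt)
  have e: "e \<Lambda> = J * \<Phi> (k 2)"
    unfolding J e_def by (rule \<Phi>_mult_eq[symmetric, OF j k]) (auto simp: jk simp flip: L2)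
  have f: "\<Phi> (\<lambda>t. \<Lambda> * sqrt t / den \<Lambda> t) = J * \<Phi> (k 1)"
    unfolding J by (rule \<Phi>_mult_eq[symmetric, OF j k]) (auto simp: jk simp flip: L2)
  show "\<exists>K\<in>Adj. e \<Lambda> = J * K \<and> e \<Lambda> = K * J \<and> norm K \<le> \<Lambda> powr \<alpha>"
  proof (intro bexI conjI)
    show "e \<Lambda> = \<Phi> (k 2) * J"
      unfolding e J by (rule \<Phi>_commute[OF j k]) simp
    show "norm (\<Phi> (k 2)) \<le> \<Lambda> powr \<alpha>"
      using den_bounds[OF L] L by (intro norm_\<Phi>_le k k_le) (simp_all add: powr_numeral)
    show "\<Phi> (k 2) \<in> Adj"
      using sa_\<Phi>[OF k, of 2] by (simp add: sa_def)
  qed (rule e)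
  show "\<exists>K\<in>Adj. f \<Lambda> = J * K \<and> f \<Lambda> = K * J \<and> norm K \<le> \<Lambda> powr \<alpha>"
  proof (intro bexI conjI)
    show "f \<Lambda> = J * (F * \<Phi> (k 1))"
      unfolding f_\<Phi>[OF L] f by (simp only: mult.assoc[symmetric] F_\<Phi>[OF cont_J] J_def)
    show "f \<Lambda> = F * \<Phi> (k 1) * J"
      unfolding f_\<Phi>[OF L] f unfolding J by (simp only: mult.assoc \<Phi>_commute[OF j k, of 1])
    show "norm (F * \<Phi> (k 1)) \<le> \<Lambda> powr \<alpha>"
      using den_bounds[OF L] L by (intro norm_F_\<Phi>_le k k_le) (simp_all add: powr_half_sqrt)
    show "F * \<Phi> (k 1) \<in> Adj"
      using sa_\<Phi>[OF k, of 1] F_Adj by (simp add: sa_def in_A)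
  qed
qed

text \<open>\<open>[D, Z] \<langle>D\<rangle>\<^sup>-\<^sup>\<alpha> = B\<close>, with \<open>Z\<close> preserving the relevant part of the domain.\<close>

definition lip :: "'e endo \<Rightarrow> 'e endo \<Rightarrow> bool" where
  "lip Z B \<longleftrightarrow> Z \<in> Adj \<and> B \<in> Adj \<and> (\<forall>x w. (J \<cdot> x, w) \<in> D \<longrightarrow> (Z \<cdot> J \<cdot> x, Z \<cdot> w + B \<cdot> x) \<in> D)"

text \<open>
  The factor \<open>\<langle>D\<rangle>\<^sup>-\<^sup>\<alpha>\<close> that tames \<open>[D, Z]\<close> is taken from the cut-off, at the cost of \<open>\<Lambda>\<^sup>\<alpha>\<close>; division by \<open>\<Lambda>\<close> leaves \<open>\<Lambda>\<^sup>\<alpha>\<^sup>-\<^sup>1\<close>.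
\<close>

lemma lip_cutoffs:
  assumes Z: "lip Z B" and L: "\<Lambda> \<ge> 1"
  shows "\<exists>c\<in>Adj. norm c \<le> norm B * \<Lambda> powr (\<alpha> - 1) \<and> (\<forall>v. (Z \<cdot> e \<Lambda> \<cdot> v, \<Lambda> *\<^sub>R ((Z * f \<Lambda> + c) \<cdot> v)) \<in> D)"
    and "\<exists>c\<in>Adj. norm c \<le> norm B * \<Lambda> powr (\<alpha> - 1) \<and> (\<forall>v. (Z \<cdot> f \<Lambda> \<cdot> v, \<Lambda> *\<^sub>R ((Z * (1 - e \<Lambda>) + c) \<cdot> v)) \<in> D)"
proof -
  have *: "\<exists>c\<in>Adj. norm c \<le> norm B * \<Lambda> powr (\<alpha> - 1) \<and> (\<forall>v. (Z \<cdot> g \<cdot> v, \<Lambda> *\<^sub>R ((Z * h + c) \<cdot> v)) \<in> D)"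
    if K: "K \<in> Adj" "g = J * K" "norm K \<le> \<Lambda> powr \<alpha>" and D: "\<And>v. (g \<cdot> v, \<Lambda> *\<^sub>R (h \<cdot> v)) \<in> D" for g h K
  proof (intro bexI conjI allI)
    let ?c = "(1 / \<Lambda>) *\<^sub>R (B * K)"
    show "?c \<in> Adj"
      using Z K by (simp add: lip_def in_A)
    have "norm ?c \<le> (1 / \<Lambda>) * (norm B * \<Lambda> powr \<alpha>)"
      using L norm_mult_ineq[of B K] mult_left_mono[OF K(3), of "norm B"] by (simp add: divide_right_mono)
    also have "\<dots> = norm B * \<Lambda> powr (\<alpha> - 1)"
      using L by (simp add: powr_diff)
    finally show "norm ?c \<le> norm B * \<Lambda> powr (\<alpha> - 1)" .
    show "(Z \<cdot> g \<cdot> v, \<Lambda> *\<^sub>R ((Z * h + ?c) \<cdot> v)) \<in> D" for v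
      using Z D[of v] L unfolding lip_def K(2) by (fastforce simp: ap_simps scaleR_add_right Adj_scaleC)
  qed
  show "\<exists>c\<in>Adj. norm c \<le> norm B * \<Lambda> powr (\<alpha> - 1) \<and> (\<forall>v. (Z \<cdot> e \<Lambda> \<cdot> v, \<Lambda> *\<^sub>R ((Z * f \<Lambda> + c) \<cdot> v)) \<in> D)"
    using J_factor(1)[OF L] *[OF _ _ _ e_graph[OF L]] by blast
  show "\<exists>c\<in>Adj. norm c \<le> norm B * \<Lambda> powr (\<alpha> - 1) \<and> (\<forall>v. (Z \<cdot> f \<Lambda> \<cdot> v, \<Lambda> *\<^sub>R ((Z * (1 - e \<Lambda>) + c) \<cdot> v)) \<in> D)"
    using J_factor(2)[OF L] *[OF _ _ _ f_graph[OF L]] by blast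
qed

text \<open>
  With \<open>c\<close> and \<open>d\<close> for \<open>[D / \<Lambda>, Z] e\<^sub>\<Lambda>\<close> and \<open>[D / \<Lambda>, Z] f\<^sub>\<Lambda>\<close> one has \<open>[e\<^sub>\<Lambda>, Z] = - (f\<^sub>\<Lambda> c + e\<^sub>\<Lambda> d)\<close> and
  \<open>[f\<^sub>\<Lambda>, Z] = e\<^sub>\<Lambda> c - f\<^sub>\<Lambda> d\<close>.
\<close>

lemma lip_commutator:
  assumes Z: "lip Z B" and L: "\<Lambda> \<ge> 1"
  shows "norm (e \<Lambda> * Z - Z * e \<Lambda>) \<le> 2 * norm B * \<Lambda> powr (\<alpha> - 1)"
    and "norm (f \<Lambda> * Z - Z * f \<Lambda>) \<le> 2 * norm B * \<Lambda> powr (\<alpha> - 1)"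
proof -
  obtain c where c: "norm c \<le> norm B * \<Lambda> powr (\<alpha> - 1)" "\<And>v. (Z \<cdot> e \<Lambda> \<cdot> v, \<Lambda> *\<^sub>R ((Z * f \<Lambda> + c) \<cdot> v)) \<in> D"
    using lip_cutoffs(1)[OF Z L] by blast
  obtain d where d: "norm d \<le> norm B * \<Lambda> powr (\<alpha> - 1)" "\<And>v. (Z \<cdot> f \<Lambda> \<cdot> v, \<Lambda> *\<^sub>R ((Z * (1 - e \<Lambda>) + d) \<cdot> v)) \<in> D"
    using lip_cutoffs(2)[OF Z L] by blast
  have L0: "\<Lambda> \<noteq> 0"
    using L by simp
  have 1: "e \<Lambda> * (Z * f \<Lambda> + c) = f \<Lambda> * (Z * e \<Lambda>)"
    using e_of_D[OF L c(2)] L0 by (intro endo_eqI) (simp add: ap_mult ap_scaleR_right)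
  have 2: "f \<Lambda> * (Z * f \<Lambda> + c) = (1 - e \<Lambda>) * (Z * e \<Lambda>)"
    using f_of_D[OF L c(2)] L0 by (intro endo_eqI) (simp add: ap_mult ap_scaleR_right)
  have 3: "e \<Lambda> * (Z * (1 - e \<Lambda>) + d) = f \<Lambda> * (Z * f \<Lambda>)"
    using e_of_D[OF L d(2)] L0 by (intro endo_eqI) (simp add: ap_mult ap_scaleR_right)
  have 4: "f \<Lambda> * (Z * (1 - e \<Lambda>) + d) = (1 - e \<Lambda>) * (Z * f \<Lambda>)"
    using f_of_D[OF L d(2)] L0 by (intro endo_eqI) (simp add: ap_mult ap_scaleR_right)
  have bound: "norm (x * c' + y * d') \<le> 2 * norm B * \<Lambda> powr (\<alpha> - 1)"
    if "norm x \<le> 1" "norm y \<le> 1" "norm c' \<le> norm B * \<Lambda> powr (\<alpha> - 1)" "norm d' \<le> norm B * \<Lambda> powr (\<alpha> - 1)"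
    for x y c' d' :: "'e endo"
  proof -
    have "norm (x * c') \<le> 1 * (norm B * \<Lambda> powr (\<alpha> - 1))" "norm (y * d') \<le> 1 * (norm B * \<Lambda> powr (\<alpha> - 1))"
      using that by (intro order_trans[OF norm_mult_ineq mult_mono]; simp)+
    then show ?thesis
      using norm_triangle_ineq[of "x * c'" "y * d'"] by simp
  qed
  have "e \<Lambda> * Z = e \<Lambda> * (Z * e \<Lambda>) + f \<Lambda> * (Z * f \<Lambda>) - e \<Lambda> * d"
    "Z * e \<Lambda> = e \<Lambda> * (Z * e \<Lambda>) + f \<Lambda> * (Z * f \<Lambda>) + f \<Lambda> * c"
    using 2 3 by (simp_all add: algebra_simps)
  from arg_cong2[where f = minus, OF this] have "e \<Lambda> * Z - Z * e \<Lambda> = - (f \<Lambda> * c + e \<Lambda> * d)"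
    by (simp add: algebra_simps)
  then show "norm (e \<Lambda> * Z - Z * e \<Lambda>) \<le> 2 * norm B * \<Lambda> powr (\<alpha> - 1)"
    using bound[OF norm_f_le[OF L] norm_e_le[OF L] c(1) d(1)] by (simp only: norm_minus_cancel)
  have "f \<Lambda> * Z = Z * f \<Lambda> + f \<Lambda> * (Z * e \<Lambda>) - e \<Lambda> * (Z * f \<Lambda>) - f \<Lambda> * d"
    "e \<Lambda> * c = f \<Lambda> * (Z * e \<Lambda>) - e \<Lambda> * (Z * f \<Lambda>)"
    using 1 4 by (simp_all add: algebra_simps)
  from arg_cong2[where f = minus, OF this] have "f \<Lambda> * Z - e \<Lambda> * c = Z * f \<Lambda> - f \<Lambda> * d"
    by simp
  then have "f \<Lambda> * Z - Z * f \<Lambda> = e \<Lambda> * c + f \<Lambda> * (- d)"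
    by (simp add: algebra_simps)
  then show "norm (f \<Lambda> * Z - Z * f \<Lambda>) \<le> 2 * norm B * \<Lambda> powr (\<alpha> - 1)"
    using bound[OF norm_e_le[OF L] norm_f_le[OF L] c(1), of "- d"] d(1) by simp
qed

lemma lip_right:
  assumes a: "a \<in> Adj" and dom: "blinfun_apply (bl a) ` Domain D \<subseteq> Domain D"
    and B: "B \<in> Adj" "commutator D (bl a) \<circ>\<^sub>u gr (bl J) \<subseteq> gr (bl B)"
  shows "lip a B"
  unfolding lip_def
proof (intro conjI allI impI a B(1))
  fix x w assume w: "(J \<cdot> x, w) \<in> D"
  then obtain z where z: "(a \<cdot> J \<cdot> x, z) \<in> D"
    using dom by (auto simp: bl_ap image_subset_iff)
  have "(x, z - a \<cdot> w) \<in> commutator D (bl a) \<circ>\<^sub>u gr (bl J)"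
    using w z by (force simp: commutator_def unb_comp_def unb_diff_def gr_def bl_ap)
  then have "z - a \<cdot> w = B \<cdot> x"
    using B(2) by (auto simp: gr_def bl_ap)
  then show "(a \<cdot> J \<cdot> x, a \<cdot> w + B \<cdot> x) \<in> D"
    using z by (metis add.commute diff_add_cancel)
qed

text \<open>
  A bound on \<open>\<langle>D\<rangle>\<^sup>-\<^sup>\<alpha> [D, y]\<close> is one on \<open>[D, y\<^sup>*] \<langle>D\<rangle>\<^sup>-\<^sup>\<alpha>\<close>. That \<open>y\<^sup>*\<close> maps the relevant vectors into the domain of \<open>D\<close>
  is part of the conclusion; it follows from the self-adjointness of \<open>D\<close>.
\<close>

lemma lip_left_ad:
  assumes y: "y \<in> Adj" and dom: "blinfun_apply (bl y) ` Domain D \<subseteq> Domain D"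
    and B: "B \<in> Adj" "gr (bl J) \<circ>\<^sub>u commutator D (bl y) \<subseteq> gr (bl B)"
  shows "lip (ad y) (- ad B)"
  unfolding lip_def
proof (intro conjI allI impI)
  show "ad y \<in> Adj" "- ad B \<in> Adj"
    using y B by (simp_all add: in_A)
  fix x w assume w: "(J \<cdot> x, w) \<in> D"
  show "(ad y \<cdot> J \<cdot> x, ad y \<cdot> w + (- ad B) \<cdot> x) \<in> D"
  proof (rule iffD2[OF D_iff], intro allI impI)
    fix u v assume uv: "(u, v) \<in> D"
    then obtain z where z: "(y \<cdot> u, z) \<in> D"
      using dom by (auto simp: bl_ap image_subset_iff)
    have "(u, J \<cdot> (z - y \<cdot> v)) \<in> gr (bl J) \<circ>\<^sub>u commutator D (bl y)"
      using uv z by (force simp: commutator_def unb_comp_def unb_diff_def gr_def bl_ap)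
    then have "J \<cdot> (z - y \<cdot> v) = B \<cdot> u"
      using B(2) by (auto simp: gr_def bl_ap)
    then have "ip (z - y \<cdot> v) (J \<cdot> x) = ip u (ad B \<cdot> x)"
      using AdjD[OF J_Adj] AdjD[OF B(1)] ad_J by metis
    then have "ip (y \<cdot> v) (J \<cdot> x) = ip z (J \<cdot> x) - ip u (ad B \<cdot> x)"
      unfolding ip_diff_left by (metis diff_diff_eq2 add_diff_cancel_left')
    also have "ip z (J \<cdot> x) = ip u (ad y \<cdot> w)"
      using D_sym[OF z w] AdjD[OF y] by simp
    finally show "ip v (ad y \<cdot> J \<cdot> x) = ip u (ad y \<cdot> w + (- ad B) \<cdot> x)"
      using AdjD[OF y] by (simp add: ip_simps ap_simps)
  qed
qed

end

section \<open>Asymptotic algebra\<close>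

text \<open>
  A family indexed by a parameter and a scale is negligible if it decays like a negative power of the
  scale, uniformly in the parameter. Bounded families modulo negligible ones form a ring, in which
  approximate identities between cut-offs become equations.
\<close>

definition lam :: "'x \<times> real \<Rightarrow> real" where
  "lam i = max 1 (snd i)"

definition bdd :: "('x \<times> real \<Rightarrow> 'r::real_normed_vector) \<Rightarrow> bool" where
  "bdd X \<longleftrightarrow> (\<exists>C. \<forall>i. norm (X i) \<le> C)"

definition negl :: "('x \<times> real \<Rightarrow> 'r::real_normed_vector) \<Rightarrow> bool" where
  "negl X \<longleftrightarrow> (\<exists>C \<theta>. \<theta> > 0 \<and> (\<forall>i. norm (X i) \<le> C * lam i powr (- \<theta>)))"

lemma lam_ge_1: "lam i \<ge> 1"
  by (simp add: lam_def)

lemma bddI: "(\<And>i. norm (X i) \<le> C) \<Longrightarrow> bdd X"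
  by (auto simp: bdd_def)

lemma bddE: assumes "bdd X" obtains C where "C > 0" "\<And>i. norm (X i) \<le> C"
proof -
  obtain C where C: "\<And>i. norm (X i) \<le> C"
    using assms by (auto simp: bdd_def)
  have "norm (X i) \<le> \<bar>C\<bar> + 1" for i
    using C[of i] by linarith
  then show ?thesis
    by (intro that[of "\<bar>C\<bar> + 1"]) auto
qed

lemma neglI: "\<theta> > 0 \<Longrightarrow> (\<And>i. norm (X i) \<le> C * lam i powr (- \<theta>)) \<Longrightarrow> negl X"
  by (auto simp: negl_def)

lemma neglE:
  assumes "negl X" obtains C \<theta> where "C > 0" "\<theta> > 0" "\<And>i. norm (X i) \<le> C * lam i powr (- \<theta>)"
proof -
  obtain C \<theta> where C: "\<theta> > 0" "\<And>i. norm (X i) \<le> C * lam i powr (- \<theta>)"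
    using assms by (auto simp: negl_def)
  have "norm (X i) \<le> (\<bar>C\<bar> + 1) * lam i powr (- \<theta>)" for i
    using C(2)[of i] by (rule order_trans) (auto intro: mult_right_mono)
  then show ?thesis
    using C(1) by (intro that[of "\<bar>C\<bar> + 1" \<theta>]) auto
qed

lemma negl_dominated:
  assumes "negl X" "\<And>i. norm (Y i) \<le> K * norm (X i)" "K \<ge> 0"
  shows "negl Y"
proof -
  obtain C \<theta> where C: "C > 0" "\<theta> > 0" "\<And>i. norm (X i) \<le> C * lam i powr (- \<theta>)"
    by (rule neglE[OF assms(1)]) blast
  show ?thesis
  proof (rule neglI[OF C(2)])
    show "norm (Y i) \<le> (K * C) * lam i powr (- \<theta>)" for i
      using order_trans[OF assms(2)[of i] mult_left_mono[OF C(3)[of i] assms(3)]] by simp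
  qed
qed

lemma negl_zero: "negl (\<lambda>i. 0)"
  by (rule neglI[of 1 _ 0]) auto

lemma negl_add: assumes "negl X" "negl Y" shows "negl (\<lambda>i. X i + Y i)"
proof -
  obtain C \<theta> where C: "C > 0" "\<theta> > 0" "\<And>i. norm (X i) \<le> C * lam i powr (- \<theta>)"
    by (rule neglE[OF assms(1)]) blast
  obtain C' \<theta>' where C': "C' > 0" "\<theta>' > 0" "\<And>i. norm (Y i) \<le> C' * lam i powr (- \<theta>')"
    by (rule neglE[OF assms(2)]) blast
  show ?thesis
  proof (rule neglI)
    show "min \<theta> \<theta>' > 0"
      using C C' by simp
    fix i :: "'a \<times> real"
    have p: "lam i powr (- \<theta>) \<le> lam i powr (- min \<theta> \<theta>')" "lam i powr (- \<theta>') \<le> lam i powr (- min \<theta> \<theta>')"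
      using lam_ge_1[of i] by (auto intro!: powr_mono)
    have "norm (X i + Y i) \<le> C * lam i powr (- \<theta>) + C' * lam i powr (- \<theta>')"
      using C(3)[of i] C'(3)[of i] norm_triangle_ineq[of "X i" "Y i"] by linarith
    also have "\<dots> \<le> C * lam i powr (- min \<theta> \<theta>') + C' * lam i powr (- min \<theta> \<theta>')"
      using p C C' by (intro add_mono mult_left_mono) auto
    finally show "norm (X i + Y i) \<le> (C + C') * lam i powr (- min \<theta> \<theta>')"
      by (simp add: algebra_simps)
  qed
qed

lemma negl_minus: "negl X \<Longrightarrow> negl (\<lambda>i. - X i)"
  by (rule negl_dominated[where K = 1]) auto

lemma negl_diff: "negl X \<Longrightarrow> negl Y \<Longrightarrow> negl (\<lambda>i. X i - Y i)"
  using negl_add[OF _ negl_minus] by fastforce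

lemma negl_mult_left:
  fixes X :: "'x \<times> real \<Rightarrow> 'r::real_normed_algebra"
  assumes "bdd X" "negl Y" shows "negl (\<lambda>i. X i * Y i)"
proof -
  obtain C where C: "C > 0" "\<And>i. norm (X i) \<le> C"
    by (rule bddE[OF assms(1)]) blast
  show ?thesis
  proof (rule negl_dominated[OF assms(2)])
    show "norm (X i * Y i) \<le> C * norm (Y i)" for i
      using C(2)[of i] by (intro order_trans[OF norm_mult_ineq] mult_right_mono) auto
  qed (use C in simp)
qed

lemma negl_mult_right:
  fixes X :: "'x \<times> real \<Rightarrow> 'r::real_normed_algebra"
  assumes "negl X" "bdd Y" shows "negl (\<lambda>i. X i * Y i)"
proof -
  obtain C where C: "C > 0" "\<And>i. norm (Y i) \<le> C"
    by (rule bddE[OF assms(2)]) blast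
  show ?thesis
  proof (rule negl_dominated[OF assms(1)])
    show "norm (X i * Y i) \<le> C * norm (X i)" for i
      using mult_left_mono[OF C(2)[of i], of "norm (X i)"] norm_mult_ineq[of "X i" "Y i"]
      by (simp add: mult.commute)
  qed (use C in simp)
qed

lemma negl_sqrt:
  assumes "negl X" "\<And>i. norm (Y i) \<le> K * sqrt (norm (X i))" "K \<ge> 0"
  shows "negl Y"
proof -
  obtain C \<theta> where C: "C > 0" "\<theta> > 0" "\<And>i. norm (X i) \<le> C * lam i powr (- \<theta>)"
    by (rule neglE[OF assms(1)]) blast
  show ?thesis
  proof (rule neglI)
    show "\<theta> / 2 > 0"
      using C by simp
    fix i :: "'a \<times> real"
    have "norm (Y i) \<le> K * sqrt (C * lam i powr (- \<theta>))"
      using assms(2)[of i] C(3)[of i] assms(3) by (meson mult_left_mono order_trans real_sqrt_le_iff)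
    also have "sqrt (C * lam i powr (- \<theta>)) = sqrt C * lam i powr (- (\<theta> / 2))"
      using lam_ge_1[of i] by (simp add: real_sqrt_mult powr_half_sqrt[symmetric] powr_powr)
    finally show "norm (Y i) \<le> (K * sqrt C) * lam i powr (- (\<theta> / 2))"
      by (simp add: mult.assoc)
  qed
qed

lemma bdd_const: "bdd (\<lambda>i. c)"
  by (rule bddI[of _ "norm c"]) simp

lemma bdd_add: assumes "bdd X" "bdd Y" shows "bdd (\<lambda>i. X i + Y i)"
proof -
  obtain C where "C > 0" "\<And>i. norm (X i) \<le> C"
    by (rule bddE[OF assms(1)]) blast
  moreover obtain C' where "C' > 0" "\<And>i. norm (Y i) \<le> C'"
    by (rule bddE[OF assms(2)]) blast
  ultimately show ?thesis
    by (intro bddI[of _ "C + C'"] order_trans[OF norm_triangle_ineq] add_mono)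
qed

lemma bdd_scaleR: assumes "bdd X" shows "bdd (\<lambda>i. t *\<^sub>R X i)"
proof -
  obtain C where "C > 0" "\<And>i. norm (X i) \<le> C"
    by (rule bddE[OF assms]) blast
  then show ?thesis
    by (intro bddI[of _ "\<bar>t\<bar> * C"]) (auto intro: mult_left_mono)
qed

lemma bdd_minus: "bdd X \<Longrightarrow> bdd (\<lambda>i. - X i)"
  by (auto simp: bdd_def)

lemma bdd_diff: "bdd X \<Longrightarrow> bdd Y \<Longrightarrow> bdd (\<lambda>i. X i - Y i)"
  using bdd_add[OF _ bdd_minus] by fastforce

lemma bdd_mult:
  fixes X :: "'x \<times> real \<Rightarrow> 'r::real_normed_algebra"
  assumes "bdd X" "bdd Y" shows "bdd (\<lambda>i. X i * Y i)"
proof -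
  obtain C where C: "C > 0" "\<And>i. norm (X i) \<le> C"
    by (rule bddE[OF assms(1)]) blast
  moreover obtain C' where C': "C' > 0" "\<And>i. norm (Y i) \<le> C'"
    by (rule bddE[OF assms(2)]) blast
  ultimately show ?thesis
    by (intro bddI[of _ "C * C'"] order_trans[OF norm_mult_ineq] mult_mono) auto
qed

lemma bdd_power:
  fixes X :: "'x \<times> real \<Rightarrow> 'r::{real_normed_algebra, monoid_mult}"
  shows "bdd X \<Longrightarrow> bdd (\<lambda>i. X i ^ n)"
  by (induction n) (auto intro: bdd_mult bdd_const)

lemmas bdd_intros = bdd_const bdd_add bdd_minus bdd_diff bdd_mult bdd_power bdd_scaleR

definition asyrel :: "('x \<times> real \<Rightarrow> 'r::real_normed_vector) \<Rightarrow> ('x \<times> real \<Rightarrow> 'r) \<Rightarrow> bool" where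
  "asyrel X Y \<longleftrightarrow> bdd X \<and> bdd Y \<and> negl (\<lambda>i. X i - Y i)"

quotient_type (overloaded) ('x, 'r) asy = "'x \<times> real \<Rightarrow> 'r::real_normed_vector" / partial: asyrel
proof (rule part_equivpI)
  show "\<exists>X :: 'x \<times> real \<Rightarrow> 'r. asyrel X X"
    by (intro exI[of _ "\<lambda>_. 0"]) (simp add: asyrel_def bdd_const negl_zero)
  show "symp (asyrel :: ('x \<times> real \<Rightarrow> 'r) \<Rightarrow> _)"
  proof (rule sympI)
    show "asyrel Y X" if "asyrel X Y" for X Y :: "'x \<times> real \<Rightarrow> 'r"
      using that negl_minus[of "\<lambda>i. X i - Y i"] by (simp add: asyrel_def)
  qed
  show "transp (asyrel :: ('x \<times> real \<Rightarrow> 'r) \<Rightarrow> _)"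
  proof (rule transpI)
    show "asyrel X Z" if "asyrel X Y" "asyrel Y Z" for X Y Z :: "'x \<times> real \<Rightarrow> 'r"
      using that negl_add[of "\<lambda>i. X i - Y i" "\<lambda>i. Y i - Z i"] by (simp add: asyrel_def)
  qed
qed

instantiation asy :: (type, "{real_normed_algebra, monoid_mult}") "{ring, monoid_mult}"
begin

lift_definition zero_asy :: "('a, 'b) asy" is "\<lambda>i. 0"
  by (simp add: asyrel_def bdd_const negl_zero)

lift_definition one_asy :: "('a, 'b) asy" is "\<lambda>i. 1"
  by (simp add: asyrel_def bdd_const negl_zero)

lift_definition plus_asy :: "('a, 'b) asy \<Rightarrow> ('a, 'b) asy \<Rightarrow> ('a, 'b) asy" is "\<lambda>X Y i. X i + Y i"
  using negl_add by (fastforce simp: asyrel_def intro: bdd_add simp: add_diff_add)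

lift_definition uminus_asy :: "('a, 'b) asy \<Rightarrow> ('a, 'b) asy" is "\<lambda>X i. - X i"
  using negl_minus by (fastforce simp: asyrel_def intro: bdd_minus)

lift_definition minus_asy :: "('a, 'b) asy \<Rightarrow> ('a, 'b) asy \<Rightarrow> ('a, 'b) asy" is "\<lambda>X Y i. X i - Y i"
proof -
  fix X X' Y Y' :: "'a \<times> real \<Rightarrow> 'b"
  assume *: "asyrel X X'" "asyrel Y Y'"
  have "(\<lambda>i. X i - Y i - (X' i - Y' i)) = (\<lambda>i. (X i - X' i) - (Y i - Y' i))"
    by (simp add: fun_eq_iff)
  then show "asyrel (\<lambda>i. X i - Y i) (\<lambda>i. X' i - Y' i)"
    using * negl_diff[of "\<lambda>i. X i - X' i" "\<lambda>i. Y i - Y' i"] by (simp add: asyrel_def bdd_diff)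
qed

lift_definition times_asy :: "('a, 'b) asy \<Rightarrow> ('a, 'b) asy \<Rightarrow> ('a, 'b) asy" is "\<lambda>X Y i. X i * Y i"
proof -
  fix X X' Y Y' :: "'a \<times> real \<Rightarrow> 'b"
  assume *: "asyrel X X'" "asyrel Y Y'"
  have "(\<lambda>i. X i * Y i - X' i * Y' i) = (\<lambda>i. (X i - X' i) * Y i + X' i * (Y i - Y' i))"
    by (simp add: fun_eq_iff algebra_simps)
  then show "asyrel (\<lambda>i. X i * Y i) (\<lambda>i. X' i * Y' i)"
    using * by (simp add: asyrel_def bdd_mult negl_add negl_mult_left negl_mult_right)
qed

instance
  by intro_classes (transfer; simp add: asyrel_def bdd_intros negl_zero algebra_simps)+

end

definition cls :: "('x \<times> real \<Rightarrow> 'r::real_normed_vector) \<Rightarrow> ('x, 'r) asy" where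
  "cls = abs_asy"


lemma cls_eq_iff: "bdd X \<Longrightarrow> bdd Y \<Longrightarrow> cls X = cls Y \<longleftrightarrow> negl (\<lambda>i. X i - Y i)"
  unfolding cls_def using Quotient3_rel[OF Quotient3_asy, of X Y]
  by (simp add: asyrel_def negl_zero)

lemma asyrel_refl: "bdd X \<Longrightarrow> asyrel X X"
  by (simp add: asyrel_def negl_zero)

lemma cls_zero: "cls (\<lambda>i. 0) = 0"
  and cls_one: "cls (\<lambda>i. 1) = 1"
  and cls_add: "bdd X \<Longrightarrow> bdd Y \<Longrightarrow> cls (\<lambda>i. X i + Y i) = cls X + cls Y"
  and cls_diff: "bdd X \<Longrightarrow> bdd Y \<Longrightarrow> cls (\<lambda>i. X i - Y i) = cls X - cls Y"
  and cls_mult: "bdd X \<Longrightarrow> bdd Y \<Longrightarrow> cls (\<lambda>i. X i * Y i) = cls X * cls Y"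
  for X Y :: "'x \<times> real \<Rightarrow> 'r::{real_normed_algebra, monoid_mult}"
  by (simp_all add: cls_def zero_asy.abs_eq one_asy.abs_eq plus_asy.abs_eq minus_asy.abs_eq
      uminus_asy.abs_eq times_asy.abs_eq asyrel_refl)

lemma cls_power: "bdd X \<Longrightarrow> cls (\<lambda>i. X i ^ n) = cls X ^ n"
  for X :: "'x \<times> real \<Rightarrow> 'r::{real_normed_algebra, monoid_mult}"
  by (induction n) (simp_all add: cls_one cls_mult bdd_power)

subsection \<open>Commutation from exchange relations\<close>

text \<open>
  Here \<open>E, G\<close> are the cut-offs of one operator and \<open>C = ce\<close>, \<open>A = kf\<close> come from another one. The
  relations say that conjugating by a conformal factor turns \<open>c\<close> into \<open>k\<close>. Both have a left and a
  right form, and comparing \<open>G A G\<close> (and then \<open>G A E\<close>) computed in the two ways yields commutation.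
\<close>

lemma exchange_commute:
  fixes E G A C :: "'a::{ring, monoid_mult}"
  assumes EG: "E * G = G * E" and GG: "G * G = E - E * E"
    and l: "G * C = E * A" "C - E * C = G * A" and r: "C * G = A * E" "C - C * E = A * G"
  shows "A * E = E * A" "A * G = G * A" "C * E = E * C" "C * G = G * C" "A * C = C * A"
proof -
  have "(C - E * C) * G = G * (C - C * E)"
    unfolding l(2) r(2) by (rule mult.assoc)
  then have "C * G - E * (C * G) = G * C - (G * C) * E"
    by (simp add: algebra_simps)
  then show AE: "A * E = E * A"
    unfolding l(1) r(1) by (simp add: mult.assoc)
  show CG: "C * G = G * C"
    by (simp only: l(1) r(1) AE)
  have "C * (G * G) = (G * G) * C"
    by (metis CG mult.assoc)
  then have 3: "C * E - C * (E * E) = E * C - (E * E) * C"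
    unfolding GG by (simp add: algebra_simps)
  have "(C - E * C) * E = E * (C - E * C)"
    unfolding l(2) by (metis AE EG mult.assoc)
  then have 1: "C * E - E * C * E = E * C - (E * E) * C"
    by (simp add: algebra_simps)
  have "E * (C - C * E) = (C - C * E) * E"
    unfolding r(2) by (metis AE EG mult.assoc)
  then have 2: "E * C - E * C * E = C * E - C * (E * E)"
    by (simp add: algebra_simps)
  show CE: "C * E = E * C"
    using 1 2 3 by simp
  show "A * G = G * A"
    using l(2) r(2) CE by simp
  have "A * (E * C) = C * (E * A)"
    by (metis l(1) r(1) mult.assoc)
  moreover have "A * C = A * (E * C) + A * (G * A)"
    unfolding l(2)[symmetric] by (simp add: algebra_simps)
  moreover have "C * A = C * (E * A) + A * G * A"
    unfolding r(2)[symmetric] by (simp add: algebra_simps)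
  ultimately show "A * C = C * A"
    by (simp add: mult.assoc)
qed

text \<open>If \<open>c, k\<close> commute up to a factor \<open>w\<close> that they commute with, products can be sorted.\<close>

lemma cube_mult:
  fixes c k w :: "'a::{ring, monoid_mult}"
  assumes cw: "c * w = w * c" and kw: "k * w = w * k" and ck: "k * c * w = c * k * w"
  shows "(c * k * w) ^ 3 = c ^ 3 * k ^ 3 * w ^ 3"
proof -
  have 1: "(c * k * w) * (c * k * w) = c * c * k * k * w * w"
    by (metis cw kw ck mult.assoc)
  have 2: "k * k * c * w = c * k * k * w"
    by (metis kw ck mult.assoc)
  have wx: "w * (c * x) = c * (w * x)" "w * (k * x) = k * (w * x)" for x
    by (simp_all only: mult.assoc[symmetric] cw kw)
  have "(c * k * w) * (c * k * w) * (c * k * w) = c * c * (k * k * c * w) * k * w * w"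
    unfolding 1 by (simp only: mult.assoc wx)
  also have "\<dots> = c * c * c * (k * k * k) * (w * w * w)"
    unfolding 2 by (simp only: mult.assoc wx)
  finally show ?thesis
    by (simp only: power3_eq_cube)
qed

context cstar_ops
begin

lemma pos_sandwich: assumes T: "pos T" and X: "X \<in> A" shows "pos (ad X * T * X)"
proof -
  let ?s = "fc sqrt T"
  have s: "?s \<in> A" "ad ?s = ?s" "?s * ?s = T"
    using sqrt_fc[OF T] by (auto simp: sa_def)
  have "pos (ad (?s * X) * (?s * X))"
    using s X by (intro pos_ad_mult in_A)
  moreover have "ad (?s * X) * (?s * X) = ad X * (?s * ?s) * X"
    unfolding ad_mult[OF s(1) X] s(2) by (simp only: mult.assoc)
  ultimately show ?thesis
    by (simp only: s(3))
qed

text \<open>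
  Uniqueness of positive square roots, in quantitative form: if \<open>Y = P - Q\<close> then \<open>Y\<^sup>3 = YPY - YQY\<close>,
  and both terms are dominated by the norm of \<open>Y (P + Q) Y\<close>.
\<close>

lemma pos_diff_le:
  assumes P: "pos P" and Q: "pos Q"
  shows "norm (P - Q) \<le> sqrt (2 * norm ((P - Q) * (P + Q)))"
proof -
  define Y where "Y = P - Q"
  define \<delta> where "\<delta> = norm (Y * (P + Q))"
  have Y: "sa Y"
    using P Q by (auto simp: Y_def intro: sa_intros pos_sa)
  then have YA: "Y \<in> A" "ad Y = Y"
    by (auto simp: sa_def)
  have pp: "pos (Y * P * Y)" "pos (Y * Q * Y)"
    using pos_sandwich[OF P YA(1)] pos_sandwich[OF Q YA(1)] YA by auto
  have sum: "norm (Y * P * Y + Y * Q * Y) \<le> \<delta> * norm Y"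
    using norm_mult_ineq[of "Y * (P + Q)" Y] by (simp add: \<delta>_def algebra_simps)
  have "norm (Y * P * Y) \<le> \<delta> * norm Y" "norm (Y * Q * Y) \<le> \<delta> * norm Y"
    using norm_le_pos_add[OF pp] norm_le_pos_add[OF pp(2,1)] sum by (simp_all add: add.commute)
  moreover have "Y * Y * Y = Y * P * Y - Y * Q * Y"
    by (simp add: Y_def algebra_simps)
  ultimately have 3: "norm (Y * Y * Y) \<le> 2 * (\<delta> * norm Y)"
    using norm_triangle_ineq4[of "Y * P * Y" "Y * Q * Y"] by simp
  have "(norm Y)\<^sup>2 * (norm Y)\<^sup>2 = norm (Y * Y) ^ 2"
    by (simp add: norm_sa_square[OF Y] power2_eq_square)
  also have "\<dots> = norm (Y * Y * (Y * Y))"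
    using Y YA by (intro norm_sa_square[symmetric]) (simp add: sa_def in_A ad_simps)
  also have "\<dots> \<le> norm (Y * Y * Y) * norm Y"
    using norm_mult_ineq[of "Y * Y * Y" Y] by (simp add: mult.assoc)
  also have "\<dots> \<le> 2 * (\<delta> * norm Y) * norm Y"
    using 3 by (intro mult_right_mono) auto
  finally have "(norm Y)\<^sup>2 * (norm Y)\<^sup>2 \<le> 2 * \<delta> * (norm Y)\<^sup>2"
    by (simp add: power2_eq_square)
  then have "(norm Y)\<^sup>2 \<le> 2 * \<delta>"
    using mult_right_le_imp_le[of "(norm Y)\<^sup>2" "(norm Y)\<^sup>2" "2 * \<delta>"] by (cases "Y = 0") (auto simp: \<delta>_def)
  then show ?thesis
    by (simp add: Y_def \<delta>_def real_le_rsqrt)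
qed

definition fam :: "('x \<times> real \<Rightarrow> 'r) \<Rightarrow> bool" where
  "fam X \<longleftrightarrow> bdd X \<and> (\<forall>i. X i \<in> A)"

lemma fam_bdd: "fam X \<Longrightarrow> bdd X"
  by (simp add: fam_def)

lemma fam_add: "fam X \<Longrightarrow> fam Y \<Longrightarrow> fam (\<lambda>i. X i + Y i)"
  and fam_mult: "fam X \<Longrightarrow> fam Y \<Longrightarrow> fam (\<lambda>i. X i * Y i)"
  and fam_power: "fam X \<Longrightarrow> fam (\<lambda>i. X i ^ n)"
  and fam_diff: "fam X \<Longrightarrow> fam Y \<Longrightarrow> fam (\<lambda>i. X i - Y i)"
  and fam_one: "fam (\<lambda>i. 1)"
  by (simp_all add: fam_def in_A bdd_intros)

lemma fam_ad: assumes "fam X" shows "fam (\<lambda>i. ad (X i))"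
proof -
  have "bdd (\<lambda>i. ad (X i))"
    using assms by (simp add: fam_def bdd_def norm_ad)
  then show ?thesis
    using assms by (simp add: fam_def in_A)
qed

lemmas fam_intros = fam_add fam_mult fam_power fam_diff fam_one fam_ad

lemma cls_ad:
  assumes "fam X" "fam Y" "cls X = cls Y"
  shows "cls (\<lambda>i. ad (X i)) = cls (\<lambda>i. ad (Y i))"
proof -
  have "negl (\<lambda>i. X i - Y i)"
    using assms by (simp add: cls_eq_iff fam_bdd)
  moreover have "norm (ad (X i) - ad (Y i)) = norm (X i - Y i)" for i
  proof -
    have "X i \<in> A" "Y i \<in> A"
      using assms unfolding fam_def by blast+
    then show ?thesis
      using norm_ad[OF diff_in] by (simp add: ad_diff)
  qed
  ultimately have "negl (\<lambda>i. ad (X i) - ad (Y i))"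
    by (simp add: negl_def)
  then show ?thesis
    using assms by (simp add: cls_eq_iff fam_bdd fam_ad)
qed

lemma fam_sqrt:
  assumes T: "fam T" "\<And>i. pos (T i)"
  shows "fam (\<lambda>i. fc sqrt (T i))" "cls (\<lambda>i. fc sqrt (T i)) * cls (\<lambda>i. fc sqrt (T i)) = cls T"
proof -
  obtain C where C: "C > 0" "\<And>i. norm (T i) \<le> C"
    using T by (auto simp: fam_def elim: bddE)
  have "(norm (fc sqrt (T i)))\<^sup>2 = norm (T i)" for i
    using sqrt_fc[OF T(2)[of i]] norm_sa_square by metis
  then have "norm (fc sqrt (T i)) \<le> sqrt C" for i
    using C by (metis real_le_rsqrt)
  then have "bdd (\<lambda>i. fc sqrt (T i))"
    by (rule bddI)
  moreover have "fc sqrt (T i) \<in> A" for i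
    using sqrt_fc(1)[OF T(2)] by (rule sa_in)
  ultimately show s: "fam (\<lambda>i. fc sqrt (T i))"
    by (simp add: fam_def)
  show "cls (\<lambda>i. fc sqrt (T i)) * cls (\<lambda>i. fc sqrt (T i)) = cls T"
    using sqrt_fc(2)[OF T(2)] s by (simp add: cls_mult[symmetric] fam_bdd)
qed

text \<open>
  The square root is continuous with exponent \<open>1/2\<close> for commutators, so that negligible ones stay negligible.
\<close>

lemma cls_sqrt_commute:
  assumes T: "fam T" "\<And>i. pos (T i)" and X: "fam X" and comm: "cls T * cls X = cls X * cls T"
  shows "cls (\<lambda>i. fc sqrt (T i)) * cls X = cls X * cls (\<lambda>i. fc sqrt (T i))"
proof -
  obtain C where C: "C > 0" "\<And>i. norm (X i) \<le> C"
    using X by (auto simp: fam_def elim: bddE)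
  note b = fam_bdd[OF T(1)] fam_bdd[OF X] fam_bdd[OF fam_sqrt(1)[OF T]]
  have n: "negl (\<lambda>i. T i * X i - X i * T i)"
    using comm b by (simp add: cls_mult[symmetric] cls_eq_iff bdd_intros)
  have "negl (\<lambda>i. fc sqrt (T i) * X i - X i * fc sqrt (T i))"
  proof (rule negl_sqrt[OF n, where K = "2 * C + 1"])
    show "norm (fc sqrt (T i) * X i - X i * fc sqrt (T i)) \<le> (2 * C + 1) * sqrt (norm (T i * X i - X i * T i))" for i
      using C(2)[of i] by (intro order_trans[OF sqrt_commutator_bound[OF T(2)] mult_right_mono]) auto
  qed (use C in simp)
  then show ?thesis
    using b by (simp add: cls_mult[symmetric] cls_eq_iff bdd_intros)
qed

text \<open>
  Asymptotic uniqueness of positive square roots: \<open>(P - Q)(P + Q)\<close> is negligible if \<open>P\<close> and \<open>Q\<close> commute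
  asymptotically and have the same square.
\<close>

lemma cls_pos_eqI:
  assumes P: "fam P" "\<And>i. pos (P i)" and Q: "fam Q" "\<And>i. pos (Q i)"
    and sq: "cls P * cls P = cls Q * cls Q" and comm: "cls P * cls Q = cls Q * cls P"
  shows "cls P = cls Q"
proof -
  note b = fam_bdd[OF P(1)] fam_bdd[OF Q(1)]
  have "cls (\<lambda>i. (P i - Q i) * (P i + Q i)) = (cls P - cls Q) * (cls P + cls Q)"
    using b by (simp add: cls_mult cls_add cls_diff bdd_intros)
  also have "\<dots> = 0"
    using sq comm by (simp add: algebra_simps)
  finally have n: "negl (\<lambda>i. (P i - Q i) * (P i + Q i))"
    using b cls_eq_iff[of "\<lambda>i. (P i - Q i) * (P i + Q i)" "\<lambda>i. 0"] by (simp add: cls_zero bdd_intros)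
  have "negl (\<lambda>i. P i - Q i)"
    by (rule negl_sqrt[OF n, where K = "sqrt 2"])
      (use pos_diff_le[OF P(2) Q(2)] in \<open>simp_all add: real_sqrt_mult\<close>)
  then show ?thesis
    using b by (simp add: cls_eq_iff)
qed

text \<open>
  Only such properties of the cut-offs at scale \<open>L\<close> and of the bounded transform are recorded as are
  invariant under conjugation, so that they pass to the transformed operator.
\<close>

definition cutoff :: "real \<Rightarrow> 'r \<Rightarrow> 'r \<Rightarrow> 'r \<Rightarrow> bool" where
  "cutoff L e f F \<longleftrightarrow> sa e \<and> sa f \<and> sa F \<and> norm e \<le> 1 \<and> norm f \<le> 1 \<and> norm F \<le> 1 \<and>
     e * f = f * e \<and> F * e = e * F \<and> F * f = f * F \<and> f * f = e - e * e \<and>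
     norm (f - F * F * f) \<le> 1 / L \<and> pos (F * f) \<and> pos (F * f * e) \<and>
     (\<forall>Y\<in>A. \<forall>M>0. norm (F * (f * Y * f) - f * Y * f * F)
        \<le> 2 * norm Y * M + 4 * (norm (e * Y - Y * e) + norm (f * Y - Y * f)) / M)"

context
  fixes e f F :: "'x \<times> real \<Rightarrow> 'r"
  assumes cut: "\<And>i. cutoff (lam i) (e i) (f i) (F i)"
begin

lemma cutoff_fam: "fam e" "fam f" "fam F"
  using cut by (auto simp: fam_def cutoff_def sa_def intro!: bddI[of _ 1])

lemmas cutoff_bdd = cutoff_fam[THEN fam_bdd]

lemma cutoff_cls:
  "cls e * cls f = cls f * cls e" "cls F * cls e = cls e * cls F" "cls F * cls f = cls f * cls F"
  "cls f * cls f = cls e - cls e * cls e" "cls F * cls F * cls f = cls f"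
proof -
  note c = cut[unfolded cutoff_def]
  show "cls e * cls f = cls f * cls e" "cls F * cls e = cls e * cls F" "cls F * cls f = cls f * cls F"
    "cls f * cls f = cls e - cls e * cls e"
    using c cutoff_bdd by (simp_all add: cls_mult[symmetric] cls_diff[symmetric] bdd_intros)
  have "norm (f i - F i * F i * f i) \<le> 1 * lam i powr (- 1)" for i
    using c[of i] lam_ge_1[of i] by (simp add: powr_minus_divide)
  then have "negl (\<lambda>i. f i - F i * F i * f i)"
    by (rule neglI[OF zero_less_one])
  then show "cls F * cls F * cls f = cls f"
    using cutoff_bdd cls_eq_iff[of f "\<lambda>i. F i * F i * f i"] by (simp add: cls_mult bdd_intros)
qed

text \<open>
  The choice \<open>M = \<Lambda>\<^sup>-\<^sup>\<theta>\<^sup>/\<^sup>2\<close> in the commutator estimate, if the commutators of \<open>Y\<close> with the cut-offs are of order \<open>\<Lambda>\<^sup>-\<^sup>\<theta>\<close>.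
\<close>

lemma cls_F_commute:
  assumes Y: "fam Y" and comm: "cls Y * cls e = cls e * cls Y" "cls Y * cls f = cls f * cls Y"
  shows "cls F * cls Y * (cls f * cls f) = cls Y * cls F * (cls f * cls f)"
proof -
  note b = cutoff_bdd fam_bdd[OF Y]
  obtain K where K: "K > 0" "\<And>i. norm (Y i) \<le> K"
    using Y by (auto simp: fam_def elim: bddE)
  have ne: "negl (\<lambda>i. e i * Y i - Y i * e i)" "negl (\<lambda>i. f i * Y i - Y i * f i)"
    using comm b by (simp_all add: cls_eq_iff[symmetric] cls_mult bdd_intros)
  have "negl (\<lambda>i. norm (e i * Y i - Y i * e i) + norm (f i * Y i - Y i * f i))"
    by (intro negl_add) (use ne in \<open>simp_all add: negl_def\<close>)
  then obtain C \<theta> where C: "C > 0" "\<theta> > 0"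
    "\<And>i. norm (norm (e i * Y i - Y i * e i) + norm (f i * Y i - Y i * f i)) \<le> C * lam i powr (- \<theta>)"
    by (rule neglE) blast
  have "negl (\<lambda>i. F i * (f i * Y i * f i) - f i * Y i * f i * F i)"
  proof (rule neglI)
    show "\<theta> / 2 > 0"
      using C by simp
    fix i :: "'x \<times> real"
    define M where "M = lam i powr (- (\<theta> / 2))"
    have M: "M > 0" "M * M = lam i powr (- \<theta>)"
      using lam_ge_1[of i] by (simp_all add: M_def powr_add[symmetric])
    have "norm (F i * (f i * Y i * f i) - f i * Y i * f i * F i)
        \<le> 2 * norm (Y i) * M + 4 * (norm (e i * Y i - Y i * e i) + norm (f i * Y i - Y i * f i)) / M"
      using cut[of i] Y M(1) unfolding cutoff_def fam_def by blast
    also have "\<dots> \<le> 2 * K * M + 4 * (C * (M * M)) / M"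
      using K(2)[of i] C(3)[of i] M by (intro add_mono mult_right_mono divide_right_mono mult_left_mono) auto
    also have "\<dots> = (2 * K + 4 * C) * M"
      using M(1) by (simp add: algebra_simps)
    finally show "norm (F i * (f i * Y i * f i) - f i * Y i * f i * F i) \<le> (2 * K + 4 * C) * lam i powr (- (\<theta> / 2))"
      by (simp add: M_def)
  qed
  then have "cls F * (cls f * cls Y * cls f) = cls f * cls Y * cls f * cls F"
    using b by (simp add: cls_eq_iff[symmetric] cls_mult bdd_intros)
  moreover have "cls f * cls Y * cls f = cls Y * (cls f * cls f)"
    by (simp only: comm(2)[symmetric] mult.assoc)
  ultimately have "cls F * (cls Y * (cls f * cls f)) = cls Y * (cls f * cls f) * cls F"
    by simp
  moreover have "cls f * cls f * cls F = cls F * (cls f * cls f)"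
    by (intro commute_mult[symmetric] cutoff_cls(3))
  ultimately show ?thesis
    by (simp only: mult.assoc)
qed

end

end

subsection \<open>Comparison of two bounded transforms\<close>

lemma left_commute_mult:
  fixes X :: "'a::semigroup_mult"
  shows "X * Y = Y * X \<Longrightarrow> X * (Y * Z) = Y * (X * Z)"
  by (metis mult.assoc)

text \<open>
  Commutation up to a factor \<open>w\<close>; it is inherited by powers and geometric sums of \<open>s\<close> if \<open>s\<close> commutes with \<open>w\<close>.
\<close>

lemma power_commute_mod:
  fixes X s w :: "'a::monoid_mult"
  assumes "X * s * w = s * X * w" "s * w = w * s"
  shows "X * s ^ n * w = s ^ n * X * w"
proof (induction n)
  case (Suc n)
  have "X * s ^ Suc n * w = X * s ^ n * (s * w)"
    by (simp only: power_Suc2 mult.assoc)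
  also have "\<dots> = (X * s ^ n * w) * s"
    by (simp only: assms(2) mult.assoc)
  also have "\<dots> = s ^ n * X * w * s"
    by (simp only: Suc)
  also have "\<dots> = s ^ n * (X * s * w)"
    by (simp only: assms(2) mult.assoc)
  also have "\<dots> = s ^ Suc n * X * w"
    unfolding assms(1) by (simp only: power_Suc2 mult.assoc)
  finally show ?case .
qed simp

lemma power_mult_commute:
  fixes X Y :: "'a::monoid_mult"
  assumes "X * Y = Y * X"
  shows "(X * Y) ^ n = X ^ n * Y ^ n"
proof (induction n)
  case (Suc n)
  have "Y * X ^ n = X ^ n * Y"
    using power_commuting_commutes[OF assms] by simp
  then show ?case
    by (simp add: Suc mult.assoc left_commute_mult[of Y "X ^ n"])
qed simp

lemma mult_geometric_sum:
  fixes x :: "'a::{ring, monoid_mult}"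
  shows "x * (\<Sum>j<n. (1 - x) ^ j) = 1 - (1 - x) ^ n"
proof (induction n)
  case (Suc n)
  have "x * (\<Sum>j<Suc n. (1 - x) ^ j) = 1 - (1 - x) ^ n + x * (1 - x) ^ n"
    by (simp add: distrib_left Suc)
  then show ?case
    by (simp add: left_diff_distrib)
qed simp

lemma geometric_sum_commute_mod:
  fixes X s w :: "'a::{ring, monoid_mult}" and n :: nat
  assumes "X * s * w = s * X * w" "s * w = w * s"
  defines "g \<equiv> \<Sum>j<n. (1 - s) ^ j"
  shows "X * g * w = g * X * w" "g * w = w * g"
proof -
  have "X * (1 - s) * w = (1 - s) * X * w" "(1 - s) * w = w * (1 - s)"
    using assms(1,2) by (simp_all add: algebra_simps)
  then have "X * (1 - s) ^ j * w = (1 - s) ^ j * X * w" "(1 - s) ^ j * w = w * (1 - s) ^ j" for j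
    by (auto intro: power_commute_mod power_commuting_commutes)
  then show "X * g * w = g * X * w" "g * w = w * g"
    by (simp_all add: g_def sum_distrib_left sum_distrib_right)
qed

context cstar_ops
begin

lemma cls_ad_commute:
  assumes X: "fam X" and Z: "\<And>i. sa (Z i)" "fam Z" and comm: "cls X * cls Z = cls Z * cls X"
  shows "cls (\<lambda>i. ad (X i)) * cls Z = cls Z * cls (\<lambda>i. ad (X i))"
proof -
  have "cls (\<lambda>i. ad (X i * Z i)) = cls (\<lambda>i. ad (Z i * X i))"
    by (rule cls_ad) (use X Z comm in \<open>simp_all add: fam_mult cls_mult fam_bdd\<close>)
  moreover have "ad (X i * Z i) = Z i * ad (X i)" "ad (Z i * X i) = ad (X i) * Z i" for i
    using X Z(1)[of i] unfolding fam_def sa_def by (metis ad_mult)+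
  ultimately show ?thesis
    using X Z(2) by (simp add: cls_mult[symmetric] fam_bdd fam_ad)
qed

context
  fixes e f F e1 f1 F1 a y :: "'x \<times> real \<Rightarrow> 'r"
  assumes cut: "\<And>i. cutoff (lam i) (e i) (f i) (F i)"
    and cut1: "\<And>i. cutoff (lam i) (e1 i) (f1 i) (F1 i)"
    and a: "fam a" "cls a * cls e = cls e * cls a" "cls a * cls f = cls f * cls a"
    and y: "fam y" "cls y * cls e = cls e * cls y" "cls y * cls f = cls f * cls y"
begin

text \<open>
  The prefix \<open>q\<close> marks classes modulo negligible families. The pair \<open>a, y\<close> stands for \<open>a\<close> and \<open>a \<mu>\<close>, with \<open>c = a a\<^sup>*\<close>
  and \<open>k = y y\<^sup>*\<close>; the index \<open>1\<close> marks the cut-offs of the transformed operator \<open>D\<^sub>1\<close>. Where \<open>D\<^sub>1\<close> corresponds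
  to \<open>\<mu> D \<mu>\<^sup>*\<close>, the operator \<open>D\<^sub>1 c e\<close> corresponds to \<open>\<Lambda> k f\<close>, which is how \<open>c e\<close> and \<open>k f\<close> form a pair.
\<close>

abbreviation "ca \<equiv> \<lambda>i. a i * ad (a i)"
abbreviation "ky \<equiv> \<lambda>i. y i * ad (y i)"
abbreviation "qe \<equiv> cls e"
abbreviation "qf \<equiv> cls f"
abbreviation "qF \<equiv> cls F"
abbreviation "qe1 \<equiv> cls e1"
abbreviation "qf1 \<equiv> cls f1"
abbreviation "qF1 \<equiv> cls F1"
definition "qc = cls ca"
definition "qk = cls ky"
definition "qkf = qk * qf"
definition "qce = qc * qe"
definition "qh = qce * qkf"
definition "qw = qe * qf"

lemma sa_cut: "sa (e i)" "sa (f i)" "sa (F i)" "sa (e1 i)" "sa (f1 i)" "sa (F1 i)"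
  using cut[of i] cut1[of i] by (auto simp: cutoff_def)

lemmas fams = cutoff_fam[OF cut] cutoff_fam[OF cut1] a(1) y(1)

lemmas bdds = fams[THEN fam_bdd]

lemma fam_ca: "fam ca" and fam_ky: "fam ky"
  by (intro fam_intros fams)+

lemmas cutoff0 = cutoff_cls[OF cut]
lemmas cutoff1 = cutoff_cls[OF cut1]

lemma c_comm: "qc * qe = qe * qc" "qc * qf = qf * qc" and k_comm: "qk * qe = qe * qk" "qk * qf = qf * qk"
  and ady_comm: "cls (\<lambda>i. ad (y i)) * qe = qe * cls (\<lambda>i. ad (y i))" "cls (\<lambda>i. ad (y i)) * qf = qf * cls (\<lambda>i. ad (y i))"
proof -
  note ad_a = cls_ad_commute[OF a(1) sa_cut(1) fams(1) a(2)] cls_ad_commute[OF a(1) sa_cut(2) fams(2) a(3)]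
  note ad_y = cls_ad_commute[OF y(1) sa_cut(1) fams(1) y(2)] cls_ad_commute[OF y(1) sa_cut(2) fams(2) y(3)]
  show "cls (\<lambda>i. ad (y i)) * qe = qe * cls (\<lambda>i. ad (y i))" "cls (\<lambda>i. ad (y i)) * qf = qf * cls (\<lambda>i. ad (y i))"
    by (rule ad_y)+
  have *: "cls (\<lambda>i. x i * ad (x i)) = cls x * cls (\<lambda>i. ad (x i))" if "fam x" for x :: "'x \<times> real \<Rightarrow> 'r"
    using that by (simp add: cls_mult fam_bdd fam_ad)
  show "qc * qe = qe * qc" "qc * qf = qf * qc"
    unfolding qc_def *[OF a(1)] by (intro commute_mult[symmetric] a(2,3)[symmetric] ad_a[symmetric])+
  show "qk * qe = qe * qk" "qk * qf = qf * qk"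
    unfolding qk_def *[OF y(1)] by (intro commute_mult[symmetric] y(2,3)[symmetric] ad_y[symmetric])+
qed

text \<open>
  Two factors \<open>f\<close> suffice for \<open>F\<close> to be moved past \<open>Y\<close>.
\<close>

lemma F_commute:
  assumes Y: "fam Y" "cls Y * qe = qe * cls Y" "cls Y * qf = qf * cls Y" and Z: "qF * Z = Z * qF"
  shows "qF * (cls Y * (qf * qf) * Z) = cls Y * (qf * qf) * Z * qF"
proof -
  have "qF * (cls Y * (qf * qf) * Z) = cls Y * qF * (qf * qf) * Z"
    using cls_F_commute[OF cut Y] by (simp only: mult.assoc[symmetric])
  also have "\<dots> = cls Y * (qf * qf * (qF * Z))"
    by (simp only: mult.assoc left_commute_mult[OF cutoff0(3)])
  finally show ?thesis
    by (simp only: Z mult.assoc)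
qed

lemma F1_commute:
  assumes Y: "fam Y" "cls Y * qe1 = qe1 * cls Y" "cls Y * qf1 = qf1 * cls Y" and Z: "qF1 * Z = Z * qF1"
  shows "qF1 * (cls Y * (qf1 * qf1) * Z) = cls Y * (qf1 * qf1) * Z * qF1"
proof -
  have "qF1 * (cls Y * (qf1 * qf1) * Z) = cls Y * qF1 * (qf1 * qf1) * Z"
    using cls_F_commute[OF cut1 Y] by (simp only: mult.assoc[symmetric])
  also have "\<dots> = cls Y * (qf1 * qf1 * (qF1 * Z))"
    by (simp only: mult.assoc left_commute_mult[OF cutoff1(3)])
  finally show ?thesis
    by (simp only: Z mult.assoc)
qed

abbreviation "kf \<equiv> \<lambda>i. ky i * f i"
abbreviation "ce \<equiv> \<lambda>i. ca i * e i"

lemma fam_kf: "fam kf" and fam_ce: "fam ce"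
  by (intro fam_intros fams)+

lemma cls_kf_ce: "cls kf = qkf" "cls ce = qce" "cls (\<lambda>i. ad (kf i)) = qkf" "cls (\<lambda>i. ad (ce i)) = qce"
proof -
  show 1: "cls kf = qkf" "cls ce = qce"
    unfolding qkf_def qce_def qc_def qk_def by (rule cls_mult; intro fam_bdd fam_ca fam_ky fams)+
  have "y i \<in> A" "a i \<in> A" "e i \<in> A" "f i \<in> A" for i
    using fams unfolding fam_def by blast+
  then have "ad (kf i) = f i * ky i" "ad (ce i) = e i * ca i" for i
    using sa_cut[of i] by (simp_all add: ad_simps in_A sa_def)
  then show "cls (\<lambda>i. ad (kf i)) = qkf" "cls (\<lambda>i. ad (ce i)) = qce"
    using fam_bdd[OF fam_ca] fam_bdd[OF fam_ky] bdds
    by (simp_all add: qkf_def qce_def cls_mult[of f] cls_mult[of e] c_comm k_comm flip: qc_def qk_def)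
qed

context
  assumes R1: "qf1 * qce = qe1 * qkf" and R2: "qce - qe1 * qce = qf1 * qkf"
begin

text \<open>
  Adjoints of the two relations, as \<open>ce\<close> and \<open>kf\<close> are asymptotically self-adjoint.
\<close>

lemma exchange_right: "qce * qf1 = qkf * qe1" "qce - qce * qe1 = qkf * qf1"
proof -
  note b = bdds fam_bdd[OF fam_kf] fam_bdd[OF fam_ce]
  have s: "kf i \<in> A" "ce i \<in> A" "ad (e1 i) = e1 i" "ad (f1 i) = f1 i" "e1 i \<in> A" "f1 i \<in> A" for i
    using fam_kf fam_ce sa_cut[of i] unfolding fam_def sa_def by blast+
  have "cls (\<lambda>i. ad (f1 i * ce i)) = cls (\<lambda>i. ad (e1 i * kf i))"
    by (rule cls_ad)
      (use R1 b in \<open>simp_all add: fam_mult fams fam_kf fam_ce cls_mult[of f1] cls_mult[of e1] cls_kf_ce\<close>)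
  then show "qce * qf1 = qkf * qe1"
    using b fam_bdd[OF fam_ad[OF fam_kf]] fam_bdd[OF fam_ad[OF fam_ce]]
    by (simp add: ad_mult s cls_mult[of _ f1] cls_mult[of _ e1] cls_kf_ce del: mult.assoc)
  have "cls (\<lambda>i. ad (ce i - e1 i * ce i)) = cls (\<lambda>i. ad (f1 i * kf i))"
    by (rule cls_ad)
      (use R2 b in \<open>simp_all add: fam_mult fam_diff fams fam_kf fam_ce cls_diff[of ce] cls_mult[of f1] cls_mult[of e1] cls_kf_ce bdd_mult\<close>)
  then show "qce - qce * qe1 = qkf * qf1"
    using b fam_bdd[OF fam_ad[OF fam_kf]] fam_bdd[OF fam_ad[OF fam_ce]]
    by (simp add: ad_mult ad_diff in_A s cls_diff bdd_mult cls_mult[of _ f1] cls_mult[of _ e1] cls_kf_ce del: mult.assoc)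
qed

lemmas exchanged = exchange_commute[OF cutoff1(1,4) R1 R2 exchange_right]

lemma F_kf_cube: "qF * (qkf * qkf * qkf) = qkf * qkf * qkf * qF" and F_ce_kf_kf: "qF * (qce * qkf * qkf) = qce * qkf * qkf * qF"
proof -
  have kx: "qf * qk = qk * qf" "qe * qk = qk * qe" "qe * qf = qf * qe" "qf * (qk * Z) = qk * (qf * Z)" "qe * (qk * Z) = qk * (qe * Z)" "qe * (qf * Z) = qf * (qe * Z)" for Z
    using k_comm cutoff0(1) left_commute_mult[of qf qk] left_commute_mult[of qe qk] left_commute_mult[of qe qf] by simp_all
  have k3: "cls (\<lambda>i. ky i ^ 3) = qk ^ 3"
    unfolding cls_power[OF fam_bdd[OF fam_ky]] qk_def ..
  have 1: "qkf * qkf * qkf = cls (\<lambda>i. ky i ^ 3) * (qf * qf) * qf"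
    unfolding k3 unfolding qkf_def power3_eq_cube by (simp only: mult.assoc kx)
  show "qF * (qkf * qkf * qkf) = qkf * qkf * qkf * qF"
    unfolding 1
  proof (rule F_commute)
    show "cls (\<lambda>i. ky i ^ 3) * qe = qe * cls (\<lambda>i. ky i ^ 3)" "cls (\<lambda>i. ky i ^ 3) * qf = qf * cls (\<lambda>i. ky i ^ 3)"
      unfolding k3 by (rule power_commuting_commutes, rule k_comm)+
  qed (intro fam_power fam_ky cutoff0)+
  have c2: "cls (\<lambda>i. ca i * ky i ^ 2) = qc * qk ^ 2"
    using cls_mult[OF fam_bdd[OF fam_ca] bdd_power[OF fam_bdd[OF fam_ky]], of 2]
      cls_power[OF fam_bdd[OF fam_ky], of 2] by (simp only: qc_def qk_def)
  have 2: "qce * qkf * qkf = cls (\<lambda>i. ca i * ky i ^ 2) * (qf * qf) * qe"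
    unfolding c2 unfolding qkf_def qce_def power2_eq_square by (simp only: mult.assoc kx)
  show "qF * (qce * qkf * qkf) = qce * qkf * qkf * qF"
    unfolding 2
  proof (rule F_commute)
    show "cls (\<lambda>i. ca i * ky i ^ 2) * qe = qe * cls (\<lambda>i. ca i * ky i ^ 2)"
      "cls (\<lambda>i. ca i * ky i ^ 2) * qf = qf * cls (\<lambda>i. ca i * ky i ^ 2)"
      unfolding c2 by (rule commute_mult[symmetric], rule c_comm[symmetric], rule power_commuting_commutes[symmetric], rule k_comm)+
  qed (intro fam_power fam_mult fam_ky fam_ca cutoff0)+
qed

text \<open>
  Multiplying the exchange relations by \<open>(kf)\<^sup>2 F\<close>, which can be done on either side, gives exchange
  relations again, and these force \<open>(kf)\<^sup>3 F\<close> to commute with the cut-offs of \<open>D\<^sub>1\<close>.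
\<close>

lemma F_exchanged: "qkf * qkf * qkf * qF * qe1 = qe1 * (qkf * qkf * qkf * qF)" "qkf * qkf * qkf * qF * qf1 = qf1 * (qkf * qkf * qkf * qF)"
proof -
  have "qce * qkf * qkf = qkf * qkf * qce"
    using commute_mult[OF exchanged(5)[symmetric] exchanged(5)[symmetric]] by (simp only: mult.assoc)
  then have QP: "qce * qkf * qkf * qF = qF * (qkf * qkf * qce)"
    using F_ce_kf_kf by simp
  note * = exchange_commute[OF cutoff1(1,4), of "qce * qkf * qkf * qF" "qkf * qkf * qkf * qF"]
  have 1: "qf1 * (qce * qkf * qkf * qF) = qe1 * (qkf * qkf * qkf * qF)"
    using R1 by (simp only: mult.assoc[symmetric])
  have 2: "qce * qkf * qkf * qF - qe1 * (qce * qkf * qkf * qF) = qf1 * (qkf * qkf * qkf * qF)"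
  proof -
    have "qce * qkf * qkf * qF - qe1 * (qce * qkf * qkf * qF) = (qce - qe1 * qce) * (qkf * qkf * qF)"
      by (simp only: left_diff_distrib mult.assoc)
    then show ?thesis
      unfolding R2 by (simp only: mult.assoc)
  qed
  have 3: "qce * qkf * qkf * qF * qf1 = qkf * qkf * qkf * qF * qe1"
    unfolding QP using exchange_right(1) F_kf_cube by (simp only: mult.assoc) (simp only: mult.assoc[symmetric])
  have 4: "qce * qkf * qkf * qF - qce * qkf * qkf * qF * qe1 = qkf * qkf * qkf * qF * qf1"
  proof -
    have "qce * qkf * qkf * qF - qce * qkf * qkf * qF * qe1 = qF * (qkf * qkf) * (qce - qce * qe1)"
      unfolding QP by (simp only: right_diff_distrib mult.assoc)
    then show ?thesis
      unfolding exchange_right(2) using F_kf_cube by (simp only: mult.assoc[symmetric])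
  qed
  show "qkf * qkf * qkf * qF * qe1 = qe1 * (qkf * qkf * qkf * qF)" "qkf * qkf * qkf * qF * qf1 = qf1 * (qkf * qkf * qkf * qF)"
    by (rule *[OF 1 2 3 4])+
qed

lemma in_and_ad: "a i \<in> A" "y i \<in> A" "e i \<in> A" "f i \<in> A" "F i \<in> A" "e1 i \<in> A" "f1 i \<in> A" "F1 i \<in> A"
  "ad (e i) = e i" "ad (f i) = f i" "ad (F i) = F i" "ad (e1 i) = e1 i" "ad (f1 i) = f1 i" "ad (F1 i) = F1 i"
  using fams sa_cut[of i] unfolding fam_def sa_def by blast+

text \<open>
  The exchange relations give \<open>h = f\<^sub>1 B\<close> for \<open>B = (kf)\<^sup>2 + (ce)\<^sup>2\<close>, which commutes with \<open>e\<^sub>1\<close> and \<open>f\<^sub>1\<close>. Up to negligible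
  terms \<open>F\<^sub>1 h\<^sup>3\<close> is therefore the compression of the positive operator \<open>F\<^sub>1 f\<^sub>1\<^sup>3\<close> by \<open>B\<^sup>3\<^sup>/\<^sup>2\<close>.
\<close>

lemma pos_representative_1:
  obtains N where "fam N" "\<And>i. pos (N i)" "cls N = qF1 * qh ^ 3" "cls N = qh ^ 3 * qF1" "qh ^ 3 = qf1 * (qf1 * qf1 * (qkf * qkf + qce * qce) ^ 3)"
proof -
  define B where "B i = ad (kf i) * kf i + ad (ce i) * ce i" for i
  define b where "b i = fc sqrt (B i)" for i
  have AC: "kf i \<in> A" "ce i \<in> A" for i
    by (simp_all add: in_A in_and_ad)
  have B: "fam B" "pos (B i)" for i
    unfolding B_def by (intro fam_intros fams) (intro pos_add pos_ad_mult AC)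
  have B_cls: "cls B = qkf * qkf + qce * qce"
    unfolding B_def using fam_bdd[OF fam_kf] fam_bdd[OF fam_ce] fam_bdd[OF fam_ad[OF fam_kf]] fam_bdd[OF fam_ad[OF fam_ce]]
      cls_add[of "\<lambda>i. ad (kf i) * kf i" "\<lambda>i. ad (ce i) * ce i"] cls_mult[of "\<lambda>i. ad (kf i)" kf] cls_mult[of "\<lambda>i. ad (ce i)" ce]
    by (simp only: cls_kf_ce bdd_mult)
  define \<beta> where "\<beta> = cls b"
  have b: "fam b" "\<beta> * \<beta> = qkf * qkf + qce * qce"
    using fam_sqrt[OF B] unfolding b_def \<beta>_def B_cls by blast+
  have BE: "cls B * qe1 = qe1 * cls B" "cls B * qf1 = qf1 * cls B"
    unfolding B_cls distrib_left distrib_right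
    by (intro arg_cong2[where f = plus] commute_mult[symmetric] exchanged(1-4)[symmetric])+
  have bE: "\<beta> * qe1 = qe1 * \<beta>" "\<beta> * qf1 = qf1 * \<beta>"
    using cls_sqrt_commute[OF B fams(4) BE(1)] cls_sqrt_commute[OF B fams(5) BE(2)]
    unfolding b_def \<beta>_def by simp_all
  have hB: "qh = qf1 * (\<beta> * \<beta>)"
  proof -
    have "qf1 * (\<beta> * \<beta>) = qf1 * qkf * qkf + qf1 * qce * qce"
      unfolding b(2) by (simp only: distrib_left mult.assoc)
    also have "\<dots> = qce * qkf - qe1 * (qce * qkf) + qe1 * (qkf * qce)"
      unfolding R1 R2[symmetric] by (simp only: left_diff_distrib mult.assoc)
    finally show ?thesis
      unfolding qh_def exchanged(5) by simp
  qed
  have bp: "cls (\<lambda>i. b i ^ n) = \<beta> ^ n" for n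
    unfolding \<beta>_def by (rule cls_power[OF fam_bdd[OF b(1)]])
  have bpE: "\<beta> ^ n * qe1 = qe1 * \<beta> ^ n" "\<beta> ^ n * qf1 = qf1 * \<beta> ^ n" for n
    by (rule power_commuting_commutes, rule bE)+
  have h3: "qh ^ 3 = qf1 ^ 3 * (\<beta> * \<beta>) ^ 3"
    unfolding hB by (rule power_mult_commute) (intro commute_mult bE[symmetric])
  have "(\<beta> * \<beta>) ^ 3 = \<beta> ^ 3 * \<beta> ^ 3" "(\<beta> * \<beta>) ^ 3 = \<beta> ^ 6"
    by (simp_all add: power2_eq_square[symmetric] power_mult[symmetric] power_add[symmetric])
  note b6 = this
  have h3': "qh ^ 3 = \<beta> ^ 6 * (qf1 * qf1) * qf1" "qh ^ 3 = \<beta> ^ 3 * (qf1 * qf1) * qf1 * \<beta> ^ 3"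
  proof -
    have g: "qf1 ^ 3 * \<beta> ^ n = \<beta> ^ n * (qf1 * qf1) * qf1" for n
      by (simp only: power3_eq_cube mult.assoc bpE(2)[symmetric] left_commute_mult[OF bpE(2)[symmetric]])
    show "qh ^ 3 = \<beta> ^ 6 * (qf1 * qf1) * qf1"
      unfolding h3 b6(2) by (rule g)
    have "qh ^ 3 = qf1 ^ 3 * \<beta> ^ 3 * \<beta> ^ 3"
      unfolding h3 b6(1) by (simp only: mult.assoc)
    then show "qh ^ 3 = \<beta> ^ 3 * (qf1 * qf1) * qf1 * \<beta> ^ 3"
      unfolding g .
  qed
  define N where "N i = ad (b i ^ 3) * (ad (f1 i) * (F1 i * f1 i) * f1 i) * b i ^ 3" for i
  have bA: "b i ^ 3 \<in> A" "ad (b i ^ 3) = b i ^ 3" for i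
    using sqrt_fc(1)[OF B(2)[of i]] by (auto simp: b_def sa_def in_A ad_power)
  have fN: "fam N"
    unfolding N_def by (intro fam_intros fams b)
  have pN: "pos (N i)" for i
  proof -
    have "pos (F1 i * f1 i)"
      using cut1[of i] unfolding cutoff_def by blast
    then show ?thesis
      unfolding N_def by (intro pos_sandwich bA in_and_ad)
  qed
  have b3: "bdd (\<lambda>i. b i ^ 3)"
    by (intro bdd_power fam_bdd b)
  have "cls N = \<beta> ^ 3 * (qf1 * (qF1 * qf1) * qf1) * \<beta> ^ 3"
    unfolding N_def bA(2) in_and_ad using b3 bdds by (simp only: cls_mult bdd_mult bp)
  also have "\<dots> = \<beta> ^ 3 * qF1 * (qf1 * qf1) * qf1 * \<beta> ^ 3"
    by (simp only: mult.assoc cutoff1(3) left_commute_mult[OF cutoff1(3)])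
  also have "\<dots> = qF1 * qh ^ 3"
    unfolding h3'(2) using cls_F_commute[OF cut1 fam_power[OF b(1)], of 3, unfolded bp, OF bpE]
    by (simp only: mult.assoc[symmetric])
  finally have N1: "cls N = qF1 * qh ^ 3" .
  have N2: "cls N = qh ^ 3 * qF1"
    unfolding N1 h3'(1) using F1_commute[OF fam_power[OF b(1)], of 6 qf1, unfolded bp, OF bpE cutoff1(3)] .
  have "qh ^ 3 = qf1 * (qf1 * qf1 * (qkf * qkf + qce * qce) ^ 3)"
    unfolding h3 b(2) by (simp only: power3_eq_cube mult.assoc)
  then show ?thesis
    by (rule that[OF fN pN N1 N2])
qed

lemma w_comm: "qc * qw = qw * qc" "qk * qw = qw * qk" "qk * qc * qw = qc * qk * qw"
proof -
  show qc: "qc * qw = qw * qc" and qk: "qk * qw = qw * qk"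
    unfolding qw_def by (rule commute_mult; rule c_comm k_comm)+
  have "qkf * qce = qk * (qc * qw)" "qce * qkf = qc * (qk * qw)"
    unfolding qkf_def qce_def qw_def
    by (simp_all only: mult.assoc cutoff0(1)[symmetric] left_commute_mult[OF c_comm(2)[symmetric]]
        left_commute_mult[OF k_comm(1)[symmetric]])
  then show "qk * qc * qw = qc * qk * qw"
    using exchanged(5) by (simp add: mult.assoc)
qed

lemma h_cube: "qh ^ 3 = qc ^ 3 * qk ^ 3 * qw ^ 3"
proof -
  have "qh = qc * qk * qw"
    unfolding qh_def qkf_def qce_def qw_def using k_comm(2)[symmetric] by (simp only: mult.assoc left_commute_mult[OF k_comm(1)[symmetric]])
  then show ?thesis
    using cube_mult[OF w_comm] by simp
qed

lemma w_cube: "qw ^ 3 = qf * qf * (qf * qe ^ 3)"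
proof -
  have "qe * qf ^ 3 = qf ^ 3 * qe"
    using power_commuting_commutes[of qf qe 3] cutoff0(1) by simp
  then have "qe ^ 3 * qf ^ 3 = qf ^ 3 * qe ^ 3"
    by (rule power_commuting_commutes)
  then show ?thesis
    unfolding qw_def power_mult_commute[OF cutoff0(1)] by (simp only: power3_eq_cube[of qf] mult.assoc)
qed

text \<open>
  Here \<open>h\<^sup>3 = c\<^sup>3 k\<^sup>3 w\<^sup>3\<close> with \<open>w = e f\<close>, and \<open>F h\<^sup>3\<close> is represented by compressing the positive \<open>F f e\<close>. As \<open>c\<close> and \<open>k\<close>
  commute only up to the factor \<open>w\<close>, this is done in two stages: the inner compression by \<open>y\<^sup>* k\<close> produces
  \<open>k y y\<^sup>* k = k\<^sup>3\<close>, and the outer one by \<open>\<surd>c\<^sup>3\<close> supplies the powers of \<open>c\<close>.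
\<close>

lemma pos_representative:
  obtains N where "fam N" "\<And>i. pos (N i)" "cls N = qF * qh ^ 3" "cls N = qh ^ 3 * qF"
proof -
  define s where "s i = fc sqrt (ca i)" for i
  have ca: "pos (ca i)" for i
    using pos_ad_mult[of "ad (a i)"] in_and_ad[of i] by (simp add: in_A ad_simps)
  have s: "fam s"
    using fam_sqrt(1)[OF fam_ca ca] unfolding s_def by blast
  define \<sigma> where "\<sigma> = cls s"
  have ss: "\<sigma> * \<sigma> = qc"
    using fam_sqrt(2)[OF fam_ca ca] unfolding s_def \<sigma>_def qc_def by blast
  have sE: "\<sigma> * qe = qe * \<sigma>" "\<sigma> * qf = qf * \<sigma>"
    using cls_sqrt_commute[OF fam_ca ca fams(1)] cls_sqrt_commute[OF fam_ca ca fams(2)] c_comm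
    unfolding s_def \<sigma>_def qc_def by simp_all
  have sw: "\<sigma> * qw = qw * \<sigma>"
    unfolding qw_def by (intro commute_mult sE)
  have kw_cls: "cls (\<lambda>i. ky i * (e i * f i)) = qk * qw"
    using fam_bdd[OF fam_ky] bdds cls_mult[of ky "\<lambda>i. e i * f i"] by (simp only: cls_mult[of e f] bdd_mult qw_def qk_def)
  have "qc * (qk * qw) = qk * qw * qc"
    using w_comm by (simp only: mult.assoc) (simp only: mult.assoc[symmetric])
  then have "\<sigma> * (qk * qw) = qk * qw * \<sigma>"
    using cls_sqrt_commute[OF fam_ca ca, of "\<lambda>i. ky i * (e i * f i)"] fam_mult[OF fam_ky fam_mult[OF fams(1,2)]]
    unfolding s_def \<sigma>_def qc_def kw_cls by blast
  then have "qk * \<sigma> * qw = \<sigma> * qk * qw"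
    by (simp only: mult.assoc sw)
  from power_commute_mod[OF power_commute_mod[OF this sw, of 3, symmetric] w_comm(2), of 3]
  have ks: "\<sigma> ^ 3 * qk ^ 3 * qw = qk ^ 3 * \<sigma> ^ 3 * qw" .
  define V where "V = qF * qw ^ 3"
  have Tw: "qF * qw ^ 3 = qw ^ 3 * qF"
    unfolding qw_def by (intro power_commuting_commutes[symmetric] commute_mult[symmetric] cutoff0(2,3))
  have V: "V * cls X = cls X * V" if X: "fam X" "cls X * qe = qe * cls X" "cls X * qf = qf * cls X" for X
  proof -
    have Xw: "cls X * qw ^ 3 = qw ^ 3 * cls X"
      unfolding qw_def by (intro power_commuting_commutes[symmetric] commute_mult[symmetric] commute_mult X)
    have "V * cls X = qF * (cls X * (qf * qf) * (qf * qe ^ 3))"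
      unfolding V_def by (simp only: mult.assoc Xw[symmetric]) (simp only: w_cube mult.assoc)
    also have "\<dots> = cls X * (qf * qf) * (qf * qe ^ 3) * qF"
      by (intro F_commute X commute_mult cutoff0 power_commuting_commutes[symmetric]) (simp add: cutoff0)
    also have "\<dots> = cls X * (qw ^ 3 * qF)"
      by (simp only: w_cube mult.assoc)
    finally show ?thesis
      by (simp only: V_def Tw)
  qed
  define X where "X i = ad (y i) * ky i" for i
  define Po where "Po i = ad (e i * f i) * (F i * f i * e i) * (e i * f i)" for i
  define N where "N i = ad (s i ^ 3) * (ad (X i) * Po i * X i) * s i ^ 3" for i
  have sA: "s i ^ 3 \<in> A" "ad (s i ^ 3) = s i ^ 3" for i
    using sqrt_fc(1)[OF ca[of i]] by (auto simp: s_def sa_def in_A ad_power)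
  have XA: "X i \<in> A" "ad (X i) = ky i * y i" for i
    using in_and_ad[of i] by (simp_all add: X_def in_A ad_simps mult.assoc)
  have fX: "fam X" and fP: "fam Po"
    unfolding X_def Po_def by (intro fam_intros fams)+
  have fN: "fam N"
    unfolding N_def by (intro fam_intros fX fP s)
  have pN: "pos (N i)" for i
  proof -
    have "pos (F i * f i * e i)"
      using cut[of i] unfolding cutoff_def by blast
    then show ?thesis
      unfolding N_def Po_def by (intro pos_sandwich sA XA in_A in_and_ad)
  qed
  define y1 where "y1 = cls y"
  define y2 where "y2 = cls (\<lambda>i. ad (y i))"
  have yy: "y1 * y2 = qk"
    unfolding y1_def y2_def qk_def by (rule cls_mult[symmetric]) (intro fam_bdd fam_ad fams)+
  have Po_cls: "cls Po = V"
  proof -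
    have "ad (e i * f i) = f i * e i" for i
      using in_and_ad[of i] by (simp add: ad_mult)
    then have "cls Po = qf * qe * (qF * qf * qe) * (qe * qf)"
      unfolding Po_def using bdds by (simp only: cls_mult bdd_mult)
    also have "\<dots> = V"
      unfolding V_def w_cube unfolding power3_eq_cube
      by (simp only: mult.assoc cutoff0(1) cutoff0(2,3)[symmetric] left_commute_mult[OF cutoff0(1)] left_commute_mult[OF cutoff0(2)[symmetric]] left_commute_mult[OF cutoff0(3)[symmetric]])
    finally show ?thesis .
  qed
  have "cls N = \<sigma> ^ 3 * (qk * y1 * V * (y2 * qk)) * \<sigma> ^ 3"
  proof -
    have "cls X = y2 * qk" "cls (\<lambda>i. ad (X i)) = qk * y1"
      unfolding XA(2) unfolding X_def y1_def y2_def qk_def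
      by (rule cls_mult; intro fam_bdd fam_ky fam_ad fams)+
    moreover have "cls (\<lambda>i. s i ^ 3) = \<sigma> ^ 3"
      unfolding \<sigma>_def by (rule cls_power[OF fam_bdd[OF s]])
    ultimately show ?thesis
      unfolding N_def sA(2) using fam_bdd[OF fX] fam_bdd[OF fam_ad[OF fX]] fam_bdd[OF fP] fam_bdd[OF fam_power[OF s]]
      by (simp only: cls_mult bdd_mult Po_cls)
  qed
  also have "\<dots> = \<sigma> ^ 3 * (qk * (y1 * y2) * qk * \<sigma> ^ 3) * V"
  proof -
    have "V * y2 = y2 * V" "V * qk = qk * V" "V * \<sigma> ^ 3 = \<sigma> ^ 3 * V"
      using V[OF fam_ad[OF y(1)] ady_comm] V[OF fam_ky] V[OF s] k_comm sE
        power_commuting_commutes[of \<sigma> V 3] by (simp_all add: y2_def qk_def \<sigma>_def)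
    then show ?thesis
      by (simp add: mult.assoc left_commute_mult[of V y2] left_commute_mult[of V qk])
  qed
  also have "\<dots> = \<sigma> ^ 3 * (qk ^ 3 * \<sigma> ^ 3 * qw) * (qw * qw * qF)"
    unfolding yy V_def Tw by (simp only: power3_eq_cube mult.assoc)
  also have "\<dots> = (\<sigma> * \<sigma>) ^ 3 * qk ^ 3 * qw ^ 3 * qF"
    unfolding ks[symmetric] power_mult_commute[OF refl] by (simp only: power3_eq_cube mult.assoc)
  finally have N: "cls N = qh ^ 3 * qF"
    unfolding ss h_cube .
  have ck3: "cls (\<lambda>i. ca i ^ 3 * ky i ^ 3) = qc ^ 3 * qk ^ 3"
    using cls_mult[OF bdd_power[OF fam_bdd[OF fam_ca]] bdd_power[OF fam_bdd[OF fam_ky]], of 3 3]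
      cls_power[OF fam_bdd[OF fam_ca], of 3] cls_power[OF fam_bdd[OF fam_ky], of 3] by (simp only: qc_def qk_def)
  have "qF * (cls (\<lambda>i. ca i ^ 3 * ky i ^ 3) * (qf * qf) * (qf * qe ^ 3))
      = cls (\<lambda>i. ca i ^ 3 * ky i ^ 3) * (qf * qf) * (qf * qe ^ 3) * qF"
  proof (rule F_commute)
    show "fam (\<lambda>i. ca i ^ 3 * ky i ^ 3)"
      by (intro fam_intros fams)
    show "cls (\<lambda>i. ca i ^ 3 * ky i ^ 3) * qe = qe * cls (\<lambda>i. ca i ^ 3 * ky i ^ 3)"
      "cls (\<lambda>i. ca i ^ 3 * ky i ^ 3) * qf = qf * cls (\<lambda>i. ca i ^ 3 * ky i ^ 3)"
      unfolding ck3 by (rule commute_mult[symmetric]; rule power_commuting_commutes[symmetric]; rule c_comm k_comm)+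
    show "qF * (qf * qe ^ 3) = qf * qe ^ 3 * qF"
      by (intro commute_mult cutoff0 power_commuting_commutes[symmetric]) (simp add: cutoff0)
  qed
  then have "qF * qh ^ 3 = qh ^ 3 * qF"
    unfolding ck3 h_cube w_cube by (simp only: mult.assoc)
  with that[OF fN pN] N show ?thesis
    by simp
qed

text \<open>
  \<open>F\<^sub>1 h\<^sup>3\<close> and \<open>F h\<^sup>3\<close> are asymptotically positive, and both have the square \<open>h\<^sup>6\<close>, because \<open>F\<^sup>2 f = f\<close> and \<open>F\<^sub>1\<^sup>2 f\<^sub>1 = f\<^sub>1\<close>
  up to negligible terms. They also commute: \<open>F\<^sub>1\<close> commutes with \<open>(kf)\<^sup>3 F\<close> up to the factor \<open>f\<^sub>1\<^sup>2\<close>. Hence they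
  agree by uniqueness of positive square roots.
\<close>

lemma bounded_transforms_agree: "(qF1 - qF) * qh ^ 3 = 0"
proof -
  obtain N where N: "fam N" "\<And>i. pos (N i)" "cls N = qF1 * qh ^ 3" "cls N = qh ^ 3 * qF1"
    and h1: "qh ^ 3 = qf1 * (qf1 * qf1 * (qkf * qkf + qce * qce) ^ 3)"
    by (rule pos_representative_1) blast
  obtain N' where N': "fam N'" "\<And>i. pos (N' i)" "cls N' = qF * qh ^ 3" "cls N' = qh ^ 3 * qF"
    by (rule pos_representative) blast
  have "cls N = cls N'"
  proof (rule cls_pos_eqI[OF N(1,2) N'(1,2)])
    have "qh ^ 3 * qF1 * (qF1 * qh ^ 3) = qh ^ 3 * (qF1 * qF1 * qf1 * (qf1 * qf1 * (qkf * qkf + qce * qce) ^ 3))"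
      by (subst (2) h1) (simp only: mult.assoc)
    also have "\<dots> = qh ^ 3 * qh ^ 3"
      by (simp only: cutoff1(5) h1[symmetric])
    finally have 1: "cls N * cls N = qh ^ 3 * qh ^ 3"
      using N(3,4) by simp
    have h0: "qh ^ 3 = qf * (qc ^ 3 * qk ^ 3 * (qf * (qf * qe ^ 3)))"
    proof -
      have "qc ^ 3 * qk ^ 3 * qf = qf * (qc ^ 3 * qk ^ 3)"
        by (rule commute_mult[symmetric]; rule power_commuting_commutes[symmetric]; rule c_comm k_comm)
      moreover have "qh ^ 3 = qc ^ 3 * qk ^ 3 * qf * (qf * (qf * qe ^ 3))"
        unfolding h_cube w_cube by (simp only: mult.assoc)
      ultimately show ?thesis
        by (simp only: mult.assoc)
    qed
    have "qh ^ 3 * qF * (qF * qh ^ 3) = qh ^ 3 * (qF * qF * qf * (qc ^ 3 * qk ^ 3 * (qf * (qf * qe ^ 3))))"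
      by (subst (2) h0) (simp only: mult.assoc)
    also have "\<dots> = qh ^ 3 * qh ^ 3"
      by (simp only: cutoff0(5) h0[symmetric])
    finally have "cls N' * cls N' = qh ^ 3 * qh ^ 3"
      using N'(3,4) by simp
    with 1 show "cls N * cls N = cls N' * cls N'"
      by simp
    define Z where "Z = qce ^ 3 * (qf1 * (qkf * qkf + qce * qce) ^ 3)"
    have hh: "qh ^ 3 * qh ^ 3 = qkf ^ 3 * (qf1 * qf1) * Z"
    proof -
      have "qce ^ 3 * qf1 = qf1 * qce ^ 3"
        by (rule power_commuting_commutes[OF exchanged(4)])
      then have sort: "qkf ^ 3 * qce ^ 3 * (qf1 * (qf1 * qf1 * X)) = qkf ^ 3 * (qf1 * qf1) * (qce ^ 3 * (qf1 * X))" for X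
        by (simp only: mult.assoc left_commute_mult[of "qce ^ 3" qf1])
      have hpq: "qh ^ 3 = qkf ^ 3 * qce ^ 3"
        unfolding qh_def exchanged(5)[symmetric] by (rule power_mult_commute[OF exchanged(5)])
      have "qh ^ 3 * qh ^ 3 = qkf ^ 3 * qce ^ 3 * (qf1 * (qf1 * qf1 * (qkf * qkf + qce * qce) ^ 3))"
        by (simp only: hpq[symmetric] h1[symmetric])
      then show ?thesis
        unfolding sort Z_def .
    qed
    have TP: "qF * qkf ^ 3 = qkf ^ 3 * qF"
      using F_kf_cube by (simp only: power3_eq_cube)
    have A3: "cls (\<lambda>i. kf i ^ 3) = qkf ^ 3"
      using cls_power[OF fam_bdd[OF fam_kf], of 3] by (simp only: cls_kf_ce)
    have A3F: "cls (\<lambda>i. kf i ^ 3 * F i) = qkf ^ 3 * qF"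
      using cls_mult[OF bdd_power[OF fam_bdd[OF fam_kf]] bdds(3), of 3] by (simp only: A3)
    have 2: "qF1 * qkf ^ 3 * (qf1 * qf1) = qkf ^ 3 * qF1 * (qf1 * qf1)"
      using cls_F_commute[OF cut1 fam_power[OF fam_kf], of 3] power_commuting_commutes[OF exchanged(1)] power_commuting_commutes[OF exchanged(2)]
      by (simp only: A3)
    have 3: "qF1 * (qkf ^ 3 * qF) * (qf1 * qf1) = qkf ^ 3 * qF * qF1 * (qf1 * qf1)"
      using cls_F_commute[OF cut1 fam_mult[OF fam_power[OF fam_kf] fams(3)], of 3] F_exchanged[folded power3_eq_cube]
      by (simp only: A3F)
    have "qF1 * qF * (qh ^ 3 * qh ^ 3) = qF1 * (qkf ^ 3 * qF) * (qf1 * qf1) * Z"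
      unfolding hh by (simp only: TP[symmetric] mult.assoc)
    also have "\<dots> = qF * (qkf ^ 3 * qF1 * (qf1 * qf1)) * Z"
      unfolding 3 by (simp only: TP[symmetric] mult.assoc)
    also have "\<dots> = qF * qF1 * (qh ^ 3 * qh ^ 3)"
      unfolding 2[symmetric] hh by (simp only: mult.assoc)
    finally have key: "qF1 * qF * (qh ^ 3 * qh ^ 3) = qF * qF1 * (qh ^ 3 * qh ^ 3)" .
    have hT: "qh ^ 3 * qF1 = qF1 * qh ^ 3" "qh ^ 3 * qF = qF * qh ^ 3"
      using N(3,4) N'(3,4) by simp_all
    have "cls N * cls N' = qF1 * (qh ^ 3 * qF) * qh ^ 3" "cls N' * cls N = qF * (qh ^ 3 * qF1) * qh ^ 3"
      unfolding N(3) N'(3) by (simp_all only: mult.assoc)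
    then show "cls N * cls N' = cls N' * cls N"
      using key unfolding hT by (simp only: mult.assoc)
  qed
  then show ?thesis
    unfolding N(3) N'(3) by (simp add: left_diff_distrib)
qed

text \<open>
  Since \<open>c\<close> and \<open>k\<close> commute up to the factor \<open>w\<close>, they may be replaced by polynomials in \<open>c\<close> and \<open>k\<close>
  that are divisible by them.
\<close>

lemma approximate_units_agree:
  "(qF1 - qF) * ((1 - (1 - qc) ^ n) ^ 3 * (1 - (1 - qk) ^ n) ^ 3 * qw ^ 3) = 0"
proof -
  define g where "g = (\<Sum>j<n. (1 - qc) ^ j)"
  define l where "l = (\<Sum>j<n. (1 - qk) ^ j)"
  note gK = geometric_sum_commute_mod[OF w_comm(3,1), of n, folded g_def]
  have g3: "qk * g ^ 3 * qw = g ^ 3 * qk * qw" "g ^ 3 * qw = qw * g ^ 3"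
    by (rule power_commute_mod[OF gK]) (rule power_commuting_commutes[OF gK(2)])
  note gl = geometric_sum_commute_mod[OF g3(1)[symmetric] w_comm(2), of n, folded l_def]
  have l3: "g ^ 3 * l ^ 3 * qw = l ^ 3 * g ^ 3 * qw" "l ^ 3 * qw = qw * l ^ 3"
    by (rule power_commute_mod[OF gl]) (rule power_commuting_commutes[OF gl(2)])
  have K3: "g ^ 3 * qk ^ 3 * qw = qk ^ 3 * g ^ 3 * qw"
    by (rule power_commute_mod[OF g3(1)[symmetric] w_comm(2)])
  have swap: "g ^ 3 * (qk ^ 3 * l ^ 3) * qw = qk ^ 3 * qw * (l ^ 3 * g ^ 3)"
  proof -
    have "g ^ 3 * (qk ^ 3 * l ^ 3) * qw = g ^ 3 * qk ^ 3 * qw * l ^ 3"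
      by (simp only: mult.assoc l3(2))
    also have "\<dots> = qk ^ 3 * (g ^ 3 * l ^ 3 * qw)"
      unfolding K3 by (simp only: mult.assoc l3(2))
    also have "\<dots> = qk ^ 3 * qw * (l ^ 3 * g ^ 3)"
      unfolding l3(1) by (simp only: mult.assoc g3(2) left_commute_mult[OF l3(2)])
    finally show ?thesis .
  qed
  have cg: "qc * g = g * qc" and kl: "qk * l = l * qk"
    unfolding g_def l_def sum_distrib_left sum_distrib_right
    by (intro sum.cong refl power_commuting_commutes[symmetric], simp add: algebra_simps)+
  have w_w: "X * qw ^ 3 = X * qw * (qw * qw)" for X
    by (simp only: power3_eq_cube mult.assoc)
  have "(1 - (1 - qc) ^ n) ^ 3 * (1 - (1 - qk) ^ n) ^ 3 * qw ^ 3 = (qc ^ 3 * g ^ 3) * (qk ^ 3 * l ^ 3) * qw ^ 3"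
    unfolding mult_geometric_sum[symmetric] g_def[symmetric] l_def[symmetric] power_mult_commute[OF cg] power_mult_commute[OF kl] ..
  also have "\<dots> = qc ^ 3 * (g ^ 3 * (qk ^ 3 * l ^ 3) * qw) * (qw * qw)"
    by (simp only: power3_eq_cube[of qw] mult.assoc)
  also have "\<dots> = qc ^ 3 * qk ^ 3 * qw ^ 3 * (l ^ 3 * g ^ 3)"
  proof -
    have "l ^ 3 * g ^ 3 * qw = qw * (l ^ 3 * g ^ 3)"
      by (simp only: mult.assoc g3(2) left_commute_mult[OF l3(2)])
    then have "l ^ 3 * g ^ 3 * (qw * qw) = qw * qw * (l ^ 3 * g ^ 3)"
      by (intro commute_mult)
    then show ?thesis
      unfolding swap by (simp only: power3_eq_cube[of qw] mult.assoc)
  qed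
  finally have "(qF1 - qF) * ((1 - (1 - qc) ^ n) ^ 3 * (1 - (1 - qk) ^ n) ^ 3 * qw ^ 3)
      = (qF1 - qF) * qh ^ 3 * (l ^ 3 * g ^ 3)"
    unfolding h_cube by (simp only: mult.assoc)
  then show ?thesis
    unfolding bounded_transforms_agree by simp
qed

end

text \<open>
  If \<open>(e, f, F)\<close> and \<open>(e\<^sub>1, f\<^sub>1, F\<^sub>1)\<close> belong to two operators related by a conformal factor, the
  bounded transforms agree asymptotically on the part where \<open>a a\<^sup>*\<close>, \<open>y y\<^sup>*\<close> and the cut-offs are
  bounded below.
\<close>

theorem negl_bounded_transforms:
  assumes R1: "negl (\<lambda>i. f1 i * ce i - e1 i * kf i)" and R2: "negl (\<lambda>i. ce i - e1 i * ce i - f1 i * kf i)"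
  shows "negl (\<lambda>i. (F1 i - F i) * ((1 - (1 - ca i) ^ n) ^ 3 * (1 - (1 - ky i) ^ n) ^ 3 * (e i * f i) ^ 3))"
proof -
  note b = bdds fam_bdd[OF fam_kf] fam_bdd[OF fam_ce] fam_bdd[OF fam_ca] fam_bdd[OF fam_ky]
  have 1: "qf1 * qce = qe1 * qkf"
    using R1 b cls_eq_iff[of "\<lambda>i. f1 i * ce i" "\<lambda>i. e1 i * kf i"]
    by (simp only: cls_mult[of f1] cls_mult[of e1] cls_kf_ce bdd_mult)
  have 2: "qce - qe1 * qce = qf1 * qkf"
    using R2 b cls_eq_iff[of "\<lambda>i. ce i - e1 i * ce i" "\<lambda>i. f1 i * kf i"]
    by (simp only: cls_mult[of f1] cls_mult[of e1] cls_diff[of ce] cls_kf_ce bdd_mult bdd_diff)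
  have unit: "fam (\<lambda>i. (1 - (1 - X i) ^ n) ^ 3)" "cls (\<lambda>i. (1 - (1 - X i) ^ n) ^ 3) = (1 - (1 - cls X) ^ n) ^ 3"
    if X: "fam X" for X :: "'x \<times> real \<Rightarrow> 'r"
  proof -
    have d: "fam (\<lambda>i. 1 - X i)" "fam (\<lambda>i. 1 - (1 - X i) ^ n)"
      by (intro fam_intros X)+
    show "fam (\<lambda>i. (1 - (1 - X i) ^ n) ^ 3)"
      by (intro fam_intros X)
    have "cls (\<lambda>i. 1 - (1 - X i) ^ n) = 1 - (1 - cls X) ^ n"
      using cls_diff[OF fam_bdd[OF fam_one] fam_bdd[OF fam_power[OF d(1)]], of n]
        cls_power[OF fam_bdd[OF d(1)], of n] cls_diff[OF fam_bdd[OF fam_one] fam_bdd[OF X]] by (simp only: cls_one)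
    then show "cls (\<lambda>i. (1 - (1 - X i) ^ n) ^ 3) = (1 - (1 - cls X) ^ n) ^ 3"
      using cls_power[OF fam_bdd[OF d(2)], of 3] by simp
  qed
  have ef: "fam (\<lambda>i. (e i * f i) ^ 3)" "cls (\<lambda>i. (e i * f i) ^ 3) = qw ^ 3"
    using cls_power[OF bdd_mult[OF b(1,2)], of 3] cls_mult[OF b(1,2)] fam_power[OF fam_mult[OF fams(1,2)]]
    by (simp_all add: qw_def)
  define Z where "Z i = (1 - (1 - ca i) ^ n) ^ 3 * (1 - (1 - ky i) ^ n) ^ 3 * (e i * f i) ^ 3" for i
  have Z: "fam Z" "cls Z = (1 - (1 - qc) ^ n) ^ 3 * (1 - (1 - qk) ^ n) ^ 3 * qw ^ 3"
  proof -
    note u = unit(1)[OF fam_ca] unit(1)[OF fam_ky]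
    show "fam Z"
      unfolding Z_def by (intro fam_mult u ef)
    show "cls Z = (1 - (1 - qc) ^ n) ^ 3 * (1 - (1 - qk) ^ n) ^ 3 * qw ^ 3"
      unfolding Z_def using cls_mult[OF fam_bdd[OF fam_mult[OF u]] fam_bdd[OF ef(1)]] cls_mult[OF fam_bdd[OF u(1)] fam_bdd[OF u(2)]]
      by (simp only: unit(2)[OF fam_ca] unit(2)[OF fam_ky] ef(2) qc_def qk_def)
  qed
  have "cls (\<lambda>i. (F1 i - F i) * Z i) = (qF1 - qF) * cls Z"
    using cls_mult[OF bdd_diff[OF b(6,3)] fam_bdd[OF Z(1)]] cls_diff[OF b(6,3)] by simp
  also have "\<dots> = cls (\<lambda>i. 0)"
    unfolding Z(2) approximate_units_agree[OF 1 2] cls_zero ..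
  finally show ?thesis
    using cls_eq_iff[of "\<lambda>i. (F1 i - F i) * Z i" "\<lambda>i. 0"] bdd_mult[OF bdd_diff[OF b(6,3)] fam_bdd[OF Z(1)]]
    by (simp add: bdd_const Z_def)
qed

end

end

section \<open>Uniform decay of the conformal difference\<close>

context cstar_ops
begin

subsection \<open>Twisting by invertible isometries\<close>

text \<open>
  The operators \<open>U\<^sub>g\<close> of a group action are not \<open>B\<close>-linear and have no adjoint in the usual sense; what
  remains of unitarity is that conjugation by them is a *-automorphism of \<open>A\<close>.
\<close>

definition twist :: "'r \<Rightarrow> 'r \<Rightarrow> bool" where
  "twist V V' \<longleftrightarrow> V * V' = 1 \<and> V' * V = 1 \<and>
     (\<forall>T\<in>A. V * T * V' \<in> A \<and> ad (V * T * V') = V * ad T * V' \<and>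
            V' * T * V \<in> A \<and> ad (V' * T * V) = V' * ad T * V)"

lemma twist_sym: "twist V V' \<Longrightarrow> twist V' V"
  by (auto simp: twist_def)

lemma twist_in: "twist V V' \<Longrightarrow> T \<in> A \<Longrightarrow> V * T * V' \<in> A"
  and twist_ad: "twist V V' \<Longrightarrow> T \<in> A \<Longrightarrow> ad (V * T * V') = V * ad T * V'"
  by (auto simp: twist_def)

lemma twist_cancel: "twist V V' \<Longrightarrow> V' * (V * X) = X" "twist V V' \<Longrightarrow> V * (V' * X) = X"
  by (simp_all add: twist_def mult.assoc[symmetric])

lemma twist_mult: "twist V V' \<Longrightarrow> V * S * V' * (V * T * V') = V * (S * T) * V'"
  by (simp only: mult.assoc twist_cancel)

lemma twist_inv_in:
  assumes V: "twist V V'" and T: "inv_in T"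
  shows "inv_in (V * T * V')"
proof -
  obtain S where S: "T \<in> A" "S \<in> A" "S * T = 1" "T * S = 1"
    using T by (auto simp: inv_in_def)
  then have "V * S * V' * (V * T * V') = 1" "V * T * V' * (V * S * V') = 1"
    using V unfolding twist_mult[OF V] by (simp_all add: twist_def)
  then show ?thesis
    using S V twist_in unfolding inv_in_def by blast
qed

lemma twist_spec: assumes V: "twist V V'" shows "spec (V * T * V') = spec T"
proof -
  have "V * V' = 1"
    using V by (simp add: twist_def)
  then have eq: "V * T * V' - t *\<^sub>R 1 = V * (T - t *\<^sub>R 1) * V'" for t T
    by (simp add: algebra_simps)
  have "V' * V = 1"
    using V by (simp add: twist_def)
  then have untwist: "V' * (V * X * V') * V = X" for X
    by (simp add: mult.assoc twist_cancel[OF V])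
  have "inv_in (V * X * V') \<longleftrightarrow> inv_in X" for X
    using twist_inv_in[OF V, of X] twist_inv_in[OF twist_sym[OF V], of "V * X * V'"] unfolding untwist by blast
  then show ?thesis
    by (simp add: spec_def eq)
qed

lemma twist_sa: "twist V V' \<Longrightarrow> sa T \<Longrightarrow> sa (V * T * V')"
  by (simp add: sa_def twist_in twist_ad)

text \<open>
  Conjugation preserves spectra, and these determine the norms of self-adjoint elements.
\<close>

lemma twist_norm: assumes V: "twist V V'" and T: "T \<in> A" shows "norm (V * T * V') = norm T"
proof -
  have sa_le: "norm S \<le> norm (V * S * V')" if "twist V V'" "sa S" for V V' S
  proof (rule norm_le_spec[OF that(2)])
    show "\<bar>t\<bar> \<le> norm (V * S * V')" if "t \<in> spec S" for t
      using that \<open>twist V V'\<close> \<open>sa S\<close> by (intro spec_le_norm twist_in) (auto simp: twist_spec sa_def)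
  qed simp
  have sa_eq: "norm (V * S * V') = norm S" if S: "sa S" for S
  proof -
    have "V' * V = 1"
      using V by (simp add: twist_def)
    then show ?thesis
      using sa_le[OF V S] sa_le[OF twist_sym[OF V] twist_sa[OF V S]]
      by (simp add: mult.assoc twist_cancel[OF V])
  qed
  have "(norm (V * T * V'))\<^sup>2 = norm (V * (ad T * T) * V')"
    using cstar_id[OF twist_in[OF V T]] by (simp only: twist_ad[OF V T] twist_mult[OF V])
  also have "\<dots> = (norm T)\<^sup>2"
    using cstar_id[OF T] sa_eq[OF sa_ad_mult[OF T]] by simp
  finally show ?thesis
    by (simp add: power2_eq_iff_nonneg)
qed

lemma twist_pos: "twist V V' \<Longrightarrow> pos T \<Longrightarrow> pos (V * T * V')"
  by (simp add: pos_def twist_sa twist_spec)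

lemma twist_cutoff:
  assumes V: "twist V V'" and c: "cutoff L e f F"
  shows "cutoff L (V * e * V') (V * f * V') (V * F * V')"
proof -
  note m = twist_mult[OF V]
  have inA: "e \<in> A" "f \<in> A" "F \<in> A"
    using c by (auto simp: cutoff_def sa_def)
  have sub: "V * X * V' - V * Z * V' = V * (X - Z) * V'" for X Z
    by (simp add: algebra_simps)
  have 1: "V * f * V' * (V * f * V') = V * e * V' - V * e * V' * (V * e * V')"
    "norm (V * f * V' - V * F * V' * (V * F * V') * (V * f * V')) \<le> 1 / L"
    unfolding m sub using c inA by (simp_all add: cutoff_def twist_norm[OF V] in_A)
  have 2: "V * e * V' * (V * f * V') = V * f * V' * (V * e * V')"
    "V * F * V' * (V * e * V') = V * e * V' * (V * F * V')" "V * F * V' * (V * f * V') = V * f * V' * (V * F * V')"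
    unfolding m using c by (simp_all add: cutoff_def)
  have 3: "pos (V * F * V' * (V * f * V'))" "pos (V * F * V' * (V * f * V') * (V * e * V'))"
    unfolding m using c by (auto simp: cutoff_def intro: twist_pos[OF V])
  have 4: "norm (V * F * V' * (V * f * V' * Y * (V * f * V')) - V * f * V' * Y * (V * f * V') * (V * F * V'))
     \<le> 2 * norm Y * M + 4 * (norm (V * e * V' * Y - Y * (V * e * V')) + norm (V * f * V' * Y - Y * (V * f * V'))) / M"
    if Y: "Y \<in> A" and M: "M > 0" for Y M
  proof -
    define Z where "Z = V' * Y * V"
    have "V * V' = 1"
      using V by (simp add: twist_def)
    then have Z: "Z \<in> A" "Y = V * Z * V'"
      using twist_in[OF twist_sym[OF V] Y] by (simp_all add: Z_def mult.assoc twist_cancel[OF V])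
    have "norm (F * (f * Z * f) - f * Z * f * F)
        \<le> 2 * norm Z * M + 4 * (norm (e * Z - Z * e) + norm (f * Z - Z * f)) / M"
      using c Z(1) M unfolding cutoff_def by blast
    then show ?thesis
      unfolding Z(2) m sub using inA Z(1) by (simp only: twist_norm[OF V] in_A)
  qed
  have 5: "sa (V * e * V')" "sa (V * f * V')" "sa (V * F * V')"
    using c by (auto simp: cutoff_def intro: twist_sa[OF V])
  have 6: "norm (V * e * V') \<le> 1" "norm (V * f * V') \<le> 1" "norm (V * F * V') \<le> 1"
    using c by (auto simp: cutoff_def twist_norm[OF V] inA)
  show ?thesis
    unfolding cutoff_def by (intro conjI ballI allI impI 1 2 3 4 5 6)
qed

end

context regular_operator
begin

lemma cutoff_D: assumes L: "\<Lambda> \<ge> 1" shows "cutoff \<Lambda> (e \<Lambda>) (f \<Lambda>) F"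
proof -
  have "f \<Lambda> - F * F * f \<Lambda> = R * f \<Lambda>"
    by (simp add: F_F algebra_simps)
  moreover have "f \<Lambda> * f \<Lambda> = e \<Lambda> - e \<Lambda> * e \<Lambda>"
    by (simp add: f_f[OF L] algebra_simps)
  ultimately show ?thesis
    unfolding cutoff_def
    using sa_e[OF L] sa_f[OF L] sa_F norm_e_le[OF L] norm_f_le[OF L] norm_F_le e_f[OF L] F_e[OF L] F_f[OF L]
      norm_R_f_le[OF L] pos_F_f[OF L] pos_F_f_e[OF L] norm_F_commutator_le[OF L] by simp
qed

subsection \<open>Summing over dyadic scales\<close>

text \<open>
  \<open>P e\<^sub>\<Lambda>\<close> is again a cut-off, and its increments over a dyadic step are divisible by \<open>(e f)\<^sup>3\<close>: this
  fixes the polynomial \<open>6 s\<^sup>5 - 5 s\<^sup>6\<close>, which vanishes to order \<open>5\<close> at \<open>0\<close> and takes the value \<open>1\<close> to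
  second order at \<open>1\<close>.
\<close>

definition Pe :: "real \<Rightarrow> 'e endo" where
  "Pe \<Lambda> = 6 *\<^sub>R e \<Lambda> ^ 5 - 5 *\<^sub>R e \<Lambda> ^ 6"

lemma \<Phi>_power: "cont h \<Longrightarrow> \<Phi> (\<lambda>t. h t ^ n) = \<Phi> h ^ n"
  by (induction n) (simp_all add: \<Phi>_const \<Phi>_mult continuous_intros)

lemma Pe_\<Phi>:
  assumes "\<Lambda> \<ge> 1"
  shows "Pe \<Lambda> = \<Phi> (\<lambda>t. 6 * (\<Lambda>\<^sup>2 * t / den \<Lambda> t) ^ 5 - 5 * (\<Lambda>\<^sup>2 * t / den \<Lambda> t) ^ 6)"
proof -
  define s where "s t = \<Lambda>\<^sup>2 * t / den \<Lambda> t" for t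
  have s: "cont s"
    using cont_e[OF assms] by (simp add: s_def[abs_def])
  have "Pe \<Lambda> = 6 *\<^sub>R \<Phi> s ^ 5 - 5 *\<^sub>R \<Phi> s ^ 6"
    by (simp add: Pe_def e_def s_def[abs_def])
  also have "\<dots> = \<Phi> (\<lambda>t. 6 * s t ^ 5 - 5 * s t ^ 6)"
    by (simp only: \<Phi>_power[OF s, symmetric] \<Phi>_scale[symmetric] \<Phi>_diff continuous_on_power[OF s] continuous_on_mult_left)
  finally show ?thesis
    by (simp only: s_def)
qed

text \<open>
  Doubling \<open>\<Lambda>\<close> replaces \<open>s = e\<^sub>\<Lambda>\<close> by \<open>4 s / (1 + 3 s)\<close>. The polynomial \<open>g\<close> is the quotient that remains once the zeros
  of the increment at \<open>0\<close> and \<open>1\<close> have been divided out.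
\<close>

lemma dyadic_increment:
  fixes s :: real
  assumes "0 \<le> s"
  defines "g \<equiv> 6138 + 10125 * s + 13392 * s ^ 2 + 14094 * s ^ 3 + 10206 * s ^ 4 + 3645 * s ^ 5"
  shows "6 * (4 * s / (1 + 3 * s)) ^ 5 - 5 * (4 * s / (1 + 3 * s)) ^ 6 - (6 * s ^ 5 - 5 * s ^ 6)
    = s ^ 5 * (1 - s) ^ 2 * (g / (1 + 3 * s) ^ 6)"
proof -
  define u where "u = 1 + 3 * s"
  have u: "u > 0"
    using assms by (simp add: u_def)
  have key: "6 * (4 * s) ^ 5 * u - 5 * (4 * s) ^ 6 - (6 * s ^ 5 - 5 * s ^ 6) * u ^ 6 = s ^ 5 * (1 - s) ^ 2 * g"
    unfolding u_def g_def by algebra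
  have "6 * (4 * s / u) ^ 5 - 5 * (4 * s / u) ^ 6 - (6 * s ^ 5 - 5 * s ^ 6)
      = (6 * (4 * s) ^ 5 * u - 5 * (4 * s) ^ 6 - (6 * s ^ 5 - 5 * s ^ 6) * u ^ 6) / u ^ 6"
    using u by (simp add: power_divide diff_divide_distrib power_Suc[of u 5, simplified])
  then show ?thesis
    unfolding key by (simp add: u_def)
qed

lemma Pe_increment:
  assumes L: "\<Lambda> \<ge> 1"
  shows "\<exists>X. Pe (2 * \<Lambda>) - Pe \<Lambda> = (e \<Lambda> * f \<Lambda>) ^ 3 * X \<and> norm X \<le> 57600"
proof -
  have L2: "2 * \<Lambda> \<ge> 1"
    using L by simp
  define s where "s t = \<Lambda>\<^sup>2 * t / den \<Lambda> t" for t
  define g where "g x = 6138 + 10125 * x + 13392 * x ^ 2 + 14094 * x ^ 3 + 10206 * x ^ 4 + 3645 * (x::real) ^ 5" for x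
  define G where "G t = g (s t) / (1 + 3 * s t) ^ 6" for t
  have s: "cont s" and e: "e \<Lambda> = \<Phi> s"
    using cont_e[OF L] by (simp_all add: s_def[abs_def] e_def)
  have s01: "0 \<le> s t" "s t \<le> 1" if "0 \<le> t" "t \<le> 1" for t
    using den_bounds[OF L that] that by (simp_all add: s_def)
  have G: "cont G"
    unfolding G_def g_def by (intro continuous_intros s) (use s01 in force)
  have s2: "(2 * \<Lambda>)\<^sup>2 * t / den (2 * \<Lambda>) t = 4 * s t / (1 + 3 * s t)" if t: "0 \<le> t" "t \<le> 1" for t
  proof -
    have d: "den \<Lambda> t > 0"
      using den_bounds[OF L t] by simp
    have "den (2 * \<Lambda>) t = den \<Lambda> t * (1 + 3 * s t)"
      using d by (simp add: s_def den_def field_simps)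
    then show ?thesis
      using d by (simp add: s_def power_mult_distrib)
  qed
  have "Pe (2 * \<Lambda>) = \<Phi> (\<lambda>t. 6 * (4 * s t / (1 + 3 * s t)) ^ 5 - 5 * (4 * s t / (1 + 3 * s t)) ^ 6)"
    unfolding Pe_\<Phi>[OF L2] using s2 by (intro \<Phi>_cong) simp
  moreover have "Pe \<Lambda> = \<Phi> (\<lambda>t. 6 * s t ^ 5 - 5 * s t ^ 6)"
    unfolding Pe_\<Phi>[OF L] s_def ..
  moreover have "cont (\<lambda>t. 6 * (4 * s t / (1 + 3 * s t)) ^ 5 - 5 * (4 * s t / (1 + 3 * s t)) ^ 6)"
    "cont (\<lambda>t. 6 * s t ^ 5 - 5 * s t ^ 6)"
    by (intro continuous_intros s; use s01 in force) (intro continuous_intros s)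
  ultimately have "Pe (2 * \<Lambda>) - Pe \<Lambda> = \<Phi> (\<lambda>t. 6 * (4 * s t / (1 + 3 * s t)) ^ 5 - 5 * (4 * s t / (1 + 3 * s t)) ^ 6
      - (6 * s t ^ 5 - 5 * s t ^ 6))"
    by (simp only: \<Phi>_diff)
  also have "\<dots> = \<Phi> (\<lambda>t. s t ^ 5 * (1 - s t) ^ 2 * G t)"
    using s01 by (intro \<Phi>_cong) (simp only: dyadic_increment G_def g_def)
  also have "\<dots> = e \<Lambda> ^ 5 * (1 - e \<Lambda>) ^ 2 * \<Phi> G"
    unfolding e using s G by (simp add: \<Phi>_mult \<Phi>_power \<Phi>_diff \<Phi>_const continuous_on_mult continuous_on_power continuous_on_diff)
  also have "\<dots> = (e \<Lambda> * f \<Lambda>) ^ 3 * (f \<Lambda> * \<Phi> G)"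
  proof -
    have "(e \<Lambda> * f \<Lambda>) ^ 3 * f \<Lambda> = e \<Lambda> ^ 3 * (f \<Lambda> * f \<Lambda>) ^ 2"
      unfolding power_mult_commute[OF e_f[OF L]] by (simp add: power3_eq_cube power2_eq_square mult.assoc)
    also have "(f \<Lambda> * f \<Lambda>) ^ 2 = e \<Lambda> ^ 2 * (1 - e \<Lambda>) ^ 2"
      unfolding f_f[OF L] by (rule power_mult_commute) (simp add: algebra_simps)
    also have "e \<Lambda> ^ 3 * (e \<Lambda> ^ 2 * (1 - e \<Lambda>) ^ 2) = e \<Lambda> ^ 5 * (1 - e \<Lambda>) ^ 2"
      by (simp add: mult.assoc[symmetric] power_add[symmetric])
    finally show ?thesis
      by (simp only: mult.assoc[symmetric])
  qed
  finally have eq: "Pe (2 * \<Lambda>) - Pe \<Lambda> = (e \<Lambda> * f \<Lambda>) ^ 3 * (f \<Lambda> * \<Phi> G)" .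
  \<comment> \<open>\<open>57600\<close> is the sum of the coefficients of \<open>g\<close>.\<close>
  have "norm (\<Phi> G) \<le> 57600"
  proof (rule norm_\<Phi>_le[OF G])
    fix t :: real assume t: "0 \<le> t" "t \<le> 1"
    have p: "0 \<le> s t ^ n" "s t ^ n \<le> 1" for n
      using s01[OF t] by (simp_all add: power_le_one)
    have "g (s t) \<le> 57600" "0 \<le> g (s t)"
      unfolding g_def using p(2)[of 1] p(2)[of 2] p(2)[of 3] p(2)[of 4] p(2)[of 5] s01[OF t] by simp_all
    moreover have "1 \<le> (1 + 3 * s t) ^ 6"
      using s01[OF t] by simp
    ultimately have "g (s t) / (1 + 3 * s t) ^ 6 \<le> 57600 / 1"
      by (intro frac_le) auto
    then show "\<bar>G t\<bar> \<le> 57600"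
      using \<open>0 \<le> g (s t)\<close> s01[OF t] by (simp add: G_def)
  qed
  then have "norm (f \<Lambda> * \<Phi> G) \<le> 1 * 57600"
    using norm_f_le[OF L] by (intro order_trans[OF norm_mult_ineq mult_mono]) auto
  then show ?thesis
    using eq by auto
qed

lemma norm_e_power_le: assumes "\<Lambda> \<ge> 1" shows "norm (e \<Lambda> ^ n) \<le> 1"
proof -
  have "norm (e \<Lambda> ^ n) \<le> norm (e \<Lambda>) ^ n"
    by (rule norm_power_le[OF sa_in[OF sa_e[OF assms]]])
  also have "\<dots> \<le> 1"
    by (rule power_le_one[OF norm_ge_zero norm_e_le[OF assms]])
  finally show ?thesis .
qed

lemma norm_Pe_le: assumes "\<Lambda> \<ge> 1" shows "norm (Pe \<Lambda>) \<le> 11"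
proof -
  have "norm (6 *\<^sub>R e \<Lambda> ^ 5) \<le> 6" "norm (5 *\<^sub>R e \<Lambda> ^ 6) \<le> 5"
    using norm_e_power_le[OF assms, of 5] norm_e_power_le[OF assms, of 6] by simp_all
  then show ?thesis
    unfolding Pe_def using norm_triangle_ineq4[of "6 *\<^sub>R e \<Lambda> ^ 5" "5 *\<^sub>R e \<Lambda> ^ 6"] by linarith
qed

lemma Pe_strong_limit:
  assumes L: "\<Lambda> \<ge> 1"
  shows "(\<lambda>n. Pe (2 ^ n * \<Lambda>) \<cdot> v) \<longlonglongrightarrow> v"
proof -
  have Ln: "2 ^ n * \<Lambda> \<ge> 1" for n
    using mult_mono[of 1 "2 ^ n" 1 \<Lambda>] L by simp
  have "(\<lambda>n. Pe (2 ^ n * \<Lambda>) \<cdot> v) \<longlonglongrightarrow> 1 \<cdot> v"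
  proof (rule dense_strong_limit[OF dense_Domain, where C = 11])
    show "norm (Pe (2 ^ n * \<Lambda>)) \<le> 11" for n
      by (rule norm_Pe_le[OF Ln])
    show "norm (1 :: 'e endo) \<le> 11"
      using norm_one_le by simp
    fix x assume "x \<in> Domain D"
    then obtain y where y: "(x, y) \<in> D"
      by auto
    have le: "norm (Pe (2 ^ n * \<Lambda>) \<cdot> x - 1 \<cdot> x) \<le> 10 * (norm y / (2 ^ n * \<Lambda>))" for n
    proof -
      let ?e = "e (2 ^ n * \<Lambda>)"
      define q where "q = 1 + ?e ^ 1 + ?e ^ 2 + ?e ^ 3 + ?e ^ 4 - 5 *\<^sub>R ?e ^ 5"
      have "6 *\<^sub>R ?e ^ 5 = 5 *\<^sub>R ?e ^ 5 + ?e ^ 5"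
        using scaleR_left_distrib[of 5 1 "?e ^ 5"] by simp
      then have eq: "1 - Pe (2 ^ n * \<Lambda>) = q * (1 - ?e)"
        by (simp add: Pe_def q_def algebra_simps eval_nat_numeral)
      have "norm (Pe (2 ^ n * \<Lambda>) \<cdot> x - 1 \<cdot> x) = norm ((1 - Pe (2 ^ n * \<Lambda>)) \<cdot> x)"
        by (simp only: ap_diff norm_minus_commute)
      also have "\<dots> \<le> norm q * norm ((1 - ?e) \<cdot> x)"
        unfolding eq ap_mult by (rule norm_ap)
      also have "\<dots> \<le> 10 * (norm y / (2 ^ n * \<Lambda>))"
      proof (rule mult_mono)
        have "norm q \<le> norm (1 :: 'e endo) + norm (?e ^ 1) + norm (?e ^ 2) + norm (?e ^ 3) + norm (?e ^ 4) + norm (5 *\<^sub>R ?e ^ 5)"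
          unfolding q_def
          by (rule order_trans[OF norm_triangle_ineq4], rule add_right_mono)
            ((rule order_trans[OF norm_triangle_ineq], rule add_right_mono)+, rule order_refl)
        then show "norm q \<le> 10"
          using norm_e_power_le[OF Ln[of n], of 1] norm_e_power_le[OF Ln[of n], of 2] norm_e_power_le[OF Ln[of n], of 3]
            norm_e_power_le[OF Ln[of n], of 4] norm_e_power_le[OF Ln[of n], of 5] norm_one_le by simp
      qed (use one_minus_e_D[OF Ln y] in auto)
      finally show ?thesis .
    qed
    have "(\<lambda>n. 10 * norm y / \<Lambda> * (1 / 2) ^ n) \<longlonglongrightarrow> 10 * norm y / \<Lambda> * 0"
      by (intro tendsto_mult tendsto_const LIMSEQ_power_zero) simp
    then have lim: "(\<lambda>n. 10 * (norm y / (2 ^ n * \<Lambda>))) \<longlonglongrightarrow> 0"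
      by (simp add: power_one_over mult.commute)
    show "(\<lambda>n. Pe (2 ^ n * \<Lambda>) \<cdot> x) \<longlonglongrightarrow> 1 \<cdot> x"
      by (rule LIM_zero_cancel, rule Lim_null_comparison[OF always_eventually lim]) (use le in blast)
  qed
  then show ?thesis
    by simp
qed

text \<open>
  Decay of \<open>W (e\<^sub>\<Lambda> f\<^sub>\<Lambda>)\<^sup>3\<close> bounds \<open>W\<close> on each dyadic band; the geometric series over the bands above \<open>\<Lambda>\<close> bounds it
  on the whole complement of the cut-off at \<open>\<Lambda>\<close>.
\<close>

lemma band_sum:
  fixes W :: "'x \<Rightarrow> 'e endo"
  assumes n: "negl (\<lambda>i. W (fst i) * (e (lam i) * f (lam i)) ^ 3)"
  obtains C \<theta> where "C > 0" "\<theta> > 0" "\<And>x \<Lambda>. \<Lambda> \<ge> 1 \<Longrightarrow> norm (W x * (1 - Pe \<Lambda>)) \<le> C * \<Lambda> powr (- \<theta>)"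
proof -
  obtain C \<theta> where C: "C > 0" "\<theta> > 0" "\<And>i. norm (W (fst i) * (e (lam i) * f (lam i)) ^ 3) \<le> C * lam i powr (- \<theta>)"
    using n by (rule neglE) blast
  define r where "r = 2 powr (- \<theta>)"
  have r: "0 \<le> r" "r < 1"
    using C by (auto simp: r_def intro: powr_less_one)
  define K where "K = C * 57600"
  have step: "norm (W x * (Pe (2 * \<Lambda>) - Pe \<Lambda>)) \<le> K * \<Lambda> powr (- \<theta>)" if L: "\<Lambda> \<ge> 1" for x \<Lambda>
  proof -
    obtain X where X: "Pe (2 * \<Lambda>) - Pe \<Lambda> = (e \<Lambda> * f \<Lambda>) ^ 3 * X" "norm X \<le> 57600"
      using Pe_increment[OF L] by blast
    have "norm (W x * (Pe (2 * \<Lambda>) - Pe \<Lambda>)) \<le> norm (W x * (e \<Lambda> * f \<Lambda>) ^ 3) * norm X"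
      unfolding X(1) using norm_mult_ineq by (simp add: mult.assoc[symmetric])
    also have "\<dots> \<le> (C * \<Lambda> powr (- \<theta>)) * 57600"
      using C(1) C(3)[of "(x, \<Lambda>)"] X(2) L by (intro mult_mono) (auto simp: lam_def)
    finally show ?thesis
      by (simp add: K_def algebra_simps)
  qed
  have bound: "norm (W x * (Pe (2 ^ n * \<Lambda>) - Pe \<Lambda>)) \<le> K / (1 - r) * \<Lambda> powr (- \<theta>)" if L: "\<Lambda> \<ge> 1" for x \<Lambda> n
  proof -
    have "norm (W x * (Pe (2 ^ n * \<Lambda>) - Pe \<Lambda>)) \<le> (\<Sum>j<n. K * \<Lambda> powr (- \<theta>) * r ^ j)"
    proof (induction n)
      case (Suc n)
      have Ln: "2 ^ n * \<Lambda> \<ge> 1"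
        using mult_mono[of 1 "2 ^ n" 1 \<Lambda>] L by simp
      have "W x * (Pe (2 ^ Suc n * \<Lambda>) - Pe \<Lambda>)
          = W x * (Pe (2 * (2 ^ n * \<Lambda>)) - Pe (2 ^ n * \<Lambda>)) + W x * (Pe (2 ^ n * \<Lambda>) - Pe \<Lambda>)"
        by (simp add: algebra_simps)
      also have "norm \<dots> \<le> K * (2 ^ n * \<Lambda>) powr (- \<theta>) + (\<Sum>j<n. K * \<Lambda> powr (- \<theta>) * r ^ j)"
        by (rule order_trans[OF norm_triangle_ineq add_mono[OF step[OF Ln] Suc.IH]])
      also have "(2 ^ n * \<Lambda>) powr (- \<theta>) = \<Lambda> powr (- \<theta>) * r ^ n"
        using L by (simp add: r_def powr_mult powr_realpow[symmetric] powr_powr mult.commute)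
      finally show ?case
        by (simp add: algebra_simps)
    qed simp
    also have "\<dots> = K * \<Lambda> powr (- \<theta>) * (\<Sum>j<n. r ^ j)"
      by (simp only: sum_distrib_left)
    also have "(\<Sum>j<n. r ^ j) = (1 - r ^ n) / (1 - r)"
      using r by (simp add: sum_gp_strict)
    also have "K * \<Lambda> powr (- \<theta>) * ((1 - r ^ n) / (1 - r)) \<le> K * \<Lambda> powr (- \<theta>) * (1 / (1 - r))"
      using r C by (intro mult_left_mono divide_right_mono) (auto simp: K_def)
    finally show ?thesis
      by simp
  qed
  have "norm (W x * (1 - Pe \<Lambda>)) \<le> K / (1 - r) * \<Lambda> powr (- \<theta>)" if L: "\<Lambda> \<ge> 1" for x \<Lambda>
  proof (rule norm_endo_bound)
    show "0 \<le> K / (1 - r) * \<Lambda> powr (- \<theta>)"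
      using r C by (simp add: K_def)
    fix v
    have "(\<lambda>n. (W x * (Pe (2 ^ n * \<Lambda>) - Pe \<Lambda>)) \<cdot> v) \<longlonglongrightarrow> W x \<cdot> (v - Pe \<Lambda> \<cdot> v)"
      unfolding ap_mult ap_diff by (intro tendsto_ap_right tendsto_diff Pe_strong_limit[OF L] tendsto_const)
    then have "(\<lambda>n. norm ((W x * (Pe (2 ^ n * \<Lambda>) - Pe \<Lambda>)) \<cdot> v)) \<longlonglongrightarrow> norm ((W x * (1 - Pe \<Lambda>)) \<cdot> v)"
      by (intro tendsto_norm) (simp add: ap_mult ap_diff)
    then show "norm ((W x * (1 - Pe \<Lambda>)) \<cdot> v) \<le> K / (1 - r) * \<Lambda> powr (- \<theta>) * norm v"
    proof (rule LIMSEQ_le_const2)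
      show "\<exists>N. \<forall>n\<ge>N. norm ((W x * (Pe (2 ^ n * \<Lambda>) - Pe \<Lambda>)) \<cdot> v) \<le> K / (1 - r) * \<Lambda> powr (- \<theta>) * norm v"
        using bound[OF L, of x] by (intro exI[of _ 0] allI impI order_trans[OF norm_ap] mult_right_mono) auto
    qed
  qed
  then show ?thesis
    using that[of "K / (1 - r)" \<theta>] C r by (simp add: K_def)
qed

end

subsection \<open>Polynomial approximate units\<close>

context cstar_ops
begin

text \<open>
  \<open>\<parallel>(1 - K)\<^sup>n X\<parallel>\<^sup>2\<close> is the norm of \<open>K (1 - K)\<^sup>2\<^sup>n\<close>, and \<open>t (1 - t)\<^sup>2\<^sup>n \<le> 1 / n\<close> on the unit interval. So \<open>1 - (1 - K)\<^sup>n\<close>, a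
  polynomial in \<open>K\<close> divisible by \<open>K\<close>, acts as an approximate unit on \<open>X\<close>.
\<close>

lemma approximate_unit_le:
  assumes X: "X \<in> A" "norm X \<le> 1"
  defines "K \<equiv> X * ad X"
  shows "norm ((1 - K) ^ n) \<le> 1" "n > 0 \<Longrightarrow> norm ((1 - K) ^ n * X) \<le> 1 / sqrt n"
proof -
  have K: "pos K"
    using pos_ad_mult[of "ad X"] X by (simp add: K_def in_A ad_simps)
  then have sK: "sa K"
    by (rule pos_sa)
  have "norm K \<le> norm X * norm X"
    using norm_mult_ineq[of X "ad X"] X by (simp add: K_def norm_ad)
  also have "\<dots> \<le> 1 * 1"
    using X by (intro mult_mono) auto
  finally have nK: "norm K \<le> 1"
    by simp
  have spec: "0 \<le> t" "t \<le> 1" if "t \<in> spec K" for t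
    using K that spec_le_norm[OF sa_in[OF sK] that] nK by (auto simp: pos_def)
  have c: "continuous_on (spec K) (\<lambda>t. (1 - t) ^ m)" for m
    by (intro continuous_intros)
  have pw: "(1 - K) ^ m = fc (\<lambda>t. (1 - t) ^ m) K" for m
  proof (induction m)
    case 0
    show ?case
      using fc_const[OF sK, of 1] by simp
  next
    case (Suc m)
    have "fc (\<lambda>t. (1 - t) ^ Suc m) K = fc (\<lambda>t. 1 - t) K * fc (\<lambda>t. (1 - t) ^ m) K"
      unfolding power_Suc by (intro fc_mult sK c continuous_intros)
    also have "fc (\<lambda>t. 1 - t) K = 1 - K"
      using fc_diff[OF sK, of "\<lambda>t. 1" "\<lambda>t. t"] fc_const[OF sK, of 1] fc_id[OF sK] by (simp add: continuous_intros)
    finally show ?case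
      by (simp add: Suc)
  qed
  show "norm ((1 - K) ^ n) \<le> 1"
    unfolding pw by (rule norm_fc_le[OF sK c]) (use spec in \<open>simp_all add: power_le_one\<close>)
  assume n: "n > 0"
  define Z where "Z = (1 - K) ^ n * X"
  have Z: "Z \<in> A" and KA: "K \<in> A" "ad K = K"
    using X sK by (simp_all add: Z_def in_A sa_def)
  have aZ: "ad Z = ad X * (1 - K) ^ n"
    using X KA by (simp add: Z_def ad_simps in_A)
  have "(norm Z)\<^sup>2 = norm (Z * ad Z)"
    using cstar_id[OF ad_in[OF Z]] Z by (simp add: ad_ad norm_ad)
  also have "Z * ad Z = K * (1 - K) ^ (2 * n)"
  proof -
    have "(1 - K) ^ n * K = K * (1 - K) ^ n"
      by (rule power_commuting_commutes) (simp add: algebra_simps)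
    moreover have "Z * ad Z = (1 - K) ^ n * K * (1 - K) ^ n"
      unfolding aZ by (simp only: Z_def K_def mult.assoc)
    ultimately show ?thesis
      by (simp add: mult.assoc power_add[symmetric] mult_2)
  qed
  also have "K * (1 - K) ^ (2 * n) = fc (\<lambda>t. t * (1 - t) ^ (2 * n)) K"
    unfolding pw using fc_mult[OF sK continuous_on_id c] fc_id[OF sK] by simp
  also have "norm \<dots> \<le> 1 / n"
  proof (rule norm_fc_le[OF sK])
    show "continuous_on (spec K) (\<lambda>t. t * (1 - t) ^ (2 * n))"
      by (intro continuous_intros)
    fix t assume t: "t \<in> spec K"
    have "(1 + real (2 * n) * t) * (1 - t) ^ (2 * n) \<le> (1 + t) ^ (2 * n) * (1 - t) ^ (2 * n)"
      using spec[OF t] by (intro mult_right_mono Bernoulli_inequality) auto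
    also have "\<dots> = (1 - t * t) ^ (2 * n)"
      by (simp add: power_mult_distrib[symmetric] algebra_simps)
    also have "\<dots> \<le> 1"
      using spec[OF t] by (intro power_le_one) (auto simp: mult_le_one)
    finally have "real n * (t * (1 - t) ^ (2 * n)) * 2 + (1 - t) ^ (2 * n) \<le> 1"
      by (simp add: algebra_simps)
    moreover have "0 \<le> (1 - t) ^ (2 * n)" "0 \<le> real n * (t * (1 - t) ^ (2 * n))"
      using spec[OF t] by simp_all
    ultimately have "real n * (t * (1 - t) ^ (2 * n)) \<le> 1"
      by linarith
    then show "\<bar>t * (1 - t) ^ (2 * n)\<bar> \<le> 1 / n"
      using n spec[OF t] by (simp add: field_simps)
  qed simp
  finally have "(norm Z)\<^sup>2 \<le> 1 / n" .
  then have "norm Z \<le> sqrt (1 / n)"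
    by (rule real_le_rsqrt)
  then show "norm ((1 - K) ^ n * X) \<le> 1 / sqrt n"
    by (simp add: Z_def real_sqrt_divide)
qed

end


lemma commutator_power_le:
  fixes a x :: "'a::{real_normed_algebra, monoid_mult}"
  assumes x: "\<And>n. norm (x ^ n) \<le> 1" and d: "norm (x * a - a * x) \<le> d"
  shows "norm (x ^ n * a - a * x ^ n) \<le> n * d"
proof (induction n)
  case (Suc n)
  have d0: "0 \<le> d"
    using d norm_ge_zero order_trans by blast
  have "x ^ Suc n * a - a * x ^ Suc n = x * (x ^ n * a - a * x ^ n) + (x * a - a * x) * x ^ n"
    by (simp add: algebra_simps)
  also have "norm \<dots> \<le> norm x * norm (x ^ n * a - a * x ^ n) + norm (x * a - a * x) * norm (x ^ n)"
    by (rule order_trans[OF norm_triangle_ineq add_mono[OF norm_mult_ineq norm_mult_ineq]])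
  also have "\<dots> \<le> 1 * (n * d) + d * 1"
    using x[of 1] x[of n] d d0 Suc by (intro add_mono mult_mono) auto
  finally show ?case
    by (simp add: algebra_simps)
qed simp

context regular_operator_power
begin

subsection \<open>The exchange relations of a conformal factor\<close>

lemma lip_adD: assumes "lip (ad Z) B" "Z \<in> Adj" "\<Lambda> \<ge> 1"
  shows "norm (e \<Lambda> * Z - Z * e \<Lambda>) \<le> 2 * norm B * \<Lambda> powr (\<alpha> - 1)"
    "norm (f \<Lambda> * Z - Z * f \<Lambda>) \<le> 2 * norm B * \<Lambda> powr (\<alpha> - 1)"
proof -
  have *: "norm (X * Z - Z * X) = norm (X * ad Z - ad Z * X)" if "sa X" for X
  proof -
    have X: "X \<in> Adj" "ad X = X"
      using that by (auto simp: sa_def)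
    have "norm (X * Z - Z * X) = norm (ad (X * Z - Z * X))"
      using X assms(2) by (intro norm_ad[symmetric] in_A)
    also have "ad (X * Z - Z * X) = ad Z * X - X * ad Z"
      using X assms(2) by (simp add: ad_simps in_A)
    finally show ?thesis
      by (simp add: norm_minus_commute)
  qed
  show "norm (e \<Lambda> * Z - Z * e \<Lambda>) \<le> 2 * norm B * \<Lambda> powr (\<alpha> - 1)"
    "norm (f \<Lambda> * Z - Z * f \<Lambda>) \<le> 2 * norm B * \<Lambda> powr (\<alpha> - 1)"
    using lip_commutator[OF assms(1,3)] by (simp_all add: *[OF sa_e[OF assms(3)]] *[OF sa_f[OF assms(3)]])
qed

text \<open>
  What is used of a conformal factor at one group element, \<open>V\<close> being the action of that element, \<open>\<nu>\<close> the
  inverse of \<open>\<mu>\<close>, and \<open>V D V\<^sup>-\<^sup>1\<close> the transformed operator. \<open>B2\<close> is the bounded operator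
  \<open>V \<langle>D\<rangle>\<^sup>-\<^sup>\<alpha> V\<^sup>-\<^sup>1 (V D V\<^sup>-\<^sup>1 a - a \<mu> D \<mu>\<^sup>*)\<close>, and \<open>B4\<close> is \<open>[D, (a \<mu>)\<^sup>*] \<langle>D\<rangle>\<^sup>-\<^sup>\<alpha>\<close>. The condition on \<open>a \<nu>\<^sup>*\<close> puts \<open>\<nu> a\<^sup>* e\<^sub>\<Lambda>\<close> into the
  domain of \<open>D\<close>, and so \<open>a a\<^sup>* e\<^sub>\<Lambda> = (a \<mu>) (\<nu> a\<^sup>* e\<^sub>\<Lambda>)\<close> into that of \<open>V D V\<^sup>-\<^sup>1\<close>.
\<close>

definition conformal_at :: "'e endo \<Rightarrow> 'e endo \<Rightarrow> 'e endo \<Rightarrow> 'e endo \<Rightarrow> 'e endo \<Rightarrow> 'e endo \<Rightarrow> 'e endo \<Rightarrow> bool" where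
  "conformal_at V V' \<mu> \<nu> a B2 B4 \<longleftrightarrow> twist V V' \<and> \<mu> \<in> Adj \<and> \<nu> \<in> Adj \<and> \<mu> * \<nu> = 1 \<and> \<nu> * \<mu> = 1 \<and>
     a \<in> Adj \<and> B2 \<in> Adj \<and> lip (ad (a * \<mu>)) B4 \<and> (\<exists>B. lip (ad (a * ad \<nu>)) B) \<and>
     (\<forall>p\<in>Domain D. V' \<cdot> a \<cdot> \<mu> \<cdot> p \<in> Domain D) \<and>
     (\<forall>p z w. (V' \<cdot> a \<cdot> p, z) \<in> D \<longrightarrow> (ad \<mu> \<cdot> p, w) \<in> D \<longrightarrow>
        V \<cdot> J \<cdot> V' \<cdot> (V \<cdot> z - a \<cdot> \<mu> \<cdot> w) = B2 \<cdot> p)"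

text \<open>
  Let \<open>e\<^sub>1, f\<^sub>1\<close> be the cut-offs of \<open>D\<^sub>1 = V D V\<^sup>-\<^sup>1\<close>. Up to \<open>O(\<Lambda>\<^sup>\<alpha>)\<close>, absorbed by the cut-off on the left,
  \<open>D\<^sub>1 a a\<^sup>* e\<^sub>\<Lambda>\<close> is \<open>a \<mu> D \<mu>\<^sup>* a\<^sup>* e\<^sub>\<Lambda>\<close>, and this is \<open>\<Lambda> y y\<^sup>* f\<^sub>\<Lambda>\<close> up to a commutator of \<open>D\<close> with \<open>y\<^sup>*\<close>. Multiplication by \<open>e\<^sub>1\<close>
  or \<open>f\<^sub>1\<close>, with \<open>e\<^sub>1 D\<^sub>1 = \<Lambda> f\<^sub>1\<close> and \<open>f\<^sub>1 D\<^sub>1 = \<Lambda> (1 - e\<^sub>1)\<close>, gives the two relations.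
\<close>

lemma exchange_bounds:
  assumes c: "conformal_at V V' \<mu> \<nu> a B2 B4" and L: "\<Lambda> \<ge> 1"
  defines "y \<equiv> a * \<mu>"
  shows "norm (V * f \<Lambda> * V' * (a * ad a * e \<Lambda>) - V * e \<Lambda> * V' * (y * ad y * f \<Lambda>))
      \<le> (norm B2 * norm a + norm y * norm B4) * \<Lambda> powr (\<alpha> - 1)"
    and "norm (a * ad a * e \<Lambda> - V * e \<Lambda> * V' * (a * ad a * e \<Lambda>) - V * f \<Lambda> * V' * (y * ad y * f \<Lambda>))
      \<le> (norm B2 * norm a + norm y * norm B4) * \<Lambda> powr (\<alpha> - 1)"
proof -
  note [simp] = ap_mult
  have V: "twist V V'" and mu: "\<mu> \<in> Adj" "\<nu> \<in> Adj" "\<mu> * \<nu> = 1" "\<nu> * \<mu> = 1" and a: "a \<in> Adj" and B2: "B2 \<in> Adj"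
    and l4: "lip (ad y) B4"
    using c by (auto simp: conformal_at_def y_def)
  obtain B6 where l6: "lip (ad (a * ad \<nu>)) B6"
    using c by (auto simp: conformal_at_def)
  have VV: "V' \<cdot> V \<cdot> v = v" "V \<cdot> V' \<cdot> v = v" for v
    using V by (metis ap_mult ap_one twist_def)+
  have ady: "ad y = ad \<mu> * ad a"
    using a mu by (simp add: y_def ad_simps)
  have adnu: "ad (a * ad \<nu>) = \<nu> * ad a"
    using a mu by (simp add: ad_simps in_A)
  obtain c4 where c4: "norm c4 \<le> norm B4 * \<Lambda> powr (\<alpha> - 1)"
    "\<And>v. (ad y \<cdot> e \<Lambda> \<cdot> v, \<Lambda> *\<^sub>R ((ad y * f \<Lambda> + c4) \<cdot> v)) \<in> D"
    using lip_cutoffs(1)[OF l4 L] by blast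
  obtain c6 where c6: "\<And>v. (\<nu> \<cdot> ad a \<cdot> e \<Lambda> \<cdot> v, \<Lambda> *\<^sub>R ((ad (a * ad \<nu>) * f \<Lambda> + c6) \<cdot> v)) \<in> D"
    using lip_cutoffs(1)[OF l6 L] unfolding adnu by auto
  have main: "norm (X - V * g * V' * (y * ad y * f \<Lambda>)) \<le> (norm B2 * norm a + norm y * norm B4) * \<Lambda> powr (\<alpha> - 1)"
    if K: "K \<in> Adj" "g = K * J" "norm K \<le> \<Lambda> powr \<alpha>" and g1: "norm g \<le> 1" "g \<in> Adj"
      and X: "\<And>p z v. (V' \<cdot> a \<cdot> ad a \<cdot> e \<Lambda> \<cdot> v, z) \<in> D \<Longrightarrow> V \<cdot> g \<cdot> z = \<Lambda> *\<^sub>R (X \<cdot> v)" for K g X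
  proof -
    have eq: "X - V * g * V' * (y * ad y * f \<Lambda>) = (1 / \<Lambda>) *\<^sub>R (V * K * V' * B2 * ad a * e \<Lambda>) + V * g * V' * y * c4"
    proof (rule endo_eqI)
      fix v
      let ?p = "ad a \<cdot> e \<Lambda> \<cdot> v"
      let ?w = "\<Lambda> *\<^sub>R ((ad y * f \<Lambda> + c4) \<cdot> v)"
      have "V' \<cdot> a \<cdot> \<mu> \<cdot> \<nu> \<cdot> ?p \<in> Domain D"
        using c c6[of v] unfolding conformal_at_def by blast
      moreover have "\<mu> \<cdot> \<nu> \<cdot> ?p = ?p"
        using mu(3) by (metis ap_mult ap_one)
      ultimately obtain z where z: "(V' \<cdot> a \<cdot> ?p, z) \<in> D"
        by auto
      have w: "(ad \<mu> \<cdot> ?p, ?w) \<in> D"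
        using c4(2)[of v] by (simp add: ady)
      have "V \<cdot> J \<cdot> V' \<cdot> (V \<cdot> z - a \<cdot> \<mu> \<cdot> ?w) = B2 \<cdot> ?p"
        using c z w unfolding conformal_at_def by blast
      then have "V \<cdot> K \<cdot> V' \<cdot> V \<cdot> J \<cdot> V' \<cdot> (V \<cdot> z - y \<cdot> ?w) = V \<cdot> K \<cdot> V' \<cdot> B2 \<cdot> ?p"
        by (simp add: y_def)
      then have "V \<cdot> g \<cdot> z - V \<cdot> g \<cdot> V' \<cdot> y \<cdot> ?w = V \<cdot> K \<cdot> V' \<cdot> B2 \<cdot> ?p"
        unfolding K(2) by (simp add: VV ap_diff_right)
      then have "\<Lambda> *\<^sub>R (X \<cdot> v) = V \<cdot> K \<cdot> V' \<cdot> B2 \<cdot> ?p + V \<cdot> g \<cdot> V' \<cdot> y \<cdot> ?w"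
        unfolding X[OF z] by (simp add: algebra_simps)
      also have "V \<cdot> g \<cdot> V' \<cdot> y \<cdot> ?w = \<Lambda> *\<^sub>R (V \<cdot> g \<cdot> V' \<cdot> y \<cdot> ad y \<cdot> f \<Lambda> \<cdot> v + V \<cdot> g \<cdot> V' \<cdot> y \<cdot> c4 \<cdot> v)"
        by (simp add: ap_simps ap_scaleR_right scaleR_add_right)
      finally have "(1 / \<Lambda>) *\<^sub>R \<Lambda> *\<^sub>R (X \<cdot> v) = (1 / \<Lambda>) *\<^sub>R (V \<cdot> K \<cdot> V' \<cdot> B2 \<cdot> ?p
          + \<Lambda> *\<^sub>R (V \<cdot> g \<cdot> V' \<cdot> y \<cdot> ad y \<cdot> f \<Lambda> \<cdot> v + V \<cdot> g \<cdot> V' \<cdot> y \<cdot> c4 \<cdot> v))"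
        by simp
      then show "(X - V * g * V' * (y * ad y * f \<Lambda>)) \<cdot> v = ((1 / \<Lambda>) *\<^sub>R (V * K * V' * B2 * ad a * e \<Lambda>) + V * g * V' * y * c4) \<cdot> v"
        using L by (simp add: ap_simps scaleR_add_right)
    qed
    have n1: "norm (V * K * V' * B2 * ad a * e \<Lambda>) \<le> \<Lambda> powr \<alpha> * norm B2 * norm a * 1"
      using K(3) norm_e_le[OF L] a
      by (intro order_trans[OF norm_mult_ineq mult_mono]) (simp_all add: twist_norm[OF V K(1)] norm_ad)
    have n2: "norm (V * g * V' * y * c4) \<le> 1 * norm y * (norm B4 * \<Lambda> powr (\<alpha> - 1))"
      using g1(1) c4(1)
      by (intro order_trans[OF norm_mult_ineq mult_mono]) (simp_all add: twist_norm[OF V g1(2)])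
    have "norm (X - V * g * V' * (y * ad y * f \<Lambda>)) \<le> (1 / \<Lambda>) * (\<Lambda> powr \<alpha> * norm B2 * norm a) + norm y * (norm B4 * \<Lambda> powr (\<alpha> - 1))"
      unfolding eq using n1 n2 L by (intro order_trans[OF norm_triangle_ineq add_mono]) (simp_all add: divide_right_mono)
    also have "\<dots> = (norm B2 * norm a + norm y * norm B4) * \<Lambda> powr (\<alpha> - 1)"
      using L by (simp add: powr_diff field_simps)
    finally show ?thesis .
  qed
  obtain Ke where Ke: "Ke \<in> Adj" "e \<Lambda> = Ke * J" "norm Ke \<le> \<Lambda> powr \<alpha>"
    using J_factor(1)[OF L] by blast
  show "norm (V * f \<Lambda> * V' * (a * ad a * e \<Lambda>) - V * e \<Lambda> * V' * (y * ad y * f \<Lambda>))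
      \<le> (norm B2 * norm a + norm y * norm B4) * \<Lambda> powr (\<alpha> - 1)"
    by (rule main[OF Ke norm_e_le[OF L] sa_in[OF sa_e[OF L]]]) (use e_of_D[OF L] in \<open>simp add: ap_scaleR_right\<close>)
  obtain Kf where Kf: "Kf \<in> Adj" "f \<Lambda> = Kf * J" "norm Kf \<le> \<Lambda> powr \<alpha>"
    using J_factor(2)[OF L] by blast
  show "norm (a * ad a * e \<Lambda> - V * e \<Lambda> * V' * (a * ad a * e \<Lambda>) - V * f \<Lambda> * V' * (y * ad y * f \<Lambda>))
      \<le> (norm B2 * norm a + norm y * norm B4) * \<Lambda> powr (\<alpha> - 1)"
    by (rule main[OF Kf norm_f_le[OF L] sa_in[OF sa_f[OF L]]]) (use f_of_D[OF L] in \<open>simp add: ap_scaleR_right ap_diff_right ap_diff VV\<close>)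
qed

subsection \<open>Uniform decay\<close>

lemma cube_defect_le:
  fixes \<rho> Z :: "'e endo"
  assumes "norm \<rho> \<le> 2"
  shows "norm ((1 - \<rho> ^ 3) * Z) \<le> 7 * norm ((1 - \<rho>) * Z)" "norm (\<rho> ^ 3) \<le> 8"
proof -
  have "norm (\<rho> * \<rho>) \<le> 2 * 2"
    using assms by (intro order_trans[OF norm_mult_ineq mult_mono]) auto
  moreover from this have "norm (\<rho> * (\<rho> * \<rho>)) \<le> 2 * 4"
    using assms by (intro order_trans[OF norm_mult_ineq mult_mono]) auto
  ultimately have n: "norm (\<rho> * \<rho>) \<le> 4" "norm (\<rho> ^ 3) \<le> 8"
    by (simp_all add: power3_eq_cube mult.assoc)
  then show "norm (\<rho> ^ 3) \<le> 8"
    by simp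
  have "(1 - \<rho> ^ 3) * Z = (1 + \<rho> + \<rho> * \<rho>) * ((1 - \<rho>) * Z)"
    by (simp add: algebra_simps power3_eq_cube)
  also have "norm \<dots> \<le> norm (1 + \<rho> + \<rho> * \<rho>) * norm ((1 - \<rho>) * Z)"
    by (rule norm_mult_ineq)
  also have "norm (1 + \<rho> + \<rho> * \<rho>) \<le> norm (1 :: 'e endo) + norm \<rho> + norm (\<rho> * \<rho>)"
    by (intro order_trans[OF norm_triangle_ineq] add_right_mono norm_triangle_ineq)
  also have "\<dots> \<le> 7"
    using norm_one_le assms n by simp
  finally show "norm ((1 - \<rho> ^ 3) * Z) \<le> 7 * norm ((1 - \<rho>) * Z)"
    by (simp add: mult_right_mono)
qed

text \<open>
  The factor \<open>t\<close> serves to normalise \<open>a\<close> and \<open>a \<mu>\<close>; the relations between them are homogeneous.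
\<close>

lemma conformal_negl:
  fixes V V' \<mu> \<nu> B2 B4 :: "'x \<Rightarrow> 'e endo" and t :: real
  assumes conf: "\<And>x. conformal_at (V x) (V' x) (\<mu> x) (\<nu> x) a (B2 x) (B4 x)" and lipa: "lip a Ba"
    and bound: "\<And>x. norm (\<mu> x) \<le> C" "\<And>x. norm (B2 x) \<le> C" "\<And>x. norm (B4 x) \<le> C"
    and t: "0 \<le> t" "t \<le> 1"
  defines "c \<equiv> (t *\<^sub>R a) * ad (t *\<^sub>R a)" and "k x \<equiv> (t *\<^sub>R (a * \<mu> x)) * ad (t *\<^sub>R (a * \<mu> x))"
  shows "negl (\<lambda>i. (V (fst i) * F * V' (fst i) - F) * ((1 - (1 - c) ^ n) ^ 3 * (1 - (1 - k (fst i)) ^ n) ^ 3 * (e (lam i) * f (lam i)) ^ 3))"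
proof -
  define \<theta> where "\<theta> = 1 - \<alpha>"
  have th: "\<theta> > 0" "\<alpha> - 1 = - \<theta>"
    using alpha by (auto simp: \<theta>_def)
  note conf' = conf[unfolded conformal_at_def]
  have a: "a \<in> Adj" and mu: "\<mu> x \<in> Adj" and tw: "twist (V x) (V' x)" and l4: "lip (ad (a * \<mu> x)) (B4 x)" for x
    using conf' by blast+
  have C: "C \<ge> 0"
    using bound(1) norm_ge_zero order_trans by blast
  have amu: "norm (a * \<mu> x) \<le> norm a * C" for x
    using bound(1)[of x] by (intro order_trans[OF norm_mult_ineq mult_left_mono]) auto
  have tle: "t * r \<le> r" "t * (t * r) \<le> r" if "r \<ge> 0" for r
  proof -
    show *: "t * r \<le> r"
      using t that by (simp add: mult_left_le_one_le)
    have "t * (t * r) \<le> t * r"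
      using t * by (intro mult_left_mono) auto
    then show "t * (t * r) \<le> r"
      using * by simp
  qed
  let ?a = "\<lambda>i::'x \<times> real. t *\<^sub>R a" and ?y = "\<lambda>i::'x \<times> real. t *\<^sub>R (a * \<mu> (fst i))"
  let ?e = "\<lambda>i::'x \<times> real. e (lam i)" and ?f = "\<lambda>i::'x \<times> real. f (lam i)"
  let ?e1 = "\<lambda>i. V (fst i) * e (lam i) * V' (fst i)" and ?f1 = "\<lambda>i. V (fst i) * f (lam i) * V' (fst i)"
  have cut: "cutoff (lam i) (?e i) (?f i) F" for i
    by (rule cutoff_D[OF lam_ge_1])
  have cut1: "cutoff (lam i) (?e1 i) (?f1 i) (V (fst i) * F * V' (fst i))" for i
    by (rule twist_cutoff[OF tw cut])
  have fa: "fam ?a"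
    using a by (simp add: fam_def bdd_const in_A)
  have fy: "fam ?y"
    unfolding fam_def
  proof
    show "bdd ?y"
      by (rule bdd_scaleR, rule bddI[of _ "norm a * C"]) (rule amu)
    show "\<forall>i. ?y i \<in> Adj"
      using a mu by (simp add: in_A)
  qed
  note fams = cutoff_fam[OF cut]
  have comm: "cls X * cls Z = cls Z * cls X" if X: "fam X" and Z: "fam Z"
    and le: "\<And>i. norm (Z i * X i - X i * Z i) \<le> K * lam i powr (\<alpha> - 1)" for X Z :: "'x \<times> real \<Rightarrow> 'e endo" and K
  proof -
    have "negl (\<lambda>i. X i * Z i - Z i * X i)"
      by (rule neglI[OF th(1), of _ K]) (use le th(2) in \<open>simp add: norm_minus_commute\<close>)
    then show ?thesis
      using X Z by (simp add: cls_mult[symmetric] cls_eq_iff fam_bdd bdd_mult)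
  qed
  have scale: "norm (Z * (t *\<^sub>R X) - (t *\<^sub>R X) * Z) \<le> r" if "norm (Z * X - X * Z) \<le> r" for Z X :: "'e endo" and r
  proof -
    have "Z * (t *\<^sub>R X) - (t *\<^sub>R X) * Z = t *\<^sub>R (Z * X - X * Z)"
      by (simp add: scaleR_right_diff_distrib)
    then show ?thesis
      using that tle(1)[of "norm (Z * X - X * Z)"] t by simp
  qed
  note la = lip_commutator[OF lipa lam_ge_1]
  have ly: "norm (?e i * (a * \<mu> (fst i)) - (a * \<mu> (fst i)) * ?e i) \<le> 2 * C * lam i powr (\<alpha> - 1)"
    "norm (?f i * (a * \<mu> (fst i)) - (a * \<mu> (fst i)) * ?f i) \<le> 2 * C * lam i powr (\<alpha> - 1)" for i
    using lip_adD[OF l4 mult_in[OF a mu] lam_ge_1] bound(3)[of "fst i"]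
    by (meson mult_left_mono mult_right_mono order_trans powr_ge_zero zero_le_numeral)+
  have R: "negl X" if le: "\<And>i. norm (X' i) \<le> (norm (B2 (fst i)) * norm a + norm (a * \<mu> (fst i)) * norm (B4 (fst i))) * lam i powr (\<alpha> - 1)"
    and X: "\<And>i. X i = t *\<^sub>R t *\<^sub>R X' i" for X X' :: "'x \<times> real \<Rightarrow> 'e endo"
  proof (rule neglI[OF th(1)])
    fix i
    have "norm (X i) \<le> norm (X' i)"
      using tle(2)[of "norm (X' i)"] t by (simp add: X)
    also have "\<dots> \<le> (C * norm a + (norm a * C) * C) * lam i powr (\<alpha> - 1)"
      using bound amu[of "fst i"] C by (intro order_trans[OF le] mult_right_mono add_mono mult_mono) auto
    finally show "norm (X i) \<le> (C * norm a + (norm a * C) * C) * lam i powr - \<theta>"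
      by (simp only: th(2))
  qed
  show ?thesis
    unfolding c_def k_def
  proof (rule negl_bounded_transforms[where a = ?a and y = ?y and e = ?e and f = ?f and ?e1.0 = ?e1 and ?f1.0 = ?f1])
    show "cls ?a * cls ?e = cls ?e * cls ?a" "cls ?a * cls ?f = cls ?f * cls ?a"
      by (rule comm[OF fa fams(1)], rule scale, rule la) (rule comm[OF fa fams(2)], rule scale, rule la)
    show "cls ?y * cls ?e = cls ?e * cls ?y" "cls ?y * cls ?f = cls ?f * cls ?y"
      by (rule comm[OF fy fams(1)], rule scale, rule ly) (rule comm[OF fy fams(2)], rule scale, rule ly)
    show "negl (\<lambda>i. ?f1 i * (t *\<^sub>R a * ad (t *\<^sub>R a) * ?e i) - ?e1 i * (t *\<^sub>R (a * \<mu> (fst i)) * ad (t *\<^sub>R (a * \<mu> (fst i))) * ?f i))"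
      by (rule R[OF exchange_bounds(1)[OF conf lam_ge_1]])
        (simp add: ad_scaleR a mu in_A scaleR_right_diff_distrib)
    show "negl (\<lambda>i. t *\<^sub>R a * ad (t *\<^sub>R a) * ?e i - ?e1 i * (t *\<^sub>R a * ad (t *\<^sub>R a) * ?e i) - ?f1 i * (t *\<^sub>R (a * \<mu> (fst i)) * ad (t *\<^sub>R (a * \<mu> (fst i))) * ?f i))"
      by (rule R[OF exchange_bounds(2)[OF conf lam_ge_1]])
        (simp add: ad_scaleR a mu in_A scaleR_right_diff_distrib)
  qed (fact cut cut1 fa fy)+
qed

text \<open>
  The weights \<open>1 - (1 - c)\<^sup>n\<close> and \<open>1 - (1 - k)\<^sup>n\<close> act on \<open>a\<close> as approximate units, uniformly in the group element, for \<open>a\<close>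
  is \<open>a \<mu>\<close> times the bounded \<open>\<nu>\<close>. First \<open>n\<close> is chosen to make the error of this replacement small, and
  then \<open>\<Lambda>\<close>, depending on \<open>n\<close>.
\<close>

lemma conformal_decay:
  fixes V V' \<mu> \<nu> B2 B4 :: "'x \<Rightarrow> 'e endo"
  assumes conf: "\<And>x. conformal_at (V x) (V' x) (\<mu> x) (\<nu> x) a (B2 x) (B4 x)" and lipa: "lip a Ba"
    and bound: "\<And>x. norm (\<mu> x) \<le> C" "\<And>x. norm (\<nu> x) \<le> C" "\<And>x. norm (B2 x) \<le> C" "\<And>x. norm (B4 x) \<le> C"
    and \<epsilon>: "\<epsilon> > 0"
  shows "\<exists>\<Lambda>\<ge>1. \<forall>x. norm ((V x * F * V' x - F) * a * (1 - Pe \<Lambda>)) \<le> \<epsilon>"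
proof -
  note conf' = conf[unfolded conformal_at_def]
  have a: "a \<in> Adj" and mu: "\<mu> x \<in> Adj" "\<mu> x * \<nu> x = 1" and tw: "twist (V x) (V' x)" for x
    using conf' by blast+
  have C: "C \<ge> 0"
    using bound(1) norm_ge_zero order_trans by blast
  define M where "M = 1 + norm a + norm a * C + C"
  have M: "M \<ge> 1" "norm a \<le> M" "norm a * C \<le> M" "C \<le> M"
    using C by (simp_all add: M_def)
  define t where "t = 1 / M"
  have t: "0 \<le> t" "t \<le> 1" "t > 0"
    using M by (simp_all add: t_def)
  define a' where "a' = t *\<^sub>R a"
  define y where "y x = t *\<^sub>R (a * \<mu> x)" for x
  have a': "a' \<in> Adj" "norm a' \<le> 1"
    using a M by (simp_all add: a'_def in_A t_def divide_le_eq)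
  have y: "y x \<in> Adj" "norm (y x) \<le> 1" for x
  proof -
    show "y x \<in> Adj"
      using a mu by (simp add: y_def in_A)
    have "norm (a * \<mu> x) \<le> norm a * C"
      using bound(1)[of x] by (intro order_trans[OF norm_mult_ineq mult_left_mono]) auto
    then show "norm (y x) \<le> 1"
      using M by (simp add: y_def t_def divide_le_eq)
  qed
  have yn: "y x * \<nu> x = a'" for x
    using mu(2)[of x] by (simp add: y_def a'_def mult.assoc)
  define c where "c = a' * ad a'"
  define k where "k x = y x * ad (y x)" for x
  \<comment> \<open>The constant collects \<open>2 \<cdot> 7 \<cdot> 12\<close> and \<open>2 \<cdot> 8 \<cdot> 7 \<cdot> 12\<close> from the estimate below.\<close>
  define A0 where "A0 = 168 + 1344 * M"
  define \<epsilon>' where "\<epsilon>' = \<epsilon> * t"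
  have e': "\<epsilon>' > 0"
    using \<epsilon> t by (simp add: \<epsilon>'_def)
  obtain n :: nat where n: "n > 0" "A0 / sqrt n \<le> \<epsilon>' / 2"
  proof -
    obtain n :: nat where n: "real n > (2 * A0 / \<epsilon>')\<^sup>2 + 1"
      using reals_Archimedean2 by blast
    have p: "real n > 0"
      using n by (meson add_nonneg_pos less_trans zero_le_power2 zero_less_one)
    have "2 * A0 / \<epsilon>' \<le> sqrt n"
      using n by (intro real_le_rsqrt) simp
    then have "A0 / sqrt n \<le> \<epsilon>' / 2"
      using e' p by (simp add: field_simps)
    then show ?thesis
      using that p by simp
  qed
  define W where "W x = (V x * F * V' x - F) * ((1 - (1 - c) ^ n) ^ 3 * (1 - (1 - k x) ^ n) ^ 3)" for x
  have "negl (\<lambda>i. W (fst i) * (e (lam i) * f (lam i)) ^ 3)"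
    using conformal_negl[OF conf lipa bound(1,3,4) t(1,2), where n = n]
    by (simp add: W_def c_def k_def a'_def y_def mult.assoc)
  then obtain C1 \<theta> where C1: "C1 > 0" "\<theta> > 0" "\<And>x \<Lambda>. \<Lambda> \<ge> 1 \<Longrightarrow> norm (W x * (1 - Pe \<Lambda>)) \<le> C1 * \<Lambda> powr (- \<theta>)"
    by (rule band_sum) blast
  have dF: "norm (V x * F * V' x - F) \<le> 2" for x
    using norm_triangle_ineq4[of "V x * F * V' x" F] twist_norm[OF tw F_Adj, of x] norm_F_le by simp
  note ca = approximate_unit_le[OF a', folded c_def] and ky = approximate_unit_le[OF y, folded k_def]
  have chi: "norm (1 - (1 - c) ^ n) \<le> 2" "norm (1 - (1 - k x) ^ n) \<le> 2" for x
    using norm_triangle_ineq4[of 1 "(1 - c) ^ n"] norm_triangle_ineq4[of 1 "(1 - k x) ^ n"] ca(1)[of n] ky(1)[of x n] norm_one_le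
    by simp_all
  note ch = cube_defect_le[OF chi(1)] and kh = cube_defect_le[OF chi(2)]
  have W_le: "norm (W x) \<le> 128" for x
  proof -
    have "norm ((1 - (1 - c) ^ n) ^ 3 * (1 - (1 - k x) ^ n) ^ 3) \<le> 8 * 8"
      using ch(2) kh(2)[of x] by (intro order_trans[OF norm_mult_ineq mult_mono]) auto
    then have "norm (V x * F * V' x - F) * norm ((1 - (1 - c) ^ n) ^ 3 * (1 - (1 - k x) ^ n) ^ 3) \<le> 2 * (8 * 8)"
      using dF[of x] by (intro mult_mono) auto
    then have "norm (W x) \<le> 2 * (8 * 8)"
      unfolding W_def using norm_mult_ineq order_trans by blast
    then show ?thesis
      by simp
  qed
  have ca1: "norm ((1 - (1 - (1 - c) ^ n) ^ 3) * a') \<le> 7 / sqrt n"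
    using ch(1)[of a'] ca(2)[OF n(1)] by simp
  have ky1: "norm ((1 - (1 - (1 - k x) ^ n) ^ 3) * a') \<le> 7 * M / sqrt n" for x
  proof -
    have "norm ((1 - k x) ^ n * a') \<le> norm ((1 - k x) ^ n * y x) * norm (\<nu> x)"
      unfolding yn[of x, symmetric] mult.assoc[symmetric] by (rule norm_mult_ineq)
    also have "\<dots> \<le> (1 / sqrt n) * M"
      using ky(2)[OF n(1), of x] bound(2)[of x] M by (intro mult_mono) auto
    finally show ?thesis
      using kh(1)[of x a'] by simp
  qed
  have est: "norm ((V x * F * V' x - F) * a' * (1 - Pe \<Lambda>)) \<le> \<epsilon>' / 2 + (C1 * \<Lambda> powr (- \<theta>) + 15360 * norm Ba * \<Lambda> powr (\<alpha> - 1))"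
    if L: "\<Lambda> \<ge> 1" for x \<Lambda>
  proof -
    define d where "d = V x * F * V' x - F"
    define p where "p = 1 - Pe \<Lambda>"
    define g where "g = (1 - (1 - c) ^ n) ^ 3"
    define h where "h = (1 - (1 - k x) ^ n) ^ 3"
    have p: "norm p \<le> 12"
      unfolding p_def using norm_triangle_ineq4[of 1 "Pe \<Lambda>"] norm_Pe_le[OF L] norm_one_le by simp
    have comm: "norm (a' * p - p * a') \<le> 120 * norm Ba * \<Lambda> powr (\<alpha> - 1)"
    proof -
      have "e \<Lambda> * a' - a' * e \<Lambda> = t *\<^sub>R (e \<Lambda> * a - a * e \<Lambda>)"
        by (simp add: a'_def scaleR_right_diff_distrib)
      then have "norm (e \<Lambda> * a' - a' * e \<Lambda>) \<le> norm (e \<Lambda> * a - a * e \<Lambda>)"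
        using t by (simp add: mult_left_le_one_le)
      then have 1: "norm (e \<Lambda> * a' - a' * e \<Lambda>) \<le> 2 * norm Ba * \<Lambda> powr (\<alpha> - 1)"
        using lip_commutator(1)[OF lipa L] by simp
      note 2 = commutator_power_le[OF norm_e_power_le[OF L] 1]
      have "a' * p - p * a' = 6 *\<^sub>R (e \<Lambda> ^ 5 * a' - a' * e \<Lambda> ^ 5) - 5 *\<^sub>R (e \<Lambda> ^ 6 * a' - a' * e \<Lambda> ^ 6)"
        by (simp add: p_def Pe_def algebra_simps)
      also have "norm \<dots> \<le> 6 * norm (e \<Lambda> ^ 5 * a' - a' * e \<Lambda> ^ 5) + 5 * norm (e \<Lambda> ^ 6 * a' - a' * e \<Lambda> ^ 6)"
        by (rule order_trans[OF norm_triangle_ineq4]) simp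
      finally show ?thesis
        using 2[of 5] 2[of 6] by simp
    qed
    have "d * a' * p = d * ((1 - g) * a') * p + d * g * ((1 - h) * a') * p + d * (g * h) * p * a' + d * (g * h) * (a' * p - p * a')"
      by (simp add: algebra_simps)
    also have "norm \<dots> \<le> norm (d * ((1 - g) * a') * p) + norm (d * g * ((1 - h) * a') * p) + norm (d * (g * h) * p * a') + norm (d * (g * h) * (a' * p - p * a'))"
      by (intro order_trans[OF norm_triangle_ineq] add_right_mono order_refl)
    also have "\<dots> \<le> 2 * (7 / sqrt n) * 12 + (2 * 8) * (7 * M / sqrt n) * 12 + C1 * \<Lambda> powr (- \<theta>) * 1 + 128 * (120 * norm Ba * \<Lambda> powr (\<alpha> - 1))"
    proof (intro add_mono)
      show "norm (d * ((1 - g) * a') * p) \<le> 2 * (7 / sqrt n) * 12"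
        using dF[of x] ca1 p unfolding d_def g_def
        by (intro order_trans[OF norm_mult3_le] mult_mono) auto
      have "norm (d * g) \<le> 2 * 8"
        using dF[of x] ch(2) unfolding d_def g_def by (intro order_trans[OF norm_mult_ineq] mult_mono) auto
      then show "norm (d * g * ((1 - h) * a') * p) \<le> (2 * 8) * (7 * M / sqrt n) * 12"
        using ky1[of x] p M unfolding h_def
        by (intro order_trans[OF norm_mult3_le] mult_mono) auto
      have dgh: "d * (g * h) = W x"
        by (simp add: W_def d_def g_def h_def)
      have ml: "norm (X * Y) \<le> r * s" if "norm X \<le> r" "norm Y \<le> s" for X Y :: "'e endo" and r s
        using mult_mono'[OF that norm_ge_zero norm_ge_zero] norm_mult_ineq order_trans by blast
      show "norm (d * (g * h) * p * a') \<le> C1 * \<Lambda> powr (- \<theta>) * 1"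
        unfolding dgh p_def by (rule ml[OF C1(3)[OF L] a'(2)])
      show "norm (d * (g * h) * (a' * p - p * a')) \<le> 128 * (120 * norm Ba * \<Lambda> powr (\<alpha> - 1))"
        unfolding dgh by (rule ml[OF W_le comm])
    qed
    also have "\<dots> = A0 / sqrt n + (C1 * \<Lambda> powr (- \<theta>) + 15360 * norm Ba * \<Lambda> powr (\<alpha> - 1))"
      by (simp add: A0_def add_divide_distrib)
    finally show ?thesis
      using n(2) unfolding d_def p_def by linarith
  qed
  have "((\<lambda>\<Lambda>. C1 * \<Lambda> powr (- \<theta>) + 15360 * norm Ba * \<Lambda> powr (\<alpha> - 1)) \<longlongrightarrow> C1 * 0 + 15360 * norm Ba * 0) at_top"
    using alpha C1 by (intro tendsto_add tendsto_mult tendsto_const tendsto_neg_powr filterlim_ident) auto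
  then have "\<forall>\<^sub>F \<Lambda> in at_top. C1 * \<Lambda> powr (- \<theta>) + 15360 * norm Ba * \<Lambda> powr (\<alpha> - 1) < \<epsilon>' / 2"
    using e' by (intro order_tendstoD(2)) auto
  then have "\<forall>\<^sub>F \<Lambda> in at_top. \<Lambda> \<ge> 1 \<and> C1 * \<Lambda> powr (- \<theta>) + 15360 * norm Ba * \<Lambda> powr (\<alpha> - 1) < \<epsilon>' / 2"
    by (intro eventually_conj eventually_ge_at_top)
  then obtain \<Lambda> where L: "\<Lambda> \<ge> 1" "C1 * \<Lambda> powr (- \<theta>) + 15360 * norm Ba * \<Lambda> powr (\<alpha> - 1) < \<epsilon>' / 2"
    by (auto dest: eventually_happens)
  have "norm ((V x * F * V' x - F) * a * (1 - Pe \<Lambda>)) \<le> \<epsilon>" for x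
  proof -
    have "norm ((V x * F * V' x - F) * a' * (1 - Pe \<Lambda>)) \<le> \<epsilon>'"
      using est[OF L(1), of x] L(2) by linarith
    then show ?thesis
      using t by (simp add: a'_def \<epsilon>'_def mult.commute[of \<epsilon>])
  qed
  then show ?thesis
    using L(1) by blast
qed

end

section \<open>Compact operators and representations\<close>

lemma bounded_linear_bl: "bounded_linear (bl :: 'a::real_normed_vector endo \<Rightarrow> _)"
  by (rule bounded_linear_intro[where K = 1]) (simp_all add: plus_endo.rep_eq scaleR_endo.rep_eq norm_endo.rep_eq)

lemma bounded_linear_En: "bounded_linear (En :: ('a::real_normed_vector \<Rightarrow>\<^sub>L 'a) \<Rightarrow> _)"
  by (rule bounded_linear_intro[where K = 1])
    (simp_all add: norm_endo.rep_eq plus_endo.rep_eq scaleR_endo.rep_eq flip: bl_eq_iff)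

lemma continuous_En: "continuous_on X En"
  using bounded_linear_En by (rule linear_continuous_on)

lemma continuous_bl: "continuous_on X bl"
  using bounded_linear_bl by (rule linear_continuous_on)

context cs_hilbert_module
begin

subsection \<open>The ideal of compact operators\<close>

definition Kop :: "'a endo set" where
  "Kop = {T. bl T \<in> compact_ops}"

definition rk :: "'a \<Rightarrow> 'a \<Rightarrow> 'a endo" where
  "rk x y = En (rank_one x y)"

lemma norm_ract_le: "norm (ract x b) \<le> norm x * norm b"
proof -
  have "(norm (ract x b))\<^sup>2 = norm (star b * (ip x x * b))"
    by (simp add: norm_ip_self[symmetric] ip_ract_left ip_ract_right mult.assoc)
  also have "\<dots> \<le> norm b * (norm (ip x x) * norm b)"
    using norm_mult_ineq[of "star b" "ip x x * b"] norm_mult_ineq[of "ip x x" b]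
    by (metis mult_left_mono norm_ge_zero norm_star order_trans)
  also have "\<dots> = (norm x * norm b)\<^sup>2"
    by (simp add: norm_ip_self power2_eq_square)
  finally show ?thesis
    by (rule power2_le_imp_le) simp
qed

lemma bounded_linear_rk: "bounded_linear (\<lambda>z. ract x (ip y z))"
proof (rule bounded_linear_intro[where K = "norm x * norm y"])
  show "norm (ract x (ip y z)) \<le> norm z * (norm x * norm y)" for z
    using order_trans[OF norm_ract_le mult_left_mono[OF cs[of y z] norm_ge_zero[of x]]] by (simp add: mult.commute mult.left_commute)
  show "ract x (ip y (r *\<^sub>R z)) = r *\<^sub>R ract x (ip y z)" for r z
    by (simp add: scaleR_scaleC ip_scaleC_right ract_scaleC_right)
qed (simp add: ip_add_right ract_add_right)

lemma rank_one_apply: "blinfun_apply (rank_one x y) z = ract x (ip y z)"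
  unfolding rank_one_def by (simp add: bounded_linear_Blinfun_apply bounded_linear_rk)

lemma rk_ap: "rk x y \<cdot> z = ract x (ip y z)"
  by (simp add: rk_def bl_ap[symmetric] rank_one_apply)

lemma norm_rk_le: "norm (rk x y) \<le> norm x * norm y"
proof (rule norm_endo_bound)
  show "norm (rk x y \<cdot> z) \<le> norm x * norm y * norm z" for z
    unfolding rk_ap using order_trans[OF norm_ract_le mult_left_mono[OF cs[of y z] norm_ge_zero[of x]]] by (simp add: mult.assoc)
qed simp

lemma rk_Adj: "rk x y \<in> Adj" and ad_rk: "ad (rk x y) = rk y x"
proof -
  have "ip (rk x y \<cdot> u) v = ip u (rk y x \<cdot> v)" for u v
    by (simp add: rk_ap ip_ract_left ip_ract_right star_ip)
  from AdjI[OF this] show "rk x y \<in> Adj" "ad (rk x y) = rk y x"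
    by auto
qed

lemma Adj_rk: "T \<in> Adj \<Longrightarrow> T * rk x y = rk (T \<cdot> x) y"
  by (rule endo_eqI, simp add: rk_ap ap_mult Adj_ract AdjD')+

lemma Kop_eq: "Kop = closure (En ` complex_vector.span {rank_one x y | x y. True})"
proof -
  let ?S = "complex_vector.span {rank_one x y | x y. True}"
  have cl: "closed (bl -` closure ?S)" "closed (En -` closure (En ` ?S))"
    by (rule closed_vimage[OF closed_closure], rule continuous_bl continuous_En)+
  have "closure (En ` ?S) \<subseteq> bl -` closure ?S"
    by (rule closure_minimal[OF _ cl(1)]) (use closure_subset[of ?S] in auto)
  moreover have "closure ?S \<subseteq> En -` closure (En ` ?S)"
    by (rule closure_minimal[OF _ cl(2)]) (use closure_subset[of "En ` ?S"] in auto)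
  ultimately show ?thesis
    unfolding Kop_def compact_ops_def by (auto simp: vimage_def)
qed

lemma closed_Kop: "closed Kop"
  unfolding Kop_eq by simp

lemma scaleC_rank_one: "c *\<^sub>C rank_one x y = rank_one (c *\<^sub>C x) y"
  by (rule blinfun_eqI) (simp add: scaleC_blinfun.rep_eq rank_one_apply ract_scaleC_left)

text \<open>Complex multiples are absorbed by the rank one operators, so additive closure suffices.\<close>

lemma Kop_induct [consumes 1, case_names closed zero add]:
  assumes T: "T \<in> Kop" and closed: "closed {T. P T}" and P0: "P 0"
    and Padd: "\<And>x y T. T \<in> Kop \<Longrightarrow> P T \<Longrightarrow> P (rk x y + T)"
  shows "P T"
proof -
  let ?S = "complex_vector.span {rank_one x y | x y. True}"
  have "P (En X)" if "X \<in> ?S" for X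
  proof -
    have "X \<in> ?S \<and> P (En X)"
      using that
    proof (induction rule: complex_vector.span_induct_alt)
      case base
      show ?case
        using P0 linear_0[OF bounded_linear.linear[OF bounded_linear_En]] complex_vector.span_zero by metis
    next
      case (step c X Y)
      then obtain x y where X: "X = rank_one x y"
        by blast
      have Y: "Y \<in> ?S" "P (En Y)"
        using step(2) by auto
      have "En Y \<in> closure (En ` ?S)"
        using Y(1) by (intro subsetD[OF closure_subset] imageI)
      then have "P (rk (c *\<^sub>C x) y + En Y)"
        using Y(2) by (intro Padd) (simp_all only: Kop_eq)
      moreover have "En (c *\<^sub>C X + Y) = rk (c *\<^sub>C x) y + En Y"
        unfolding X scaleC_rank_one rk_def by (rule linear_add[OF bounded_linear.linear[OF bounded_linear_En]])
      moreover have "c *\<^sub>C X + Y \<in> ?S"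
        by (rule complex_vector.span_add[OF complex_vector.span_scale[OF complex_vector.span_base[OF step(1)]] Y(1)])
      ultimately show ?case
        by simp
    qed
    then show ?thesis ..
  qed
  then have "En ` ?S \<subseteq> {T. P T}"
    by auto
  from closure_minimal[OF this closed] show ?thesis
    using T unfolding Kop_eq by blast
qed

lemma Kop_zero: "0 \<in> Kop" and rk_add_Kop: "T \<in> Kop \<Longrightarrow> rk x y + T \<in> Kop"
proof -
  let ?S = "complex_vector.span {rank_one x y | x y. True}"
  show "0 \<in> Kop"
    using complex_vector.span_zero closure_subset bounded_linear.linear[OF bounded_linear_En, THEN linear_0]
    unfolding Kop_eq by (metis (no_types, lifting) image_eqI subsetD)
  have En_add: "En (X + Y) = En X + En Y" for X Y :: "'a \<Rightarrow>\<^sub>L 'a"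
    by (rule linear_add[OF bounded_linear.linear[OF bounded_linear_En]])
  have "rk x y + En X \<in> En ` ?S" if "X \<in> ?S" for X
  proof -
    have "rank_one x y + X \<in> ?S"
      by (rule complex_vector.span_add[OF complex_vector.span_base that]) blast
    then show ?thesis
      by (simp only: rk_def En_add[symmetric] imageI)
  qed
  then have "(\<lambda>T. rk x y + T) ` En ` ?S \<subseteq> En ` ?S"
    by blast
  then have "(\<lambda>T. rk x y + T) ` closure (En ` ?S) \<subseteq> closure (En ` ?S)"
    using closure_translation[of "rk x y" "En ` ?S"] closure_mono by blast
  then show "rk x y + T \<in> Kop" if "T \<in> Kop"
    using that unfolding Kop_eq by blast
qed

lemma closed_preimage: "closed {T. P T} \<Longrightarrow> continuous_on UNIV g \<Longrightarrow> closed {T. P (g T)}"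
  using closed_vimage[of "{T. P T}" g] by (simp add: vimage_def)

lemma Kop_add: assumes "S \<in> Kop" "T \<in> Kop" shows "S + T \<in> Kop"
  using assms(1)
proof (induction rule: Kop_induct)
  case closed
  show ?case
    using closed_preimage[of "\<lambda>T. T \<in> Kop" "\<lambda>S. S + T"] closed_Kop by (simp add: continuous_intros)
qed (simp_all add: assms(2) add.assoc rk_add_Kop)

lemma Kop_minus: assumes "T \<in> Kop" shows "- T \<in> Kop"
  using assms
proof (induction rule: Kop_induct)
  case closed
  show ?case
    using closed_preimage[of "\<lambda>T. T \<in> Kop" uminus] closed_Kop by (simp add: continuous_intros)
next
  case (add x y T)
  have "ract (- x) b = - ract x b" for b
    using ract_scaleC_left[of "- 1" x b] by (simp add: complex_vector.scale_minus_left complex_vector.scale_one)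
  then have "- (rk x y + T) = rk (- x) y + - T"
    by (intro endo_eqI) (simp add: rk_ap ap_simps)
  then show ?case
    using rk_add_Kop[OF add(2), of "- x" y] by (simp only:)
qed (simp add: Kop_zero)

lemma Kop_mult_left: assumes X: "X \<in> Adj" and T: "T \<in> Kop" shows "X * T \<in> Kop"
  using T
proof (induction rule: Kop_induct)
  case closed
  show ?case
    using closed_preimage[of "\<lambda>T. T \<in> Kop" "\<lambda>T. X * T"] closed_Kop by (simp add: continuous_intros)
qed (simp_all add: Kop_zero distrib_left Adj_rk[OF X] rk_add_Kop)

lemma Kop_ad: assumes "T \<in> Kop" shows "ad T \<in> Kop"
proof -
  have "T \<in> Adj \<and> ad T \<in> Kop"
    using assms
  proof (induction rule: Kop_induct)
    case closed
    show ?case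
      unfolding closed_sequential_limits
    proof (intro allI impI, elim conjE)
      fix X L assume X: "\<forall>n. X n \<in> {T \<in> Adj. ad T \<in> Kop}" and lim: "X \<longlonglongrightarrow> L"
      have L: "L \<in> Adj"
        by (rule closed_sequentially[OF closed_Adj _ lim]) (use X in blast)
      have lim_ad: "(\<lambda>n. ad (X n)) \<longlonglongrightarrow> ad L"
      proof (rule LIM_zero_cancel, rule tendsto_norm_zero_cancel)
        have "norm (ad (X n) - ad L) = norm (X n - L)" for n
          using X L norm_ad[of "X n - L"] by (simp add: ad_diff in_A)
        then show "(\<lambda>n. norm (ad (X n) - ad L)) \<longlonglongrightarrow> 0"
          using tendsto_norm_zero[OF LIM_zero[OF lim]] by simp
      qed
      have "ad L \<in> Kop"
        by (rule closed_sequentially[OF closed_Kop _ lim_ad]) (use X in blast)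
      then show "L \<in> {T \<in> Adj. ad T \<in> Kop}"
        using L by blast
    qed
  qed (simp_all add: in_A ad_zero Kop_zero rk_Adj ad_add ad_rk rk_add_Kop)
  then show ?thesis ..
qed

end

subsection \<open>Contractivity of representations\<close>

lemma ex_quasi_inverse:
  fixes z :: "'a::{real_normed_algebra, banach}"
  assumes z: "norm z < 1"
  shows "\<exists>y. y = z + z * y \<and> y = z + y * z"
proof -
  define s where "s n = ((\<lambda>w. z * w) ^^ n) z" for n
  have s0: "s 0 = z" and sS: "s (Suc n) = z * s n" for n
    by (simp_all add: s_def)
  have sz: "s n * z = s (Suc n)" for n
    by (induction n) (simp_all add: s0 sS mult.assoc)
  have "norm (s n) \<le> norm z ^ Suc n" for n
  proof (induction n)
    case (Suc n)
    then show ?case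
      unfolding sS power_Suc[of _ "Suc n"] by (intro order_trans[OF norm_mult_ineq mult_left_mono]) auto
  qed (simp add: s0)
  moreover have "summable (\<lambda>n. norm z ^ Suc n)"
    using z by (simp add: summable_geometric summable_Suc_iff)
  ultimately have s: "summable s"
    using summable_comparison_test'[of _ 0 s] by blast
  have "suminf s = z + (\<Sum>n. s (Suc n))"
    using suminf_split_head[OF s] s0 by simp
  moreover have "(\<Sum>n. s (Suc n)) = z * suminf s" "(\<Sum>n. s (Suc n)) = suminf s * z"
    by (simp_all only: sS bounded_linear.suminf[OF bounded_linear_mult_right s])
      (simp only: sz[symmetric] sS[symmetric] bounded_linear.suminf[OF bounded_linear_mult_left s])
  ultimately show ?thesis
    by metis
qed

locale rep = cs_hilbert_module ip ract + correspondence ip ract \<pi>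
  for ip :: "'e::cbanach \<Rightarrow> 'e \<Rightarrow> 'b::cstar_algebra" and ract :: "'e \<Rightarrow> 'b \<Rightarrow> 'e"
    and \<pi> :: "'a::cstar_algebra \<Rightarrow> ('e \<Rightarrow>\<^sub>L 'e)"
begin

definition p :: "'a \<Rightarrow> 'e endo" where
  "p a = En (\<pi> a)"

lemma bl_p: "bl (p a) = \<pi> a"
  by (simp add: p_def)

lemma p_Adj: "p a \<in> Adj"
  by (simp add: Adj_def bl_p \<pi>_adjointable)

lemma p_add: "p (a + b) = p a + p b"
  by (simp only: bl_eq_iff[symmetric] bl_p \<pi>_add plus_endo.rep_eq)

lemma p_mult: "p (a * b) = p a * p b"
  by (simp only: bl_eq_iff[symmetric] bl_p \<pi>_mult times_endo.rep_eq)

lemma p_star: "p (star a) = ad (p a)"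
  by (simp only: bl_eq_iff[symmetric] bl_p \<pi>_star bl_ad)

lemma p_scaleR: "p (t *\<^sub>R a) = t *\<^sub>R p a"
  by (simp only: bl_eq_iff[symmetric] bl_p scaleR_endo.rep_eq scaleR_scaleC \<pi>_scaleC)

lemma p_diff: "p (a - b) = p a - p b"
  using p_add[of "a - b" b] by simp

text \<open>
  A quasi-inverse in the algebra is mapped to one of operators, whence the spectrum can only shrink.
\<close>

lemma norm_p_le: "norm (p a) \<le> norm a"
proof -
  have inv: "inv_in (1 - p z)" if z: "norm z < 1" for z
  proof -
    obtain y where y: "y = z + z * y" "y = z + y * z"
      using ex_quasi_inverse[OF z] by blast
    have "p y = p z + p z * p y" "p y = p z + p y * p z"
      using y p_add p_mult by metis+
    then have "(1 - p z) * (1 + p y) = 1" "(1 + p y) * (1 - p z) = 1"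
      by (simp_all add: algebra_simps)
    then show ?thesis
      unfolding inv_in_def using p_Adj by (intro conjI bexI[of _ "1 + p y"]) (auto intro: in_A)
  qed
  have sa_le: "norm (p x) \<le> norm x" if x: "sa (p x)" for x
  proof (rule norm_le_spec[OF x])
    fix t assume t: "t \<in> spec (p x)"
    show "\<bar>t\<bar> \<le> norm x"
    proof (rule ccontr)
      assume "\<not> \<bar>t\<bar> \<le> norm x"
      then have t0: "t \<noteq> 0" "norm ((1 / t) *\<^sub>R x) < 1"
        by (auto simp: divide_less_eq norm_ge_zero order.strict_trans1)
      have "p x - t *\<^sub>R 1 = (- t) *\<^sub>R (1 - p ((1 / t) *\<^sub>R x))"
        using t0 by (simp add: p_scaleR algebra_simps)
      then show False
        using inv_in_scaleR[OF inv[OF t0(2)], of "- t"] t t0(1) by (simp add: spec_def)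
    qed
  qed simp
  have "(norm (p a))\<^sup>2 = norm (p (star a * a))"
    using cstar_id[OF p_Adj, of a] by (simp add: p_mult p_star)
  also have "\<dots> \<le> norm (star a * a)"
    using p_Adj[of a] by (intro sa_le) (simp add: p_mult p_star sa_ad_mult)
  also have "\<dots> = (norm a)\<^sup>2"
    by (rule cstar_identity)
  finally show ?thesis
    by (rule power2_le_imp_le) simp
qed

end

section \<open>Equivariance of the bounded transform\<close>

lemma (in cs_hilbert_module) bounded_bilinear_rk: "bounded_bilinear rk"
proof (rule bounded_bilinear.intro)
  fix x x' y y' :: 'a and r :: real
  show "rk (x + x') y = rk x y + rk x' y"
    by (rule endo_eqI) (simp add: rk_ap ap_add ract_add_left)
  show "rk x (y + y') = rk x y + rk x y'"
    by (rule endo_eqI) (simp add: rk_ap ap_add ip_add_left ract_add_right)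
  show "rk (r *\<^sub>R x) y = r *\<^sub>R rk x y"
    by (rule endo_eqI) (simp add: rk_ap ap_scaleR scaleR_scaleC ract_scaleC_left)
  show "rk x (r *\<^sub>R y) = r *\<^sub>R rk x y"
    by (rule endo_eqI) (simp add: rk_ap ap_scaleR ip_scaleR_left, simp add: scaleR_scaleC ract_scaleC_right)
  show "\<exists>K. \<forall>a b. norm (rk a b) \<le> norm a * norm b * K"
    using norm_rk_le by (intro exI[of _ 1]) simp
qed

text \<open>Strong continuity of a bounded family of maps becomes norm continuity on compact operators.\<close>

lemma (in cs_hilbert_module) continuous_on_Kop:
  fixes \<Psi> :: "'g::topological_space \<Rightarrow> 'a endo \<Rightarrow> 'a endo"
  assumes K: "K \<in> Kop" and add: "\<And>g S T. \<Psi> g (S + T) = \<Psi> g S + \<Psi> g T"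
    and bound: "\<And>g T. T \<in> Adj \<Longrightarrow> norm (\<Psi> g T) \<le> C * norm T"
    and rank_one: "\<And>x y. continuous_on UNIV (\<lambda>g. \<Psi> g (rk x y))"
  shows "continuous_on UNIV (\<lambda>g. \<Psi> g K)"
proof -
  have "K \<in> Adj \<and> continuous_on UNIV (\<lambda>g. \<Psi> g K)"
    using K
  proof (induction rule: Kop_induct)
    case closed
    show ?case
      unfolding closed_sequential_limits
    proof (intro allI impI, elim conjE)
      fix X L assume X: "\<forall>n. X n \<in> {T. T \<in> Adj \<and> continuous_on UNIV (\<lambda>g. \<Psi> g T)}" and lim: "X \<longlonglongrightarrow> L"
      have L: "L \<in> Adj"
        by (rule closed_sequentially[OF closed_Adj _ lim]) (use X in blast)
      have "uniform_limit UNIV (\<lambda>n g. \<Psi> g (X n)) (\<lambda>g. \<Psi> g L) sequentially"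
      proof (rule metric_uniform_limit_imp_uniform_limit)
        show "uniform_limit UNIV (\<lambda>n (g::'g). C * norm (X n - L)) (\<lambda>g. 0) sequentially"
          using tendsto_mult_right_zero[OF tendsto_norm_zero[OF LIM_zero[OF lim]], of C]
          by (auto simp: uniform_limit_iff tendsto_iff)
        have "dist (\<Psi> g (X n)) (\<Psi> g L) \<le> dist (C * norm (X n - L)) 0" for n g
        proof -
          have "\<Psi> g (X n) - \<Psi> g L = \<Psi> g (X n - L)"
            using add[of g "X n - L" L] by (simp add: algebra_simps)
          moreover have "norm (\<Psi> g (X n - L)) \<le> C * norm (X n - L)"
            using X L by (intro bound in_A) auto
          ultimately show ?thesis
            by (simp add: dist_norm)
        qed
        then show "\<forall>\<^sub>F n in sequentially. \<forall>g\<in>UNIV. dist (\<Psi> g (X n)) (\<Psi> g L) \<le> dist (C * norm (X n - L)) 0"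
          by simp
      qed
      from uniform_limit_theorem[OF _ this] have "continuous_on UNIV (\<lambda>g. \<Psi> g L)"
        using X by simp
      with L show "L \<in> {T. T \<in> Adj \<and> continuous_on UNIV (\<lambda>g. \<Psi> g T)}"
        by simp
    qed
  next
    case zero
    have "\<Psi> g 0 = 0" for g
      using add[of g 0 0] by simp
    then show ?case
      by (simp add: in_A)
  next
    case (add x y T)
    then show ?case
      by (simp add: assms(2) rk_Adj in_A continuous_on_add[OF rank_one])
  qed
  then show ?thesis ..
qed

text \<open>The extension is unique since the domain is dense.\<close>

lemma (in regular_operator) bounded_ext:
  assumes "unb_bounded T"
  shows "bounded_ext T \<in> adjointable_ops" "T \<subseteq> gr (bounded_ext T)"
proof -
  obtain S where S: "S \<in> adjointable_ops" "T \<subseteq> gr S" and dense: "closure (Domain T) = UNIV"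
    using assms by (auto simp: unb_bounded_def densely_defined_def)
  have uniq: "S' = S" if "S' \<in> adjointable_ops \<and> T \<subseteq> gr S'" for S'
  proof -
    have "En S' = En S"
    proof (rule dense_endo_eqI[OF dense])
      fix x assume "x \<in> Domain T"
      then show "En S' \<cdot> x = En S \<cdot> x"
        using S that by (auto simp: gr_def bl_ap[symmetric])
    qed
    then show ?thesis
      by (metis bl_En)
  qed
  have "bounded_ext T = S"
    unfolding bounded_ext_def by (rule the_equality, rule conjI[OF S(1,2)], rule uniq)
  then show "bounded_ext T \<in> adjointable_ops" "T \<subseteq> gr (bounded_ext T)"
    using S(1,2) by simp_all
qed

locale conformal_cycle =
  conformally_equivariant_cycle ip ract \<pi> \<alpha>A \<beta> U \<Gamma> \<alpha> D + regular_operator_power ip ract D \<alpha> + rep ip ract \<pi>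
  for ip :: "'e::cbanach \<Rightarrow> 'e \<Rightarrow> 'b::cstar_algebra" and ract :: "'e \<Rightarrow> 'b \<Rightarrow> 'e"
    and \<pi> :: "'a::cstar_algebra \<Rightarrow> ('e \<Rightarrow>\<^sub>L 'e)"
    and \<alpha>A :: "'g::{topological_group_add, t2_space} \<Rightarrow> 'a \<Rightarrow> 'a"
    and \<beta> :: "'g \<Rightarrow> 'b \<Rightarrow> 'b"
    and U :: "'g \<Rightarrow> ('e \<Rightarrow>\<^sub>L 'e)"
    and \<Gamma> :: "('e \<Rightarrow>\<^sub>L 'e) option" and \<alpha> :: real and D :: "'e unb" +
  assumes locally_compact: "locally_compact_space (euclidean :: 'g topology)"
    and action_A: "cstar_action \<alpha>A" and action_B: "cstar_action \<beta>"
begin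

subsection \<open>The group action on operators\<close>

definition u :: "'g \<Rightarrow> 'e endo" where
  "u g = En (U g)"

lemma u_ap: "u g \<cdot> x = blinfun_apply (U g) x"
  by (simp add: u_def bl_ap[symmetric])

lemma bl_u: "bl (u g) = U g"
  by (simp add: u_def)

lemma u_add: "u (g + h) = u g * u h"
  by (simp only: bl_eq_iff[symmetric] bl_u U_add times_endo.rep_eq)

text \<open>\<open>U\<^sub>0\<close> is an idempotent isometry.\<close>

lemma u_0: "u 0 = 1"
proof (rule endo_eqI)
  fix x
  have iso: "norm (u 0 \<cdot> x) = norm x" for x
    using U_ip[of 0 x x] action_B by (simp add: norm_ip u_ap cstar_action_def)
  have "u 0 \<cdot> (u 0 \<cdot> x - x) = 0"
    using u_add[of 0 0] by (simp add: ap_diff_right) (metis ap_mult)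
  then have "norm (u 0 \<cdot> x - x) = 0"
    using iso[of "u 0 \<cdot> x - x"] by simp
  then show "u 0 \<cdot> x = 1 \<cdot> x"
    by simp
qed

lemma u_inv: "u g * u (- g) = 1" "u (- g) * u g = 1"
  by (simp_all add: u_add[symmetric] u_0)

lemma u_inv_ap: "u g \<cdot> u (- g) \<cdot> x = x" "u (- g) \<cdot> u g \<cdot> x = x"
  using u_inv by (metis ap_mult ap_one)+

lemma ip_u: "ip (u g \<cdot> x) (u g \<cdot> y) = \<beta> g (ip x y)"
  by (simp add: u_ap U_ip)

lemma twist_u: "twist (u g) (u (- g))"
proof -
  have *: "u g * T * u (- g) \<in> Adj \<and> ad (u g * T * u (- g)) = u g * ad T * u (- g)" if T: "T \<in> Adj" for g T
  proof -
    have "ip ((u g * T * u (- g)) \<cdot> x) y = ip x ((u g * ad T * u (- g)) \<cdot> y)" for x y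
    proof -
      have "ip (u g \<cdot> T \<cdot> u (- g) \<cdot> x) (u g \<cdot> u (- g) \<cdot> y) = ip (u g \<cdot> u (- g) \<cdot> x) (u g \<cdot> ad T \<cdot> u (- g) \<cdot> y)"
        unfolding ip_u AdjD[OF T] ..
      then show ?thesis
        by (simp add: ap_mult u_inv_ap)
    qed
    from AdjI[OF this] show ?thesis
      by blast
  qed
  then show ?thesis
    unfolding twist_def using u_inv *[of _ "- g"] by simp
qed

lemma op_inv_U: "op_inv (U g) = U (- g)"
  unfolding op_inv_def
proof (rule the_equality)
  have "bl (u (- g) * u g) = bl 1" "bl (u g * u (- g)) = bl 1"
    by (simp_all add: u_inv)
  then show *: "U (- g) o\<^sub>L U g = id_blinfun \<and> U g o\<^sub>L U (- g) = id_blinfun"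
    by (simp add: times_endo.rep_eq one_endo.rep_eq bl_u)
  show "S = U (- g)" if "S o\<^sub>L U g = id_blinfun \<and> U g o\<^sub>L S = id_blinfun" for S
  proof (rule blinfun_eqI)
    fix x
    have "S (U g (U (- g) x)) = U (- g) x"
      using that by (metis blinfun_apply_blinfun_compose id_blinfun.rep_eq)
    then show "S x = U (- g) x"
      using u_inv_ap(1)[of g x] by (simp add: u_ap)
  qed
qed

lemma u_p: "u g * p a = p (\<alpha>A g a) * u g"
proof (rule endo_eqI)
  have p_ap: "p a \<cdot> x = blinfun_apply (\<pi> a) x" for a x
    by (simp add: bl_ap[symmetric] bl_p)
  show "(u g * p a) \<cdot> x = (p (\<alpha>A g a) * u g) \<cdot> x" for x
    by (simp add: ap_mult u_ap p_ap U_\<pi>)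
qed

lemma u_rk: "u g * rk x y * u (- g) = rk (u g \<cdot> x) (u g \<cdot> y)"
proof (rule endo_eqI)
  fix z
  have "u g \<cdot> ract x (ip y (u (- g) \<cdot> z)) = ract (u g \<cdot> x) (ip (u g \<cdot> y) (u g \<cdot> u (- g) \<cdot> z))"
    unfolding ip_u by (simp add: u_ap U_ract)
  then show "(u g * rk x y * u (- g)) \<cdot> z = rk (u g \<cdot> x) (u g \<cdot> y) \<cdot> z"
    by (simp add: ap_mult rk_ap u_inv_ap)
qed

lemma continuous_u: "continuous_on UNIV (\<lambda>g. u (h g) \<cdot> k g)"
  if "continuous_on UNIV h" "continuous_on UNIV k" for h :: "'z::topological_space \<Rightarrow> 'g" and k
proof -
  have "continuous_on UNIV (\<lambda>g. (h g, k g))"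
    using that by (rule continuous_on_Pair)
  then show ?thesis
    using continuous_on_compose2[OF U_continuous, of UNIV "\<lambda>g. (h g, k g)"] by (simp add: u_ap)
qed

text \<open>
  The cocycle whose products with \<open>A\<close> are to be compact and norm-continuous.
\<close>

definition V :: "'g \<Rightarrow> 'e endo" where
  "V g = u g * F * u (- g) - F"

lemma bl_V: "bl (V g) = (U g o\<^sub>L bounded_transform D o\<^sub>L op_inv (U g)) - bounded_transform D"
  by (simp add: V_def bounded_transform_eq op_inv_U minus_endo.rep_eq times_endo.rep_eq bl_u)

lemma V_Adj: "V g \<in> Adj"
  unfolding V_def by (intro in_A twist_in[OF twist_u] F_Adj)

lemma norm_V_le: "norm (V g) \<le> 2"
  unfolding V_def using norm_triangle_ineq4[of "u g * F * u (- g)" F] twist_norm[OF twist_u F_Adj, of g] norm_F_le by simp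

lemma norm_V_mult_le: "norm (V g * T) \<le> 2 * norm T"
  using mult_right_mono[OF norm_V_le norm_ge_zero] norm_mult_ineq order_trans by blast

lemma V_add: "V (g + h) = u g * V h * u (- g) + V g"
proof -
  have "u (- (g + h)) = u (- h) * u (- g)"
    by (simp add: minus_add u_add[symmetric])
  then show ?thesis
    by (simp add: V_def u_add algebra_simps)
qed

lemma continuous_V: "continuous_on UNIV (\<lambda>g. V g \<cdot> x)"
proof -
  have "continuous_on UNIV (\<lambda>g. u g \<cdot> (F \<cdot> u (- g) \<cdot> x) - F \<cdot> x)"
    by (intro continuous_on_diff continuous_on_const continuous_u continuous_on_id
        bounded_linear.continuous_on[OF bounded_linear_ap] continuous_on_minus)
  then show ?thesis
    by (simp add: V_def ap_mult ap_diff)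
qed

lemma continuous_V_Kop: "K \<in> Kop \<Longrightarrow> continuous_on UNIV (\<lambda>g. V g * K)"
  by (rule continuous_on_Kop[where C = 2])
    (simp_all add: distrib_left norm_V_mult_le Adj_rk V_Adj
      bounded_bilinear.continuous_on[OF bounded_bilinear_rk] continuous_V)

lemma continuous_u_Kop: "K \<in> Kop \<Longrightarrow> continuous_on UNIV (\<lambda>g. u g * K * u (- g))"
  by (rule continuous_on_Kop[where C = 1])
    (simp_all add: distrib_left distrib_right twist_norm[OF twist_u] u_rk
      bounded_bilinear.continuous_on[OF bounded_bilinear_rk] continuous_u continuous_on_id)

end

context conformal_cycle
begin

subsection \<open>Consequences of the existence of a conformal factor\<close>

text \<open>The cut-offs contain a factor \<open>(1 + D\<^sup>2)\<^sup>-\<^sup>1\<close>.\<close>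

lemma Pe_compact: assumes L: "\<Lambda> \<ge> 1" shows "Pe \<Lambda> * p a \<in> Kop" "Pe \<Lambda> \<in> Adj"
proof -
  have eA: "e \<Lambda> \<in> Adj"
    using sa_e[OF L] by (rule sa_in)
  then show "Pe \<Lambda> \<in> Adj"
    by (simp add: Pe_def in_A)
  have mA: "m \<Lambda> \<in> Adj"
    using sa_\<Phi>[OF cont_m[OF L]] by (simp add: m_def sa_def)
  define Z where "Z = 6 *\<^sub>R e \<Lambda> ^ 4 - 5 *\<^sub>R e \<Lambda> ^ 5"
  have "Pe \<Lambda> = Z * e \<Lambda>"
    by (simp add: Pe_def Z_def algebra_simps eval_nat_numeral)
  moreover have "e \<Lambda> = (\<Lambda>\<^sup>2 *\<^sub>R m \<Lambda>) * R"
    by (simp add: e_eq[OF L] m_comm[OF L])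
  ultimately have "Pe \<Lambda> * p a = Z * (\<Lambda>\<^sup>2 *\<^sub>R m \<Lambda>) * (R * p a)"
    by (simp only: mult.assoc)
  moreover have "R * p a \<in> Kop"
    using resolvent_compact[of a] by (simp add: Kop_def resolvent_eq times_endo.rep_eq bl_p)
  moreover have "Z * (\<Lambda>\<^sup>2 *\<^sub>R m \<Lambda>) \<in> Adj"
    using eA mA by (simp add: in_A Z_def)
  ultimately show "Pe \<Lambda> * p a \<in> Kop"
    by (simp only: Kop_mult_left)
qed

lemma lip_Lip: assumes "q \<in> Lip \<alpha> D" shows "\<exists>B. lip (En q) B"
proof -
  obtain B where B: "B \<in> adjointable_ops" "commutator D q \<circ>\<^sub>u gr (bl J) \<subseteq> gr B"
    using assms by (auto simp: Lip_def unb_bounded_def japanese_power_J)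
  have "lip (En q) (En B)"
    by (rule lip_right) (use assms B in \<open>simp_all add: Lip_def Adj_def\<close>)
  then show ?thesis ..
qed

context
  fixes \<mu> :: "'g \<Rightarrow> ('e \<Rightarrow>\<^sub>L 'e)"
  assumes conf: "conformal_factor \<pi> U \<Gamma> \<alpha> D \<mu>"
begin

abbreviation "Q \<equiv> conformal_set \<alpha> D U \<mu>"

definition "mu g = En (\<mu> g)"
definition "nu g = En (op_inv (\<mu> g))"

definition "\<Delta> q g = (gr (U g) \<circ>\<^sub>u D \<circ>\<^sub>u gr (op_inv (U g)) \<circ>\<^sub>u gr q) -\<^sub>u (gr (q o\<^sub>L \<mu> g) \<circ>\<^sub>u D \<circ>\<^sub>u gr (adj (\<mu> g)))"

definition "B2 q g = En (bounded_ext (gr (U g o\<^sub>L bl J o\<^sub>L op_inv (U g)) \<circ>\<^sub>u \<Delta> q g))"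
definition "C4 q g = En (bounded_ext (gr (bl J) \<circ>\<^sub>u commutator D (q o\<^sub>L \<mu> g)))"

lemma mu_nu: "mu g \<in> Adj" "nu g \<in> Adj" "mu g * nu g = 1" "nu g * mu g = 1"
proof -
  have "invertible_op (\<mu> g)"
    using conf by (simp add: conformal_factor_def)
  then obtain S where S: "S \<in> adjointable_ops" "S o\<^sub>L \<mu> g = id_blinfun" "\<mu> g o\<^sub>L S = id_blinfun" and mu: "\<mu> g \<in> adjointable_ops"
    unfolding invertible_op_def by blast
  have "op_inv (\<mu> g) = S"
    unfolding op_inv_def
  proof (rule the_equality)
    show "S o\<^sub>L \<mu> g = id_blinfun \<and> \<mu> g o\<^sub>L S = id_blinfun"
      using S by simp
    show "X = S" if "X o\<^sub>L \<mu> g = id_blinfun \<and> \<mu> g o\<^sub>L X = id_blinfun" for X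
    proof (rule blinfun_eqI)
      fix x
      have "X (\<mu> g (S x)) = S x"
        using that by (metis blinfun_apply_blinfun_compose id_blinfun.rep_eq)
      moreover have "\<mu> g (S x) = x"
        using S by (metis blinfun_apply_blinfun_compose id_blinfun.rep_eq)
      ultimately show "X x = S x"
        by simp
    qed
  qed
  then show "mu g \<in> Adj" "nu g \<in> Adj" "mu g * nu g = 1" "nu g * mu g = 1"
    using S mu by (simp_all add: mu_def nu_def Adj_def bl_eq_iff[symmetric] times_endo.rep_eq one_endo.rep_eq)
qed

lemma bl_mu: "bl (mu g) = \<mu> g" "bl (nu g) = op_inv (\<mu> g)"
  by (simp_all add: mu_def nu_def)

lemma QD:
  assumes "q \<in> Q"
  shows "q \<in> Lip \<alpha> D"
    and "blinfun_apply (q o\<^sub>L \<mu> g) ` Domain D \<subseteq> Domain D \<inter> blinfun_apply (U g) ` Domain D"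
    and "blinfun_apply (q o\<^sub>L adj (op_inv (\<mu> g))) ` Domain D \<subseteq> Domain D"
    and "star_strongly_continuous_unb (\<lambda>g. gr (U g o\<^sub>L bl J o\<^sub>L op_inv (U g)) \<circ>\<^sub>u \<Delta> q g)"
    and "star_strongly_continuous_unb (\<lambda>g. gr (bl J) \<circ>\<^sub>u commutator D (q o\<^sub>L \<mu> g))"
    and "star_strongly_continuous_unb (\<lambda>g. gr (bl J) \<circ>\<^sub>u commutator D (q o\<^sub>L adj (op_inv (\<mu> g))))"
  using assms unfolding conformal_set_def Let_def japanese_power_J \<Delta>_def by blast+

lemma unb_comp_iff: "(x, y) \<in> X \<circ>\<^sub>u Y \<longleftrightarrow> (\<exists>z. (x, z) \<in> Y \<and> (z, y) \<in> X)"
  by (auto simp: unb_comp_def)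

lemma gr_iff: "(x, y) \<in> gr T \<longleftrightarrow> y = blinfun_apply T x"
  by (auto simp: gr_def)

lemma conformal_at_Q:
  assumes q: "q \<in> Q"
  shows "conformal_at (u g) (u (- g)) (mu g) (nu g) (En q) (B2 q g) (- ad (C4 q g))"
proof -
  note QD = QD[OF q]
  define a where "a = En q"
  have a: "a \<in> Adj" "bl a = q"
    using QD(1) by (simp_all add: a_def Adj_def Lip_def)
  have bl_amu: "bl (a * mu g) = q o\<^sub>L \<mu> g" "bl (a * ad (nu g)) = q o\<^sub>L adj (op_inv (\<mu> g))"
    by (simp_all add: times_endo.rep_eq a bl_mu bl_ad)
  have ub2: "unb_bounded (gr (U g o\<^sub>L bl J o\<^sub>L op_inv (U g)) \<circ>\<^sub>u \<Delta> q g)"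
    using QD(4) by (simp add: star_strongly_continuous_unb_def)
  have ub4: "unb_bounded (gr (bl J) \<circ>\<^sub>u commutator D (q o\<^sub>L \<mu> g))"
    using QD(5) by (simp add: star_strongly_continuous_unb_def)
  have ub6: "unb_bounded (gr (bl J) \<circ>\<^sub>u commutator D (q o\<^sub>L adj (op_inv (\<mu> g))))"
    using QD(6) by (simp add: star_strongly_continuous_unb_def)
  note b2 = bounded_ext[OF ub2] and b4 = bounded_ext[OF ub4] and b6 = bounded_ext[OF ub6]
  have EnA: "En X \<in> Adj" if "X \<in> adjointable_ops" for X
    using that by (simp add: Adj_def)
  have l4: "lip (ad (a * mu g)) (- ad (C4 q g))"
  proof (rule lip_left_ad)
    show "a * mu g \<in> Adj"
      by (intro in_A a mu_nu)
    show "blinfun_apply (bl (a * mu g)) ` Domain D \<subseteq> Domain D"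
      unfolding bl_amu using QD(2) by blast
    show "C4 q g \<in> Adj"
      unfolding C4_def by (rule EnA[OF b4(1)])
    show "gr (bl J) \<circ>\<^sub>u commutator D (bl (a * mu g)) \<subseteq> gr (bl (C4 q g))"
      unfolding C4_def bl_En bl_amu by (rule b4(2))
  qed
  have l6: "\<exists>B. lip (ad (a * ad (nu g))) B"
  proof (rule exI, rule lip_left_ad)
    show "a * ad (nu g) \<in> Adj"
      by (intro in_A a mu_nu)
    show "blinfun_apply (bl (a * ad (nu g))) ` Domain D \<subseteq> Domain D"
      unfolding bl_amu using QD(3) by blast
    show "En (bounded_ext (gr (bl J) \<circ>\<^sub>u commutator D (q o\<^sub>L adj (op_inv (\<mu> g))))) \<in> Adj"
      by (rule EnA[OF b6(1)])
    show "gr (bl J) \<circ>\<^sub>u commutator D (bl (a * ad (nu g)))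
        \<subseteq> gr (bl (En (bounded_ext (gr (bl J) \<circ>\<^sub>u commutator D (q o\<^sub>L adj (op_inv (\<mu> g)))))))"
      unfolding bl_En bl_amu by (rule b6(2))
  qed
  have dom: "u (- g) \<cdot> a \<cdot> mu g \<cdot> x \<in> Domain D" if "x \<in> Domain D" for x
  proof -
    have "blinfun_apply (q o\<^sub>L \<mu> g) x \<in> blinfun_apply (U g) ` Domain D"
      using QD(2)[of g] that by blast
    then have "(a * mu g) \<cdot> x \<in> blinfun_apply (U g) ` Domain D"
      by (simp only: bl_ap[symmetric] bl_amu)
    then obtain z where "z \<in> Domain D" "a \<cdot> mu g \<cdot> x = u g \<cdot> z"
      by (auto simp: u_ap ap_mult)
    then show ?thesis
      by (simp add: u_inv_ap)
  qed
  have B2: "u g \<cdot> J \<cdot> u (- g) \<cdot> (u g \<cdot> z - a \<cdot> mu g \<cdot> w) = B2 q g \<cdot> x"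
    if z: "(u (- g) \<cdot> a \<cdot> x, z) \<in> D" and w: "(ad (mu g) \<cdot> x, w) \<in> D" for x z w
  proof -
    have q_ap: "blinfun_apply q v = a \<cdot> v" for v
      by (simp add: bl_ap[symmetric] a)
    have mu_ap: "blinfun_apply (\<mu> g) v = mu g \<cdot> v" "blinfun_apply (adj (\<mu> g)) v = ad (mu g) \<cdot> v" for v
      by (simp_all add: bl_ap[symmetric] bl_mu bl_ad)
    have "(x, u g \<cdot> z) \<in> gr (U g) \<circ>\<^sub>u D \<circ>\<^sub>u gr (op_inv (U g)) \<circ>\<^sub>u gr q"
      using z by (auto simp: unb_comp_iff gr_iff op_inv_U u_ap[symmetric] q_ap)
    moreover have "(x, a \<cdot> mu g \<cdot> w) \<in> gr (q o\<^sub>L \<mu> g) \<circ>\<^sub>u D \<circ>\<^sub>u gr (adj (\<mu> g))"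
      using w by (auto simp: unb_comp_iff gr_iff q_ap mu_ap)
    ultimately have "(x, u g \<cdot> z - a \<cdot> mu g \<cdot> w) \<in> \<Delta> q g"
      by (auto simp: \<Delta>_def unb_diff_def)
    then have "(x, u g \<cdot> J \<cdot> u (- g) \<cdot> (u g \<cdot> z - a \<cdot> mu g \<cdot> w)) \<in> gr (U g o\<^sub>L bl J o\<^sub>L op_inv (U g)) \<circ>\<^sub>u \<Delta> q g"
      unfolding unb_comp_iff gr_iff by (auto simp: op_inv_U u_ap[symmetric] bl_ap)
    then show ?thesis
      using b2(2) by (auto simp: gr_iff B2_def bl_ap[symmetric])
  qed
  have "B2 q g \<in> Adj"
    using b2(1) by (simp add: B2_def Adj_def)
  then show ?thesis
    unfolding conformal_at_def using twist_u mu_nu a(1) l4 l6 dom B2 unfolding a_def by blast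
qed

lemma strongly_continuous:
  shows "continuous_on UNIV (\<lambda>g. mu g \<cdot> x)"
    and "q \<in> Q \<Longrightarrow> continuous_on UNIV (\<lambda>g. B2 q g \<cdot> x)"
    and "q \<in> Q \<Longrightarrow> continuous_on UNIV (\<lambda>g. C4 q g \<cdot> x)"
  using conf QD(4,5)[of q]
  by (simp_all add: conformal_factor_def star_strongly_continuous_def star_strongly_continuous_unb_def
      mu_def B2_def C4_def bl_ap[symmetric])

lemma norm_C4: assumes "q \<in> Q" shows "norm (- ad (C4 q g)) = norm (C4 q g)"
proof -
  have "C4 q g \<in> Adj"
    using bounded_ext(1) QD(5)[OF assms] by (simp add: C4_def Adj_def star_strongly_continuous_unb_def)
  then show ?thesis
    by (simp add: norm_ad)
qed

text \<open>
  The sets on which all relevant operators are bounded by \<open>n\<close> are closed by strong continuity alone,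
  if the bound on the inverse of \<open>\<mu>\<close> is expressed by \<open>\<mu>\<close> being bounded below.
\<close>

definition bounded_by :: "real \<Rightarrow> ('e \<Rightarrow>\<^sub>L 'e) set \<Rightarrow> 'g \<Rightarrow> bool" where
  "bounded_by n Qw g \<longleftrightarrow> (\<forall>x. norm (mu g \<cdot> x) \<le> n * norm x) \<and> (\<forall>x. norm x \<le> n * norm (mu g \<cdot> x)) \<and>
     (\<forall>q x. q \<in> Qw \<longrightarrow> norm (B2 q g \<cdot> x) \<le> n * norm x \<and> norm (C4 q g \<cdot> x) \<le> n * norm x)"

lemma closed_bounded_by: assumes "Qw \<subseteq> Q" shows "closed {g. bounded_by n Qw g}"
proof -
  have "closed {g. q \<in> Qw \<longrightarrow> norm (B2 q g \<cdot> x) \<le> n * norm x \<and> norm (C4 q g \<cdot> x) \<le> n * norm x}" for q x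
  proof (cases "q \<in> Qw")
    case True
    then have q: "q \<in> Q"
      using assms by blast
    have "closed {g. norm (B2 q g \<cdot> x) \<le> n * norm x \<and> norm (C4 q g \<cdot> x) \<le> n * norm x}"
      by (intro closed_Collect_conj closed_Collect_le continuous_on_norm continuous_on_const strongly_continuous q)
    then show ?thesis
      using True by simp
  qed simp
  then show ?thesis
    unfolding bounded_by_def
    by (intro closed_Collect_conj closed_Collect_all closed_Collect_le continuous_on_norm
        continuous_on_const continuous_on_mult_left strongly_continuous)
qed

lemma bounded_by_exists: assumes "finite Qw" shows "\<exists>n. bounded_by (real n) Qw g"
proof -
  define c where "c = norm (mu g) + norm (nu g) + (\<Sum>q\<in>Qw. norm (B2 q g) + norm (C4 q g))"
  obtain n :: nat where n: "c \<le> real n"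
    using real_arch_simple by blast
  have s: "(\<Sum>q\<in>Qw. norm (B2 q g) + norm (C4 q g)) \<ge> 0"
    by (intro sum_nonneg) simp
  have le: "norm (T \<cdot> x) \<le> real n * norm x" if "norm T \<le> c" for T :: "'e endo" and x
    using norm_ap[of T x] mult_right_mono[of "norm T" "real n" "norm x"] that n by simp
  have "norm (mu g) \<le> c" "norm (nu g) \<le> c"
    using s norm_ge_zero[of "mu g"] norm_ge_zero[of "nu g"] by (simp_all add: c_def)
  moreover have "norm (B2 q g) \<le> c" "norm (C4 q g) \<le> c" if "q \<in> Qw" for q
  proof -
    have "norm (B2 q g) + norm (C4 q g) \<le> (\<Sum>q\<in>Qw. norm (B2 q g) + norm (C4 q g))"
      using that assms by (intro member_le_sum) auto
    then show "norm (B2 q g) \<le> c" "norm (C4 q g) \<le> c"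
      using norm_ge_zero[of "mu g"] norm_ge_zero[of "nu g"] norm_ge_zero[of "B2 q g"] norm_ge_zero[of "C4 q g"]
      unfolding c_def by linarith+
  qed
  moreover have "norm x \<le> real n * norm (mu g \<cdot> x)" for x
  proof -
    have "x = nu g \<cdot> mu g \<cdot> x"
      using mu_nu(4) by (metis ap_mult ap_one)
    then show ?thesis
      using le[OF \<open>norm (nu g) \<le> c\<close>, of "mu g \<cdot> x"] by simp
  qed
  ultimately show ?thesis
    unfolding bounded_by_def using le by blast
qed

text \<open>
  Uniformity over \<open>N\<close> is obtained by treating \<open>N\<close> as the parameter set of the asymptotic algebra.
\<close>

lemma uniform_decay:
  assumes q: "q \<in> Q" "q \<in> Qw" and N: "N \<noteq> {}" "\<And>g. g \<in> N \<Longrightarrow> bounded_by n Qw g" and \<epsilon>: "\<epsilon> > 0"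
  shows "\<exists>\<Lambda>\<ge>1. \<forall>g\<in>N. norm (V g * En q * (1 - Pe \<Lambda>)) \<le> \<epsilon>"
proof -
  obtain g0 where g0: "g0 \<in> N"
    using N by blast
  \<comment> \<open>Families are indexed by a whole type; outside \<open>N\<close> they are extended by a value on \<open>N\<close>.\<close>
  define \<rho> where "\<rho> g = (if g \<in> N then g else g0)" for g
  have bounded_by: "bounded_by n Qw (\<rho> g)" for g
    using N g0 by (simp add: \<rho>_def)
  obtain Ba where Ba: "lip (En q) Ba"
    using lip_Lip[OF QD(1)[OF q(1)]] by blast
  have n0: "norm T \<le> \<bar>n\<bar>" if "\<And>x. norm (T \<cdot> x) \<le> n * norm x" for T :: "'e endo"
  proof (rule norm_endo_bound)
    show "norm (T \<cdot> v) \<le> \<bar>n\<bar> * norm v" for v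
      using that[of v] mult_right_mono[OF abs_ge_self[of n] norm_ge_zero[of v]] by linarith
  qed simp
  have b: "norm (mu (\<rho> g)) \<le> \<bar>n\<bar>" "norm (B2 q (\<rho> g)) \<le> \<bar>n\<bar>" "norm (- ad (C4 q (\<rho> g))) \<le> \<bar>n\<bar>" "norm (nu (\<rho> g)) \<le> \<bar>n\<bar>" for g
  proof -
    show "norm (mu (\<rho> g)) \<le> \<bar>n\<bar>" "norm (B2 q (\<rho> g)) \<le> \<bar>n\<bar>" "norm (- ad (C4 q (\<rho> g))) \<le> \<bar>n\<bar>"
      using bounded_by[of g] q n0 unfolding bounded_by_def norm_C4[OF q(1)] by blast+
    have "norm (nu (\<rho> g) \<cdot> x) \<le> n * norm (mu (\<rho> g) \<cdot> nu (\<rho> g) \<cdot> x)" for x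
      using bounded_by[of g] unfolding bounded_by_def by blast
    then have "norm (nu (\<rho> g) \<cdot> x) \<le> n * norm x" for x
      using mu_nu(3) by (metis ap_mult ap_one)
    then show "norm (nu (\<rho> g)) \<le> \<bar>n\<bar>"
      by (rule n0)
  qed
  obtain \<Lambda> where L: "\<Lambda> \<ge> 1" "\<And>g. norm ((u (\<rho> g) * F * u (- \<rho> g) - F) * En q * (1 - Pe \<Lambda>)) \<le> \<epsilon>"
    using conformal_decay[where V = "\<lambda>g. u (\<rho> g)" and V' = "\<lambda>g. u (- \<rho> g)" and \<mu> = "\<lambda>g. mu (\<rho> g)"
        and \<nu> = "\<lambda>g. nu (\<rho> g)" and ?B2.0 = "\<lambda>g. B2 q (\<rho> g)" and ?B4.0 = "\<lambda>g. - ad (C4 q (\<rho> g))",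
        OF conformal_at_Q[OF q(1)] Ba b(1,4,2,3) \<epsilon>] by blast
  have "norm (V g * En q * (1 - Pe \<Lambda>)) \<le> \<epsilon>" if "g \<in> N" for g
    using L(2)[of g] that by (simp add: V_def \<rho>_def)
  with L(1) show ?thesis
    by blast
qed

text \<open>
  \<open>V\<^sub>g q a\<close> is close to \<open>V\<^sub>g q P(e\<^sub>\<Lambda>) a\<close>, where \<open>P(e\<^sub>\<Lambda>) a\<close> is compact. The scale \<open>\<Lambda>\<close>, and with it the compact operator, can
  be chosen independently of \<open>g\<close>, which is what continuity in \<open>g\<close> rests on.
\<close>

lemma span_approximation:
  assumes "T \<in> complex_vector.span {q o\<^sub>L \<pi> a | a q. q \<in> Q}"
  shows "\<exists>Qw. finite Qw \<and> Qw \<subseteq> Q \<and> (\<forall>N n \<epsilon>. N \<noteq> {} \<longrightarrow> (\<forall>g\<in>N. bounded_by n Qw g) \<longrightarrow> \<epsilon> > 0 \<longrightarrow>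
    (\<exists>K\<in>Kop. \<forall>g\<in>N. norm (V g * (En T - K)) \<le> \<epsilon>))"
  using assms
proof (induction rule: complex_vector.span_induct_alt)
  case base
  have "En (0 :: 'e \<Rightarrow>\<^sub>L 'e) = 0"
    by (simp add: bl_eq_iff[symmetric] zero_endo.rep_eq)
  then show ?case
    by (intro exI[of _ "{}"] conjI allI impI bexI[of _ 0]) (auto simp: Kop_zero)
next
  case (step c X Y)
  obtain q a where q: "q \<in> Q" "X = q o\<^sub>L \<pi> a"
    using step(1) by blast
  obtain Qw where Qw: "finite Qw" "Qw \<subseteq> Q" and K: "\<And>N n \<epsilon>. N \<noteq> {} \<Longrightarrow> \<forall>g\<in>N. bounded_by n Qw g \<Longrightarrow> \<epsilon> > 0 \<Longrightarrow>
      \<exists>K\<in>Kop. \<forall>g\<in>N. norm (V g * (En Y - K)) \<le> \<epsilon>"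
    using step(2) by blast
  have qA: "En q \<in> Adj"
    using QD(1)[OF q(1)] by (simp add: Lip_def Adj_def)
  define b where "b = c *\<^sub>C a"
  have X: "En (c *\<^sub>C X + Y) = En q * p b + En Y"
  proof (rule endo_eqI)
    fix x
    have ap: "blinfun_apply q v = En q \<cdot> v" "blinfun_apply (\<pi> z) v = p z \<cdot> v" "blinfun_apply Y v = En Y \<cdot> v" for v z
      by (simp_all add: bl_ap[symmetric] bl_p)
    have "En (c *\<^sub>C X + Y) \<cdot> x = blinfun_apply (c *\<^sub>C X + Y) x"
      by (simp add: bl_ap[symmetric])
    also have "\<dots> = c *\<^sub>C (En q \<cdot> p a \<cdot> x) + En Y \<cdot> x"
      by (simp add: q(2) blinfun.add_left scaleC_blinfun.rep_eq ap)
    also have "c *\<^sub>C (En q \<cdot> p a \<cdot> x) = En q \<cdot> p b \<cdot> x"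
      by (simp add: b_def \<pi>_scaleC scaleC_blinfun.rep_eq Adj_scaleC[OF qA] flip: ap(2))
    finally show "En (c *\<^sub>C X + Y) \<cdot> x = (En q * p b + En Y) \<cdot> x"
      by (simp add: ap_simps)
  qed
  show ?case
  proof (intro exI conjI allI impI)
    show "finite (insert q Qw)" "insert q Qw \<subseteq> Q"
      using Qw q by auto
    fix N :: "'g set" and n \<epsilon> :: real
    assume N: "N \<noteq> {}" and bounded_by: "\<forall>g\<in>N. bounded_by n (insert q Qw) g" and \<epsilon>: "\<epsilon> > 0"
    have "\<forall>g\<in>N. bounded_by n Qw g"
      using bounded_by by (simp add: bounded_by_def)
    then obtain K where K: "K \<in> Kop" "\<And>g. g \<in> N \<Longrightarrow> norm (V g * (En Y - K)) \<le> \<epsilon> / 2"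
      using K[OF N, of n "\<epsilon> / 2"] \<epsilon> by auto
    define \<epsilon>' where "\<epsilon>' = \<epsilon> / 2 / (1 + norm (p b))"
    have e': "\<epsilon>' > 0"
      using \<epsilon> by (simp add: \<epsilon>'_def add_pos_nonneg)
    obtain \<Lambda> where L: "\<Lambda> \<ge> 1" "\<And>g. g \<in> N \<Longrightarrow> norm (V g * En q * (1 - Pe \<Lambda>)) \<le> \<epsilon>'"
      using uniform_decay[OF q(1) insertI1 N _ e'] bounded_by by blast
    show "\<exists>K\<in>Kop. \<forall>g\<in>N. norm (V g * (En (c *\<^sub>C X + Y) - K)) \<le> \<epsilon>"
    proof (intro bexI ballI)
      show "En q * (Pe \<Lambda> * p b) + K \<in> Kop"
        by (intro Kop_add Kop_mult_left qA Pe_compact L K)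
      fix g assume g: "g \<in> N"
      have "V g * (En (c *\<^sub>C X + Y) - (En q * (Pe \<Lambda> * p b) + K)) = V g * En q * (1 - Pe \<Lambda>) * p b + V g * (En Y - K)"
        unfolding X by (simp add: algebra_simps)
      also have "norm \<dots> \<le> norm (V g * En q * (1 - Pe \<Lambda>)) * norm (p b) + norm (V g * (En Y - K))"
        by (rule order_trans[OF norm_triangle_ineq add_right_mono[OF norm_mult_ineq]])
      also have "\<dots> \<le> \<epsilon>' * (1 + norm (p b)) + \<epsilon> / 2"
        using L(2)[OF g] K(2)[OF g] e' by (intro add_mono mult_mono) auto
      also have "\<dots> = \<epsilon>"
      proof -
        have "1 + norm (p b) \<noteq> 0"
          using norm_ge_zero[of "p b"] by linarith
        moreover have "r \<noteq> 0 \<Longrightarrow> \<epsilon> / 2 / r * r + \<epsilon> / 2 = \<epsilon>" for r :: real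
          by simp
        ultimately show ?thesis
          unfolding \<epsilon>'_def by blast
      qed
      finally show "norm (V g * (En (c *\<^sub>C X + Y) - (En q * (Pe \<Lambda> * p b) + K))) \<le> \<epsilon>" .
    qed
  qed
qed

lemma compact_approximation:
  assumes \<epsilon>: "\<epsilon> > 0"
  shows "\<exists>Qw. finite Qw \<and> Qw \<subseteq> Q \<and> (\<forall>N n. N \<noteq> {} \<longrightarrow> (\<forall>g\<in>N. bounded_by n Qw g) \<longrightarrow>
    (\<exists>K\<in>Kop. \<forall>g\<in>N. norm (V g * (p b - K)) \<le> \<epsilon>))"
proof -
  have "\<pi> b \<in> closure (complex_vector.span {q o\<^sub>L \<pi> a | a q. q \<in> Q})"
    using conf by (auto simp: conformal_factor_def)
  then obtain T where T: "T \<in> complex_vector.span {q o\<^sub>L \<pi> a | a q. q \<in> Q}" "dist T (\<pi> b) < \<epsilon> / 4"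
    using \<epsilon> unfolding closure_approachable by (meson divide_pos_pos zero_less_numeral)
  have d: "norm (p b - En T) < \<epsilon> / 4"
    using T(2) by (simp add: norm_endo.rep_eq minus_endo.rep_eq bl_p dist_norm norm_minus_commute)
  obtain Qw where Qw: "finite Qw" "Qw \<subseteq> Q" and K: "\<And>N n \<epsilon>. N \<noteq> {} \<Longrightarrow> \<forall>g\<in>N. bounded_by n Qw g \<Longrightarrow> \<epsilon> > 0 \<Longrightarrow>
      \<exists>K\<in>Kop. \<forall>g\<in>N. norm (V g * (En T - K)) \<le> \<epsilon>"
    using span_approximation[OF T(1)] by blast
  have "\<exists>K\<in>Kop. \<forall>g\<in>N. norm (V g * (p b - K)) \<le> \<epsilon>" if N: "N \<noteq> {}" "\<forall>g\<in>N. bounded_by n Qw g" for N n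
  proof -
    obtain K where K: "K \<in> Kop" "\<And>g. g \<in> N \<Longrightarrow> norm (V g * (En T - K)) \<le> \<epsilon> / 2"
      using K[OF N, of "\<epsilon> / 2"] \<epsilon> by auto
    have "norm (V g * (p b - K)) \<le> \<epsilon>" if "g \<in> N" for g
    proof -
      have "V g * (p b - K) = V g * (p b - En T) + V g * (En T - K)"
        by (simp add: algebra_simps)
      then show ?thesis
        using norm_triangle_ineq[of "V g * (p b - En T)" "V g * (En T - K)"] K(2)[OF that]
          norm_V_mult_le[of g "p b - En T"] d by simp
    qed
    then show ?thesis
      using K(1) by blast
  qed
  then show ?thesis
    using Qw by blast
qed

end

end

lemma eventually_dist_less:
  fixes h :: "'g::t2_space \<Rightarrow> 'r::real_normed_vector"
  assumes "continuous_on UNIV h" "\<epsilon> > 0"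
  shows "\<forall>\<^sub>F g in nhds a. norm (h g - h a) < \<epsilon>"
proof -
  have "isCont h a"
    using assms(1) by (simp add: continuous_on_eq_continuous_at)
  then have "(h \<longlongrightarrow> h a) (nhds a)"
    by (simp add: isCont_def tendsto_at_iff_tendsto_nhds)
  from tendstoD[OF this assms(2)] show ?thesis
    by (simp add: dist_norm)
qed

context conformal_cycle
begin

context
  fixes \<mu> :: "'g \<Rightarrow> ('e \<Rightarrow>\<^sub>L 'e)"
  assumes conf: "conformal_factor \<pi> U \<Gamma> \<alpha> D \<mu>"
begin

lemma V_compact: "V g * p b \<in> Kop"
proof -
  have "\<exists>T\<in>Kop. dist T (V g * p b) < \<epsilon>" if \<epsilon>: "\<epsilon> > 0" for \<epsilon>
  proof -
    obtain Qw where Qw: "finite Qw" and K: "\<And>N n. N \<noteq> {} \<Longrightarrow> \<forall>g\<in>N. bounded_by \<mu> n Qw g \<Longrightarrow>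
        \<exists>K\<in>Kop. \<forall>g\<in>N. norm (V g * (p b - K)) \<le> \<epsilon> / 2"
      using compact_approximation[OF conf half_gt_zero[OF \<epsilon>], of b] by blast
    obtain n where "bounded_by \<mu> (real n) Qw g"
      using bounded_by_exists[OF conf Qw] by blast
    then obtain K where "K \<in> Kop" "norm (V g * (p b - K)) \<le> \<epsilon> / 2"
      using K[of "{g}" "real n"] by auto
    then show ?thesis
      using \<epsilon> by (intro bexI[of _ "V g * K"] Kop_mult_left V_Adj) (simp_all add: dist_norm norm_minus_commute algebra_simps)
  qed
  then have "V g * p b \<in> closure Kop"
    by (simp add: closure_approachable)
  then show ?thesis
    by (simp add: closed_Kop)
qed

text \<open>
  Local compactness enters through Baire's theorem: one of the countably many closed sets that cover
  the group has an interior point.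
\<close>

lemma bounded_by_interior:
  assumes Qw: "finite Qw" "Qw \<subseteq> conformal_set \<alpha> D U \<mu>"
  obtains n :: nat and W g1 where "open W" "g1 \<in> W" "\<And>g. g \<in> W \<Longrightarrow> bounded_by \<mu> (real n) Qw g"
proof -
  have haus: "Hausdorff_space (euclidean :: 'g topology)"
    unfolding Hausdorff_space_def disjnt_def using hausdorff by (metis open_openin)
  let ?G = "range (\<lambda>n::nat. {g. bounded_by \<mu> (real n) Qw g})"
  have "\<Union>?G = UNIV"
    using bounded_by_exists[OF conf Qw(1)] by blast
  then have "euclidean interior_of \<Union>?G \<noteq> {}"
    using interior_of_topspace[of "euclidean :: 'g topology"] by simp
  then have "\<exists>n::nat. interior {g. bounded_by \<mu> (real n) Qw g} \<noteq> {}"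
    using Baire_category_alt[of "euclidean :: 'g topology" ?G] closed_bounded_by[OF conf Qw(2)]
      locally_compact locally_compact_Hausdorff_imp_regular_space[OF locally_compact haus]
    by (auto simp: closed_closedin[symmetric])
  then obtain n :: nat and g1 where "g1 \<in> interior {g. bounded_by \<mu> (real n) Qw g}"
    by blast
  then show ?thesis
    using that[of "interior {g. bounded_by \<mu> (real n) Qw g}" g1 n] interior_subset by fastforce
qed

text \<open>
  For every \<open>\<epsilon>\<close> there are a point \<open>g\<^sub>1\<close> and a compact \<open>K\<close> such that \<open>V\<^sub>g b\<close> is within \<open>\<epsilon>\<close> of the continuous \<open>V\<^sub>g K\<close> for
  \<open>g\<close> near \<open>g\<^sub>1\<close>. The identity \<open>V\<^sub>h = V\<^bsub>h+g1\<^esub> - U\<^sub>h V\<^bsub>g1\<^esub> U\<^sub>h\<^sup>-\<^sup>1\<close> carries this to the unit, as conjugation by \<open>U\<^sub>h\<close> is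
  continuous on the compact operator \<open>V\<^bsub>g1\<^esub> b\<close>.
\<close>

lemma continuous_V_at_unit: assumes \<epsilon>: "\<epsilon> > 0" shows "\<forall>\<^sub>F h in nhds 0. norm (V h * p b) < \<epsilon>"
proof -
  define \<delta> where "\<delta> = \<epsilon> / 8"
  have \<delta>: "\<delta> > 0"
    using \<epsilon> by (simp add: \<delta>_def)
  obtain Qw where Qw: "finite Qw" "Qw \<subseteq> conformal_set \<alpha> D U \<mu>" and K: "\<And>N n. N \<noteq> {} \<Longrightarrow> \<forall>g\<in>N. bounded_by \<mu> n Qw g \<Longrightarrow>
      \<exists>K\<in>Kop. \<forall>g\<in>N. norm (V g * (p b - K)) \<le> \<delta>"
    using compact_approximation[OF conf \<delta>, of b] by blast
  obtain n :: nat and W g1 where W: "open W" "g1 \<in> W" "\<And>g. g \<in> W \<Longrightarrow> bounded_by \<mu> (real n) Qw g"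
    by (rule bounded_by_interior[OF Qw]) blast
  then obtain K where K: "K \<in> Kop" "\<And>g. g \<in> W \<Longrightarrow> norm (V g * (p b - K)) \<le> \<delta>"
    using K[of W "real n"] by blast
  define K0 where "K0 = V g1 * p b"
  have K0: "K0 \<in> Kop"
    by (simp add: K0_def V_compact)
  have shift: "continuous_on UNIV (\<lambda>h. h + g1)"
    by (intro continuous_intros)
  have 1: "\<forall>\<^sub>F h in nhds 0. h + g1 \<in> W"
    using eventually_nhds[of "\<lambda>h. h + g1 \<in> W" 0] open_vimage[OF W(1) shift] W(2) by (auto simp: vimage_def)
  have 2: "\<forall>\<^sub>F h in nhds 0. norm (V (h + g1) * K - V g1 * K) < \<delta>"
    using eventually_dist_less[OF continuous_on_compose2[OF continuous_V_Kop[OF K(1)] shift] \<delta>, of 0] by simp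
  have 3: "\<forall>\<^sub>F h in nhds 0. norm (u h * K0 * u (- h) - K0) < \<delta>"
    using eventually_dist_less[OF continuous_u_Kop[OF K0] \<delta>, of 0] by (simp add: u_0)
  have "continuous_on UNIV (\<lambda>h. \<alpha>A (- h) b)"
    using action_A unfolding cstar_action_def
    by (intro continuous_on_compose2[of UNIV "\<lambda>g. \<alpha>A g b" UNIV uminus] continuous_intros) auto
  from eventually_dist_less[OF this \<delta>, of 0] have 4: "\<forall>\<^sub>F h in nhds 0. norm (\<alpha>A (- h) b - b) < \<delta>"
    using action_A by (simp add: cstar_action_def)
  show ?thesis
    using 1 2 3 4
  proof eventually_elim
    case (elim h)
    define X where "X = V (h + g1) * (p b - K) + (V (h + g1) * K - V g1 * K) - V g1 * (p b - K)"
    define Y where "Y = u h * (V g1 * (p (\<alpha>A (- h) b) - p b)) * u (- h)"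
    have "V h * p b = V (h + g1) * p b - u h * (V g1 * (u (- h) * p b))"
      by (simp add: V_add algebra_simps)
    also have "\<dots> = X - (u h * K0 * u (- h) - K0) - Y"
      by (simp add: u_p X_def Y_def K0_def algebra_simps)
    finally have eq: "V h * p b = X - (u h * K0 * u (- h) - K0) - Y" .
    have x: "norm X \<le> norm (V (h + g1) * (p b - K)) + norm (V (h + g1) * K - V g1 * K) + norm (V g1 * (p b - K))"
      unfolding X_def by (rule order_trans[OF norm_triangle_ineq4 add_right_mono[OF norm_triangle_ineq]])
    have "norm Y = norm (V g1 * p (\<alpha>A (- h) b - b))"
      unfolding Y_def p_diff by (intro twist_norm[OF twist_u] in_A V_Adj p_Adj)
    also have "\<dots> \<le> 2 * norm (\<alpha>A (- h) b - b)"
      by (rule order_trans[OF norm_V_mult_le]) (simp add: norm_p_le)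
    finally have y: "norm Y < 2 * \<delta>"
      using elim(4) by simp
    have "norm (V h * p b) \<le> norm X + norm (u h * K0 * u (- h) - K0) + norm Y"
      unfolding eq by (rule order_trans[OF norm_triangle_ineq4 add_right_mono[OF norm_triangle_ineq4]])
    then show ?case
      using x y elim(2,3) K(2)[OF elim(1)] K(2)[OF W(2)] \<epsilon> unfolding \<delta>_def by linarith
  qed
qed

text \<open>
  By the cocycle identity \<open>V\<^sub>g - V\<^bsub>g0\<^esub>\<close> is conjugate to \<open>V\<^bsub>-g0+g\<^esub>\<close>.
\<close>

lemma continuous_V_p: "continuous_on UNIV (\<lambda>g. V g * p b)"
proof -
  have "isCont (\<lambda>g. V g * p b) g0" for g0
  proof -
    define b0 where "b0 = \<alpha>A (- g0) b"
    have ev: "\<forall>\<^sub>F g in nhds g0. norm (V (- g0 + g) * p b0) < \<epsilon>" if "\<epsilon> > 0" for \<epsilon>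
    proof -
      have "isCont (\<lambda>g. - g0 + g) g0"
        by (intro continuous_intros)
      then have "filterlim (\<lambda>g. - g0 + g) (nhds 0) (nhds g0)"
        using tendsto_at_iff_tendsto_nhds[of "\<lambda>g. - g0 + g" g0] by (simp add: isCont_def)
      then show ?thesis
        using continuous_V_at_unit[OF that, of b0] by (auto simp: filterlim_iff)
    qed
    have eq: "norm (V g * p b - V g0 * p b) = norm (V (- g0 + g) * p b0)" for g
    proof -
      have "V g * p b - V g0 * p b = u g0 * V (- g0 + g) * (u (- g0) * p b)"
        using V_add[of g0 "- g0 + g"] by (simp add: algebra_simps add.assoc[symmetric])
      also have "\<dots> = u g0 * (V (- g0 + g) * p b0) * u (- g0)"
        by (simp add: u_p b0_def mult.assoc)
      finally show ?thesis
        by (simp add: twist_norm[OF twist_u] in_A V_Adj p_Adj)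
    qed
    have "((\<lambda>g. V g * p b) \<longlongrightarrow> V g0 * p b) (nhds g0)"
      unfolding tendsto_iff dist_norm eq using ev by blast
    then show ?thesis
      using tendsto_at_iff_tendsto_nhds[of "\<lambda>g. V g * p b" g0] by (simp add: isCont_def)
  qed
  then show ?thesis
    by (simp add: continuous_on_eq_continuous_at)
qed

end

end

context conformal_cycle
begin

section \<open>The bounded transform as a Kasparov module\<close>

text \<open>
  The argument for \<open>V\<close> with a constant family: \<open>Z\<close> commutes asymptotically with the cut-offs, hence
  \<open>[F, Z]\<close> decays on dyadic bands, and \<open>[F, Z] P(e\<^sub>\<Lambda>)\<close> tends to \<open>[F, Z]\<close> in norm.
\<close>

lemma lip_F_commutator_compact: assumes Z: "lip Z B" shows "(F * Z - Z * F) * p b \<in> Kop"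
proof -
  let ?e = "\<lambda>i :: unit \<times> real. e (lam i)" and ?f = "\<lambda>i :: unit \<times> real. f (lam i)"
  let ?F = "\<lambda>i :: unit \<times> real. F" and ?Z = "\<lambda>i :: unit \<times> real. Z"
  have ZA: "Z \<in> Adj"
    using Z by (simp add: lip_def)
  have cut: "cutoff (lam i) (?e i) (?f i) (?F i)" for i
    by (rule cutoff_D[OF lam_ge_1])
  note fams = cutoff_fam[OF cut] and cutb = cutoff_bdd[OF cut]
  have fZ: "fam ?Z"
    using ZA by (simp add: fam_def bdd_const)
  have comm: "cls ?Z * cls X = cls X * cls ?Z" if X: "bdd X"
    and le: "\<And>i. norm (X i * Z - Z * X i) \<le> 2 * norm B * lam i powr (\<alpha> - 1)" for X :: "unit \<times> real \<Rightarrow> 'e endo"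
  proof -
    have "negl (\<lambda>i. Z * X i - X i * Z)"
      by (rule neglI[of "1 - \<alpha>" _ "2 * norm B"]) (use alpha le in \<open>simp_all add: norm_minus_commute\<close>)
    then show ?thesis
      using X by (simp add: cls_mult[symmetric] cls_eq_iff bdd_intros)
  qed
  have "cls ?F * cls ?Z * (cls ?f * cls ?f) = cls ?Z * cls ?F * (cls ?f * cls ?f)"
  proof (rule cls_F_commute[OF cut fZ])
    show "cls ?Z * cls ?e = cls ?e * cls ?Z" "cls ?Z * cls ?f = cls ?f * cls ?Z"
      by (rule comm[OF cutb(1) lip_commutator(1)[OF Z lam_ge_1]], rule comm[OF cutb(2) lip_commutator(2)[OF Z lam_ge_1]])
  qed
  then have n: "negl (\<lambda>i. F * Z * (?f i * ?f i) - Z * F * (?f i * ?f i))"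
    using cutb by (simp add: cls_mult[symmetric] cls_eq_iff bdd_intros)
  have "negl (\<lambda>i. (F * Z * (?f i * ?f i) - Z * F * (?f i * ?f i)) * (?f i * ?e i ^ 3))"
    by (rule negl_mult_right[OF n]) (intro bdd_intros cutb)
  moreover have "(F * Z * (?f i * ?f i) - Z * F * (?f i * ?f i)) * (?f i * ?e i ^ 3) = (F * Z - Z * F) * (?e i * ?f i) ^ 3" for i
  proof -
    have "(?e i * ?f i) ^ 3 = ?e i ^ 3 * ?f i ^ 3"
      by (rule power_mult_commute[OF e_f[OF lam_ge_1]])
    also have "\<dots> = ?f i ^ 3 * ?e i ^ 3"
      by (intro power_commuting_commutes power_commuting_commutes[symmetric] e_f[OF lam_ge_1, symmetric])
    also have "\<dots> = ?f i * ?f i * (?f i * ?e i ^ 3)"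
      by (simp add: power3_eq_cube mult.assoc)
    finally show ?thesis
      by (simp add: left_diff_distrib mult.assoc)
  qed
  ultimately have n3: "negl (\<lambda>i :: unit \<times> real. (F * Z - Z * F) * (e (lam i) * f (lam i)) ^ 3)"
    by simp
  define W where "W = F * Z - Z * F"
  from n3 have "negl (\<lambda>i :: unit \<times> real. W * (e (lam i) * f (lam i)) ^ 3)"
    by (simp only: W_def)
  then obtain C \<theta> where C: "C > 0" "\<theta> > 0" "\<And>\<Lambda>. \<Lambda> \<ge> 1 \<Longrightarrow> norm (W * (1 - Pe \<Lambda>)) \<le> C * \<Lambda> powr (- \<theta>)"
    by (rule band_sum[where W = "\<lambda>_ :: unit. W"]) blast
  have WA: "W \<in> Adj"
    unfolding W_def by (intro in_A F_Adj ZA)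
  have "((\<lambda>\<Lambda>. C * \<Lambda> powr (- \<theta>) * norm (p b)) \<longlongrightarrow> C * 0 * norm (p b)) at_top"
    by (intro tendsto_mult tendsto_const tendsto_neg_powr filterlim_ident) (use C in auto)
  then have null: "((\<lambda>\<Lambda>. C * \<Lambda> powr (- \<theta>) * norm (p b)) \<longlongrightarrow> 0) at_top"
    by simp
  have "((\<lambda>\<Lambda>. W * Pe \<Lambda> * p b - W * p b) \<longlongrightarrow> 0) at_top"
  proof (rule Lim_null_comparison[OF _ null])
    show "\<forall>\<^sub>F \<Lambda> in at_top. norm (W * Pe \<Lambda> * p b - W * p b) \<le> C * \<Lambda> powr (- \<theta>) * norm (p b)"
      using eventually_ge_at_top[of 1]
    proof eventually_elim
      case (elim \<Lambda>)
      have "W * Pe \<Lambda> * p b - W * p b = - (W * (1 - Pe \<Lambda>) * p b)"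
        by (simp add: algebra_simps)
      also have "norm \<dots> \<le> norm (W * (1 - Pe \<Lambda>)) * norm (p b)"
        by (simp only: norm_minus_cancel norm_mult_ineq)
      also have "\<dots> \<le> C * \<Lambda> powr (- \<theta>) * norm (p b)"
        using C(3)[OF elim] by (rule mult_right_mono) simp
      finally show ?case .
    qed
  qed
  then have lim: "((\<lambda>\<Lambda>. W * Pe \<Lambda> * p b) \<longlongrightarrow> W * p b) at_top"
    by (rule LIM_zero_cancel)
  have "W * p b \<in> Kop"
  proof (rule Lim_in_closed_set[OF closed_Kop _ _ lim])
    show "\<forall>\<^sub>F \<Lambda> in at_top. W * Pe \<Lambda> * p b \<in> Kop"
      using eventually_ge_at_top[of 1] unfolding mult.assoc
      by eventually_elim (rule Kop_mult_left[OF WA Pe_compact(1)])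
  qed simp
  then show ?thesis
    by (simp only: W_def)
qed

text \<open>
  By density, \<open>[F, x] b\<close> is compact for all \<open>x\<close> and \<open>b\<close>, hence so are \<open>b [F, x]\<close> and \<open>[F, x z]\<close>. Every element is a limit of sums
  of products: if \<open>X\<close> is the image of \<open>y\<close>, rescaled, then \<open>X - (1 - X X\<^sup>*)\<^sup>n X\<close> is the image of such a sum.
\<close>

lemma F_commutator_compact: "F * p y - p y * F \<in> Kop"
proof -
  define P where "P T \<longleftrightarrow> F * T - T * F \<in> Kop" for T
  have 1: "(F * p x - p x * F) * p b \<in> Kop" for x b
  proof -
    let ?X = "{q. (F * En q - En q * F) * p b \<in> Kop}"
    have "closed ?X"
      by (rule closed_preimage[of "\<lambda>T. T \<in> Kop" "\<lambda>q. (F * En q - En q * F) * p b"])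
        (simp add: closed_Kop, intro continuous_intros continuous_En)
    moreover have "Lip \<alpha> D \<subseteq> ?X"
      using lip_Lip lip_F_commutator_compact by blast
    ultimately have "\<pi> x \<in> ?X"
      using \<pi>_in_closure_Lip closure_minimal by blast
    then show ?thesis
      by (simp add: p_def)
  qed
  have 2: "p b * (F * p x - p x * F) \<in> Kop" for x b
  proof -
    have "ad ((F * p (star x) - p (star x) * F) * p (star b)) \<in> Kop"
      by (rule Kop_ad[OF 1])
    also have "ad ((F * p (star x) - p (star x) * F) * p (star b)) = p b * (p x * F - F * p x)"
      by (simp add: p_star ad_simps in_A F_Adj p_Adj ad_F)
    also have "\<dots> = - (p b * (F * p x - p x * F))"
      by (simp add: algebra_simps)
    finally show ?thesis
      using Kop_minus by fastforce
  qed
  have prod: "P (p (x * z))" for x z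
  proof -
    have "F * p (x * z) - p (x * z) * F = (F * p x - p x * F) * p z + p x * (F * p z - p z * F)"
      by (simp add: p_mult algebra_simps)
    then show ?thesis
      unfolding P_def using Kop_add[OF 1 2] by simp
  qed
  have add: "P (S + T)" if "P S" "P T" for S T
  proof -
    have "F * (S + T) - (S + T) * F = (F * S - S * F) + (F * T - T * F)"
      by (simp add: algebra_simps)
    then show ?thesis
      using that Kop_add unfolding P_def by simp
  qed
  have scale: "P (r *\<^sub>R T)" if "P T" for r T
  proof -
    have "F * (r *\<^sub>R T) - (r *\<^sub>R T) * F = (r *\<^sub>R 1) * (F * T - T * F)"
      by (simp add: algebra_simps)
    then show ?thesis
      using that Kop_mult_left[of "r *\<^sub>R 1"] unfolding P_def by (simp add: in_A)
  qed
  have closed: "closed {T. P T}"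
    unfolding P_def 
    by (rule closed_preimage[of "\<lambda>T. T \<in> Kop" "\<lambda>T. F * T - T * F"]) (simp add: closed_Kop, intro continuous_intros)
  define t where "t = 1 / (1 + norm (p y))"
  have t: "t > 0" "norm (t *\<^sub>R p y) \<le> 1"
    by (auto simp: t_def add_pos_nonneg field_simps)
  define X where "X = t *\<^sub>R p y"
  define K where "K = X * ad X"
  have X: "X \<in> Adj" "norm X \<le> 1"
    using t by (simp_all add: X_def in_A p_Adj)
  have approx: "\<exists>s. X - (1 - K) ^ n * X = p s \<and> P (p s)" for n
  proof (induction n)
    case 0
    have "p 0 = 0"
      using p_diff[of 0 0] by simp
    then show ?case
      by (intro exI[of _ 0]) (simp add: P_def Kop_zero)
  next
    case (Suc n)
    then obtain s where s: "X - (1 - K) ^ n * X = p s" "P (p s)"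
      by blast
    define s' where "s' = (t\<^sup>2 *\<^sub>R y) * (star y * (t *\<^sub>R y - s))"
    have K: "K * Z = t\<^sup>2 *\<^sub>R (p y * (p (star y) * Z))" for Z
      by (simp add: K_def X_def p_star ad_scaleR p_Adj mult.assoc power2_eq_square)
    have "X - (1 - K) ^ Suc n * X = (X - (1 - K) ^ n * X) + K * ((1 - K) ^ n * X)"
      by (simp add: algebra_simps)
    also have "(1 - K) ^ n * X = X - p s"
      using s(1) by (simp add: algebra_simps)
    also have "(X - (X - p s)) + K * (X - p s) = p (s + s')"
      unfolding K by (simp add: s'_def p_add p_mult p_scaleR p_diff X_def)
    finally have "X - (1 - K) ^ Suc n * X = p (s + s')" .
    moreover have "P (p (s + s'))"
      using add[OF s(2) prod] by (simp only: s'_def p_add)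
    ultimately show ?case
      by blast
  qed
  have "(\<lambda>n. norm ((1 - K) ^ n * X)) \<longlonglongrightarrow> 0"
  proof (rule tendsto_sandwich[OF _ _ tendsto_const])
    show "(\<lambda>n. 1 / sqrt (real n)) \<longlonglongrightarrow> 0"
      using tendsto_inverse_0_at_top[OF filterlim_compose[OF sqrt_at_top filterlim_real_sequentially]]
      by (simp add: divide_inverse)
    show "\<forall>\<^sub>F n in sequentially. norm ((1 - K) ^ n * X) \<le> 1 / sqrt (real n)"
      using eventually_gt_at_top[of 0] by eventually_elim (use approximate_unit_le(2)[OF X] in \<open>simp add: K_def\<close>)
  qed simp
  then have "(\<lambda>n. X - (1 - K) ^ n * X) \<longlonglongrightarrow> X - 0"
    by (intro tendsto_diff tendsto_const) (simp add: tendsto_norm_zero_iff)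
  then have lim: "(\<lambda>n. X - (1 - K) ^ n * X) \<longlonglongrightarrow> X"
    by (simp only: diff_zero)
  have "X - (1 - K) ^ n * X \<in> {T. P T}" for n
  proof -
    obtain s where s: "X - (1 - K) ^ n * X = p s" "P (p s)"
      using approx[of n] by (elim exE conjE)
    show ?thesis
      unfolding s(1) using s(2) by (rule CollectI)
  qed
  with closed_sequentially[OF closed _ lim] have "P X"
    by blast
  then have "P ((1 / t) *\<^sub>R X)"
    by (rule scale)
  moreover have "(1 / t) *\<^sub>R X = p y"
    using t(1) by (simp add: X_def)
  ultimately show ?thesis
    by (simp only: P_def)
qed

text \<open>
  The grading commutes with \<open>D\<^sup>2\<close>, hence with \<open>(1 + D\<^sup>2)\<^sup>-\<^sup>1\<^sup>/\<^sup>2\<close>, and anticommutes with \<open>D\<close>.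
\<close>

lemma odd_F: assumes "grading \<gamma>" "odd_unb \<gamma> D" shows "odd_op \<gamma> (bl F)"
proof -
  define g where "g = En \<gamma>"
  have odd: "(g \<cdot> x, - (g \<cdot> y)) \<in> D" if "(x, y) \<in> D" for x y
    using assms(2) that by (auto simp: odd_unb_def g_def bl_ap[symmetric])
  have "g * R = R * g"
  proof (rule endo_eqI)
    fix v
    obtain y where y: "(R \<cdot> v, y) \<in> D" "(y, v - R \<cdot> v) \<in> D"
      by (rule R_D)
    have "R \<cdot> g \<cdot> v = g \<cdot> R \<cdot> v"
      using D_scaleR[OF odd[OF y(2)], of "- 1"] by (intro R_eqI[OF odd[OF y(1)]]) (simp add: ap_simps)
    then show "(g * R) \<cdot> v = (R * g) \<cdot> v"
      by (simp add: ap_mult)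
  qed
  then have S: "g * S = S * g"
    unfolding S_def by (rule \<Phi>_comm[OF cont_sqrt])
  have "F * g = - (g * F)"
  proof (rule endo_eqI)
    fix v
    have "F \<cdot> g \<cdot> v = - (g \<cdot> F \<cdot> v)"
      using odd[OF D_S[of v]] S by (intro F_eq) (metis ap_mult)
    then show "(F * g) \<cdot> v = (- (g * F)) \<cdot> v"
      by (simp add: ap_mult ap_simps)
  qed
  then have "bl (F * g) = bl (- (g * F))"
    by simp
  then show ?thesis
    by (simp add: odd_op_def times_endo.rep_eq uminus_endo.rep_eq g_def)
qed

lemma equivariant_bounded_transform: "equivariant_kasparov_module ip ract \<pi> \<alpha>A \<beta> U \<Gamma> (bounded_transform D)"
proof -
  obtain \<mu> where \<mu>: "conformal_factor \<pi> U \<Gamma> \<alpha> D \<mu>"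
    using ex_conformal_factor by blast
  have bt: "bounded_transform D = bl F"
    by (rule bounded_transform_eq)
  show ?thesis
    unfolding bt
  proof (unfold_locales)
    show "bl F \<in> adjointable_ops"
      using F_Adj by (simp add: Adj_def)
    have "adj (bl F) = bl F"
      using ad_F bl_ad[of F] by simp
    then show "(adj (bl F) - bl F) o\<^sub>L \<pi> a \<in> compact_ops" for a
      using Kop_zero by (simp add: Kop_def zero_endo.rep_eq)
    show "(id_blinfun - (bl F o\<^sub>L bl F)) o\<^sub>L \<pi> a \<in> compact_ops" for a
    proof -
      have "bl ((1 - F * F) * p a) = (id_blinfun - (bl F o\<^sub>L bl F)) o\<^sub>L \<pi> a"
        by (simp only: times_endo.rep_eq minus_endo.rep_eq one_endo.rep_eq bl_p)
      moreover have "(1 - F * F) * p a = R * p a"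
        by (simp add: F_F)
      ultimately show ?thesis
        using resolvent_compact[of a] by (simp add: resolvent_eq times_endo.rep_eq bl_p)
    qed
    show "(bl F o\<^sub>L \<pi> a) - (\<pi> a o\<^sub>L bl F) \<in> compact_ops" for a
      using F_commutator_compact[of a] by (simp add: Kop_def times_endo.rep_eq minus_endo.rep_eq bl_p)
    show "grading \<gamma> \<and> (\<forall>a. even_op \<gamma> (\<pi> a)) \<and> odd_op \<gamma> (bl F)" if "\<Gamma> = Some \<gamma>" for \<gamma>
      using graded[OF that] odd_F by blast
    have V: "((U g o\<^sub>L bl F o\<^sub>L op_inv (U g)) - bl F) o\<^sub>L \<pi> a = bl (V g * p a)" for g a
      by (simp add: times_endo.rep_eq bl_V bt bl_p)
    show "((U g o\<^sub>L bl F o\<^sub>L op_inv (U g)) - bl F) o\<^sub>L \<pi> a \<in> compact_ops" for g a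
      unfolding V using V_compact[OF \<mu>] by (simp add: Kop_def)
    show "continuous_on UNIV (\<lambda>g. ((U g o\<^sub>L bl F o\<^sub>L op_inv (U g)) - bl F) o\<^sub>L \<pi> a)" for a
      unfolding V by (rule continuous_on_compose2[OF continuous_bl[of UNIV] continuous_V_p[OF \<mu>]]) simp
  qed
qed

end

theorem theorem3p21:
  fixes ip :: "'e::cbanach \<Rightarrow> 'e \<Rightarrow> 'b::cstar_algebra"
    and ract :: "'e \<Rightarrow> 'b \<Rightarrow> 'e"
    and \<pi> :: "'a::cstar_algebra \<Rightarrow> ('e \<Rightarrow>\<^sub>L 'e)"
    and \<alpha>A :: "'g::{topological_group_add, t2_space} \<Rightarrow> 'a \<Rightarrow> 'a"
    and \<beta> :: "'g \<Rightarrow> 'b \<Rightarrow> 'b"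
    and U :: "'g \<Rightarrow> ('e \<Rightarrow>\<^sub>L 'e)"
    and \<Gamma> :: "('e \<Rightarrow>\<^sub>L 'e) option"
    and \<alpha> :: real
    and D :: "'e unb"
  assumes "locally_compact_space (euclidean :: 'g topology)"
    and "cstar_action \<alpha>A"
    and "cstar_action \<beta>"
    and "0 \<le> \<alpha>" and "\<alpha> < 1"
    and "conformally_equivariant_cycle ip ract \<pi> \<alpha>A \<beta> U \<Gamma> \<alpha> D"
  shows "equivariant_kasparov_module ip ract \<pi> \<alpha>A \<beta> U \<Gamma> (hilbert_module.bounded_transform ip D)"
proof -
  interpret conformally_equivariant_cycle ip ract \<pi> \<alpha>A \<beta> U \<Gamma> \<alpha> D
    by fact
  have "regular_operator_power ip ract D \<alpha>"
    by (intro regular_operator_power.intro regular_operator.intro regular_operator_axioms.intro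
        regular_operator_power_axioms.intro cs_hilbert_module D_selfadjoint_regular assms(4,5))
  moreover have "rep ip ract \<pi>"
    by (intro rep.intro cs_hilbert_module correspondence_axioms)
  moreover have "conformal_cycle_axioms \<alpha>A \<beta>"
    by (intro conformal_cycle_axioms.intro assms(1-3))
  ultimately interpret conformal_cycle ip ract \<pi> \<alpha>A \<beta> U \<Gamma> \<alpha> D
    by (intro conformal_cycle.intro assms(6))
  show ?thesis
    by (rule equivariant_bounded_transform)
qed

end
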